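(* Let $T>0$ and let $B$ be the $d$-dimensional $G$-Brownian motion. Let $X_0\in\mathbb{R}^n$ be a constant and let $b,h_{ij},\sigma_j$ ($i,j=1,\dots,d$) be given functions such that $b(\cdot,x),h_{ij}(\cdot,x),\sigma_j(\cdot,x)\in\bar M_G^2(0,T;\mathbb{R}^n)$ for each $x\in\mathbb{R}^n$ and, for some constant $K$, $|\phi(t,x)-\phi(t,x')|\le K|x-x'|$ for each $t\in[0,T]$, $x,x'\in\mathbb{R}^n$, and $\phi=b,h_{ij},\sigma_j$. Then there exists a unique solution $X\in\bar M_G^2(0,T;\mathbb{R}^n)$ of the stochastic differential equation $$X_t=X_0+\int_0^tb(s,X_s)ds+\int_0^th_{ij}(s,X_s)d\langle B^i,B^j\rangle_s+\int_0^t\sigma_j(s,X_s)dB_s^j,\qquad t\in[0,T]$$ (repeated indices $i,j$ are summed).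
   Context: $\mathbb{S}(d)$: symmetric $d\times d$ real matrices. $G:\mathbb{S}(d)\to\mathbb{R}$ is a given sublinear (subadditive, positively homogeneous) function, monotone ($A\ge A'\Rightarrow G(A)\ge G(A')$). $C_{l.Lip}(\mathbb{R}^n)$: functions $\varphi:\mathbb{R}^n\to\mathbb{R}$ with $|\varphi(x)-\varphi(y)|\le C(1+|x|^m+|y|^m)|x-y|$ for some $C>0$, $m\in\mathbb{N}$. Sublinear expectation space $(\tilde\Omega,\tilde{\mathcal{H}},\tilde{\mathbb{E}})$: $\tilde{\mathcal{H}}$ is a linear space of real functions on the set $\tilde\Omega$ containing constants and stable under $|\cdot|$ and under composition with $C_{l.Lip}$ functions; $\tilde{\mathbb{E}}:\tilde{\mathcal{H}}\to\mathbb{R}$ is monotone, constant preserving, subadditive and positively homogeneous. $X\overset{d}{=}Y$ means equality of the expectations of $\varphi(X)$ and $\varphi(Y)$ for all $\varphi\in C_{l.Lip}$; $Y$ is independent from $X$ if $\tilde{\mathbb{E}}[\varphi(X,Y)]=\tilde{\mathbb{E}}[\tilde{\mathbb{E}}[\varphi(x,Y)]_{x=X}]$ for all $\varphi\in C_{l.Lip}$. A $d$-dimensional random vector $\xi$ is $G$-normal if $a\xi+b\bar\xi\overset{d}{=}\sqrt{a^2+b^2}\,\xi$ for all $a,b\ge0$, $\bar\xi$ being an independent copy of $\xi$, and $\frac12\tilde{\mathbb{E}}[\langle A\xi,\xi\rangle]=G(A)$ for all $A\in\mathbb{S}(d)$. $G$-expectation: $\Omega$ is the space of continuous paths $\omega:[0,\infty)\to\mathbb{R}^d$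 with $\omega_0=0$, $B_t(\omega)=\omega_t$; $L_{ip}(\Omega)$ is the space of all $\varphi(B_{t_1},\dots,B_{t_n})$, $n\in\mathbb{N}$, $t_i\ge0$, $\varphi\in C_{l.Lip}(\mathbb{R}^{d\times n})$, and $L_{ip}(\Omega_t)$ the subspace with all $t_i\le t$. Let $\xi_1,\xi_2,\dots$ be $G$-normal vectors on a sublinear expectation space $(\tilde\Omega,\tilde{\mathcal{H}},\tilde{\mathbb{E}})$ with $\xi_{i+1}$ independent from $(\xi_1,\dots,\xi_i)$. For $0=t_0<t_1<\dots<t_n$, $$\hat{\mathbb{E}}[\varphi(B_{t_1}-B_{t_0},\dots,B_{t_n}-B_{t_{n-1}})]:=\tilde{\mathbb{E}}[\varphi(\sqrt{t_1-t_0}\,\xi_1,\dots,\sqrt{t_n-t_{n-1}}\,\xi_n)].$$ The canonical process $B$ under $\hat{\mathbb{E}}$ is the $d$-dimensional $G$-Brownian motion. $L_G^p(\Omega)$, $L_G^p(\Omega_t)$ are the completions of $L_{ip}(\Omega)$, $L_{ip}(\Omega_t)$ under $\|X\|_p=(\hat{\mathbb{E}}[|X|^p])^{1/p}$, $p\ge1$; $\hat{\mathbb{E}}$ is extended by continuity. Integrals: $M_G^{p,0}(0,T)$ is the set of $\eta_t=\sum_{k=0}^{N-1}\xi_k\mathbf{1}_{[t_k,t_{k+1})}(t)$ with $0=t_0<\dots<t_N=T$, $\xi_k\in L_G^p(\Omega_{t_k})$; $M_G^p(0,T)$ is its completion under $(\hat{\mathbb{E}}[\int_0^T|\eta_t|^pdt])^{1/p}$.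 For $\mathbf{a}\in\mathbb{R}^d$ let $B^{\mathbf{a}}_t=\langle\mathbf{a},B_t\rangle$. $\int_0^T\eta_tdB^{\mathbf{a}}_t:=\sum_k\xi_k(B^{\mathbf{a}}_{t_{k+1}}-B^{\mathbf{a}}_{t_k})$ on $M_G^{2,0}(0,T)$ extends continuously to $M_G^2(0,T)\to L_G^2(\Omega_T)$. $\langle B^{\mathbf{a}}\rangle_t:=(B^{\mathbf{a}}_t)^2-2\int_0^tB^{\mathbf{a}}_sdB^{\mathbf{a}}_s$; $\int_0^T\eta_td\langle B^{\mathbf{a}}\rangle_t:=\sum_k\xi_k(\langle B^{\mathbf{a}}\rangle_{t_{k+1}}-\langle B^{\mathbf{a}}\rangle_{t_k})$ on $M_G^{1,0}(0,T)$ extends continuously to $M_G^1(0,T)\to L_G^1(\Omega_T)$; $\int_0^T\eta_tdt:=\sum_k\xi_k(t_{k+1}-t_k)$ likewise. $\langle B^{\mathbf{a}},B^{\bar{\mathbf{a}}}\rangle:=\frac14[\langle B^{\mathbf{a}+\bar{\mathbf{a}}}\rangle-\langle B^{\mathbf{a}-\bar{\mathbf{a}}}\rangle]$, with integrals defined by the same linear combination. $B^i:=B^{\mathbf{e}_i}$ for a fixed orthonormal basis $(\mathbf{e}_i)$ of $\mathbb{R}^d$. $\int_0^t\eta_u\,d\cdot:=\int_0^T\mathbf{1}_{[0,t]}(u)\eta_u\,d\cdot$. Vector-valued versions are componentwise. $\bar M_G^p(0,T;\mathbb{R}^n)$, $p\ge1$, is the completion of $M_G^{p,0}(0,T;\mathbb{R}^n)$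 ($n$-dimensional processes with components in $M_G^{p,0}(0,T)$) under the norm $(\int_0^T\hat{\mathbb{E}}[|\eta_t|^p]dt)^{1/p}$; it is contained in $M_G^p(0,T;\mathbb{R}^n)$. A solution is a process $X\in\bar M_G^2(0,T;\mathbb{R}^n)$ satisfying the equation (as an identity in $\bar M_G^2(0,T;\mathbb{R}^n)$). *)

theory Defs
  imports "HOL-Analysis.Analysis"
begin

section \<open>Sublinear expectation spaces\<close>

text \<open>
  \<open>C_lLip k\<close> is the space \<open>C_{l.Lip}\<close> over \<open>('a)\<^sup>k\<close>. A \<open>k\<close>-tuple is a function on \<open>nat\<close> of which
  only the arguments \<open>i < k\<close> matter (the estimate forces \<open>\<phi>\<close> to ignore the others); the Euclidean
  norm of the tuple is \<open>L2_set\<close>. Values may be vectors, in which case membership is the same as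
  membership of all components.
\<close>

definition C_lLip ::
    "nat \<Rightarrow> ((nat \<Rightarrow> 'a::real_normed_vector) \<Rightarrow> 'b::real_normed_vector) set" where
  "C_lLip k = {\<phi>. \<exists>C>0. \<exists>m::nat. \<forall>x y.
     norm (\<phi> x - \<phi> y) \<le>
       C * (1 + L2_set (\<lambda>i. norm (x i)) {..<k} ^ m + L2_set (\<lambda>i. norm (y i)) {..<k} ^ m)
         * L2_set (\<lambda>i. norm (x i - y i)) {..<k}}"

locale sublinear_expectation_space =
  fixes H :: "('w \<Rightarrow> real) set" and E :: "('w \<Rightarrow> real) \<Rightarrow> real"
  assumes const_in: "\<And>c. (\<lambda>_. c) \<in> H"
    and add_in: "\<And>X Y. X \<in> H \<Longrightarrow> Y \<in> H \<Longrightarrow> (\<lambda>w. X w + Y w) \<in> H"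
    and scale_in: "\<And>c X. X \<in> H \<Longrightarrow> (\<lambda>w. c * X w) \<in> H"
    and abs_in: "\<And>X. X \<in> H \<Longrightarrow> (\<lambda>w. \<bar>X w\<bar>) \<in> H"
    and lLip_in: "\<And>k X \<phi>. (\<And>i. i < k \<Longrightarrow> X i \<in> H) \<Longrightarrow> \<phi> \<in> C_lLip k \<Longrightarrow>
                    (\<lambda>w. \<phi> (\<lambda>i. X i w)) \<in> H"
    and mono: "\<And>X Y. X \<in> H \<Longrightarrow> Y \<in> H \<Longrightarrow> (\<And>w. Y w \<le> X w) \<Longrightarrow> E Y \<le> E X"
    and const_preserving: "\<And>c. E (\<lambda>_. c) = c"
    and subadditive: "\<And>X Y. X \<in> H \<Longrightarrow> Y \<in> H \<Longrightarrow> E (\<lambda>w. X w + Y w) \<le> E X + E Y"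
    and pos_homogeneous: "\<And>c X. X \<in> H \<Longrightarrow> 0 \<le> c \<Longrightarrow> E (\<lambda>w. c * X w) = c * E X"

definition random_vector :: "('w \<Rightarrow> real) set \<Rightarrow> ('w \<Rightarrow> real^'d) \<Rightarrow> bool" where
  "random_vector H X \<longleftrightarrow> (\<forall>i. (\<lambda>w. X w $ i) \<in> H)"

definition eq_distr ::
    "(('w \<Rightarrow> real) \<Rightarrow> real) \<Rightarrow> ('w \<Rightarrow> real^'d) \<Rightarrow> ('w \<Rightarrow> real^'d) \<Rightarrow> bool" where
  "eq_distr E X Y \<longleftrightarrow>
     (\<forall>\<phi>\<in>C_lLip 1. E (\<lambda>w. \<phi> (\<lambda>_. X w)) = E (\<lambda>w. \<phi> (\<lambda>_. Y w)))"

text \<open>\<open>indep_from E k X Y\<close>: \<open>Y\<close> is independent from the tuple \<open>(X 0, \<dots>, X (k-1))\<close>.\<close>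

definition indep_from ::
    "(('w \<Rightarrow> real) \<Rightarrow> real) \<Rightarrow> nat \<Rightarrow> (nat \<Rightarrow> 'w \<Rightarrow> real^'d) \<Rightarrow> ('w \<Rightarrow> real^'d) \<Rightarrow> bool" where
  "indep_from E k X Y \<longleftrightarrow>
     (\<forall>\<phi>\<in>C_lLip (Suc k).
        E (\<lambda>w. \<phi> ((\<lambda>i. X i w)(k := Y w))) =
        E (\<lambda>w. E (\<lambda>w'. \<phi> ((\<lambda>i. X i w)(k := Y w')))))"

definition symmetric_matrix :: "real^'d^'d \<Rightarrow> bool" where
  "symmetric_matrix A \<longleftrightarrow> transpose A = A"

text \<open>\<open>A \<ge> A'\<close> for symmetric matrices means that \<open>A - A'\<close> is positive semidefinite.\<close>

definition monotone_sublinear :: "(real^'d^'d \<Rightarrow> real) \<Rightarrow> bool" where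
  "monotone_sublinear G \<longleftrightarrow>
     (\<forall>A A'. symmetric_matrix A \<longrightarrow> symmetric_matrix A' \<longrightarrow> G (A + A') \<le> G A + G A') \<and>
     (\<forall>A c. symmetric_matrix A \<longrightarrow> 0 \<le> c \<longrightarrow> G (c *\<^sub>R A) = c * G A) \<and>
     (\<forall>A A'. symmetric_matrix A \<longrightarrow> symmetric_matrix A' \<longrightarrow>
        (\<forall>x. 0 \<le> ((A - A') *v x) \<bullet> x) \<longrightarrow> G A' \<le> G A)"

text \<open>
  The law of the pair (vector, independent copy) is determined by the law of the vector, so it is
  immaterial which independent copy is used.
\<close>

definition G_normal ::
    "('w \<Rightarrow> real) set \<Rightarrow> (('w \<Rightarrow> real) \<Rightarrow> real) \<Rightarrow> (real^'d^'d \<Rightarrow> real) \<Rightarrow>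
     ('w \<Rightarrow> real^'d) \<Rightarrow> bool" where
  "G_normal H E G \<xi> \<longleftrightarrow>
     random_vector H \<xi> \<and>
     (\<exists>\<xi>'. random_vector H \<xi>' \<and> eq_distr E \<xi>' \<xi> \<and> indep_from E 1 (\<lambda>_. \<xi>) \<xi>' \<and>
        (\<forall>a b. 0 \<le> a \<longrightarrow> 0 \<le> b \<longrightarrow>
           eq_distr E (\<lambda>w. a *\<^sub>R \<xi> w + b *\<^sub>R \<xi>' w) (\<lambda>w. sqrt (a\<^sup>2 + b\<^sup>2) *\<^sub>R \<xi> w))) \<and>
     (\<forall>A. symmetric_matrix A \<longrightarrow> 1/2 * E (\<lambda>w. (A *v \<xi> w) \<bullet> \<xi> w) = G A)"


section \<open>Path space and G-expectation\<close>

text \<open>Paths are indexed by \<open>[0,\<infinity>)\<close>; they are extended by \<open>0\<close> to negative times.\<close>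

typedef (overloaded) ('d::finite) cpath =
  "{\<omega> :: real \<Rightarrow> real^'d. continuous_on {0..} \<omega> \<and> (\<forall>t\<le>0. \<omega> t = 0)}"
  by (rule exI[of _ "\<lambda>_. 0"]) simp

definition BM :: "real \<Rightarrow> 'd::finite cpath \<Rightarrow> real^'d" where
  "BM t \<omega> = Rep_cpath \<omega> t"

definition L_ip :: "('d::finite cpath \<Rightarrow> 'v::euclidean_space) set" where
  "L_ip = {X. \<exists>k t \<phi>. (\<forall>i<k. 0 \<le> t i) \<and> \<phi> \<in> C_lLip k \<and> X = (\<lambda>\<omega>. \<phi> (\<lambda>i. BM (t i) \<omega>))}"

definition L_ip_upto :: "real \<Rightarrow> ('d::finite cpath \<Rightarrow> 'v::euclidean_space) set" where
  "L_ip_upto s =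
     {X. \<exists>k t \<phi>. (\<forall>i<k. 0 \<le> t i \<and> t i \<le> s) \<and> \<phi> \<in> C_lLip k \<and> X = (\<lambda>\<omega>. \<phi> (\<lambda>i. BM (t i) \<omega>))}"

text \<open>
  The defining identity of the G-expectation; it determines \<open>E\<close> on \<open>L_ip\<close>.
  The sequence is numbered from 0, so \<open>\<xi> i\<close> is the vector belonging to the increment over
  \<open>[t i, t (i+1)]\<close>.
\<close>

definition is_G_expectation ::
    "(('w \<Rightarrow> real) \<Rightarrow> real) \<Rightarrow> (nat \<Rightarrow> 'w \<Rightarrow> real^'d::finite) \<Rightarrow>
     (('d cpath \<Rightarrow> real) \<Rightarrow> real) \<Rightarrow> bool" where
  "is_G_expectation E' \<xi> E \<longleftrightarrow>
     (\<forall>n t. \<forall>\<phi>\<in>C_lLip n. t 0 = 0 \<longrightarrow> (\<forall>i<n. t i < t (Suc i)) \<longrightarrow>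
        E (\<lambda>\<omega>. \<phi> (\<lambda>i. BM (t (Suc i)) \<omega> - BM (t i) \<omega>)) =
        E' (\<lambda>w. \<phi> (\<lambda>i. sqrt (t (Suc i) - t i) *\<^sub>R \<xi> i w)))"


section \<open>The completions of \<open>L_ip\<close>\<close>

text \<open>
  An element of the completion is given by a Cauchy sequence of (vector valued) elements of
  \<open>L_ip\<close>; two sequences denote the same element iff \<open>LG_eq\<close> holds. Continuous operations on
  \<open>L_ip\<close> (sums, norms, positive parts, products with elements of \<open>L_ip\<close>) extend to the completion
  by applying them termwise, and \<open>Eext E\<close> is the extension of \<open>E\<close>. Norms appear without the
  \<open>p\<close>-th root, which does not change the notion of Cauchy sequence or of convergence.
  Only the exponents 1 and 2 are needed.
\<close>

type_synonym ('d, 'v) rv = "nat \<Rightarrow> 'd cpath \<Rightarrow> 'v"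

definition Cauchy_p ::
    "(('d::finite cpath \<Rightarrow> real) \<Rightarrow> real) \<Rightarrow> nat \<Rightarrow> ('d, 'v::euclidean_space) rv \<Rightarrow> bool" where
  "Cauchy_p E p x \<longleftrightarrow>
     (\<forall>\<epsilon>>0. \<exists>M. \<forall>m\<ge>M. \<forall>l\<ge>M. E (\<lambda>\<omega>. norm (x m \<omega> - x l \<omega>) ^ p) < \<epsilon>)"

definition LG ::
    "(('d::finite cpath \<Rightarrow> real) \<Rightarrow> real) \<Rightarrow> nat \<Rightarrow> ('d, 'v::euclidean_space) rv set" where
  "LG E p = {x. (\<forall>m. x m \<in> L_ip) \<and> Cauchy_p E p x}"

definition LG_upto ::
    "(('d::finite cpath \<Rightarrow> real) \<Rightarrow> real) \<Rightarrow> nat \<Rightarrow> real \<Rightarrow> ('d, 'v::euclidean_space) rv set" where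
  "LG_upto E p s = {x. (\<forall>m. x m \<in> L_ip_upto s) \<and> Cauchy_p E p x}"

definition Eext :: "(('d::finite cpath \<Rightarrow> real) \<Rightarrow> real) \<Rightarrow> ('d, real) rv \<Rightarrow> real" where
  "Eext E x = lim (\<lambda>m. E (x m))"

definition LG_eq ::
    "(('d::finite cpath \<Rightarrow> real) \<Rightarrow> real) \<Rightarrow> nat \<Rightarrow>
     ('d, 'v::euclidean_space) rv \<Rightarrow> ('d, 'v) rv \<Rightarrow> bool" where
  "LG_eq E p x y \<longleftrightarrow> (\<lambda>m. E (\<lambda>\<omega>. norm (x m \<omega> - y m \<omega>) ^ p)) \<longlonglongrightarrow> 0"

text \<open>\<open>x \<le> y\<close> in the completion: the positive part of \<open>x - y\<close> is zero.\<close>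

definition LG_le ::
    "(('d::finite cpath \<Rightarrow> real) \<Rightarrow> real) \<Rightarrow> ('d, real) rv \<Rightarrow> ('d, real) rv \<Rightarrow> bool" where
  "LG_le E x y \<longleftrightarrow> (\<lambda>m. E (\<lambda>\<omega>. max 0 (x m \<omega> - y m \<omega>))) \<longlonglongrightarrow> 0"

definition LG_tendsto ::
    "(('d::finite cpath \<Rightarrow> real) \<Rightarrow> real) \<Rightarrow> nat \<Rightarrow>
     (nat \<Rightarrow> ('d, 'v::euclidean_space) rv) \<Rightarrow> ('d, 'v) rv \<Rightarrow> bool" where
  "LG_tendsto E p J x \<longleftrightarrow> (\<lambda>k. Eext E (\<lambda>m \<omega>. norm (J k m \<omega> - x m \<omega>) ^ p)) \<longlonglongrightarrow> 0"

text \<open>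
  \<open>z\<close> is the product of \<open>x\<close> (in \<open>LG E 1\<close>) and the scalar \<open>y\<close> (in \<open>LG E 2\<close>), as the limit in
  \<open>LG E 1\<close> of the products of \<open>y\<close> with the elements \<open>x m\<close> of \<open>L_ip\<close>. The simple termwise product
  need not be a Cauchy sequence when \<open>x\<close> is only in \<open>LG E 1\<close>.
\<close>

definition LG_prod ::
    "(('d::finite cpath \<Rightarrow> real) \<Rightarrow> real) \<Rightarrow>
     ('d, 'v::euclidean_space) rv \<Rightarrow> ('d, real) rv \<Rightarrow> ('d, 'v) rv \<Rightarrow> bool" where
  "LG_prod E x y z \<longleftrightarrow>
     z \<in> LG E 1 \<and> (\<lambda>m. Eext E (\<lambda>l \<omega>. norm (y l \<omega> *\<^sub>R x m \<omega> - z l \<omega>))) \<longlonglongrightarrow> 0"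


section \<open>Spaces of processes\<close>

type_synonym ('d, 'v) process = "real \<Rightarrow> ('d, 'v) rv"

definition step_rep ::
    "(('d::finite cpath \<Rightarrow> real) \<Rightarrow> real) \<Rightarrow> nat \<Rightarrow> real \<Rightarrow> ('d, 'v::euclidean_space) process \<Rightarrow>
     nat \<Rightarrow> (nat \<Rightarrow> real) \<Rightarrow> (nat \<Rightarrow> ('d, 'v) rv) \<Rightarrow> bool" where
  "step_rep E p T \<eta> N t \<xi> \<longleftrightarrow>
     t 0 = 0 \<and> t N = T \<and> (\<forall>k<N. t k < t (Suc k)) \<and> (\<forall>k<N. \<xi> k \<in> LG_upto E p (t k)) \<and>
     \<eta> = (\<lambda>s m \<omega>. \<Sum>k<N. indicator {t k..<t (Suc k)} s *\<^sub>R \<xi> k m \<omega>)"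

definition MG0 ::
    "(('d::finite cpath \<Rightarrow> real) \<Rightarrow> real) \<Rightarrow> nat \<Rightarrow> real \<Rightarrow>
     ('d, 'v::euclidean_space) process set" where
  "MG0 E p T = {\<eta>. \<exists>N t \<xi>. step_rep E p T \<eta> N t \<xi>}"

text \<open>\<open>MG E p T\<close>: the elements of \<open>M_G^p(0,T)\<close>, as Cauchy sequences of step processes.\<close>

definition MG ::
    "(('d::finite cpath \<Rightarrow> real) \<Rightarrow> real) \<Rightarrow> nat \<Rightarrow> real \<Rightarrow>
     (nat \<Rightarrow> ('d, 'v::euclidean_space) process) set" where
  "MG E p T = {H. (\<forall>k. H k \<in> MG0 E p T) \<and>
     (\<forall>\<epsilon>>0. \<exists>M. \<forall>k\<ge>M. \<forall>l\<ge>M.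
        Eext E (\<lambda>m \<omega>. integral {0..T} (\<lambda>t. norm (H k t m \<omega> - H l t m \<omega>) ^ p)) < \<epsilon>)}"

text \<open>
  The completion under the norm \<open>\<integral>\<^sub>0\<^sup>T E |\<eta>\<^sub>t|\<^sup>p dt\<close> is realised by functions of time with values
  in \<open>LG E p\<close> (as a Bochner space): these are the functions that can be approximated by step
  processes, and two of them are the same element iff \<open>MGbar_eq\<close> holds, that is, iff they
  coincide at almost every time in \<open>[0,T]\<close>.
\<close>

definition MGbar_approx ::
    "(('d::finite cpath \<Rightarrow> real) \<Rightarrow> real) \<Rightarrow> nat \<Rightarrow> real \<Rightarrow>
     (nat \<Rightarrow> ('d, 'v::euclidean_space) process) \<Rightarrow> ('d, 'v) process \<Rightarrow> bool" where
  "MGbar_approx E p T H \<eta> \<longleftrightarrow>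
     (\<exists>r. (\<forall>k. ((\<lambda>t. Eext E (\<lambda>m \<omega>. norm (H k t m \<omega> - \<eta> t m \<omega>) ^ p)) has_integral r k) {0..T})
          \<and> r \<longlonglongrightarrow> 0)"

definition MGbar ::
    "(('d::finite cpath \<Rightarrow> real) \<Rightarrow> real) \<Rightarrow> nat \<Rightarrow> real \<Rightarrow>
     ('d, 'v::euclidean_space) process set" where
  "MGbar E p T = {\<eta>. (\<forall>t\<in>{0..T}. \<eta> t \<in> LG E p) \<and>
     (\<exists>H. (\<forall>k. H k \<in> MG0 E p T) \<and> MGbar_approx E p T H \<eta>)}"

definition MGbar_eq ::
    "(('d::finite cpath \<Rightarrow> real) \<Rightarrow> real) \<Rightarrow> nat \<Rightarrow> real \<Rightarrow>
     ('d, 'v::euclidean_space) process \<Rightarrow> ('d, 'v) process \<Rightarrow> bool" where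
  "MGbar_eq E p T \<eta> \<eta>' \<longleftrightarrow>
     ((\<lambda>t. Eext E (\<lambda>m \<omega>. norm (\<eta> t m \<omega> - \<eta>' t m \<omega>) ^ p)) has_integral 0) {0..T}"

text \<open>The inclusion of \<open>MGbar E p T\<close> in \<open>MG E p T\<close>: \<open>H\<close> is the element given by \<open>\<eta>\<close>.\<close>

definition MG_of ::
    "(('d::finite cpath \<Rightarrow> real) \<Rightarrow> real) \<Rightarrow> nat \<Rightarrow> real \<Rightarrow>
     ('d, 'v::euclidean_space) process \<Rightarrow> (nat \<Rightarrow> ('d, 'v) process) \<Rightarrow> bool" where
  "MG_of E p T \<eta> H \<longleftrightarrow> \<eta> \<in> MGbar E p T \<and> H \<in> MG E p T \<and> MGbar_approx E p T H \<eta>"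

definition restrict_upto :: "real \<Rightarrow> ('d::finite, 'v::euclidean_space) process \<Rightarrow> ('d, 'v) process" where
  "restrict_upto t \<eta> = (\<lambda>s m \<omega>. indicator {0..t} s *\<^sub>R \<eta> s m \<omega>)"


section \<open>Integrals\<close>

text \<open>
  Each integral is given by its values on step processes (\<open>step_int\<close>) and extended by continuity.
  Vectors are integrated componentwise.
\<close>

definition step_int_dt ::
    "(('d::finite cpath \<Rightarrow> real) \<Rightarrow> real) \<Rightarrow> real \<Rightarrow>
     ('d, 'v::euclidean_space) process \<Rightarrow> ('d, 'v) rv \<Rightarrow> bool" where
  "step_int_dt E T \<eta> I \<longleftrightarrow>
     (\<exists>N t \<xi>. step_rep E 1 T \<eta> N t \<xi> \<and>
        I = (\<lambda>m \<omega>. \<Sum>k<N. (t (Suc k) - t k) *\<^sub>R \<xi> k m \<omega>))"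

definition has_int_dt ::
    "(('d::finite cpath \<Rightarrow> real) \<Rightarrow> real) \<Rightarrow> real \<Rightarrow>
     ('d, 'v::euclidean_space) process \<Rightarrow> ('d, 'v) rv \<Rightarrow> bool" where
  "has_int_dt E T \<eta> I \<longleftrightarrow>
     I \<in> LG E 1 \<and>
     (\<exists>H J. MG_of E 1 T \<eta> H \<and> (\<forall>k. step_int_dt E T (H k) (J k)) \<and> LG_tendsto E 1 J I)"

definition step_int_dB ::
    "(('d::finite cpath \<Rightarrow> real) \<Rightarrow> real) \<Rightarrow> real \<Rightarrow> real^'d \<Rightarrow>
     ('d, 'v::euclidean_space) process \<Rightarrow> ('d, 'v) rv \<Rightarrow> bool" where
  "step_int_dB E T a \<eta> I \<longleftrightarrow>
     (\<exists>N t \<xi>. step_rep E 2 T \<eta> N t \<xi> \<and>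
        I = (\<lambda>m \<omega>. \<Sum>k<N. (a \<bullet> BM (t (Suc k)) \<omega> - a \<bullet> BM (t k) \<omega>) *\<^sub>R \<xi> k m \<omega>))"

definition has_int_dB ::
    "(('d::finite cpath \<Rightarrow> real) \<Rightarrow> real) \<Rightarrow> real \<Rightarrow> real^'d \<Rightarrow>
     ('d, 'v::euclidean_space) process \<Rightarrow> ('d, 'v) rv \<Rightarrow> bool" where
  "has_int_dB E T a \<eta> I \<longleftrightarrow>
     I \<in> LG E 2 \<and>
     (\<exists>H J. MG_of E 2 T \<eta> H \<and> (\<forall>k. step_int_dB E T a (H k) (J k)) \<and> LG_tendsto E 2 J I)"

text \<open>\<open>q\<close> is the quadratic variation process of \<open>a \<bullet> B\<close> on \<open>[0,T]\<close>.\<close>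

definition is_QV ::
    "(('d::finite cpath \<Rightarrow> real) \<Rightarrow> real) \<Rightarrow> real \<Rightarrow> real^'d \<Rightarrow> ('d, real) process \<Rightarrow> bool" where
  "is_QV E T a q \<longleftrightarrow>
     (\<forall>t\<in>{0..T}. q t \<in> LG E 2 \<and>
        (\<exists>I. has_int_dB E T a (restrict_upto t (\<lambda>s m \<omega>. a \<bullet> BM s \<omega>)) I \<and>
             LG_eq E 2 (q t) (\<lambda>m \<omega>. (a \<bullet> BM t \<omega>)\<^sup>2 - 2 * I m \<omega>)))"

definition step_int_dQV ::
    "(('d::finite cpath \<Rightarrow> real) \<Rightarrow> real) \<Rightarrow> real \<Rightarrow> ('d, real) process \<Rightarrow>
     ('d, 'v::euclidean_space) process \<Rightarrow> ('d, 'v) rv \<Rightarrow> bool" where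
  "step_int_dQV E T q \<eta> I \<longleftrightarrow>
     (\<exists>N t \<xi> Z. step_rep E 1 T \<eta> N t \<xi> \<and>
        (\<forall>k<N. LG_prod E (\<xi> k) (\<lambda>m \<omega>. q (t (Suc k)) m \<omega> - q (t k) m \<omega>) (Z k)) \<and>
        I = (\<lambda>m \<omega>. \<Sum>k<N. Z k m \<omega>))"

definition has_int_dQV ::
    "(('d::finite cpath \<Rightarrow> real) \<Rightarrow> real) \<Rightarrow> real \<Rightarrow> real^'d \<Rightarrow>
     ('d, 'v::euclidean_space) process \<Rightarrow> ('d, 'v) rv \<Rightarrow> bool" where
  "has_int_dQV E T a \<eta> I \<longleftrightarrow>
     I \<in> LG E 1 \<and>
     (\<exists>q H J. is_QV E T a q \<and> MG_of E 1 T \<eta> H \<and>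
        (\<forall>k. step_int_dQV E T q (H k) (J k)) \<and> LG_tendsto E 1 J I)"

definition has_int_dQV2 ::
    "(('d::finite cpath \<Rightarrow> real) \<Rightarrow> real) \<Rightarrow> real \<Rightarrow> real^'d \<Rightarrow> real^'d \<Rightarrow>
     ('d, 'v::euclidean_space) process \<Rightarrow> ('d, 'v) rv \<Rightarrow> bool" where
  "has_int_dQV2 E T a a' \<eta> I \<longleftrightarrow>
     (\<exists>I1 I2. has_int_dQV E T (a + a') \<eta> I1 \<and> has_int_dQV E T (a - a') \<eta> I2 \<and>
        I = (\<lambda>m \<omega>. (1/4) *\<^sub>R (I1 m \<omega> - I2 m \<omega>)))"


section \<open>The stochastic differential equation\<close>

text \<open>
  \<open>lipschitz_field E K f\<close>: \<open>|f x - f x'| \<le> K |x - x'|\<close> for all deterministic \<open>x, x'\<close>, where each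
  \<open>f x\<close> is an element of the completion and so is the left-hand side.
\<close>

definition lipschitz_field ::
    "(('d::finite cpath \<Rightarrow> real) \<Rightarrow> real) \<Rightarrow> real \<Rightarrow> (real^'n \<Rightarrow> ('d, real^'n) rv) \<Rightarrow> bool" where
  "lipschitz_field E K f \<longleftrightarrow>
     (\<forall>x x'. LG_le E (\<lambda>m \<omega>. norm (f x m \<omega> - f x' m \<omega>)) (\<lambda>m \<omega>. K * norm (x - x')))"

text \<open>
  \<open>is_subst E f X Y\<close>: \<open>Y\<close> is the random variable \<open>f(X)\<close> obtained by inserting the random
  vector \<open>X\<close> for the space variable of the random field \<open>f\<close>. Elements of the completion have no
  values at individual paths, so the substitution cannot be made path by path. For a field
  that is Lipschitz in space, \<open>f(X)\<close> is the element whose distance from \<open>f x\<close> is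
  controlled by the distance of \<open>X\<close> from \<open>x\<close>, for every \<open>x\<close>, with one constant \<open>K\<close>. This is what
  pathwise substitution satisfies, and it determines \<open>f(X)\<close>: if \<open>Y\<close> and \<open>Y'\<close> both qualify, then
  \<open>|Y - Y'| \<le> (K + K') |X - x|\<close> for all \<open>x\<close>, where the infimum of the right-hand side over finer and
  finer finite grids of points \<open>x\<close> converges to \<open>0\<close>.
\<close>

definition is_subst ::
    "(('d::finite cpath \<Rightarrow> real) \<Rightarrow> real) \<Rightarrow> (real^'n \<Rightarrow> ('d, real^'n) rv) \<Rightarrow>
     ('d, real^'n) rv \<Rightarrow> ('d, real^'n) rv \<Rightarrow> bool" where
  "is_subst E f X Y \<longleftrightarrow>
     (\<exists>K. \<forall>x. LG_le E (\<lambda>m \<omega>. norm (Y m \<omega> - f x m \<omega>)) (\<lambda>m \<omega>. K * norm (X m \<omega> - x)))"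

definition is_subst_process ::
    "(('d::finite cpath \<Rightarrow> real) \<Rightarrow> real) \<Rightarrow> real \<Rightarrow> (real \<Rightarrow> real^'n \<Rightarrow> ('d, real^'n) rv) \<Rightarrow>
     ('d, real^'n) process \<Rightarrow> ('d, real^'n) process \<Rightarrow> bool" where
  "is_subst_process E T f X \<beta> \<longleftrightarrow>
     \<beta> \<in> MGbar E 2 T \<and> (\<forall>t\<in>{0..T}. is_subst E (f t) (X t) (\<beta> t))"

text \<open>
  \<open>e\<close> is the orthonormal basis. \<open>R\<close> is the right-hand side of the equation as an element of
  \<open>MGbar E 2 T\<close>; its value at time \<open>t\<close> is compared with the sum of the integrals in
  \<open>LG E 1\<close>, the space in which the integrals \<open>dt\<close> and those against the
  quadratic variations are defined.
\<close>

definition is_solution ::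
    "(('d::finite cpath \<Rightarrow> real) \<Rightarrow> real) \<Rightarrow> real \<Rightarrow> ('d \<Rightarrow> real^'d) \<Rightarrow> real^'n \<Rightarrow>
     (real \<Rightarrow> real^'n \<Rightarrow> ('d, real^'n) rv) \<Rightarrow>
     ('d \<Rightarrow> 'd \<Rightarrow> real \<Rightarrow> real^'n \<Rightarrow> ('d, real^'n) rv) \<Rightarrow>
     ('d \<Rightarrow> real \<Rightarrow> real^'n \<Rightarrow> ('d, real^'n) rv) \<Rightarrow>
     ('d, real^'n) process \<Rightarrow> bool" where
  "is_solution E T e X0 b h \<sigma> X \<longleftrightarrow>
     X \<in> MGbar E 2 T \<and>
     (\<exists>\<beta> \<gamma> \<zeta> R I J S.
        is_subst_process E T b X \<beta> \<and>
        (\<forall>i j. is_subst_process E T (h i j) X (\<gamma> i j)) \<and>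
        (\<forall>j. is_subst_process E T (\<sigma> j) X (\<zeta> j)) \<and>
        (\<forall>t\<in>{0..T}.
           has_int_dt E T (restrict_upto t \<beta>) (I t) \<and>
           (\<forall>i j. has_int_dQV2 E T (e i) (e j) (restrict_upto t (\<gamma> i j)) (J i j t)) \<and>
           (\<forall>j. has_int_dB E T (e j) (restrict_upto t (\<zeta> j)) (S j t)) \<and>
           LG_eq E 1 (R t)
             (\<lambda>m \<omega>. X0 + I t m \<omega> + (\<Sum>i\<in>UNIV. \<Sum>j\<in>UNIV. J i j t m \<omega>)
                      + (\<Sum>j\<in>UNIV. S j t m \<omega>))) \<and>
        R \<in> MGbar E 2 T \<and> MGbar_eq E 2 T X R)"

end

theory Submission
  imports Defs
begin

text \<open>
  All three kinds of integrals are limits of sums \<open>\<Sum> D\<^sub>i u(r\<^sub>i)\<close> over the uniform grids \<open>r\<^sub>i = i T / l\<close>, where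
  \<open>D\<^sub>i\<close> is \<open>r\<^sub>i\<^sub>+\<^sub>1 - r\<^sub>i\<close>, an increment of \<open>a \<bullet> B\<close>, or the square of such an increment. That an increment has
  zero mean and controlled moments given the past yields one estimate
  \<open>\<parallel>\<Sum> D\<^sub>i u(r\<^sub>i)\<parallel>\<^sup>p \<le> C \<Sum> (r\<^sub>i\<^sub>+\<^sub>1 - r\<^sub>i) \<parallel>u(r\<^sub>i)\<parallel>\<^sup>p\<close> for all of them; in particular the integrals of
  \<open>M\<^sup>2\<close>-processes against the quadratic variation lie in \<open>L\<^sup>2\<close>, and the sums of squared increments converge
  in \<open>L\<^sup>2\<close> to the quadratic variation.

  The substitution \<open>f(X)\<close> is the limit of McShane extensions of \<open>f\<close> from finite subsets of a dense
  sequence, evaluated at \<open>X\<close>. It is unique, and Lipschitz in \<open>X\<close> with constant \<open>n K\<close>.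

  Hence the right-hand sides \<open>R, R'\<close> belonging to \<open>X, X'\<close> satisfy
  \<open>\<parallel>R\<^sub>t - R'\<^sub>t\<parallel>\<^sup>2 \<le> \<kappa> \<integral>\<^sub>0\<^sup>t \<parallel>X\<^sub>s - X'\<^sub>s\<parallel>\<^sup>2 ds\<close>. Iterating this inequality gives a bound
  \<open>M exp(4 \<kappa> t) 4\<^sup>-\<^sup>m\<close>, so the Picard iterates converge uniformly in time, and two solutions coincide.
\<close>

text \<open>Elements of the completions have no values on single paths, and \<open>E\<close> is only
  sublinear, not in general given by one measure; so pathwise arguments and almost sure limits are
  not at hand, and every identity has to come out as a vanishing norm. This fixes the
  representation: for a simple process \<open>u\<close> with values in \<open>L_ip\<close> the grid
  sums \<open>S D u l\<close> are indexed by \<open>l\<close>, and the sequence \<open>S D u\<close>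
  is itself an element of the completion, namely the integral. The notion \<open>integrator\<close>
  collects what is needed of \<open>D\<close>; after that all integrals are treated alike. Two
  mismatches have to be bridged. The equation compares its sides in L^1, whereas the iteration takes
  place in L^2; members of \<open>L_ip\<close> have moments of all orders, and therefore an element
  of L^2 with vanishing L^1 norm vanishes. And a process with values in the completion carries no
  measurability of its own, so integrability in time is always derived from approximation by
  piecewise constant processes. The 4 in the exponential weight is a choice: any number above 1
  gives geometric decay.\<close>

notation (ASCII) LIMSEQ ("(_)/ ----> (_)" [60, 60] 60)

section \<open>Cylinder functions on path space\<close>

lemma power_sum3_le:
  fixes a b :: real
  assumes "0 \<le> a" "0 \<le> b"
  shows "(1 + a + b) ^ m \<le> 3 ^ m * (1 + a ^ m + b ^ m)"
proof -
  define c where "c = max 1 (max a b)"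
  have "(1 + a + b) ^ m \<le> (3 * c) ^ m" by (rule power_mono) (use assms in \<open>auto simp: c_def\<close>)
  also have "... = 3 ^ m * c ^ m" by (rule power_mult_distrib)
  also have "c ^ m \<le> 1 + a ^ m + b ^ m" using assms by (auto simp: c_def max_def)
  finally show ?thesis by simp
qed

text \<open>Euclidean norms of tuples are dominated by sums of norms, and a sum of powers by one
  power of a sum. In this form the estimate survives composition and regrouping of the arguments;
  \<open>C_lLipI\<close> leads back.\<close>

lemma C_lLipD:
  fixes phi :: "(nat => 'a::real_normed_vector) => 'b::real_normed_vector"
  assumes "phi \<in> C_lLip k"
  shows "\<exists>C m. 0 \<le> C \<and> (\<forall>x y. norm (phi x - phi y) \<le>
     C * (1 + (\<Sum>i<k. norm (x i)) + (\<Sum>i<k. norm (y i))) ^ m * (\<Sum>i<k. norm (x i - y i)))"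
proof -
  obtain C m where C: "C > 0" and *: "\<And>x y. norm (phi x - phi y) \<le>
       C * (1 + L2_set (%i. norm (x i)) {..<k} ^ m + L2_set (%i. norm (y i)) {..<k} ^ m)
         * L2_set (%i. norm (x i - y i)) {..<k}" using assms unfolding C_lLip_def by blast
  have "norm (phi x - phi y) \<le> (3 * C) * (1 + (\<Sum>i<k. norm (x i)) + (\<Sum>i<k. norm (y i))) ^ m *
      (\<Sum>i<k. norm (x i - y i))" for x y
  proof -
    define A B where "A = (\<Sum>i<k. norm (x i))" and "B = (\<Sum>i<k. norm (y i))"
    have nn: "0 \<le> A" "0 \<le> B" unfolding A_def B_def by (auto intro: sum_nonneg)
    have a: "L2_set (%i. norm (x i)) {..<k} ^ m \<le> (1 + A + B) ^ m"
      by (rule power_mono) (use nn L2_set_le_sum[of "{..<k}" "%i. norm (x i)"] in \<open>auto simp: A_def\<close>)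
    have b: "L2_set (%i. norm (y i)) {..<k} ^ m \<le> (1 + A + B) ^ m"
      by (rule power_mono) (use nn L2_set_le_sum[of "{..<k}" "%i. norm (y i)"] in \<open>auto simp: B_def\<close>)
    have c: "1 \<le> (1 + A + B) ^ m" using nn by simp
    have le: "1 + L2_set (%i. norm (x i)) {..<k} ^ m + L2_set (%i. norm (y i)) {..<k} ^ m
        \<le> 3 * (1 + A + B) ^ m" using a b c by linarith
    have "norm (phi x - phi y) \<le> C * (3 * (1 + A + B) ^ m) * (\<Sum>i<k. norm (x i - y i))"
      by (rule order_trans[OF *], intro mult_mono mult_left_mono L2_set_le_sum le)
         (use C nn in \<open>auto intro!: mult_nonneg_nonneg add_nonneg_nonneg\<close>)
    then show ?thesis by (simp add: A_def B_def mult_ac)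
  qed
  then show ?thesis using C by (intro exI[of _ "3 * C"] exI[of _ m]) auto
qed

lemma C_lLipI:
  fixes phi :: "(nat => 'a::real_normed_vector) => 'b::real_normed_vector"
  assumes C: "0 \<le> C" and *: "\<And>x y. norm (phi x - phi y) \<le>
     C * (1 + (\<Sum>i<k. norm (x i)) + (\<Sum>i<k. norm (y i))) ^ m * (\<Sum>i<k. norm (x i - y i))"
  shows "phi \<in> C_lLip k"
proof -
  \<comment> \<open>The summand 1 makes the constant strictly positive, as \<open>C_lLip\<close>
    demands, even if \<open>C\<close> is 0.\<close>
  define C' where "C' = C * ((1 + real k) ^ m * 3 ^ m) * (1 + real k) + 1"
  have "norm (phi x - phi y) \<le>
       C' * (1 + L2_set (%i. norm (x i)) {..<k} ^ m + L2_set (%i. norm (y i)) {..<k} ^ m)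
         * L2_set (%i. norm (x i - y i)) {..<k}" for x y
  proof -
    define a b d where "a = L2_set (%i. norm (x i)) {..<k}" and "b = L2_set (%i. norm (y i)) {..<k}"
      and "d = L2_set (%i. norm (x i - y i)) {..<k}"
    have nn: "0 \<le> a" "0 \<le> b" "0 \<le> d" by (auto simp: a_def b_def d_def)
    have le: "(\<Sum>i<k. norm (z i)) \<le> (1 + real k) * L2_set (%i. norm (z i)) {..<k}"
      for z :: "nat => 'a"
    proof -
      have "(\<Sum>i<k. norm (z i)) \<le> (\<Sum>i<k. L2_set (%i. norm (z i)) {..<k})"
        by (intro sum_mono member_le_L2_set) auto
      also have "... \<le> (1 + real k) * L2_set (%i. norm (z i)) {..<k}" by (simp add: algebra_simps)
      finally show ?thesis .
    qed
    have "(1 + (\<Sum>i<k. norm (x i)) + (\<Sum>i<k. norm (y i))) ^ m \<le> ((1 + real k) * (1 + a + b)) ^ m"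
      using le[of x] le[of y]
      by (intro power_mono) (auto simp: a_def b_def algebra_simps intro!: add_nonneg_nonneg sum_nonneg)
    also have "... \<le> (1 + real k) ^ m * (3 ^ m * (1 + a ^ m + b ^ m))"
      unfolding power_mult_distrib using power_sum3_le[OF nn(1,2), of m] by (intro mult_left_mono) auto
    finally have p: "(1 + (\<Sum>i<k. norm (x i)) + (\<Sum>i<k. norm (y i))) ^ m \<le>
        (1 + real k) ^ m * (3 ^ m * (1 + a ^ m + b ^ m))" .
    have "norm (phi x - phi y) \<le>
      C * ((1 + real k) ^ m * (3 ^ m * (1 + a ^ m + b ^ m))) * ((1 + real k) * d)"
      by (rule order_trans[OF *], intro mult_mono mult_left_mono p)
         (use C le[of "%i. x i - y i"] nn in \<open>auto simp: d_def intro!: mult_nonneg_nonneg sum_nonneg add_nonneg_nonneg\<close>)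
    also have "... \<le> C' * (1 + a ^ m + b ^ m) * d" unfolding C'_def using C nn by (simp add: algebra_simps)
    finally show ?thesis by (simp add: a_def b_def d_def)
  qed
  moreover have "C' > 0" unfolding C'_def using C by (smt (verit) mult_nonneg_nonneg of_nat_0_le_iff zero_le_power)
  ultimately show ?thesis unfolding C_lLip_def by blast
qed

section \<open>Functions of finitely many path values\<close>

definition psum :: "real set => 'd::finite cpath => real" where
  "psum P w = (\<Sum>p\<in>P. norm (BM p w))"

definition pdist :: "real set => 'd::finite cpath => 'd cpath => real" where
  "pdist P w w' = (\<Sum>p\<in>P. norm (BM p w - BM p w'))"

text \<open>
  A coordinate-free form of \<open>L_ip\<close>: \<open>X\<close> depends on the path only through its values at the
  times in \<open>P\<close>, in a locally Lipschitz way with polynomial growth. Different elements can then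
  be combined by enlarging \<open>P\<close>.
\<close>

definition cyl :: "real set => ('d::finite cpath => 'v::real_normed_vector) => bool" where
  "cyl P X \<longleftrightarrow> (\<exists>C m. 0 \<le> C \<and> (\<forall>w w'. norm (X w - X w') \<le>
     C * (1 + psum P w + psum P w') ^ m * pdist P w w'))"

text \<open>The growth condition for maps of one argument. Pairing and composition with such maps
  preserve \<open>cyl\<close>, so closure of \<open>L_ip\<close> under sums, products and norms
  reduces to one check per operation.\<close>

definition plip :: "('a::real_normed_vector => 'b::real_normed_vector) => bool" where
  "plip psi \<longleftrightarrow> (\<exists>C m. 0 \<le> C \<and> (\<forall>x y. norm (psi x - psi y) \<le> C * (1 + norm x + norm y) ^ m * norm (x - y)))"

lemma psum_nonneg [simp]: "0 \<le> psum P w" by (simp add: psum_def sum_nonneg)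

lemma pdist_nonneg [simp]: "0 \<le> pdist P w w'" by (simp add: pdist_def sum_nonneg)

lemma BM_at_nonpos: "t \<le> 0 ==> BM t w = 0" using Rep_cpath[of w] by (auto simp: BM_def)

lemma cyl_mono:
  assumes "cyl P X" "P \<subseteq> Q" "finite Q"
  shows "cyl Q X"
proof -
  obtain C m where C: "0 \<le> C" "\<And>w w'. norm (X w - X w') \<le>
     C * (1 + psum P w + psum P w') ^ m * pdist P w w'" using assms(1) unfolding cyl_def by blast
  have s: "psum P w \<le> psum Q w" for w unfolding psum_def by (rule sum_mono2) (use assms in auto)
  have d: "pdist P w w' \<le> pdist Q w w'" for w w' unfolding pdist_def by (rule sum_mono2) (use assms in auto)
  have "norm (X w - X w') \<le> C * (1 + psum Q w + psum Q w') ^ m * pdist Q w w'" for w w'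
    by (rule order_trans[OF C(2)], intro mult_mono mult_left_mono power_mono add_mono s d order_refl)
       (use C(1) in \<open>auto intro!: mult_nonneg_nonneg zero_le_power add_nonneg_nonneg\<close>)
  with C(1) show ?thesis unfolding cyl_def by blast
qed

text \<open>All paths start at 0, so time 0 contributes nothing to either sum. It is discarded
  because values of a path can be prescribed only at positive times.\<close>

lemma cyl_remove_0:
  assumes "cyl P X"
  shows "cyl (P - {0}) X"
proof -
  have "psum (P - {0}) w = psum P w" for w :: "'a cpath" by (cases "finite P") (auto simp: psum_def sum_diff1 BM_at_nonpos)
  moreover have "pdist (P - {0}) w w' = pdist P w w'" for w w' :: "'a cpath"
    by (cases "finite P") (auto simp: pdist_def sum_diff1 BM_at_nonpos)
  ultimately show ?thesis using assms by (simp add: cyl_def)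
qed

lemma cyl_cong: "cyl P X ==> (\<And>p. p \<in> P ==> BM p w = BM p w') ==> X w = X w'"
proof -
  assume "cyl P X" and eq: "\<And>p. p \<in> P ==> BM p w = BM p w'"
  then obtain C m where C: "\<And>w w'. norm (X w - X w') \<le>
     C * (1 + psum P w + psum P w') ^ m * pdist P w w'" unfolding cyl_def by blast
  have "pdist P w w' = 0" using eq by (simp add: pdist_def)
  then show "X w = X w'" using C[of w w'] by simp
qed

lemma cyl_const: "cyl P (%_. c)" unfolding cyl_def by (intro exI[of _ 0]) simp

text \<open>Comparison with the zero path: the Lipschitz estimate bounds the difference by a power
  of \<open>1 + psum P w\<close>, and the constant \<open>norm (X z)\<close> is absorbed.\<close>

lemma cyl_growth:
  fixes X :: "'d::finite cpath => 'v::real_normed_vector"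
  assumes "cyl P X"
  shows "\<exists>C m. 0 \<le> C \<and> (\<forall>w. norm (X w) \<le> C * (1 + psum P w) ^ m)"
proof -
  obtain C m where C: "0 \<le> C" "\<And>w w'. norm (X w - X w') \<le>
     C * (1 + psum P w + psum P w') ^ m * pdist P w w'" using assms unfolding cyl_def by blast
  define z :: "'d cpath" where "z = Abs_cpath (%_. 0)"
  have z: "BM p z = 0" for p by (simp add: z_def BM_def Abs_cpath_inverse)
  have "norm (X w) \<le> (norm (X z) + C) * (1 + psum P w) ^ Suc m" for w
  proof -
    have "norm (X w) \<le> norm (X z) + norm (X w - X z)" by norm
    also have "norm (X w - X z) \<le> C * (1 + psum P w) ^ m * psum P w"
      using C(2)[of w z] by (simp add: psum_def pdist_def z)
    also have "... \<le> C * (1 + psum P w) ^ Suc m"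
      using C(1) mult_left_mono[of "psum P w" "1 + psum P w" "C * (1 + psum P w) ^ m"] by (simp add: mult_ac)
    also have "norm (X z) \<le> norm (X z) * (1 + psum P w) ^ Suc m"
      using mult_left_mono[of 1 "(1 + psum P w) ^ Suc m" "norm (X z)"] by (simp add: one_le_power del: power_Suc)
    finally show ?thesis by (simp add: algebra_simps)
  qed
  then show ?thesis using C(1) by (intro exI[of _ "norm (X z) + C"] exI[of _ "Suc m"]) auto
qed

lemma cyl_plip:
  fixes X :: "'d::finite cpath => 'v::real_normed_vector"
  assumes "cyl P X" "plip psi"
  shows "cyl P (%w. psi (X w))"
proof -
  obtain C m where C: "0 \<le> C" "\<And>w w'. norm (X w - X w') \<le>
     C * (1 + psum P w + psum P w') ^ m * pdist P w w'" using assms unfolding cyl_def by blast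
  obtain D n where D: "0 \<le> D" "\<And>x y. norm (psi x - psi y) \<le> D * (1 + norm x + norm y) ^ n * norm (x - y)"
    using assms unfolding plip_def by blast
  obtain A k where A: "0 \<le> A" "\<And>w. norm (X w) \<le> A * (1 + psum P w) ^ k" using cyl_growth[OF assms(1)] by blast
  have "norm (psi (X w) - psi (X w')) \<le>
      (D * (1 + 2 * A) ^ n * C) * (1 + psum P w + psum P w') ^ (k * n + m) * pdist P w w'" for w w'
  proof -
    define s where "s = 1 + psum P w + psum P w'"
    have s: "1 \<le> s ^ k" "(1 + psum P w) ^ k \<le> s ^ k" "(1 + psum P w') ^ k \<le> s ^ k"
      by (auto simp: s_def intro!: one_le_power power_mono)
    have "1 + norm (X w) + norm (X w') \<le> s ^ k + A * s ^ k + A * s ^ k" using A(2)[of w] A(2)[of w'] s A(1)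
      by (intro add_mono) (auto intro: order_trans[OF _ mult_left_mono])
    then have "(1 + norm (X w) + norm (X w')) ^ n \<le> ((1 + 2 * A) * s ^ k) ^ n"
      by (intro power_mono) (auto simp: algebra_simps)
    then have "norm (psi (X w) - psi (X w')) \<le>
        D * ((1 + 2 * A) * s ^ k) ^ n * (C * s ^ m * pdist P w w')"
      by (intro order_trans[OF D(2)] mult_mono mult_left_mono C(2)[folded s_def])
         (use A C D in \<open>auto simp: s_def\<close>)
    then show ?thesis by (simp add: s_def power_mult_distrib power_mult power_add mult_ac)
  qed
  then show ?thesis unfolding cyl_def using A C D by (intro exI[of _ "D * (1 + 2 * A) ^ n * C"] exI[of _ "k * n + m"]) auto
qed

lemma cyl_Pair:
  assumes "cyl P X" "cyl P Y"
  shows "cyl P (%w. (X w, Y w))"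
proof -
  obtain C m where C: "0 \<le> C" "\<And>w w'. norm (X w - X w') \<le>
     C * (1 + psum P w + psum P w') ^ m * pdist P w w'" using assms unfolding cyl_def by blast
  obtain D n where D: "0 \<le> D" "\<And>w w'. norm (Y w - Y w') \<le>
     D * (1 + psum P w + psum P w') ^ n * pdist P w w'" using assms unfolding cyl_def by blast
  have "norm ((X w, Y w) - (X w', Y w')) \<le>
      (C + D) * (1 + psum P w + psum P w') ^ (m + n) * pdist P w w'" for w w'
  proof -
    define s where "s = 1 + psum P w + psum P w'"
    have s: "1 \<le> s" by (simp add: s_def)
    have "norm ((X w, Y w) - (X w', Y w')) \<le> norm (X w - X w') + norm (Y w - Y w')"
      using norm_Pair_le[of "X w - X w'" "Y w - Y w'"] by simp
    also have "... \<le> C * s ^ m * pdist P w w' + D * s ^ n * pdist P w w'"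
      using C(2)[of w w'] D(2)[of w w'] by (intro add_mono) (auto simp: s_def)
    also have "... \<le> C * s ^ (m + n) * pdist P w w' + D * s ^ (m + n) * pdist P w w'"
      using C D s by (intro add_mono mult_right_mono mult_left_mono power_increasing) auto
    finally show ?thesis by (simp add: s_def algebra_simps)
  qed
  then show ?thesis unfolding cyl_def using C D by (intro exI[of _ "C + D"] exI[of _ "m + n"]) auto
qed

text \<open>A sum of hat functions of half-width \<open>delta\<close> centred at the points of
  \<open>P\<close>. As \<open>delta\<close> is at most the distance between distinct points of
  \<open>P\<close> together with 0, each hat vanishes at the other points and at all nonpositive
  times.\<close>

lemma path_interpolation:
  fixes v :: "real => real^'d::finite"
  assumes "finite P" "P \<subseteq> {0<..}"
  shows "\<exists>w. \<forall>p\<in>P. BM p w = v p"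
proof -
  obtain delta where delta: "delta > 0" "\<And>p q. p \<in> insert 0 P ==> q \<in> insert 0 P ==> p \<noteq> q ==> delta \<le> dist p q"
  proof -
    \<comment> \<open>The extra element 1 keeps the set nonempty when \<open>P\<close> is
      empty.\<close>
    define S where "S = insert 1 ((%(p, q). dist p q) ` ({(p, q) \<in> insert 0 P \<times> insert 0 P. p \<noteq> q}))"
    have "finite {(p, q) \<in> insert 0 P \<times> insert 0 P. p \<noteq> q}"
      by (rule finite_subset[of _ "insert 0 P \<times> insert 0 P"]) (use assms in auto)
    then have S: "finite S" "S \<noteq> {}" "\<forall>s\<in>S. s > 0" by (auto simp: S_def)
    show thesis
    proof (rule that[of "Min S"])
      show "Min S > 0" using S by simp
      fix p q assume "p \<in> insert 0 P" "q \<in> insert 0 P" "p \<noteq> q"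
      then have "dist p q \<in> S" unfolding S_def by (intro insertI2 image_eqI[of _ _ "(p, q)"]) auto
      then show "Min S \<le> dist p q" using S by simp
    qed
  qed
  define f where "f t = (\<Sum>p\<in>P. max 0 (1 - \<bar>t - p\<bar> / delta) *\<^sub>R v p)" for t
  have "continuous_on {0..} f" unfolding f_def using delta(1) by (intro continuous_intros) auto
  moreover have "f t = 0" if "t \<le> 0" for t
  proof -
    have "1 \<le> \<bar>t - p\<bar> / delta" if "p \<in> P" for p
    proof -
      have "delta \<le> p" "0 < p" using delta(2)[of p 0] that assms by (auto simp: dist_real_def)
      then show ?thesis using \<open>t \<le> 0\<close> delta(1) by (auto simp: field_simps)
    qed
    then show ?thesis unfolding f_def by (intro sum.neutral) (force simp: max_def)
  qed
  ultimately have f: "BM t (Abs_cpath f) = f t" for t by (simp add: BM_def Abs_cpath_inverse)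
  have "f q = v q" if "q \<in> P" for q
  proof -
    have "f q = (\<Sum>p\<in>P. if p = q then v q else 0)" unfolding f_def
    proof (intro sum.cong refl)
      fix p assume "p \<in> P"
      show "max 0 (1 - \<bar>q - p\<bar> / delta) *\<^sub>R v p = (if p = q then v q else 0)"
      proof (cases "p = q")
        case False
        then have "1 \<le> \<bar>q - p\<bar> / delta"
          using delta(1) delta(2)[of q p] that \<open>p \<in> P\<close> by (auto simp: field_simps dist_real_def)
        then show ?thesis using False by (auto simp: max_def)
      qed auto
    qed
    then show ?thesis using assms that by simp
  qed
  with f show ?thesis by metis
qed

text \<open>Repetitions among the times \<open>t i\<close> merge in the set \<open>P\<close>; a sum
  over the indices is at most \<open>1 + k\<close> times the sum over \<open>P\<close>.\<close>

lemma L_ip_upto_cylD: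
  assumes "X \<in> L_ip_upto s"
  shows "\<exists>P. finite P \<and> P \<subseteq> {0..s} \<and> cyl P X"
proof -
  obtain k t phi where t: "\<forall>i<k. 0 \<le> t i \<and> t i \<le> s" and phi: "phi \<in> C_lLip k"
    and X: "X = (%w. phi (%i. BM (t i) w))"
    using assms unfolding L_ip_upto_def by blast
  obtain C m where C: "0 \<le> C" "\<And>x y. norm (phi x - phi y) \<le>
     C * (1 + (\<Sum>i<k. norm (x i)) + (\<Sum>i<k. norm (y i))) ^ m * (\<Sum>i<k. norm (x i - y i))"
    using C_lLipD[OF phi] by blast
  define P where "P = t ` {..<k}"
  have sum_le: "(\<Sum>i<k. g (t i)) \<le> (1 + real k) * sum g P" if "\<And>p. 0 \<le> g p" for g :: "real => real"
  proof -
    have "(\<Sum>i<k. g (t i)) \<le> (\<Sum>i<k. sum g P)" by (intro sum_mono member_le_sum) (auto simp: P_def that)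
    also have "... \<le> (1 + real k) * sum g P" by (simp add: that sum_nonneg algebra_simps)
    finally show ?thesis .
  qed
  have "norm (X w - X w') \<le>
      (C * (1 + real k) ^ m * (1 + real k)) * (1 + psum P w + psum P w') ^ m * pdist P w w'" for w w'
  proof -
    have p: "(1 + (\<Sum>i<k. norm (BM (t i) w)) + (\<Sum>i<k. norm (BM (t i) w'))) ^ m \<le>
        ((1 + real k) * (1 + psum P w + psum P w')) ^ m" using sum_le[of "%p. norm (BM p w)"] sum_le[of "%p. norm (BM p w')"]
      by (intro power_mono) (auto simp: psum_def algebra_simps intro!: add_nonneg_nonneg sum_nonneg)
    have "norm (X w - X w') \<le>
        C * ((1 + real k) * (1 + psum P w + psum P w')) ^ m * ((1 + real k) * pdist P w w')" unfolding X
      by (rule order_trans[OF C(2)], intro mult_mono mult_left_mono p)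
         (use C(1) sum_le[of "%p. norm (BM p w - BM p w')"] in
            \<open>auto simp: pdist_def intro!: mult_nonneg_nonneg zero_le_power add_nonneg_nonneg sum_nonneg\<close>)
    then show ?thesis by (simp add: power_mult_distrib mult_ac)
  qed
  then have "cyl P X" unfolding cyl_def using C(1) by (intro exI[of _ "C * (1 + real k) ^ m * (1 + real k)"] exI[of _ m]) auto
  moreover have "finite P" "P \<subseteq> {0..s}" using t by (auto simp: P_def)
  ultimately show ?thesis by (intro exI[of _ P]) simp
qed

text \<open>A representing function is recovered by evaluating \<open>X\<close> at some path with
  the given values at the times in \<open>Q\<close>. The choice of the path is immaterial since
  \<open>X\<close> sees these values only, and the estimate for \<open>X\<close> becomes the one for
  \<open>C_lLip\<close>.\<close>

lemma cyl_L_ip_upto: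
  fixes X :: "'d::finite cpath => 'v::euclidean_space"
  assumes "finite P" "P \<subseteq> {0..s}" "cyl P X"
  shows "X \<in> L_ip_upto s"
proof -
  define Q where "Q = P - {0}"
  have Q: "finite Q" "Q \<subseteq> {0<..}" "Q \<subseteq> {0..s}" using assms by (auto simp: Q_def)
  obtain C m where C: "0 \<le> C" "\<And>w w'. norm (X w - X w') \<le>
     C * (1 + psum Q w + psum Q w') ^ m * pdist Q w w'" using cyl_remove_0[OF assms(3)] unfolding cyl_def Q_def by blast
  define k where "k = card Q"
  obtain t where t: "bij_betw t {..<k} Q" using ex_bij_betw_nat_finite[OF Q(1)] by (auto simp: k_def atLeast0LessThan)
  define t' where "t' = the_inv_into {..<k} t"
  define path where "path x = (SOME w. \<forall>p\<in>Q. BM p w = x (t' p))" for x :: "nat => real^'d"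
  have path: "BM (t i) (path x) = x i" if "i < k" for x i
  proof -
    have "\<forall>p\<in>Q. BM p (path x) = x (t' p)"
      unfolding path_def by (rule someI_ex, rule path_interpolation[OF Q(1,2)])
    then show ?thesis using that t by (auto simp: t'_def bij_betw_def the_inv_into_f_f)
  qed
  have sum_Q: "sum g Q = (\<Sum>i<k. g (t i))" for g :: "real => real" using sum.reindex_bij_betw[OF t, of g] by simp
  have "(%x. X (path x)) \<in> C_lLip k"
  proof (rule C_lLipI[OF C(1)])
    fix x y
    show "norm (X (path x) - X (path y)) \<le>
      C * (1 + (\<Sum>i<k. norm (x i)) + (\<Sum>i<k. norm (y i))) ^ m * (\<Sum>i<k. norm (x i - y i))"
      using C(2)[of "path x" "path y"] by (simp add: psum_def pdist_def sum_Q path)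
  qed
  moreover have "X = (%w. X (path (%i. BM (t i) w)))"
  proof
    fix w
    have "pdist Q w (path (%i. BM (t i) w)) = 0" by (simp add: pdist_def sum_Q path)
    then show "X w = X (path (%i. BM (t i) w))" using C(2)[of w "path (%i. BM (t i) w)"] by simp
  qed
  moreover have "\<forall>i<k. 0 \<le> t i \<and> t i \<le> s" using Q t by (auto simp: bij_betw_def)
  ultimately show ?thesis unfolding L_ip_upto_def by (intro CollectI exI[of _ k] exI[of _ t] exI[of _ "%x. X (path x)"]) auto
qed

lemma L_ip_upto_iff_cyl: "X \<in> L_ip_upto s \<longleftrightarrow> (\<exists>P. finite P \<and> P \<subseteq> {0..s} \<and> cyl P X)"
proof
  assume "X \<in> L_ip_upto s"
  then show "\<exists>P. finite P \<and> P \<subseteq> {0..s} \<and> cyl P X" by (rule L_ip_upto_cylD)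
next
  assume "\<exists>P. finite P \<and> P \<subseteq> {0..s} \<and> cyl P X"
  then show "X \<in> L_ip_upto s" using cyl_L_ip_upto by meson
qed

section \<open>Closure of \<open>L_ip\<close> under pointwise operations\<close>

lemma L_ip_upto_mono: "s \<le> t ==> L_ip_upto s \<subseteq> L_ip_upto t"
proof
  fix X :: "'a cpath => 'b"
  assume "s \<le> t" "X \<in> L_ip_upto s"
  then obtain P where "finite P" "P \<subseteq> {0..s}" "cyl P X" using L_ip_upto_cylD by meson
  with \<open>s \<le> t\<close> show "X \<in> L_ip_upto t" by (intro cyl_L_ip_upto[of P]) auto
qed

lemma L_ip_upto_subset_L_ip: "L_ip_upto s \<subseteq> L_ip"
proof
  fix X :: "'a cpath => 'b"
  assume "X \<in> L_ip_upto s"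
  then obtain k t phi where "\<forall>i<k. 0 \<le> t i \<and> t i \<le> s" "phi \<in> C_lLip k" "X = (%w. phi (%i. BM (t i) w))"
    unfolding L_ip_upto_def by blast
  then show "X \<in> L_ip" unfolding L_ip_def by (intro CollectI exI[of _ k] exI[of _ t] exI[of _ phi]) auto
qed

lemma L_ip_upto_L_ip: "X \<in> L_ip_upto s ==> X \<in> L_ip" using L_ip_upto_subset_L_ip by blast

lemma L_ip_D: "X \<in> L_ip ==> \<exists>s\<ge>0. X \<in> L_ip_upto s"
proof -
  assume "X \<in> L_ip"
  then obtain k t phi where t: "\<forall>i<k. 0 \<le> t i" "phi \<in> C_lLip k" "X = (%w. phi (%i. BM (t i) w))"
    unfolding L_ip_def by blast
  have "\<forall>i<k. 0 \<le> t i \<and> t i \<le> (\<Sum>i<k. t i)" using t(1) by (auto intro!: member_le_sum)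
  moreover have "0 \<le> (\<Sum>i<k. t i)" using t(1) by (auto intro: sum_nonneg)
  ultimately show ?thesis using t(2,3) unfolding L_ip_upto_def
    by (intro exI[of _ "\<Sum>i<k. t i"] conjI CollectI exI[of _ k] exI[of _ t] exI[of _ phi]) auto
qed

lemma L_ip_upto_plip:
  "X \<in> L_ip_upto s ==> plip psi ==> (%w. psi (X w)) \<in> L_ip_upto s"
  using cyl_plip[of _ X psi] unfolding L_ip_upto_iff_cyl by meson

lemma L_ip_upto_Pair:
  assumes "X \<in> L_ip_upto s" "Y \<in> L_ip_upto s"
  shows "(%w. (X w, Y w)) \<in> L_ip_upto s"
proof -
  obtain P Q where "finite P" "P \<subseteq> {0..s}" "cyl P X" "finite Q" "Q \<subseteq> {0..s}" "cyl Q Y"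
    using L_ip_upto_cylD[OF assms(1)] L_ip_upto_cylD[OF assms(2)] by meson
  then have "cyl (P \<union> Q) (%w. (X w, Y w))" "finite (P \<union> Q) \<and> P \<union> Q \<subseteq> {0..s}"
    using cyl_Pair[OF cyl_mono[of P X "P \<union> Q"] cyl_mono[of Q Y "P \<union> Q"]] by auto
  then show ?thesis unfolding L_ip_upto_iff_cyl by (intro exI[of _ "P \<union> Q"]) simp
qed

lemma plip_lipschitz: "(\<And>x y. norm (psi x - psi y) \<le> L * norm (x - y)) ==> plip psi" unfolding plip_def
  by (intro exI[of _ "\<bar>L\<bar>"] exI[of _ 0]) (auto intro: order_trans[OF _ mult_right_mono[OF abs_ge_self]])

text \<open>One argument is changed at a time, the other is bounded by the norms; this gives growth
  of degree 1 and covers scalar multiples, inner products and ordinary products.\<close>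

lemma plip_bilinear:
  assumes "bounded_bilinear B"
  shows "plip (%z. B (fst z) (snd z))"
proof -
  interpret bounded_bilinear B by fact
  obtain K where K: "0 \<le> K" "\<And>a b. norm (B a b) \<le> norm a * norm b * K" using nonneg_bounded by blast
  have "norm (B (fst x) (snd x) - B (fst y) (snd y)) \<le> K * (1 + norm x + norm y) ^ 1 * norm (x - y)" for x y
  proof -
    have "B (fst x) (snd x) - B (fst y) (snd y) = B (fst x) (snd (x - y)) + B (fst (x - y)) (snd y)"
      by (simp add: diff_left diff_right)
    also have "norm ... \<le> norm (fst x) * norm (snd (x - y)) * K + norm (fst (x - y)) * norm (snd y) * K"
      using K(2) by (intro order_trans[OF norm_triangle_ineq] add_mono)
    also have "... \<le> norm x * norm (x - y) * K + norm (x - y) * norm y * K"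
      using K(1) norm_fst_le[of "fst x" "snd x"] norm_snd_le[of "snd y" "fst y"]
        norm_fst_le[of "fst (x - y)" "snd (x - y)"] norm_snd_le[of "snd (x - y)" "fst (x - y)"] unfolding prod.collapse
      by (intro add_mono mult_right_mono mult_mono) auto
    also have "... \<le> K * (1 + norm x + norm y) ^ 1 * norm (x - y)" using K(1) by (simp add: algebra_simps)
    finally show ?thesis .
  qed
  then show ?thesis unfolding plip_def using K(1) by blast
qed

lemma plip_add: "plip (%z. fst z + snd z)"
proof (rule plip_lipschitz)
  fix x y :: "'a \<times> 'a"
  have "norm (fst x + snd x - (fst y + snd y)) \<le> norm (fst (x - y)) + norm (snd (x - y))"
    by (simp add: norm_diff_triangle_ineq)
  also have "... \<le> 2 * norm (x - y)"
    using norm_fst_le[of "fst (x - y)" "snd (x - y)"] norm_snd_le[of "snd (x - y)" "fst (x - y)"]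
    unfolding prod.collapse by linarith
  finally show "norm (fst x + snd x - (fst y + snd y)) \<le> 2 * norm (x - y)" .
qed

lemma plip_scale: "plip (%x. c *\<^sub>R x)" by (rule plip_lipschitz[of _ "\<bar>c\<bar>"]) (simp flip: scaleR_diff_right)

lemma plip_norm: "plip norm" by (rule plip_lipschitz[of _ 1]) (simp add: norm_triangle_ineq3)

lemma L_ip_upto_plip2:
  "X \<in> L_ip_upto s ==> Y \<in> L_ip_upto s ==> plip (%z. psi (fst z) (snd z)) ==>
   (%w. psi (X w) (Y w)) \<in> L_ip_upto s"
  using L_ip_upto_plip[OF L_ip_upto_Pair, of X s Y "%z. psi (fst z) (snd z)"] by simp

lemma L_ip_upto_const: "(%_. c) \<in> L_ip_upto s" unfolding L_ip_upto_iff_cyl using cyl_const by (intro exI[of _ "{}"]) simp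

lemma L_ip_upto_add: "X \<in> L_ip_upto s ==> Y \<in> L_ip_upto s ==> (%w. X w + Y w) \<in> L_ip_upto s"
  by (rule L_ip_upto_plip2[OF _ _ plip_add])

lemma L_ip_upto_scaleR: "X \<in> L_ip_upto s ==> (%w. c *\<^sub>R X w) \<in> L_ip_upto s"
  by (rule L_ip_upto_plip[OF _ plip_scale])

lemma L_ip_upto_minus: "X \<in> L_ip_upto s ==> (%w. - X w) \<in> L_ip_upto s" using L_ip_upto_scaleR[of X s "-1"] by simp

lemma L_ip_upto_diff: "X \<in> L_ip_upto s ==> Y \<in> L_ip_upto s ==> (%w. X w - Y w) \<in> L_ip_upto s"
  using L_ip_upto_add[OF _ L_ip_upto_minus, of X s Y] by simp

lemma L_ip_upto_norm: "X \<in> L_ip_upto s ==> (%w. norm (X w)) \<in> L_ip_upto s" by (rule L_ip_upto_plip[OF _ plip_norm])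

lemma L_ip_upto_scale_by:
  "r \<in> L_ip_upto s ==> X \<in> L_ip_upto s ==> (%w. r w *\<^sub>R X w) \<in> L_ip_upto s"
  by (rule L_ip_upto_plip2[OF _ _ plip_bilinear[OF bounded_bilinear_scaleR]])

lemma L_ip_upto_inner:
  "X \<in> L_ip_upto s ==> Y \<in> L_ip_upto s ==> (%w. X w \<bullet> Y w) \<in> L_ip_upto s"
  by (rule L_ip_upto_plip2[OF _ _ plip_bilinear[OF bounded_bilinear_inner]])

lemma L_ip_upto_mult:
  fixes X Y :: "_ => real"
  shows "X \<in> L_ip_upto s ==> Y \<in> L_ip_upto s ==> (%w. X w * Y w) \<in> L_ip_upto s"
  using L_ip_upto_inner[of X s Y] by simp

lemma L_ip_upto_power:
  fixes X :: "_ => real"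
  shows "X \<in> L_ip_upto s ==> (%w. X w ^ n) \<in> L_ip_upto s"
  by (induction n) (auto intro: L_ip_upto_const L_ip_upto_mult)

lemma L_ip_upto_sum: "(\<And>i. i \<in> I ==> X i \<in> L_ip_upto s) ==> (%w. \<Sum>i\<in>I. X i w) \<in> L_ip_upto s"
  by (induction I rule: infinite_finite_induct) (auto intro: L_ip_upto_const L_ip_upto_add)

lemma L_ip_upto_max:
  fixes X Y :: "_ => real"
  assumes "X \<in> L_ip_upto s" "Y \<in> L_ip_upto s"
  shows "(%w. max (X w) (Y w)) \<in> L_ip_upto s"
proof -
  have "max x y = (1/2) *\<^sub>R (x + y + norm (x - y))" for x y :: real by (auto simp: max_def)
  then show ?thesis by (simp only:) (intro L_ip_upto_scaleR L_ip_upto_add L_ip_upto_norm L_ip_upto_diff assms)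
qed

lemma L_ip_upto_BM: "0 \<le> t ==> t \<le> s ==> BM t \<in> L_ip_upto s"
  unfolding L_ip_upto_iff_cyl cyl_def psum_def pdist_def by (intro exI[of _ "{t}"] conjI exI[of _ 1] exI[of _ 0]) auto

lemma L_ip_common:
  assumes "X \<in> L_ip" "Y \<in> L_ip"
  shows "\<exists>s\<ge>0. X \<in> L_ip_upto s \<and> Y \<in> L_ip_upto s"
proof -
  obtain s t where "0 \<le> s" "X \<in> L_ip_upto s" "Y \<in> L_ip_upto t" using L_ip_D assms by meson
  then show ?thesis using L_ip_upto_mono[of s "max s t"] L_ip_upto_mono[of t "max s t"] by (intro exI[of _ "max s t"]) auto
qed

lemma L_ip_plip: "X \<in> L_ip ==> plip psi ==> (%w. psi (X w)) \<in> L_ip"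
  by (elim L_ip_D[THEN exE] conjE) (rule L_ip_upto_L_ip, rule L_ip_upto_plip)

lemma L_ip_plip2:
  "X \<in> L_ip ==> Y \<in> L_ip ==> plip (%z. psi (fst z) (snd z)) ==> (%w. psi (X w) (Y w)) \<in> L_ip"
  by (drule (1) L_ip_common, elim exE conjE) (rule L_ip_upto_L_ip, rule L_ip_upto_plip2)

lemma L_ip_const: "(%_. c) \<in> L_ip" by (rule L_ip_upto_L_ip[OF L_ip_upto_const])

lemma L_ip_add: "X \<in> L_ip ==> Y \<in> L_ip ==> (%w. X w + Y w) \<in> L_ip" by (rule L_ip_plip2[OF _ _ plip_add])

lemma L_ip_scaleR: "X \<in> L_ip ==> (%w. c *\<^sub>R X w) \<in> L_ip" by (rule L_ip_plip[OF _ plip_scale])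

lemma L_ip_minus: "X \<in> L_ip ==> (%w. - X w) \<in> L_ip" using L_ip_scaleR[of X "-1"] by simp

lemma L_ip_diff: "X \<in> L_ip ==> Y \<in> L_ip ==> (%w. X w - Y w) \<in> L_ip"
  using L_ip_add[OF _ L_ip_minus, of X Y] by simp

lemma L_ip_norm: "X \<in> L_ip ==> (%w. norm (X w)) \<in> L_ip" by (rule L_ip_plip[OF _ plip_norm])

lemma L_ip_scale_by: "r \<in> L_ip ==> X \<in> L_ip ==> (%w. r w *\<^sub>R X w) \<in> L_ip"
  by (rule L_ip_plip2[OF _ _ plip_bilinear[OF bounded_bilinear_scaleR]])

lemma L_ip_inner: "X \<in> L_ip ==> Y \<in> L_ip ==> (%w. X w \<bullet> Y w) \<in> L_ip"
  by (rule L_ip_plip2[OF _ _ plip_bilinear[OF bounded_bilinear_inner]])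

lemma L_ip_mult: "X \<in> L_ip ==> Y \<in> L_ip ==> (%w. X w * Y w :: real) \<in> L_ip" using L_ip_inner[of X Y] by simp

lemma L_ip_power: "X \<in> L_ip ==> (%w. X w ^ n :: real) \<in> L_ip" by (induction n) (auto intro: L_ip_const L_ip_mult)

lemma L_ip_sum: "(\<And>i. i \<in> I ==> X i \<in> L_ip) ==> (%w. \<Sum>i\<in>I. X i w) \<in> L_ip"
  by (induction I rule: infinite_finite_induct) (auto intro: L_ip_const L_ip_add)

lemma L_ip_max: "X \<in> L_ip ==> Y \<in> L_ip ==> (%w. max (X w) (Y w) :: real) \<in> L_ip"
  by (drule (1) L_ip_common, elim exE conjE) (rule L_ip_upto_L_ip, rule L_ip_upto_max)

lemma L_ip_BM: "0 \<le> t ==> BM t \<in> L_ip" by (rule L_ip_upto_L_ip[OF L_ip_upto_BM[of t t]]) auto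

lemmas L_ip_intros =
  L_ip_const L_ip_add L_ip_scaleR L_ip_minus L_ip_diff L_ip_norm L_ip_scale_by L_ip_inner
  L_ip_mult L_ip_power L_ip_sum L_ip_max

section \<open>The G-expectation as a sublinear expectation\<close>

definition gridn :: "nat => (nat => real) => bool" where
  "gridn n t \<longleftrightarrow> t 0 = 0 \<and> (\<forall>i<n. t i < t (Suc i))"

lemma gridn_less: "gridn n t ==> i < j ==> j \<le> n ==> t i < t j"
proof (induction j)
  case (Suc j)
  then show ?case unfolding gridn_def by (metis Suc_le_lessD less_SucE less_trans order_less_imp_le)
qed simp

lemma gridn_pos: "gridn n t ==> 0 < j ==> j \<le> n ==> 0 < t j" using gridn_less[of n t 0 j] by (simp add: gridn_def)

lemma gridn_exists:
  assumes "finite P" "P \<subseteq> {0..s}" "0 \<le> s"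
  shows "\<exists>n t. gridn n t \<and> P \<subseteq> t ` {..n} \<and> t n = s"
proof -
  define xs where "xs = sorted_list_of_set (insert 0 (insert s P))"
  have set: "set xs = insert 0 (insert s P)" unfolding xs_def by (rule set_sorted_list_of_set) (use assms in auto)
  have srt: "sorted_wrt (<) xs" by (simp add: xs_def)
  define n where "n = length xs - 1"
  have len: "length xs = Suc n" using set by (cases xs) (auto simp: n_def)
  have in_range: "xs ! i \<in> {0..s}" if "i \<le> n" for i using nth_mem[of i xs] that len set assms by auto
  have less: "xs ! i < xs ! j" if "i < j" "j \<le> n" for i j using sorted_wrt_nth_less[OF srt, of i j] that len by simp
  obtain i where i: "i \<le> n" "xs ! i = 0" using set len by (metis insertI1 in_set_conv_nth less_Suc_eq_le)
  obtain j where j: "j \<le> n" "xs ! j = s" using set len by (metis insertI1 insertI2 in_set_conv_nth less_Suc_eq_le)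
  have "xs ! 0 = 0" using less[of 0 i] in_range[of 0] i by (cases "i = 0") auto
  moreover have "xs ! n = s" using less[of j n] in_range[of n] j by (cases "j = n") auto
  moreover have "P \<subseteq> (%i. xs ! i) ` {..n}"
  proof
    fix p assume "p \<in> P"
    then have "p \<in> set xs" using set by simp
    then obtain i where "i < length xs" "xs ! i = p" by (auto simp: in_set_conv_nth)
    then show "p \<in> (%i. xs ! i) ` {..n}" using len by auto
  qed
  ultimately show ?thesis using less by (intro exI[of _ n] exI[of _ "%i. xs ! i"]) (auto simp: gridn_def)
qed

text \<open>The G-expectation is defined through increments, cylinder functions depend on values.
  Composition with a path that has the increments \<open>v i\<close> over the cells of the grid
  translates one description into the other.\<close>

definition grid_path :: "nat => (nat => real) => (nat => real^'d) => 'd::finite cpath" where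
  "grid_path n t v = (SOME \<omega>. \<forall>j\<le>n. BM (t j) \<omega> = (\<Sum>i<j. v i))"

lemma BM_grid_path:
  assumes "gridn n t" "j \<le> n"
  shows "BM (t j) (grid_path n t v) = (\<Sum>i<j. v i)"
proof -
  have inj: "inj_on t {..n}" using gridn_less[OF assms(1)] by (intro inj_onI) (metis atMost_iff less_irrefl linorder_neqE_nat)
  have "\<exists>\<omega>. \<forall>p\<in>t ` {1..n}. BM p \<omega> = (\<Sum>i<the_inv_into {..n} t p. v i)"
    by (rule path_interpolation) (use gridn_pos[OF assms(1)] in auto)
  then obtain \<omega> where \<omega>: "\<And>j. 1 \<le> j ==> j \<le> n ==> BM (t j) \<omega> = (\<Sum>i<j. v i)"
    using inj by (auto simp: the_inv_into_f_f) (metis atLeastAtMost_iff One_nat_def)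
  have "\<forall>j\<le>n. BM (t j) \<omega> = (\<Sum>i<j. v i)"
  proof (intro allI impI)
    fix j assume "j \<le> n"
    then show "BM (t j) \<omega> = (\<Sum>i<j. v i)"
      using \<omega>[of j] assms(1) by (cases "j = 0") (auto simp: gridn_def BM_at_nonpos)
  qed
  then have "\<forall>j\<le>n. BM (t j) (grid_path n t v) = (\<Sum>i<j. v i)" unfolding grid_path_def by (rule someI)
  with assms(2) show ?thesis by blast
qed

text \<open>The value at \<open>t j\<close> is the sum of the first \<open>j\<close> increments, so
  the sum of the norms of the values is at most \<open>1 + n\<close> times that of the
  increments.\<close>

lemma cyl_grid_path_C_lLip:
  fixes X :: "'d::finite cpath => 'v::real_normed_vector"
  assumes "gridn n t" "cyl P X" "P \<subseteq> t ` {..n}"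
  shows "(%v. X (grid_path n t v)) \<in> C_lLip n"
proof -
  obtain C m where C: "0 \<le> C" "\<And>\<omega> \<omega>'. norm (X \<omega> - X \<omega>') \<le>
     C * (1 + psum (t ` {..n}) \<omega> + psum (t ` {..n}) \<omega>') ^ m * pdist (t ` {..n}) \<omega> \<omega>'"
    using cyl_mono[OF assms(2,3)] unfolding cyl_def by blast
  have inj: "inj_on t {..n}" using gridn_less[OF assms(1)] by (intro inj_onI) (metis atMost_iff less_irrefl linorder_neqE_nat)
  have le: "(\<Sum>j\<le>n. norm (\<Sum>i<j. x i)) \<le> (1 + real n) * (\<Sum>i<n. norm (x i))" for x :: "nat => real^'d"
  proof -
    have "(\<Sum>j\<le>n. norm (\<Sum>i<j. x i)) \<le> (\<Sum>j\<le>n. \<Sum>i<n. norm (x i))"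
      by (intro sum_mono order_trans[OF norm_sum] sum_mono2) auto
    then show ?thesis by simp
  qed
  show ?thesis
  proof (rule C_lLipI)
    show "0 \<le> C * (1 + real n) ^ m * (1 + real n)" using C(1) by simp
    fix x y :: "nat => real^'d"
    define a b d where "a = (\<Sum>i<n. norm (x i))" and "b = (\<Sum>i<n. norm (y i))"
      and "d = (\<Sum>i<n. norm (x i - y i))"
    have nn: "0 \<le> a" "0 \<le> b" "0 \<le> d" by (auto simp: a_def b_def d_def intro: sum_nonneg)
    have p: "psum (t ` {..n}) (grid_path n t z) \<le> (1 + real n) * (\<Sum>i<n. norm (z i))" for z :: "nat => real^'d"
      using le[of z] by (simp add: psum_def sum.reindex[OF inj] BM_grid_path[OF assms(1)] cong: sum.cong_simp)
    have q: "pdist (t ` {..n}) (grid_path n t x) (grid_path n t y) \<le> (1 + real n) * d" using le[of "%i. x i - y i"]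
      by (simp add: pdist_def d_def sum.reindex[OF inj] BM_grid_path[OF assms(1)] sum_subtractf cong: sum.cong_simp)
    have "norm (X (grid_path n t x) - X (grid_path n t y)) \<le>
        C * ((1 + real n) * (1 + a + b)) ^ m * ((1 + real n) * d)"
    proof (rule order_trans[OF C(2)], intro mult_mono mult_left_mono power_mono q)
      show "1 + psum (t ` {..n}) (grid_path n t x) + psum (t ` {..n}) (grid_path n t y)
          \<le> (1 + real n) * (1 + a + b)" using p[of x] p[of y] by (simp add: a_def b_def algebra_simps)
    qed (use C(1) nn in \<open>auto intro!: mult_nonneg_nonneg zero_le_power add_nonneg_nonneg\<close>)
    then show "norm (X (grid_path n t x) - X (grid_path n t y)) \<le> C * (1 + real n) ^ m * (1 + real n) *
        (1 + (\<Sum>i<n. norm (x i)) + (\<Sum>i<n. norm (y i))) ^ m * (\<Sum>i<n. norm (x i - y i))"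
      unfolding a_def b_def d_def by (simp add: power_mult_distrib mult_ac)
  qed
qed

text \<open>By telescoping, the path rebuilt from the increments of a given path agrees with it at
  the grid times, and \<open>X\<close> depends on no others.\<close>

lemma grid_path_increments:
  assumes "gridn n t" "cyl P X" "P \<subseteq> t ` {..n}"
  shows "X (grid_path n t (%i. BM (t (Suc i)) \<omega> - BM (t i) \<omega>)) = X \<omega>"
proof (rule cyl_cong[OF assms(2)])
  fix p assume "p \<in> P"
  then obtain j where j: "j \<le> n" "p = t j" using assms(3) by auto
  have "(\<Sum>i<j. BM (t (Suc i)) \<omega> - BM (t i) \<omega>) = BM (t j) \<omega> - BM (t 0) \<omega>"
    by (rule sum_lessThan_telescope)
  then show "BM p (grid_path n t (%i. BM (t (Suc i)) \<omega> - BM (t i) \<omega>)) = BM p \<omega>"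
    using j assms(1) by (simp add: BM_grid_path gridn_def BM_at_nonpos)
qed

lemma C_lLip_scale:
  fixes phi :: "(nat => 'a::real_normed_vector) => 'b::real_normed_vector"
  assumes "phi \<in> C_lLip n"
  shows "(%x. phi (%i. c i *\<^sub>R x i)) \<in> C_lLip n"
proof -
  obtain C m where C: "0 \<le> C" "\<And>x y. norm (phi x - phi y) \<le>
     C * (1 + (\<Sum>i<n. norm (x i)) + (\<Sum>i<n. norm (y i))) ^ m * (\<Sum>i<n. norm (x i - y i))"
    using C_lLipD[OF assms] by blast
  define D where "D = 1 + (\<Sum>i<n. \<bar>c i\<bar>)"
  have D: "1 \<le> D" by (simp add: D_def sum_nonneg)
  have le: "(\<Sum>i<n. norm (c i *\<^sub>R z i)) \<le> D * (\<Sum>i<n. norm (z i))" for z :: "nat => 'a"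
    unfolding sum_distrib_left
  proof (rule sum_mono)
    fix i assume "i \<in> {..<n}"
    then have "\<bar>c i\<bar> \<le> D" unfolding D_def using member_le_sum[of i "{..<n}" "%i. \<bar>c i\<bar>"] by auto
    then show "norm (c i *\<^sub>R z i) \<le> D * norm (z i)" by (simp add: mult_right_mono)
  qed
  show ?thesis
  proof (rule C_lLipI)
    show "0 \<le> C * D ^ m * D" using C(1) D by simp
    fix x y :: "nat => 'a"
    define a b d where "a = (\<Sum>i<n. norm (x i))" and "b = (\<Sum>i<n. norm (y i))"
      and "d = (\<Sum>i<n. norm (x i - y i))"
    have nn: "0 \<le> a" "0 \<le> b" "0 \<le> d" by (auto simp: a_def b_def d_def intro: sum_nonneg)
    have q: "(\<Sum>i<n. norm (c i *\<^sub>R x i - c i *\<^sub>R y i)) \<le> D * d"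
      using le[of "%i. x i - y i"] by (simp add: d_def scaleR_diff_right)
    have "norm (phi (%i. c i *\<^sub>R x i) - phi (%i. c i *\<^sub>R y i)) \<le> C * (D * (1 + a + b)) ^ m * (D * d)"
    proof (rule order_trans[OF C(2)], intro mult_mono mult_left_mono power_mono q)
      have "1 + a + b \<le> D * (1 + a + b) ==> 1 + D * a + D * b \<le> D * (1 + a + b)" using D by (simp add: algebra_simps)
      then show "1 + (\<Sum>i<n. norm (c i *\<^sub>R x i)) + (\<Sum>i<n. norm (c i *\<^sub>R y i)) \<le> D * (1 + a + b)"
        using le[of x] le[of y] D by (simp add: a_def b_def algebra_simps)
    qed (use C(1) nn D in \<open>auto intro!: mult_nonneg_nonneg zero_le_power add_nonneg_nonneg sum_nonneg\<close>)
    then show "norm (phi (%i. c i *\<^sub>R x i) - phi (%i. c i *\<^sub>R y i)) \<le> C * D ^ m * D *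
        (1 + (\<Sum>i<n. norm (x i)) + (\<Sum>i<n. norm (y i))) ^ m * (\<Sum>i<n. norm (x i - y i))"
      unfolding a_def b_def d_def by (simp add: power_mult_distrib mult_ac)
  qed
qed

context sublinear_expectation_space
begin

text \<open>Stability of \<open>H\<close> under composition is available for tuples of real
  functions. The \<open>n\<close> vectors are therefore flattened into \<open>n * D\<close>
  coordinates, with coordinate \<open>c\<close> of vector \<open>i\<close> at position
  \<open>i * D + f c\<close>, and recovered by \<open>div\<close> and \<open>mod\<close>.\<close>

lemma C_lLip_vector_in:
  fixes Z :: "nat => 'w => real^'d" and phi :: "(nat => real^'d) => real"
  assumes Z: "\<And>i. i < n ==> random_vector H (Z i)" and phi: "phi \<in> C_lLip n"
  shows "(%w. phi (%i. Z i w)) \<in> H"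
proof -
  define D where "D = CARD('d)"
  have D: "D > 0" by (simp add: D_def)
  obtain f :: "'d => nat" where f: "bij_betw f UNIV {..<D}"
    using ex_bij_betw_finite_nat[OF finite_class.finite_UNIV] by (auto simp: D_def atLeast0LessThan)
  define g where "g = inv f"
  have gf: "g (f c) = c" for c using f by (simp add: g_def bij_betw_def)
  have fD: "f c < D" for c using f by (auto simp: bij_betw_def)
  obtain C m where C: "0 \<le> C" "\<And>x y. norm (phi x - phi y) \<le>
     C * (1 + (\<Sum>i<n. norm (x i)) + (\<Sum>i<n. norm (y i))) ^ m * (\<Sum>i<n. norm (x i - y i))"
    using C_lLipD[OF phi] by blast
  define V where "V x i = (\<chi> c. x (i * D + f c))" for x :: "nat => real" and i
  have le: "(\<Sum>i<n. norm (V x i)) \<le> (\<Sum>j<n * D. norm (x j))" for x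
  proof -
    have "norm (V x i) \<le> sum (%j. norm (x j)) {i * D..<i * D + D}" for i
    proof -
      have "norm (V x i) \<le> (\<Sum>c\<in>UNIV. \<bar>x (i * D + f c)\<bar>)"
        using norm_le_l1_cart[of "V x i"] by (simp add: V_def)
      also have "... = (\<Sum>k<D. \<bar>x (i * D + k)\<bar>)" by (rule sum.reindex_bij_betw[OF f])
      also have "... = sum (%j. norm (x j)) {i * D..<i * D + D}"
        using sum.shift_bounds_nat_ivl[of "%j. norm (x j)" 0 "i * D" D] by (simp add: add.commute atLeast0LessThan)
      finally show ?thesis .
    qed
    then have "(\<Sum>i<n. norm (V x i)) \<le> (\<Sum>i<n. sum (%j. norm (x j)) {i * D..<i * D + D})" by (rule sum_mono)
    then show ?thesis by (simp only: sum.nat_group)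
  qed
  have "(%x. phi (V x)) \<in> C_lLip (n * D)"
  proof (rule C_lLipI[OF C(1)])
    fix x y :: "nat => real"
    have q: "(\<Sum>i<n. norm (V x i - V y i)) \<le> (\<Sum>j<n * D. norm (x j - y j))"
    proof -
      have "V x i - V y i = V (%j. x j - y j) i" for i by (simp add: V_def vec_eq_iff)
      then show ?thesis using le[of "%j. x j - y j"] by simp
    qed
    show "norm (phi (V x) - phi (V y)) \<le>
      C * (1 + (\<Sum>i<n*D. norm (x i)) + (\<Sum>i<n*D. norm (y i))) ^ m * (\<Sum>i<n*D. norm (x i - y i))"
      by (rule order_trans[OF C(2)], intro mult_mono mult_left_mono power_mono add_mono le q order_refl)
         (use C(1) in \<open>auto intro!: mult_nonneg_nonneg zero_le_power add_nonneg_nonneg sum_nonneg\<close>)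
  qed
  then have "(%w. phi (V (%j. Z (j div D) w $ g (j mod D)))) \<in> H"
  proof (rule lLip_in[rotated])
    fix j assume "j < n * D"
    then have "j div D < n" using D by (simp add: less_mult_imp_div_less)
    then show "(%w. Z (j div D) w $ g (j mod D)) \<in> H" using Z unfolding random_vector_def by blast
  qed
  moreover have "V (%j. Z (j div D) w $ g (j mod D)) = (%i. Z i w)" for w
    using D fD gf by (auto simp: V_def vec_eq_iff fun_eq_iff)
  ultimately show ?thesis by simp
qed

lemma E_nonneg: "X \<in> H ==> (\<And>w. 0 \<le> X w) ==> 0 \<le> E X"
  using mono[of X "%_. 0"] const_in const_preserving[of 0] by simp

lemma E_add_const:
  assumes "X \<in> H"
  shows "E (%w. X w + c) = E X + c"
proof (rule antisym)
  show "E (%w. X w + c) \<le> E X + c" using subadditive[OF assms const_in, of c] by (simp add: const_preserving)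
  have "E X \<le> E (%w. X w + c) - c"
    using subadditive[OF add_in[OF assms const_in] const_in, of c "- c"] by (simp add: const_preserving)
  then show "E X + c \<le> E (%w. X w + c)" by simp
qed

end

lemma C_lLip_inner: "i < n ==> (%x. c \<bullet> x i) \<in> C_lLip n"
proof (rule C_lLipI[of "norm c" _ _ 0])
  fix x y :: "nat => 'a" assume "i < n"
  then have "norm (x i - y i) \<le> (\<Sum>i<n. norm (x i - y i))"
    by (intro member_le_sum[of i "{..<n}" "%i. norm (x i - y i)"]) auto
  moreover have "norm (c \<bullet> x i - c \<bullet> y i) \<le> norm c * norm (x i - y i)"
    by (simp add: Cauchy_Schwarz_ineq2 flip: inner_diff_right)
  ultimately show "norm (c \<bullet> x i - c \<bullet> y i) \<le>
      norm c * (1 + (\<Sum>i<n. norm (x i)) + (\<Sum>i<n. norm (y i))) ^ 0 * (\<Sum>i<n. norm (x i - y i))"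
    by (simp add: mult_left_mono order_trans)
qed simp

text \<open>Comparing \<open>xi + xi'\<close> with \<open>\<surd>2 xi\<close> gives \<open>2 E[c \<bullet> xi] = \<surd>2 E[c \<bullet> xi]\<close>.\<close>

lemma G_normal_mean_zero:
  fixes xi :: "'w => real^'d"
  assumes "sublinear_expectation_space H E" "G_normal H E G xi"
  shows "E (%w. c \<bullet> xi w) = 0"
proof -
  interpret sublinear_expectation_space H E by fact
  obtain xi' where xi: "random_vector H xi" and xi': "random_vector H xi'" "eq_distr E xi' xi" "indep_from E 1 (%_. xi) xi'"
    and st: "\<And>a b. 0 \<le> a ==> 0 \<le> b ==> eq_distr E (%w. a *\<^sub>R xi w + b *\<^sub>R xi' w) (%w. sqrt (a^2 + b^2) *\<^sub>R xi w)"
    using assms(2) unfolding G_normal_def by blast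
  have in1: "(%w. c \<bullet> Z w) \<in> H" if "random_vector H Z" for Z :: "'w => real^'d"
    using C_lLip_vector_in[of 1 "%_. Z" "%x. c \<bullet> x 0"] that C_lLip_inner[of 0 1 c] by simp
  define mu where "mu = E (%w. c \<bullet> xi w)"
  have mu': "E (%w. c \<bullet> xi' w) = mu"
    using xi'(2) C_lLip_inner[of 0 1 c] unfolding eq_distr_def mu_def by (auto dest: bspec[of _ _ "%x. c \<bullet> x 0"])
  have "E (%w. c \<bullet> (1 *\<^sub>R xi w + 1 *\<^sub>R xi' w)) = E (%w. c \<bullet> (sqrt (1^2 + 1^2) *\<^sub>R xi w))"
    using st[of 1 1] C_lLip_inner[of 0 1 c] unfolding eq_distr_def by (auto dest: bspec[of _ _ "%x. c \<bullet> x 0"])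
  then have 1: "E (%w. c \<bullet> xi w + c \<bullet> xi' w) = sqrt 2 * mu"
    using pos_homogeneous[OF in1[OF xi], of "sqrt 2"] by (simp add: inner_add_right mu_def)
  have phi: "(%x. c \<bullet> x 0 + c \<bullet> x 1) \<in> C_lLip (Suc 1)" for c :: "real^'d"
  proof (rule C_lLipI[of "norm c" _ _ 0])
    fix x y :: "nat => real^'d"
    have "c \<bullet> x 0 + c \<bullet> x 1 - (c \<bullet> y 0 + c \<bullet> y 1) = c \<bullet> ((x 0 - y 0) + (x 1 - y 1))"
      by (simp add: inner_add_right inner_diff_right)
    also have "norm ... \<le> norm c * norm ((x 0 - y 0) + (x 1 - y 1))" by (simp add: Cauchy_Schwarz_ineq2)
    also have "... \<le> norm c * (norm (x 0 - y 0) + norm (x 1 - y 1))" by (intro mult_left_mono norm_triangle_ineq) auto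
    finally show "norm (c \<bullet> x 0 + c \<bullet> x 1 - (c \<bullet> y 0 + c \<bullet> y 1)) \<le> norm c *
        (1 + (\<Sum>i<Suc 1. norm (x i)) + (\<Sum>i<Suc 1. norm (y i))) ^ 0 * (\<Sum>i<Suc 1. norm (x i - y i))" by simp
  qed simp
  have "E (%w. c \<bullet> xi w + c \<bullet> xi' w) = E (%w. E (%w'. c \<bullet> xi w + c \<bullet> xi' w'))"
    using xi'(3) phi[of c] unfolding indep_from_def by (auto dest: bspec[of _ _ "%x. c \<bullet> x 0 + c \<bullet> x 1"])
  also have "... = E (%w. c \<bullet> xi w + mu)" using E_add_const[OF in1[OF xi'(1)]] by (simp add: add.commute mu')
  also have "... = 2 * mu" using E_add_const[OF in1[OF xi]] by (simp add: mu_def)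
  finally have "2 * mu = sqrt 2 * mu" using 1 by simp
  then have "mu = 0 \<or> sqrt 2 = 2" by auto
  then show ?thesis by (auto simp: mu_def real_sqrt_eq_iff[of 2 4, simplified])
qed

section \<open>The expectation on path space\<close>

locale G_construction = sublinear_expectation_space H' E'
  for H' :: "('w => real) set" and E' :: "('w => real) => real" +
  fixes G :: "real^'d^'d::finite => real" and xi :: "nat => 'w => real^'d"
    and E :: "('d cpath => real) => real"
  assumes normal: "\<And>i. G_normal H' E' G (xi i)"
    and indep: "\<And>i. indep_from E' (Suc i) xi (xi (Suc i))"
    and is_G: "is_G_expectation E' xi E"
begin

text \<open>The function on the space of the \<open>xi i\<close> that has the expectation of
  \<open>X\<close>: the scaled vectors are inserted as increments. Being composition with a fixed
  map, \<open>pull\<close> commutes with pointwise operations, so the properties of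
  \<open>E'\<close> carry over to \<open>E\<close>.\<close>

definition pull :: "nat => (nat => real) => ('d cpath => real) => 'w => real" where
  "pull n t X w = X (grid_path n t (%i. sqrt (t (Suc i) - t i) *\<^sub>R xi i w))"

lemma pull_in:
  assumes "gridn n t" "cyl P X" "P \<subseteq> t ` {..n}"
  shows "pull n t X \<in> H'"
proof -
  have "random_vector H' (xi i)" for i using normal unfolding G_normal_def by blast
  then show ?thesis unfolding pull_def by (intro C_lLip_vector_in[OF _ C_lLip_scale[OF cyl_grid_path_C_lLip[OF assms]]])
qed

lemma E_pull:
  assumes "gridn n t" "cyl P X" "P \<subseteq> t ` {..n}"
  shows "E X = E' (pull n t X)"
proof -
  have "E (%\<omega>. X (grid_path n t (%i. BM (t (Suc i)) \<omega> - BM (t i) \<omega>))) = E' (pull n t X)"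
    using is_G[unfolded is_G_expectation_def, THEN spec[of _ n], THEN spec[of _ t],
        THEN bspec[OF _ cyl_grid_path_C_lLip[OF assms]]] assms(1) unfolding gridn_def pull_def by simp
  then show ?thesis unfolding grid_path_increments[OF assms] .
qed

lemma common_grid:
  assumes "X \<in> L_ip" "Y \<in> L_ip"
  shows "\<exists>n t P. gridn n t \<and> P \<subseteq> t ` {..n} \<and> cyl P X \<and> cyl P Y"
proof -
  obtain s where s: "0 \<le> s" "X \<in> L_ip_upto s" "Y \<in> L_ip_upto s" using L_ip_common[OF assms] by blast
  obtain P Q where P: "finite P" "P \<subseteq> {0..s}" "cyl P X" "finite Q" "Q \<subseteq> {0..s}" "cyl Q Y"
    using L_ip_upto_cylD[OF s(2)] L_ip_upto_cylD[OF s(3)] by meson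
  then have "finite (P \<union> Q)" "P \<union> Q \<subseteq> {0..s}" by auto
  moreover have "cyl (P \<union> Q) X" "cyl (P \<union> Q) Y"
    using cyl_mono[of P X "P \<union> Q"] cyl_mono[of Q Y "P \<union> Q"] P by auto
  ultimately show ?thesis using gridn_exists[of "P \<union> Q" s] s(1) by meson
qed

lemma G_mono:
  assumes "X \<in> L_ip" "Y \<in> L_ip" "\<And>\<omega>. X \<omega> \<le> Y \<omega>"
  shows "E X \<le> E Y"
proof -
  obtain n t P where g: "gridn n t" "P \<subseteq> t ` {..n}" "cyl P X" "cyl P Y" using common_grid[OF assms(1,2)] by meson
  show ?thesis unfolding E_pull[OF g(1,3,2)] E_pull[OF g(1,4,2)]
    by (rule mono[OF pull_in[OF g(1,4,2)] pull_in[OF g(1,3,2)]]) (simp add: pull_def assms(3))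
qed

lemma G_const: "E (%_. c) = c"
  using E_pull[of 0 "%_. 0" "{}" "%_. c"] by (simp add: gridn_def cyl_const pull_def[abs_def] const_preserving)

lemma cyl_add:
  assumes "cyl P X" "cyl P Y"
  shows "cyl P (%\<omega>. X \<omega> + Y \<omega>)"
  using cyl_plip[OF cyl_Pair[OF assms] plip_add] by simp

lemma cyl_mult:
  fixes X Y :: "'d cpath => real"
  assumes "cyl P X" "cyl P Y"
  shows "cyl P (%\<omega>. X \<omega> * Y \<omega>)"
  using cyl_plip[OF cyl_Pair[OF assms] plip_bilinear[OF bounded_bilinear_mult]] by simp

lemma cyl_power:
  fixes X :: "'d cpath => real"
  shows "cyl P X ==> cyl P (%\<omega>. X \<omega> ^ k)"
  by (induction k) (auto intro: cyl_const cyl_mult)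

lemma cyl_BM: "finite P ==> t \<in> P ==> cyl P (%\<omega>. BM t \<omega>)" unfolding cyl_def pdist_def
  by (intro exI[of _ 1] exI[of _ 0]) (auto intro: member_le_sum[of t P "%p. norm (BM p _ - BM p _)"])

lemma cyl_inner_increment:
  assumes "finite P" "s \<in> P" "t \<in> P"
  shows "cyl P (%\<omega>. a \<bullet> (BM t \<omega> - BM s \<omega>))"
proof -
  have "plip (%x. a \<bullet> x)"
    by (rule plip_lipschitz[of _ "norm a"]) (simp add: Cauchy_Schwarz_ineq2 flip: inner_diff_right)
  moreover have "cyl P (%\<omega>. BM t \<omega> + (-1) *\<^sub>R BM s \<omega>)"
    by (intro cyl_add cyl_BM assms cyl_plip[OF _ plip_scale])
  ultimately show ?thesis using cyl_plip by fastforce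
qed

lemma G_subadd:
  assumes "X \<in> L_ip" "Y \<in> L_ip"
  shows "E (%\<omega>. X \<omega> + Y \<omega>) \<le> E X + E Y"
proof -
  obtain n t P where g: "gridn n t" "P \<subseteq> t ` {..n}" "cyl P X" "cyl P Y" using common_grid[OF assms] by meson
  have "E (%\<omega>. X \<omega> + Y \<omega>) = E' (%w. pull n t X w + pull n t Y w)"
    unfolding E_pull[OF g(1) cyl_add[OF g(3,4)] g(2)] by (simp add: pull_def[abs_def])
  then show ?thesis
    using subadditive[OF pull_in[OF g(1,3,2)] pull_in[OF g(1,4,2)]] E_pull[OF g(1,3,2)] E_pull[OF g(1,4,2)] by simp
qed

lemma G_scale:
  assumes "X \<in> L_ip" "0 \<le> c"
  shows "E (%\<omega>. c * X \<omega>) = c * E X"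
proof -
  obtain n t P where g: "gridn n t" "P \<subseteq> t ` {..n}" "cyl P X" using common_grid[OF assms(1) assms(1)] by meson
  have "E (%\<omega>. c * X \<omega>) = E' (%w. c * pull n t X w)"
    unfolding E_pull[OF g(1) cyl_mult[OF cyl_const g(3)] g(2)] by (simp add: pull_def[abs_def])
  then show ?thesis using pos_homogeneous[OF pull_in[OF g(1,3,2)] assms(2)] E_pull[OF g(1,3,2)] by simp
qed

text \<open>For a fixed number \<open>x\<close>, positive homogeneity evaluates the expectation of
  \<open>x * y\<close> as the positive part of \<open>x\<close> times that of \<open>y\<close> plus
  the negative part of \<open>x\<close> times that of \<open>- y\<close>; both signs occur because
  the expectation is not linear. Independence of the last vector from the earlier ones permits the
  pulled back \<open>X\<close> to be inserted for \<open>x\<close>.\<close>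

lemma G_increment_indep:
  assumes X: "X \<in> L_ip_upto s" and st: "0 \<le> s" "s < t"
    and g: "cyl {s, t} (%\<omega>. g (BM t \<omega> - BM s \<omega>))"
  shows "E (%\<omega>. X \<omega> * g (BM t \<omega> - BM s \<omega>)) =
    E (%\<omega>. max 0 (X \<omega>) * E (%\<omega>. g (BM t \<omega> - BM s \<omega>)) +
            max 0 (- X \<omega>) * E (%\<omega>. - g (BM t \<omega> - BM s \<omega>)))"
proof -
  obtain P where P: "finite P" "P \<subseteq> {0..s}" "cyl P X" using L_ip_upto_cylD[OF X] by meson
  obtain n tau where tau: "gridn n tau" "P \<subseteq> tau ` {..n}" "tau n = s" using gridn_exists[OF P(1,2) st(1)] by (elim exE conjE) (rule that)
  \<comment> \<open>The grid for the past ends at \<open>s\<close>. One more cell, from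
    \<open>s\<close> to \<open>t\<close>, carries the increment, which thus belongs to
    \<open>xi n\<close>.\<close>
  define tau' where "tau' = tau(Suc n := t)"
  have tau'_eq: "tau' j = tau j" if "j \<le> n" for j using that by (simp add: tau'_def)
  have tau': "gridn (Suc n) tau'" using tau st by (auto simp: gridn_def tau'_def less_Suc_eq)
  define Y where "Y \<omega> = g (BM t \<omega> - BM s \<omega>)" for \<omega>
  define Q where "Q = tau' ` {..Suc n}"
  have ims: "s \<in> Q" "t \<in> Q" "P \<subseteq> Q" "finite Q"
  proof -
    show "s \<in> Q" using tau(3) tau'_eq[of n] by (auto simp: Q_def intro!: image_eqI[of _ _ n])
    show "t \<in> Q" by (auto simp: Q_def tau'_def)
    show "P \<subseteq> Q"
    proof
      fix p assume "p \<in> P"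
      then obtain j where "j \<le> n" "p = tau j" using tau(2) by auto
      then show "p \<in> Q" unfolding Q_def using tau'_eq[of j] by (intro image_eqI[of _ _ j]) auto
    qed
  qed (simp add: Q_def)
  have cX: "cyl Q X" using cyl_mono[OF P(3)] ims by blast
  have cY: "cyl Q Y" using cyl_mono[OF g] ims unfolding Y_def[abs_def] by blast
  have cY': "cyl Q (%\<omega>. - Y \<omega>)" using cyl_mult[OF cyl_const cY, of "-1"] by simp
  have QQ: "Q \<subseteq> tau' ` {..Suc n}" by (simp add: Q_def)
  have XY: "cyl Q (%\<omega>. X \<omega> * Y \<omega>)" by (rule cyl_mult[OF cX cY])
  have Xp: "X (grid_path (Suc n) tau' v) = X (grid_path n tau v)" for v
  proof (rule cyl_cong[OF P(3)])
    fix p assume "p \<in> P"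
    then obtain j where j: "j \<le> n" "p = tau j" using tau(2) by auto
    then show "BM p (grid_path (Suc n) tau' v) = BM p (grid_path n tau v)"
      using BM_grid_path[OF tau', of j v] BM_grid_path[OF tau(1), of j v] tau'_eq[of j] by simp
  qed
  have Yp: "Y (grid_path (Suc n) tau' v) = g (v n)" for v
  proof -
    have "BM t (grid_path (Suc n) tau' v) = (\<Sum>i<Suc n. v i)"
      using BM_grid_path[OF tau', of "Suc n" v] by (simp add: tau'_def)
    moreover have "BM s (grid_path (Suc n) tau' v) = (\<Sum>i<n. v i)"
      using BM_grid_path[OF tau', of n v] tau(3) tau'_eq[of n] by simp
    ultimately show ?thesis by (simp add: Y_def)
  qed
  define c c' where "c = E Y" and "c' = E (%\<omega>. - Y \<omega>)"
  have inc: "tau' (Suc n) - tau' n = t - s" using tau(3) by (simp add: tau'_def)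
  define y where "y w = g (sqrt (t - s) *\<^sub>R xi n w)" for w
  have py: "pull (Suc n) tau' Y = y" "pull (Suc n) tau' (%\<omega>. - Y \<omega>) = (%w. - y w)"
    by (simp_all add: pull_def Yp y_def inc fun_eq_iff)
  have y_in: "y \<in> H'" "(%w. - y w) \<in> H'" using pull_in[OF tau' cY QQ] pull_in[OF tau' cY' QQ] by (simp_all add: py)
  have cy: "E' y = c" "E' (%w. - y w) = c'"
    using E_pull[OF tau' cY QQ] E_pull[OF tau' cY' QQ] by (simp_all add: py c_def c'_def)
  have inner: "E' (%w'. x * y w') = max 0 x * c + max 0 (- x) * c'" for x
  proof (cases "0 \<le> x")
    case True then show ?thesis using pos_homogeneous[OF y_in(1) True] by (simp add: cy)
  next
    case False
    then show ?thesis using pos_homogeneous[OF y_in(2), of "- x"] by (simp add: cy)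
  qed
  have "E (%\<omega>. X \<omega> * Y \<omega>) = E (%\<omega>. max 0 (X \<omega>) * c + max 0 (- X \<omega>) * c')"
  proof (cases n)
    \<comment> \<open>Independence speaks of at least one earlier vector. With a trivial grid for
      the past, \<open>s = 0\<close>, and \<open>X\<close> is constant since all paths start at
      0.\<close>
    case 0
    then have "P \<subseteq> {0}" using tau by (auto simp: gridn_def)
    have "X \<omega> = X \<omega>'" for \<omega> \<omega>'
      by (rule cyl_cong[OF P(3)]) (use \<open>P \<subseteq> {0}\<close> in \<open>auto simp: BM_at_nonpos\<close>)
    then obtain x0 where x0: "X = (%_. x0)" by (metis (full_types) ext)
    have "E (%\<omega>. x0 * Y \<omega>) = E' (%w. x0 * pull (Suc n) tau' Y w)"
      unfolding E_pull[OF tau' cyl_mult[OF cyl_const cY] QQ] by (simp add: pull_def[abs_def])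
    then show ?thesis by (simp add: x0 py inner G_const)
  next
    case (Suc m)
    define phi where "phi x = X (grid_path (Suc n) tau' (%i. sqrt (tau' (Suc i) - tau' i) *\<^sub>R x i)) *
      Y (grid_path (Suc n) tau' (%i. sqrt (tau' (Suc i) - tau' i) *\<^sub>R x i))" for x
    have "phi \<in> C_lLip (Suc n)" unfolding phi_def by (rule C_lLip_scale[OF cyl_grid_path_C_lLip[OF tau' XY QQ]])
    then have *: "E' (%w. phi ((%i. xi i w)(n := xi n w))) = E' (%w. E' (%w'. phi ((%i. xi i w)(n := xi n w'))))"
      using indep[of m, unfolded indep_from_def, THEN bspec] unfolding Suc by simp
    have "E (%\<omega>. X \<omega> * Y \<omega>) = E' (%w. phi ((%i. xi i w)(n := xi n w)))"
    proof -
      have "phi ((%i. xi i w)(n := xi n w)) = pull (Suc n) tau' (%\<omega>. X \<omega> * Y \<omega>) w" for w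
      proof -
        have "(%i. xi i w)(n := xi n w) = (%i. xi i w)" by auto
        then show ?thesis by (simp add: pull_def phi_def)
      qed
      then show ?thesis unfolding E_pull[OF tau' XY QQ] by simp
    qed
    also note *
    also have "(%w. E' (%w'. phi ((%i. xi i w)(n := xi n w')))) =
        pull n tau (%\<omega>. max 0 (X \<omega>) * c + max 0 (- X \<omega>) * c')"
    proof
      fix w
      have "phi ((%i. xi i w)(n := xi n w')) = pull n tau X w * y w'" for w'
      proof -
        \<comment> \<open>The overwritten coordinate \<open>n\<close> does not enter the path at the
          times of the past grid.\<close>
        have "X (grid_path n tau (%i. sqrt (tau' (Suc i) - tau' i) *\<^sub>R ((%i. xi i w)(n := xi n w')) i)) =
            X (grid_path n tau (%i. sqrt (tau (Suc i) - tau i) *\<^sub>R xi i w))"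
        proof (rule cyl_cong[OF P(3)])
          fix p assume "p \<in> P"
          then obtain j where j: "j \<le> n" "p = tau j" using tau(2) by auto
          then show "BM p (grid_path n tau (%i. sqrt (tau' (Suc i) - tau' i) *\<^sub>R ((%i. xi i w)(n := xi n w')) i)) =
              BM p (grid_path n tau (%i. sqrt (tau (Suc i) - tau i) *\<^sub>R xi i w))"
            by (simp add: BM_grid_path[OF tau(1)] tau'_eq cong: sum.cong_simp)
        qed
        then show ?thesis by (simp add: phi_def Xp Yp pull_def y_def inc)
      qed
      then show "E' (%w'. phi ((%i. xi i w)(n := xi n w'))) =
          pull n tau (%\<omega>. max 0 (X \<omega>) * c + max 0 (- X \<omega>) * c') w"
        by (simp only: inner) (simp add: pull_def)
    qed
    also have "E' (pull n tau (%\<omega>. max 0 (X \<omega>) * c + max 0 (- X \<omega>) * c')) =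
        E (%\<omega>. max 0 (X \<omega>) * c + max 0 (- X \<omega>) * c')"
    proof (rule E_pull[OF tau(1) _ tau(2), symmetric])
      have "plip (%x. max 0 x * c + max 0 (- x) * c')"
      proof (rule plip_lipschitz[of _ "\<bar>c\<bar> + \<bar>c'\<bar>"])
        fix x y :: real
        have "\<bar>(max 0 x - max 0 y) * c + (max 0 (- x) - max 0 (- y)) * c'\<bar> \<le>
            \<bar>max 0 x - max 0 y\<bar> * \<bar>c\<bar> + \<bar>max 0 (- x) - max 0 (- y)\<bar> * \<bar>c'\<bar>"
          by (metis abs_mult abs_triangle_ineq)
        also have "... \<le> \<bar>x - y\<bar> * \<bar>c\<bar> + \<bar>x - y\<bar> * \<bar>c'\<bar>"
          by (intro add_mono mult_right_mono) auto
        finally show "norm (max 0 x * c + max 0 (- x) * c' - (max 0 y * c + max 0 (- y) * c')) \<le>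
            (\<bar>c\<bar> + \<bar>c'\<bar>) * norm (x - y)" by (simp add: algebra_simps)
      qed
      from cyl_plip[OF P(3) this] show "cyl P (%\<omega>. max 0 (X \<omega>) * c + max 0 (- X \<omega>) * c')" .
    qed
    finally show ?thesis .
  qed
  then show ?thesis by (simp add: c_def c'_def Y_def[abs_def])
qed

text \<open>
  The expectation of a function of one increment can be computed on a grid with two intervals,
  so only \<open>xi 0\<close> and \<open>xi 1\<close> enter and the constants are uniform.
\<close>

lemma G_increment:
  assumes "0 \<le> s" "s < t" "cyl {s, t} (%\<omega>. g (BM t \<omega> - BM s \<omega>))"
  shows "\<exists>k<2. (%w. g (sqrt (t - s) *\<^sub>R xi k w)) \<in> H' \<and>
    E (%\<omega>. g (BM t \<omega> - BM s \<omega>)) = E' (%w. g (sqrt (t - s) *\<^sub>R xi k w))"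
proof (cases "s = 0")
  case True
  define tau where "tau i = (if i = 0 then 0 else t)" for i :: nat
  have g: "gridn 1 tau" using assms True by (auto simp: tau_def gridn_def)
  have sub: "{s, t} \<subseteq> tau ` {..1}" using True by (auto simp: tau_def image_iff intro: bexI[of _ 1])
  have "pull 1 tau (%\<omega>. g (BM t \<omega> - BM s \<omega>)) = (%w. g (sqrt (t - s) *\<^sub>R xi 0 w))"
  proof
    fix w
    have "BM t (grid_path 1 tau v) = v 0" "BM s (grid_path 1 tau v) = 0" "tau (Suc 0) - tau 0 = t - s"
      for v :: "nat => real^'d" using BM_grid_path[OF g, of 1 v] True by (auto simp: tau_def BM_at_nonpos)
    then show "pull 1 tau (%\<omega>. g (BM t \<omega> - BM s \<omega>)) w = g (sqrt (t - s) *\<^sub>R xi 0 w)"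
      unfolding pull_def by simp
  qed
  then show ?thesis using pull_in[OF g assms(3) sub] E_pull[OF g assms(3) sub] by (intro exI[of _ 0]) simp
next
  case False
  define tau where "tau i = (if i = 0 then 0 else if i = 1 then s else t)" for i :: nat
  have g: "gridn 2 tau" using assms False by (auto simp: tau_def gridn_def less_2_cases_iff)
  have sub: "{s, t} \<subseteq> tau ` {..2}"
  proof -
    have "s = tau 1" "t = tau 2" by (auto simp: tau_def)
    then show ?thesis by auto
  qed
  have "pull 2 tau (%\<omega>. g (BM t \<omega> - BM s \<omega>)) = (%w. g (sqrt (t - s) *\<^sub>R xi 1 w))"
  proof
    fix w
    have "BM t (grid_path 2 tau v) = v 0 + v 1" "BM s (grid_path 2 tau v) = v 0" "tau (Suc 1) - tau 1 = t - s"
      for v :: "nat => real^'d" using BM_grid_path[OF g, of 1 v] BM_grid_path[OF g, of 2 v]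
      by (auto simp: tau_def numeral_2_eq_2)
    then show "pull 2 tau (%\<omega>. g (BM t \<omega> - BM s \<omega>)) w = g (sqrt (t - s) *\<^sub>R xi 1 w)"
      unfolding pull_def by simp
  qed
  then show ?thesis using pull_in[OF g assms(3) sub] E_pull[OF g assms(3) sub] by (intro exI[of _ 1]) simp
qed

text \<open>Both \<open>a\<close> and \<open>- a\<close> give increments of zero expectation, so in
  the independence formula the coefficients of the positive and of the negative part of
  \<open>X\<close> vanish.\<close>

lemma G_mean:
  assumes X: "X \<in> L_ip_upto s" and st: "0 \<le> s" "s < t"
  shows "E (%\<omega>. X \<omega> * (a \<bullet> (BM t \<omega> - BM s \<omega>))) = 0"
proof -
  have c: "cyl {s, t} (%\<omega>. c \<bullet> (BM t \<omega> - BM s \<omega>))" for c by (rule cyl_inner_increment) auto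
  have z: "E (%\<omega>. c \<bullet> (BM t \<omega> - BM s \<omega>)) = 0" for c
  proof -
    obtain k where "E (%\<omega>. c \<bullet> (BM t \<omega> - BM s \<omega>)) = E' (%w. c \<bullet> (sqrt (t - s) *\<^sub>R xi k w))"
      using G_increment[OF st c] by meson
    also have "... = E' (%w. (sqrt (t - s) *\<^sub>R c) \<bullet> xi k w)" by simp
    also have "... = 0" by (rule G_normal_mean_zero[OF _ normal]) unfold_locales
    finally show ?thesis .
  qed
  show ?thesis using G_increment_indep[OF X st c, of a] z[of a] z[of "- a"] G_const[of 0] by simp
qed

text \<open>The square root in front of the vector produces \<open>(t - s) ^ p\<close>, a fixed
  moment of the vector remains, and the nonnegative \<open>X\<close> factors out.\<close>

lemma G_moment:
  "\<exists>c\<ge>0. \<forall>X s t. X \<in> L_ip_upto s --> (\<forall>\<omega>. 0 \<le> X \<omega>) --> 0 \<le> s --> s < t -->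
     E (%\<omega>. X \<omega> * (a \<bullet> (BM t \<omega> - BM s \<omega>)) ^ (2 * p)) \<le> c * (t - s) ^ p * E X"
proof -
  define m where "m k = E' (%w. (a \<bullet> xi k w) ^ (2 * p))" for k
  \<comment> \<open>Covers both vectors with which an increment may be computed.\<close>
  define c where "c = \<bar>m 0\<bar> + \<bar>m 1\<bar>"
  have "E (%\<omega>. X \<omega> * (a \<bullet> (BM t \<omega> - BM s \<omega>)) ^ (2 * p)) \<le> c * (t - s) ^ p * E X"
    if X: "X \<in> L_ip_upto s" "\<And>\<omega>. 0 \<le> X \<omega>" and st: "0 \<le> s" "s < t" for X s t
  proof -
    define e where "e = E (%\<omega>. (a \<bullet> (BM t \<omega> - BM s \<omega>)) ^ (2 * p))"
    have cy: "cyl {s, t} (%\<omega>. (a \<bullet> (BM t \<omega> - BM s \<omega>)) ^ (2 * p))"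
      by (intro cyl_power cyl_inner_increment) auto
    obtain k where k: "k < 2" "(%w. (a \<bullet> (sqrt (t - s) *\<^sub>R xi k w)) ^ (2 * p)) \<in> H'"
        "e = E' (%w. (a \<bullet> (sqrt (t - s) *\<^sub>R xi k w)) ^ (2 * p))"
      using G_increment[OF st cy] unfolding e_def by meson
    have eq: "(a \<bullet> (sqrt (t - s) *\<^sub>R xi k w)) ^ (2 * p) = (t - s) ^ p * (a \<bullet> xi k w) ^ (2 * p)" for w
      using st by (simp add: power_mult_distrib power_mult)
    have in1: "(%w. (a \<bullet> xi k w) ^ (2 * p)) \<in> H'"
      using scale_in[OF k(2)[unfolded eq], of "1 / (t - s) ^ p"] st by simp
    have "e = (t - s) ^ p * m k" unfolding k(3) eq m_def using pos_homogeneous[OF in1, of "(t - s) ^ p"] st by simp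
    also have "... \<le> (t - s) ^ p * c" using k(1) st by (intro mult_left_mono) (auto simp: c_def less_2_cases_iff)
    finally have e: "e \<le> c * (t - s) ^ p" by (simp add: mult.commute)
    have e0: "0 \<le> e" unfolding k(3) by (rule E_nonneg[OF k(2)]) simp
    have XL: "X \<in> L_ip" by (rule L_ip_upto_L_ip[OF X(1)])
    have mx: "max 0 (X \<omega>) = X \<omega>" "max 0 (- X \<omega>) = 0" for \<omega> using X(2)[of \<omega>] by auto
    have "E (%\<omega>. X \<omega> * (a \<bullet> (BM t \<omega> - BM s \<omega>)) ^ (2 * p)) = E (%\<omega>. e * X \<omega>)"
      unfolding G_increment_indep[OF X(1) st cy] mx e_def by (simp add: mult.commute)
    also have "... = e * E X" by (rule G_scale[OF XL e0])
    also have "... \<le> c * (t - s) ^ p * E X"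
      using G_mono[OF L_ip_const XL, of 0] X(2) G_const[of 0] by (intro mult_right_mono e) auto
    finally show ?thesis .
  qed
  then show ?thesis by (intro exI[of _ c]) (auto simp: c_def)
qed

end

section \<open>Norms on \<open>L_ip\<close> and its completions\<close>

text \<open>Only L^1 and L^2 occur. For these two exponents the triangle inequality is proved
  directly, and \<open>ok\<close> allows most lemmas to treat both at once.\<close>

definition ok :: "nat => bool" where
  "ok p \<longleftrightarrow> p = 1 \<or> p = 2"

lemma ok1 [simp]: "ok 1" and ok_Suc_0 [simp]: "ok (Suc 0)" and ok2 [simp]: "ok 2" by (simp_all add: ok_def)

lemma ok_pos: "ok p ==> 0 < p" by (auto simp: ok_def)

text \<open>What the rest relies on: a sublinear expectation on \<open>L_ip\<close>, increments with
  zero mean given the past, and even moments of increments, weighted by nonnegative functions of the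
  past, bounded by powers of the elapsed time.\<close>

locale G_setting =
  fixes E :: "('d::finite cpath => real) => real"
  assumes E_mono: "\<And>X Y. X \<in> L_ip ==> Y \<in> L_ip ==> (\<And>w. X w \<le> Y w) ==> E X \<le> E Y"
    and E_const: "\<And>c. E (%_. c) = c"
    and E_add: "\<And>X Y. X \<in> L_ip ==> Y \<in> L_ip ==> E (%w. X w + Y w) \<le> E X + E Y"
    and E_scale: "\<And>X c. X \<in> L_ip ==> 0 \<le> c ==> E (%w. c * X w) = c * E X"
    and E_mean: "\<And>X s t a. X \<in> L_ip_upto s ==> 0 \<le> s ==> s < t ==>
      E (%w. X w * (a \<bullet> (BM t w - BM s w))) = 0"
    and E_moment: "\<And>a p. \<exists>c\<ge>0. \<forall>X s t. X \<in> L_ip_upto s --> (\<forall>w. 0 \<le> X w) --> 0 \<le> s --> s < t -->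
      E (%w. X w * (a \<bullet> (BM t w - BM s w)) ^ (2 * p)) \<le> c * (t - s) ^ p * E X"
begin

lemma E_nonneg: "X \<in> L_ip ==> (\<And>w. 0 \<le> X w) ==> 0 \<le> E X"
  using E_mono[OF L_ip_const, of X 0] E_const[of 0] by simp

lemma E_sum:
  assumes "\<And>i. i \<in> I ==> X i \<in> L_ip"
  shows "E (%w. \<Sum>i\<in>I. X i w) \<le> (\<Sum>i\<in>I. E (X i))"
  using assms
proof (induction I rule: infinite_finite_induct)
  case (insert i I)
  then have "E (%w. X i w + (\<Sum>i\<in>I. X i w)) \<le> E (X i) + E (%w. \<Sum>i\<in>I. X i w)"
    by (intro E_add L_ip_sum) auto
  with insert show ?case by simp
qed (simp_all add: E_const)

definition nr :: "nat => ('d cpath => 'v::euclidean_space) => real" where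
  "nr p X = root p (E (%w. norm (X w) ^ p))"

lemma norm_power_L_ip: "X \<in> L_ip ==> (%w. norm (X w) ^ p) \<in> L_ip" by (intro L_ip_intros)

lemma E_norm_power_nonneg: "X \<in> L_ip ==> 0 \<le> E (%w. norm (X w) ^ p)" by (intro E_nonneg norm_power_L_ip) auto

lemma nr_nonneg: "X \<in> L_ip ==> 0 \<le> nr p X" unfolding nr_def by (cases "p = 0") (simp_all add: E_norm_power_nonneg)

lemma nr_power: "X \<in> L_ip ==> 0 < p ==> nr p X ^ p = E (%w. norm (X w) ^ p)"
  unfolding nr_def by (simp add: E_norm_power_nonneg)

lemma nr_1: "nr 1 X = E (%w. norm (X w))" by (simp add: nr_def)

lemma nr_2: "X \<in> L_ip ==> (nr 2 X)^2 = E (%w. (norm (X w))\<^sup>2)" by (simp add: nr_power)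

lemma nr_mono:
  assumes "X \<in> L_ip" "Y \<in> L_ip" "\<And>w. norm (X w) \<le> norm (Y w)" "0 < p"
  shows "nr p X \<le> nr p Y"
  unfolding nr_def using assms by (intro real_root_le_mono E_mono norm_power_L_ip power_mono) auto

lemma nr_scaleR: "X \<in> L_ip ==> 0 < p ==> nr p (%w. c *\<^sub>R X w) = \<bar>c\<bar> * nr p X"
  using E_scale[OF norm_power_L_ip[of X p], of "\<bar>c\<bar> ^ p"]
  by (simp add: nr_def power_mult_distrib real_root_mult real_root_power_cancel)

lemma nr_const: "0 < p ==> nr p (%_. c) = norm c" by (simp add: nr_def E_const real_root_power_cancel)

text \<open>Weighted inequality of arithmetic and geometric means, with the ratio of the norms as
  weight, under the monotone and sublinear \<open>E\<close>. A \<open>delta\<close> is added to both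
  norms so that one may divide when a norm is 0; it is sent to 0 along
  \<open>1 / real (Suc n)\<close>.\<close>

lemma Cauchy_Schwarz:
  fixes X Y :: "'d cpath => real"
  assumes X: "X \<in> L_ip" and Y: "Y \<in> L_ip"
  shows "E (%w. X w * Y w) \<le> nr 2 X * nr 2 Y"
proof -
  define a b where "a = nr 2 X" and "b = nr 2 Y"
  have ab: "0 \<le> a" "0 \<le> b" using nr_nonneg X Y by (auto simp: a_def b_def)
  have "E (%w. X w * Y w) \<le> (a + delta) * (b + delta)" if "delta > 0" for delta
  proof -
    define a' b' where "a' = a + delta" and "b' = b + delta"
    have p: "0 < a'" "0 < b'" "a \<le> a'" "b \<le> b'" using ab that by (auto simp: a'_def b'_def)
    have am: "X w * Y w \<le> (b' / a' / 2) * (X w)^2 + (a' / b' / 2) * (Y w)^2" for w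
    proof -
      have "0 \<le> (b' * X w - a' * Y w)^2" by simp
      then have "2 * (a' * b') * (X w * Y w) \<le> (b' * X w)^2 + (a' * Y w)^2" by (simp add: power2_eq_square algebra_simps)
      then have "X w * Y w \<le> ((b' * X w)^2 + (a' * Y w)^2) / (2 * (a' * b'))"
        using p by (simp add: pos_le_divide_eq mult.commute)
      also have "... = (b' / a' / 2) * (X w)^2 + (a' / b' / 2) * (Y w)^2" using p by (simp add: field_simps power2_eq_square)
      finally show ?thesis .
    qed
    have "E (%w. X w * Y w) \<le> E (%w. (b' / a' / 2) * (X w)^2 + (a' / b' / 2) * (Y w)^2)"
      by (intro E_mono am L_ip_intros X Y)
    also have "... \<le> E (%w. (b' / a' / 2) * (X w)^2) + E (%w. (a' / b' / 2) * (Y w)^2)" by (intro E_add L_ip_intros X Y)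
    also have "... = (b' / a' / 2) * a^2 + (a' / b' / 2) * b^2"
    proof -
      have "E (%w. (b' / a' / 2) * (X w)^2) = (b' / a' / 2) * E (%w. (X w)\<^sup>2)"
        by (intro E_scale L_ip_power X) (use p in simp)
      moreover have "E (%w. (a' / b' / 2) * (Y w)^2) = (a' / b' / 2) * E (%w. (Y w)\<^sup>2)"
        by (intro E_scale L_ip_power Y) (use p in simp)
      ultimately show ?thesis using nr_2[OF X] nr_2[OF Y] by (simp add: a_def b_def)
    qed
    also have "... \<le> (b' / a' / 2) * a'^2 + (a' / b' / 2) * b'^2"
      using p ab by (intro add_mono mult_left_mono power_mono) auto
    also have "... = a' * b'" using p by (simp add: field_simps power2_eq_square)
    finally show ?thesis by (simp add: a'_def b'_def)
  qed
  then have *: "E (%w. X w * Y w) \<le> (a + 1 / real (Suc n)) * (b + 1 / real (Suc n))" for n by simp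
  have "(%n. (a + 1 / real (Suc n)) * (b + 1 / real (Suc n))) ----> (a + 0) * (b + 0)"
    by (intro tendsto_intros LIMSEQ_Suc[OF lim_1_over_n])
  then have "E (%w. X w * Y w) \<le> (a + 0) * (b + 0)" by (rule LIMSEQ_le_const) (use * in blast)
  then show ?thesis by (simp add: a_def b_def)
qed

lemma nr_1_scale_by:
  assumes "r \<in> L_ip" "X \<in> L_ip"
  shows "nr 1 (%w. r w *\<^sub>R X w) \<le> nr 2 r * nr 2 X"
proof -
  have "E (%w. norm (r w) * norm (X w)) \<le> nr 2 (%w. norm (r w)) * nr 2 (%w. norm (X w))"
    by (intro Cauchy_Schwarz L_ip_norm assms)
  then show ?thesis by (simp add: nr_1[simplified] nr_def)
qed

lemma nr_triangle:
  assumes X: "X \<in> L_ip" and Y: "Y \<in> L_ip" and p: "ok p"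
  shows "nr p (%w. X w + Y w) \<le> nr p X + nr p Y"
proof (cases "p = 1")
  case True
  have "E (%w. norm (X w + Y w)) \<le> E (%w. norm (X w) + norm (Y w))" by (intro E_mono L_ip_intros X Y norm_triangle_ineq)
  also have "... \<le> E (%w. norm (X w)) + E (%w. norm (Y w))" by (intro E_add L_ip_intros X Y)
  finally show ?thesis using True by (simp add: nr_def)
next
  case False
  then have p: "p = 2" using p by (simp add: ok_def)
  have nn: "0 \<le> nr 2 X" "0 \<le> nr 2 Y" using nr_nonneg X Y by auto
  have "(nr 2 (%w. X w + Y w))^2 = E (%w. (norm (X w + Y w))\<^sup>2)" by (intro nr_2 L_ip_intros X Y)
  also have "... \<le> E (%w. (norm (X w))\<^sup>2 + (norm (Y w))^2 + 2 * (norm (X w) * norm (Y w)))"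
  proof (intro E_mono L_ip_intros X Y)
    fix w
    have "(norm (X w + Y w))^2 \<le> (norm (X w) + norm (Y w))^2" by (intro power_mono norm_triangle_ineq) auto
    then show "(norm (X w + Y w))^2 \<le> (norm (X w))^2 + (norm (Y w))^2 + 2 * (norm (X w) * norm (Y w))"
      by (simp add: power2_sum)
  qed
  also have "... \<le> E (%w. (norm (X w))\<^sup>2 + (norm (Y w))^2) + E (%w. 2 * (norm (X w) * norm (Y w)))"
    by (intro E_add L_ip_intros X Y)
  also have "... \<le> E (%w. (norm (X w))\<^sup>2) + E (%w. (norm (Y w))\<^sup>2) + 2 * (nr 2 X * nr 2 Y)"
  proof (intro add_mono E_add L_ip_intros X Y)
    have "E (%w. norm (X w) * norm (Y w)) \<le> nr 2 (%w. norm (X w)) * nr 2 (%w. norm (Y w))"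
      by (intro Cauchy_Schwarz L_ip_norm X Y)
    moreover have "E (%w. 2 * (norm (X w) * norm (Y w))) = 2 * E (%w. norm (X w) * norm (Y w))"
      by (intro E_scale L_ip_intros X Y) simp
    ultimately show "E (%w. 2 * (norm (X w) * norm (Y w))) \<le> 2 * (nr 2 X * nr 2 Y)" by (simp add: nr_def)
  qed
  also have "... = (nr 2 X + nr 2 Y)^2" by (simp add: nr_2[OF X, symmetric] nr_2[OF Y, symmetric] power2_sum)
  finally have "nr 2 (%w. X w + Y w) \<le> nr 2 X + nr 2 Y" by (rule power2_le_imp_le) (use nn in simp)
  then show ?thesis by (simp add: p)
qed

lemma nr_minus: "nr p (%w. - X w) = nr p X" by (simp add: nr_def)

lemma nr_commute: "nr p (%w. X w - Y w) = nr p (%w. Y w - X w)" by (simp add: nr_def norm_minus_commute)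

lemma nr_triangle_rev:
  assumes X: "X \<in> L_ip" and Y: "Y \<in> L_ip" and p: "ok p"
  shows "\<bar>nr p X - nr p Y\<bar> \<le> nr p (%w. X w - Y w)"
  using nr_triangle[OF L_ip_diff[OF X Y] Y p] nr_triangle[OF L_ip_diff[OF Y X] X p]
    nr_commute[of p X Y] by simp

lemma nr_sum:
  assumes "\<And>i. i \<in> I ==> X i \<in> L_ip" "ok p"
  shows "nr p (%w. \<Sum>i\<in>I. X i w) \<le> (\<Sum>i\<in>I. nr p (X i))"
  using assms(1)
proof (induction I rule: infinite_finite_induct)
  case (insert i I)
  then have "nr p (%w. X i w + (\<Sum>i\<in>I. X i w)) \<le> nr p (X i) + nr p (%w. \<Sum>i\<in>I. X i w)"
    by (intro nr_triangle L_ip_sum assms(2)) auto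
  with insert show ?case by simp
qed (simp_all add: nr_const ok_pos[OF assms(2)])

lemma nr_1_le_2: "X \<in> L_ip ==> nr 1 X \<le> nr 2 X"
  using Cauchy_Schwarz[OF L_ip_norm[of X] L_ip_const[of 1]] nr_const[of 2 "1::real"] by (simp add: nr_def)

lemma nr_1_le: "X \<in> L_ip ==> ok p ==> nr 1 X \<le> nr p X" using nr_1_le_2 by (auto simp: ok_def)

section \<open>Norm and distance on the completions\<close>

lemma Cauchy_p_iff:
  assumes x: "\<And>m. x m \<in> L_ip" and p: "0 < p"
  shows "Cauchy_p E p x \<longleftrightarrow> (\<forall>eps>0. \<exists>M. \<forall>m\<ge>M. \<forall>l\<ge>M. nr p (%w. x m w - x l w) < eps)"
proof -
  have *: "E (%w. norm (x m w - x l w) ^ p) = nr p (%w. x m w - x l w) ^ p" for m l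
    by (rule nr_power[symmetric]) (intro L_ip_diff x, fact)
  have nn: "0 \<le> nr p (%w. x m w - x l w)" for m l by (intro nr_nonneg L_ip_diff x)
  show ?thesis
  proof
    assume L: "Cauchy_p E p x"
    show "\<forall>eps>0. \<exists>M. \<forall>m\<ge>M. \<forall>l\<ge>M. nr p (%w. x m w - x l w) < eps"
    proof (intro allI impI)
      fix eps :: real assume "0 < eps"
      then obtain M where "\<forall>m\<ge>M. \<forall>l\<ge>M. nr p (%w. x m w - x l w) ^ p < eps ^ p"
        using L unfolding Cauchy_p_def * by (meson zero_less_power)
      then show "\<exists>M. \<forall>m\<ge>M. \<forall>l\<ge>M. nr p (%w. x m w - x l w) < eps"
        using \<open>0 < eps\<close> by (meson power_less_imp_less_base less_imp_le)
    qed
  next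
    assume R: "\<forall>eps>0. \<exists>M. \<forall>m\<ge>M. \<forall>l\<ge>M. nr p (%w. x m w - x l w) < eps"
    show "Cauchy_p E p x" unfolding Cauchy_p_def *
    proof (intro allI impI)
      fix eps :: real assume e: "0 < eps"
      then have "0 < root p eps" using p by simp
      then obtain M where M: "\<forall>m\<ge>M. \<forall>l\<ge>M. nr p (%w. x m w - x l w) < root p eps" using R by blast
      have "nr p (%w. x m w - x l w) ^ p < eps" if "M \<le> m" "M \<le> l" for m l
      proof -
        have "nr p (%w. x m w - x l w) ^ p < root p eps ^ p" using M that nn p by (intro power_strict_mono) auto
        then show ?thesis using p e by simp
      qed
      then show "\<exists>M. \<forall>m\<ge>M. \<forall>l\<ge>M. nr p (%w. x m w - x l w) ^ p < eps" by blast
    qed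
  qed
qed

text \<open>The norm of an element of the completion: along a Cauchy sequence the termwise norms
  converge. Equality of elements becomes \<open>ds p x y = 0\<close>.\<close>

definition Np :: "nat => ('d, 'v::euclidean_space) rv => real" where
  "Np p x = lim (%m. nr p (x m))"

abbreviation ds :: "nat => ('d, 'v::euclidean_space) rv => ('d, 'v) rv => real" where
  "ds p x y \<equiv> Np p (%m w. x m w - y m w)"

lemma LG_L_ip: "x \<in> LG E p ==> x m \<in> L_ip" by (simp add: LG_def)

lemma LG_Cauchy:
  assumes "x \<in> LG E p" "ok p" "0 < eps"
  shows "\<exists>M. \<forall>m\<ge>M. \<forall>l\<ge>M. nr p (%w. x m w - x l w) < eps"
  using assms Cauchy_p_iff[of x p] ok_pos[of p] unfolding LG_def by auto

lemma LG_I: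
  assumes "\<And>m. x m \<in> L_ip" "ok p"
    "\<And>eps. 0 < eps ==> \<exists>M. \<forall>m\<ge>M. \<forall>l\<ge>M. nr p (%w. x m w - x l w) < eps"
  shows "x \<in> LG E p"
  using assms Cauchy_p_iff[of x p] ok_pos[of p] unfolding LG_def by auto

text \<open>Lipschitz maps respect the norms, which a general member of \<open>C_lLip\<close> does
  not, so they act termwise on Cauchy sequences. Most operations on the completions arise from this
  lemma or from \<open>LG_lip2\<close>.\<close>

lemma LG_lip:
  fixes x :: "('d, 'v::euclidean_space) rv" and Phi :: "'v => 'u::euclidean_space"
  assumes x: "x \<in> LG E p" and p: "ok p"
    and Phi: "\<And>a b. norm (Phi a - Phi b) \<le> L * norm (a - b)"
  shows "(%m w. Phi (x m w)) \<in> LG E p"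
proof (rule LG_I[OF _ p])
  have L: "plip Phi" by (rule plip_lipschitz[OF Phi])
  show m: "(%w. Phi (x m w)) \<in> L_ip" for m by (rule L_ip_plip[OF LG_L_ip[OF x] L])
  fix eps :: real assume "0 < eps"
  then have "0 < eps / (\<bar>L\<bar> + 1)" by simp
  then obtain M where M: "\<forall>m\<ge>M. \<forall>l\<ge>M. nr p (%w. x m w - x l w) < eps / (\<bar>L\<bar> + 1)"
    using LG_Cauchy[OF x p] by blast
  have "nr p (%w. Phi (x m w) - Phi (x l w)) < eps" if "m \<ge> M" "l \<ge> M" for m l
  proof -
    have "nr p (%w. Phi (x m w) - Phi (x l w)) \<le> nr p (%w. (\<bar>L\<bar> + 1) *\<^sub>R (x m w - x l w))"
    proof (rule nr_mono)
      fix w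
      show "norm (Phi (x m w) - Phi (x l w)) \<le> norm ((\<bar>L\<bar> + 1) *\<^sub>R (x m w - x l w))"
        by (simp, rule order_trans[OF Phi], rule mult_right_mono) auto
    qed (intro L_ip_diff m L_ip_scaleR LG_L_ip[OF x] ok_pos[OF p])+
    also have "... = (\<bar>L\<bar> + 1) * nr p (%w. x m w - x l w)"
      by (subst nr_scaleR) (auto intro!: L_ip_diff LG_L_ip[OF x] ok_pos[OF p])
    also have "... < eps" using M that by (auto simp: pos_less_divide_eq mult.commute)
    finally show ?thesis .
  qed
  then show "\<exists>M. \<forall>m\<ge>M. \<forall>l\<ge>M. nr p (%w. Phi (x m w) - Phi (x l w)) < eps" by blast
qed

lemma LG_Pair:
  assumes x: "x \<in> LG E p" and y: "y \<in> LG E p" and p: "ok p"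
  shows "(%m w. (x m w, y m w)) \<in> LG E p"
proof (rule LG_I[OF _ p])
  show m: "(%w. (x m w, y m w)) \<in> L_ip" for m
    using L_ip_common[OF LG_L_ip[OF x] LG_L_ip[OF y], of m m] L_ip_upto_Pair L_ip_upto_L_ip by blast
  fix eps :: real assume "0 < eps"
  then obtain M M' where M: "\<forall>m\<ge>M. \<forall>l\<ge>M. nr p (%w. x m w - x l w) < eps / 2"
    and M': "\<forall>m\<ge>M'. \<forall>l\<ge>M'. nr p (%w. y m w - y l w) < eps / 2"
    using LG_Cauchy[OF x p, of "eps / 2"] LG_Cauchy[OF y p, of "eps / 2"] by auto
  have "nr p (%w. (x m w, y m w) - (x l w, y l w)) < eps" if "m \<ge> max M M'" "l \<ge> max M M'" for m l
  proof -
    have "nr p (%w. (x m w, y m w) - (x l w, y l w)) \<le>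
        nr p (%w. norm (x m w - x l w) + norm (y m w - y l w))" by (rule nr_mono, rule L_ip_diff[OF m m])
         (auto intro!: L_ip_intros LG_L_ip[OF x] LG_L_ip[OF y] ok_pos[OF p] norm_Pair_le)
    also have "... \<le> nr p (%w. norm (x m w - x l w)) + nr p (%w. norm (y m w - y l w))"
      by (intro nr_triangle p L_ip_intros LG_L_ip[OF x] LG_L_ip[OF y])
    also have "... = nr p (%w. x m w - x l w) + nr p (%w. y m w - y l w)" by (simp add: nr_def)
    also have "... < eps / 2 + eps / 2" using M M' that by (intro add_strict_mono) auto
    finally show ?thesis by simp
  qed
  then show "\<exists>M. \<forall>m\<ge>M. \<forall>l\<ge>M. nr p (%w. (x m w, y m w) - (x l w, y l w)) < eps" by blast
qed

lemma LG_lip2: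
  fixes Phi :: "'v::euclidean_space => 'u::euclidean_space => 'z::euclidean_space"
  assumes x: "x \<in> LG E p" and y: "y \<in> LG E p" and p: "ok p"
    and Phi: "\<And>a b a' b'. norm (Phi a b - Phi a' b') \<le> L * (norm (a - a') + norm (b - b'))"
  shows "(%m w. Phi (x m w) (y m w)) \<in> LG E p"
proof -
  have "norm (Phi (fst a) (snd a) - Phi (fst b) (snd b)) \<le> (2 * \<bar>L\<bar>) * norm (a - b)" for a b
  proof -
    have "norm (Phi (fst a) (snd a) - Phi (fst b) (snd b)) \<le> L * (norm (fst (a - b)) + norm (snd (a - b)))"
      using Phi by simp
    also have "... \<le> \<bar>L\<bar> * (norm (a - b) + norm (a - b))"
      using norm_fst_le[of "fst (a - b)" "snd (a - b)"] norm_snd_le[of "snd (a - b)" "fst (a - b)"]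
      unfolding prod.collapse by (intro mult_mono add_mono) auto
    finally show ?thesis by simp
  qed
  from LG_lip[OF LG_Pair[OF x y p] p this] show ?thesis by simp
qed

lemma LG_const: "X \<in> L_ip ==> ok p ==> (%_. X) \<in> LG E p" by (rule LG_I) (auto simp: nr_const ok_pos)

lemma LG_add: "x \<in> LG E p ==> y \<in> LG E p ==> ok p ==> (%m w. x m w + y m w) \<in> LG E p"
  by (rule LG_lip2[of _ _ _ _ 1]) (auto simp: norm_diff_triangle_ineq)

lemma LG_diff: "x \<in> LG E p ==> y \<in> LG E p ==> ok p ==> (%m w. x m w - y m w) \<in> LG E p"
proof (rule LG_lip2[of x p y "%a b. a - b" 1])
  fix a b a' b' :: 'a
  show "norm (a - b - (a' - b')) \<le> 1 * (norm (a - a') + norm (b - b'))"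
    using norm_triangle_ineq4[of "a - a'" "b - b'"] by (simp add: algebra_simps)
qed

lemma LG_scaleR: "x \<in> LG E p ==> ok p ==> (%m w. c *\<^sub>R x m w) \<in> LG E p"
  by (rule LG_lip[of _ _ _ "\<bar>c\<bar>"]) (auto simp flip: scaleR_diff_right)

lemma LG_norm: "x \<in> LG E p ==> ok p ==> (%m w. norm (x m w)) \<in> LG E p"
  by (rule LG_lip[of _ _ _ 1]) (auto simp: norm_triangle_ineq3)

lemma LG_sum: "(\<And>i. i \<in> I ==> x i \<in> LG E p) ==> ok p ==> (%m w. \<Sum>i\<in>I. x i m w) \<in> LG E p"
  by (induction I rule: infinite_finite_induct) (auto intro: LG_const L_ip_const LG_add)

lemma LG_2_1: "x \<in> LG E 2 ==> x \<in> LG E 1"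
proof (rule LG_I)
  assume x: "x \<in> LG E 2"
  show "x m \<in> L_ip" for m by (rule LG_L_ip[OF x])
  fix eps :: real assume "0 < eps"
  then obtain M where "\<forall>m\<ge>M. \<forall>l\<ge>M. nr 2 (%w. x m w - x l w) < eps" using LG_Cauchy[OF x ok2] by meson
  then show "\<exists>M. \<forall>m\<ge>M. \<forall>l\<ge>M. nr 1 (%w. x m w - x l w) < eps"
    using nr_1_le_2[OF L_ip_diff[OF LG_L_ip[OF x] LG_L_ip[OF x]]] by (meson le_less_trans)
qed simp

lemma LG_to_1: "x \<in> LG E p ==> ok p ==> x \<in> LG E 1" using LG_2_1 by (auto simp: ok_def)

lemma Np_tendsto:
  assumes x: "x \<in> LG E p" and p: "ok p"
  shows "(%m. nr p (x m)) ----> Np p x"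
proof -
  have "Cauchy (%m. nr p (x m))"
  proof (rule CauchyI)
    fix eps :: real assume "0 < eps"
    then obtain M where M: "\<forall>m\<ge>M. \<forall>l\<ge>M. nr p (%w. x m w - x l w) < eps" using LG_Cauchy[OF x p] by blast
    have "norm (nr p (x m) - nr p (x n)) < eps" if "M \<le> m" "M \<le> n" for m n
      using nr_triangle_rev[OF LG_L_ip[OF x, of m] LG_L_ip[OF x, of n] p] M that by fastforce
    then show "\<exists>M. \<forall>m\<ge>M. \<forall>n\<ge>M. norm (nr p (x m) - nr p (x n)) < eps" by blast
  qed
  then show ?thesis unfolding Np_def by (simp add: Cauchy_convergent_iff convergent_LIMSEQ_iff)
qed

lemma Np_eqI: "(%m. nr p (x m)) ----> c ==> Np p x = c" unfolding Np_def by (rule limI)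

lemma Np_const: "Np p (%_. X) = nr p X" by (rule Np_eqI) simp

lemma Np_nonneg: "x \<in> LG E p ==> ok p ==> 0 \<le> Np p x"
  by (rule LIMSEQ_le_const[OF Np_tendsto]) (auto intro: nr_nonneg LG_L_ip)

lemma Eext_norm_power:
  assumes x: "x \<in> LG E p" and p: "ok p"
  shows "Eext E (%m w. norm (x m w) ^ p) = Np p x ^ p"
proof -
  have "(%m. nr p (x m) ^ p) ----> Np p x ^ p" by (intro tendsto_power Np_tendsto x p)
  moreover have "nr p (x m) ^ p = E (%w. norm (x m w) ^ p)" for m by (intro nr_power LG_L_ip[OF x] ok_pos[OF p])
  ultimately show ?thesis unfolding Eext_def by (intro limI) simp
qed

lemma Np_mono:
  assumes "x \<in> LG E p" "y \<in> LG E p" "ok p" "\<And>m w. norm (x m w) \<le> norm (y m w)"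
  shows "Np p x \<le> Np p y"
  by (rule LIMSEQ_le[OF Np_tendsto[OF assms(1,3)] Np_tendsto[OF assms(2,3)]])
     (use assms in \<open>auto intro!: exI[of _ 0] nr_mono LG_L_ip ok_pos\<close>)

lemma Np_triangle:
  assumes "x \<in> LG E p" "y \<in> LG E p" "ok p"
  shows "Np p (%m w. x m w + y m w) \<le> Np p x + Np p y"
  by (rule LIMSEQ_le[OF Np_tendsto[OF LG_add[OF assms]] tendsto_add[OF Np_tendsto[OF assms(1,3)] Np_tendsto[OF assms(2,3)]]])
     (use assms in \<open>auto intro!: exI[of _ 0] nr_triangle LG_L_ip\<close>)

lemma Np_scaleR: "x \<in> LG E p ==> ok p ==> Np p (%m w. c *\<^sub>R x m w) = \<bar>c\<bar> * Np p x"
proof -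
  assume x: "x \<in> LG E p" and p: "ok p"
  then have "nr p (%w. c *\<^sub>R x m w) = \<bar>c\<bar> * nr p (x m)" for m by (intro nr_scaleR LG_L_ip ok_pos)
  then show ?thesis using tendsto_mult_left[OF Np_tendsto[OF x p], of "\<bar>c\<bar>"] by (intro Np_eqI) simp
qed

lemma Np_norm: "Np p (%m w. norm (x m w)) = Np p x" by (simp add: Np_def nr_def)

lemma Np_sum:
  assumes "\<And>i. i \<in> I ==> x i \<in> LG E p" "ok p"
  shows "Np p (%m w. \<Sum>i\<in>I. x i m w) \<le> (\<Sum>i\<in>I. Np p (x i))"
  by (rule LIMSEQ_le[OF Np_tendsto[OF LG_sum[OF assms]] tendsto_sum[OF Np_tendsto[OF assms]]])
     (use assms in \<open>auto intro!: exI[of _ 0] nr_sum LG_L_ip\<close>)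

lemma ds_commute: "ds p x y = ds p y x" unfolding Np_def by (subst nr_commute) (rule refl)

lemma ds_triangle:
  assumes "x \<in> LG E p" "y \<in> LG E p" "z \<in> LG E p" "ok p"
  shows "ds p x z \<le> ds p x y + ds p y z"
  using Np_triangle[OF LG_diff[OF assms(1,2,4)] LG_diff[OF assms(2,3,4)] assms(4)] by simp

lemma ds_nonneg: "x \<in> LG E p ==> y \<in> LG E p ==> ok p ==> 0 \<le> ds p x y" by (intro Np_nonneg LG_diff)

lemma ds_self: "0 < p ==> ds p x x = 0" by (rule Np_eqI) (simp add: nr_const)

lemma ds_const: "ds p (%_. X) (%_. Y) = nr p (%w. X w - Y w)" by (rule Np_const)

lemma Np_le_ds: "x \<in> LG E p ==> y \<in> LG E p ==> ok p ==> Np p x \<le> Np p y + ds p x y"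
  using Np_triangle[OF _ LG_diff, of y p x y] by simp

lemma Np_1_le:
  assumes "x \<in> LG E p" "ok p"
  shows "Np 1 x \<le> Np p x"
  by (rule LIMSEQ_le[OF Np_tendsto[OF LG_to_1[OF assms]] Np_tendsto[OF assms]])
     (auto intro!: exI[of _ 0] nr_1_le[simplified] LG_L_ip[OF assms(1)] assms(2))

lemma LG_eq_iff:
  assumes "x \<in> LG E p" "y \<in> LG E p" "ok p"
  shows "LG_eq E p x y \<longleftrightarrow> ds p x y = 0"
proof -
  have l: "(%m. nr p (%w. x m w - y m w)) ----> ds p x y" by (intro Np_tendsto LG_diff assms)
  have e: "nr p (%w. x m w - y m w) ^ p = E (%w. norm (x m w - y m w) ^ p)" for m
    by (intro nr_power L_ip_diff LG_L_ip[OF assms(1)] LG_L_ip[OF assms(2)] ok_pos[OF assms(3)])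
  have "(%m. E (%w. norm (x m w - y m w) ^ p)) ----> ds p x y ^ p" using tendsto_power[OF l, of p] by (simp add: e)
  then show ?thesis unfolding LG_eq_def
    using LIMSEQ_unique[of _ 0 "ds p x y ^ p"] ok_pos[OF assms(3)] by (auto simp: zero_power)
qed

lemma LG_tendsto_iff:
  assumes "\<And>k. J k \<in> LG E p" "x \<in> LG E p" "ok p"
  shows "LG_tendsto E p J x \<longleftrightarrow> (%k. ds p (J k) x) ----> 0"
proof -
  have e: "Eext E (%m w. norm (J k m w - x m w) ^ p) = ds p (J k) x ^ p" for k by (intro Eext_norm_power LG_diff assms)
  have nn: "0 \<le> ds p (J k) x" for k by (intro ds_nonneg assms)
  have "(%k. ds p (J k) x ^ p) ----> 0 \<longleftrightarrow> (%k. ds p (J k) x) ----> 0"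
  proof
    assume "(%k. ds p (J k) x ^ p) ----> 0"
    then have "(%k. root p (ds p (J k) x ^ p)) ----> root p 0" by (rule tendsto_real_root)
    then show "(%k. ds p (J k) x) ----> 0" by (simp add: real_root_power_cancel nn ok_pos[OF assms(3)])
  next
    assume "(%k. ds p (J k) x) ----> 0"
    then show "(%k. ds p (J k) x ^ p) ----> 0" by (rule tendsto_null_power) (rule ok_pos[OF assms(3)])
  qed
  then show ?thesis unfolding LG_tendsto_def e .
qed

text \<open>Density of \<open>L_ip\<close>: an element of the completion is the limit of its own
  terms, each regarded as a constant sequence.\<close>

lemma ds_initial_tendsto:
  assumes x: "x \<in> LG E p" and p: "ok p"
  shows "(%M. ds p (%_. x M) x) ----> 0"
proof (rule LIMSEQ_I)
  fix eps :: real assume "0 < eps"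
  then obtain M where M: "\<forall>m\<ge>M. \<forall>l\<ge>M. nr p (%w. x m w - x l w) < eps / 2"
    using LG_Cauchy[OF x p, of "eps / 2"] by auto
  have "ds p (%_. x n) x \<le> eps / 2" if "M \<le> n" for n
    by (rule LIMSEQ_le_const2[OF Np_tendsto[OF LG_diff[OF LG_const[OF LG_L_ip[OF x] p] x p] p]])
       (use M that in \<open>auto intro!: exI[of _ M] less_imp_le\<close>)
  then show "\<exists>M. \<forall>n\<ge>M. norm (ds p (%_. x n) x - 0) < eps"
    using ds_nonneg[OF LG_const[OF LG_L_ip[OF x] p] x p] \<open>0 < eps\<close>
    by (intro exI[of _ M]) (fastforce intro: le_less_trans[of _ "eps / 2"])
qed

lemma LG_approx:
  assumes x: "x \<in> LG E p" and p: "ok p" and "0 < eps"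
  shows "\<exists>M. \<forall>m\<ge>M. ds p (%_. x m) x < eps"
proof -
  obtain M where "\<forall>m\<ge>M. norm (ds p (%_. x m) x - 0) < eps"
    using LIMSEQ_D[OF ds_initial_tendsto[OF x p] \<open>0 < eps\<close>] by blast
  then show ?thesis by (intro exI[of _ M]) (simp add: abs_less_iff)
qed

text \<open>A diagonal choice: from the \<open>k\<close>-th Cauchy sequence a term at distance below
  \<open>1 / real (Suc k)\<close> from the element it represents is taken, and these terms form the
  limit.\<close>

lemma LG_complete:
  fixes x :: "nat => ('d, 'v::euclidean_space) rv"
  assumes x: "\<And>k. x k \<in> LG E p" and p: "ok p"
    and C: "\<And>eps. 0 < eps ==> \<exists>M. \<forall>k\<ge>M. \<forall>l\<ge>M. ds p (x k) (x l) < eps"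
  shows "\<exists>z\<in>LG E p. (%k. ds p (x k) z) ----> 0"
proof -
  have "\<exists>M. ds p (%_. x k M) (x k) < 1 / real (Suc k)" for k using LG_approx[OF x p, of "1 / real (Suc k)" k] by auto
  then obtain M where M: "\<And>k. ds p (%_. x k (M k)) (x k) < 1 / real (Suc k)" by metis
  define z where "z k = x k (M k)" for k
  have zL: "z k \<in> L_ip" for k unfolding z_def by (rule LG_L_ip[OF x])
  have zc: "(%_. z k) \<in> LG E p" for k by (rule LG_const[OF zL p])
  have zx: "ds p (%_. z k) (x k) < 1 / real (Suc k)" for k using M by (simp add: z_def)
  have lim: "(%k. 1 / real (Suc k)) ----> 0" by (rule LIMSEQ_Suc[OF lim_1_over_n])
  have z: "z \<in> LG E p"
  proof (rule LG_I[OF zL p])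
    fix eps :: real assume "0 < eps"
    then obtain A where A: "\<forall>k\<ge>A. \<forall>l\<ge>A. ds p (x k) (x l) < eps / 3" using C[of "eps / 3"] by auto
    obtain B where B: "\<forall>k\<ge>B. 1 / real (Suc k) < eps / 3"
      using LIMSEQ_D[OF lim, of "eps / 3"] \<open>0 < eps\<close> by auto
    have "nr p (%w. z k w - z l w) < eps" if "max A B \<le> k" "max A B \<le> l" for k l
    proof -
      have "nr p (%w. z k w - z l w) = ds p (%_. z k) (%_. z l)" by (simp add: ds_const)
      also have "... \<le> ds p (%_. z k) (x k) + (ds p (x k) (x l) + ds p (x l) (%_. z l))"
      proof -
        have "ds p (%_. z k) (%_. z l) \<le> ds p (%_. z k) (x k) + ds p (x k) (%_. z l)" by (rule ds_triangle[OF zc x zc p])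
        moreover have "ds p (x k) (%_. z l) \<le> ds p (x k) (x l) + ds p (x l) (%_. z l)" by (rule ds_triangle[OF x x zc p])
        ultimately show ?thesis by simp
      qed
      also have "... < eps / 3 + (eps / 3 + eps / 3)" using A B that zx[of k] zx[of l] ds_commute[of p "x l" "%_. z l"]
        by (intro add_strict_mono) (auto intro: less_trans)
      finally show ?thesis by simp
    qed
    then show "\<exists>M. \<forall>k\<ge>M. \<forall>l\<ge>M. nr p (%w. z k w - z l w) < eps" by blast
  qed
  have "(%k. ds p (x k) z) ----> 0"
  proof (rule real_tendsto_sandwich[where f = "%_. 0" and h = "%k. 1 / real (Suc k) + ds p (%_. z k) z"])
    show "(%k. 1 / real (Suc k) + ds p (%_. z k) z) ----> 0" using tendsto_add[OF lim ds_initial_tendsto[OF z p]] by simp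
    show "\<forall>\<^sub>F k in sequentially. ds p (x k) z \<le> 1 / real (Suc k) + ds p (%_. z k) z"
    proof (rule always_eventually, rule allI)
      fix k
      show "ds p (x k) z \<le> 1 / real (Suc k) + ds p (%_. z k) z"
        using ds_triangle[OF x[of k] zc[of k] z p] zx[of k] ds_commute[of p "x k" "%_. z k"] by linarith
    qed
  qed (use ds_nonneg[OF x z p] in auto)
  with z show ?thesis by blast
qed

text \<open>
  For \<open>L_ip\<close>-approximants all moments are finite, so an element of the \<open>L\<^sup>2\<close> completion that
  vanishes in \<open>L\<^sup>1\<close> vanishes in \<open>L\<^sup>2\<close>: \<open>|x\<^sub>m|\<^sup>2 \<le> |x\<^sub>m| |x\<^sub>m - x\<^sub>l| + |x\<^sub>m| |x\<^sub>l|\<close> and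
  \<open>|x\<^sub>m| |x\<^sub>l| \<le> N |x\<^sub>m| + |x\<^sub>m| |x\<^sub>l|\<^sup>2 / N\<close>.
\<close>

lemma Np_2_zero:
  assumes x: "x \<in> LG E 2" and z: "Np 1 x = 0"
  shows "Np 2 x = 0"
proof -
  have xL: "x m \<in> L_ip" for m by (rule LG_L_ip[OF x])
  define a where "a = Np 2 x"
  have lim2: "(%m. nr 2 (x m)) ----> a" unfolding a_def using x by (intro Np_tendsto) auto
  have lim1: "(%m. nr 1 (x m)) ----> 0" using Np_tendsto[OF LG_2_1[OF x]] z by auto
  have a0: "0 \<le> a" unfolding a_def using x by (intro Np_nonneg) auto
  have small: "a^2 \<le> a * eps" if e: "0 < eps" for eps
  proof -
    obtain M where M: "\<forall>m\<ge>M. \<forall>l\<ge>M. nr 2 (%w. x m w - x l w) < eps" using LG_Cauchy[OF x _ e] by auto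
    \<comment> \<open>The root of the fourth moment of the approximant \<open>x M\<close>, which
      lies in \<open>L_ip\<close> and does not depend on \<open>m\<close>.\<close>
    define q where "q = nr 2 (%w. (norm (x M w))\<^sup>2)"
    have bound: "(nr 2 (x m))^2 \<le> nr 2 (x m) * eps + (N * nr 1 (x m) + nr 2 (x m) * q / N)"
      if "M \<le> m" "0 < N" for m N
    proof -
      have pt: "(norm (x m w))^2 \<le> norm (x m w) * norm (x m w - x M w) +
          (N * norm (x m w) + (1 / N) * (norm (x m w) * (norm (x M w))^2))" for w
      proof -
        define u v where "u = norm (x m w)" and "v = norm (x M w)"
        have uv: "0 \<le> u" "0 \<le> v" by (auto simp: u_def v_def)
        have "u \<le> norm (x m w - x M w) + v"
          using norm_triangle_ineq[of "x m w - x M w" "x M w"] by (simp add: u_def v_def)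
        then have "u^2 \<le> u * (norm (x m w - x M w) + v)" using uv by (simp add: power2_eq_square mult_left_mono)
        moreover have "v \<le> N + v^2 / N"
        proof (cases "v \<le> N")
          case True
          then have "0 \<le> v^2 / N" using \<open>0 < N\<close> by simp
          with True show ?thesis by linarith
        next
          case False
          then have "v * N \<le> v * v" using uv by (intro mult_left_mono) auto
          then have "v \<le> v^2 / N" using \<open>0 < N\<close> by (simp add: field_simps power2_eq_square)
          then show ?thesis using \<open>0 < N\<close> by linarith
        qed
        then have "u * v \<le> u * (N + v^2 / N)" using uv by (intro mult_left_mono) auto
        ultimately show ?thesis unfolding u_def[symmetric] v_def[symmetric] by (simp add: algebra_simps)
      qed
      have L: "(%w. norm (x m w) * norm (x m w - x M w)) \<in> L_ip"
        "(%w. N * norm (x m w)) \<in> L_ip" "(%w. (1 / N) * (norm (x m w) * (norm (x M w))^2)) \<in> L_ip"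
        by (intro L_ip_intros xL)+
      have "(nr 2 (x m))^2 = E (%w. (norm (x m w))\<^sup>2)" by (rule nr_2[OF xL])
      also have "... \<le> E (%w. norm (x m w) * norm (x m w - x M w) +
          (N * norm (x m w) + (1 / N) * (norm (x m w) * (norm (x M w))^2)))" by (intro E_mono pt L_ip_intros xL)
      also have "... \<le> E (%w. norm (x m w) * norm (x m w - x M w)) +
          E (%w. N * norm (x m w) + (1 / N) * (norm (x m w) * (norm (x M w))^2))" by (intro E_add L L_ip_add)
      also have "... \<le> E (%w. norm (x m w) * norm (x m w - x M w)) +
          (E (%w. N * norm (x m w)) + E (%w. (1 / N) * (norm (x m w) * (norm (x M w))^2)))" by (intro add_left_mono E_add L)
      also have "... = E (%w. norm (x m w) * norm (x m w - x M w)) +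
          (N * nr 1 (x m) + (1 / N) * E (%w. norm (x m w) * (norm (x M w))^2))"
        using \<open>0 < N\<close> by (simp only: nr_1) (subst E_scale, intro L_ip_intros xL, simp, subst E_scale, intro L_ip_intros xL, simp, simp)
      also have "... \<le> nr 2 (x m) * eps + (N * nr 1 (x m) + (1 / N) * (nr 2 (x m) * q))"
      proof (intro add_mono order_refl mult_left_mono)
        have "E (%w. norm (x m w) * norm (x m w - x M w)) \<le>
            nr 2 (%w. norm (x m w)) * nr 2 (%w. norm (x m w - x M w))" by (intro Cauchy_Schwarz L_ip_intros xL)
        also have "... = nr 2 (x m) * nr 2 (%w. x m w - x M w)" by (simp add: nr_def)
        also have "... \<le> nr 2 (x m) * eps" using M \<open>M \<le> m\<close> by (intro mult_left_mono nr_nonneg xL less_imp_le) auto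
        finally show "E (%w. norm (x m w) * norm (x m w - x M w)) \<le> nr 2 (x m) * eps" .
        have "E (%w. norm (x m w) * (norm (x M w))^2) \<le>
            nr 2 (%w. norm (x m w)) * nr 2 (%w. (norm (x M w))\<^sup>2)" by (intro Cauchy_Schwarz L_ip_intros xL)
        then show "E (%w. norm (x m w) * (norm (x M w))^2) \<le> nr 2 (x m) * q" by (simp add: nr_def q_def)
      qed (use \<open>0 < N\<close> in simp)
      finally show ?thesis by simp
    qed
    \<comment> \<open>With \<open>N\<close> fixed, \<open>m\<close> to infinity removes the L^1
      norm; afterwards \<open>N\<close> to infinity removes the term with \<open>q\<close>.\<close>
    have "a^2 \<le> a * eps + a * q / N" if "0 < N" for N
    proof (rule LIMSEQ_le)
      show "(%m. (nr 2 (x m))\<^sup>2) ----> a^2" by (intro tendsto_power lim2)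
      show "(%m. nr 2 (x m) * eps + (N * nr 1 (x m) + nr 2 (x m) * q / N)) ----> a * eps + a * q / N"
        using tendsto_add[OF tendsto_mult_right[OF lim2, of eps] tendsto_add[OF tendsto_mult_left[OF lim1, of N]
           tendsto_divide[OF tendsto_mult_right[OF lim2, of q] tendsto_const[of N]]]] that by simp
      show "\<exists>K. \<forall>m\<ge>K. (nr 2 (x m))\<^sup>2 \<le> nr 2 (x m) * eps + (N * nr 1 (x m) + nr 2 (x m) * q / N)"
        using bound that by blast
    qed
    then have "a^2 \<le> a * eps + (a * q) * (1 / real (Suc n))" for n by (simp del: of_nat_Suc)
    moreover have "(%n. a * eps + (a * q) * (1 / real (Suc n))) ----> a * eps + (a * q) * 0"
      by (intro tendsto_intros LIMSEQ_Suc[OF lim_1_over_n])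
    ultimately show ?thesis by (intro LIMSEQ_le_const) (auto simp del: of_nat_Suc)
  qed
  have "a = 0"
  proof (rule ccontr)
    assume "a \<noteq> 0"
    then have "0 < a" using a0 by simp
    then have "a^2 \<le> a * (a / 2)" by (intro small) simp
    with \<open>0 < a\<close> show False by (simp add: power2_eq_square)
  qed
  then show ?thesis by (simp add: a_def)
qed

lemma LG_upto_LG: "x \<in> LG_upto E p s ==> x \<in> LG E p" by (auto simp: LG_upto_def LG_def intro: L_ip_upto_L_ip)

lemma LG_upto_iff: "x \<in> LG_upto E p s \<longleftrightarrow> x \<in> LG E p \<and> (\<forall>m. x m \<in> L_ip_upto s)"
  by (auto simp: LG_upto_def LG_def intro: L_ip_upto_L_ip)

end

section \<open>Piecewise constant functions of time\<close>

text \<open>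
  \<open>U\<close> is constant on each of the finitely many intervals \<open>[a, b)\<close> cut out by \<open>F\<close>. In this form
  common refinements are unions of the sets \<open>F\<close>.
\<close>

definition pc :: "(real => 'a) => bool" where
  "pc U \<longleftrightarrow> (\<exists>F. finite F \<and> (\<forall>s s'. (\<forall>f\<in>F. f \<le> s \<longleftrightarrow> f \<le> s') --> U s = U s'))"

lemma pc_const: "pc (%_. c)" unfolding pc_def by (intro exI[of _ "{}"]) auto

lemma pc_comp: "pc U ==> pc (%s. g (U s))" unfolding pc_def by metis

lemma pc_comp2:
  assumes "pc U" "pc v"
  shows "pc (%s. g (U s) (v s))"
proof -
  obtain F F' where "finite F" "\<forall>s s'. (\<forall>f\<in>F. f \<le> s \<longleftrightarrow> f \<le> s') --> U s = U s'"
    "finite F'" "\<forall>s s'. (\<forall>f\<in>F'. f \<le> s \<longleftrightarrow> f \<le> s') --> v s = v s'"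
    using assms unfolding pc_def by meson
  then show ?thesis unfolding pc_def by (intro exI[of _ "F \<union> F'"]) (metis UnCI finite_UnI)
qed

lemma pc_le: "pc (%s. a \<le> s)" unfolding pc_def by (intro exI[of _ "{a}"]) auto

lemma pc_indicator_Ico: "pc (%s. indicator {a..<b} s :: real)"
proof -
  have "pc (%s. (if a \<le> s then 1 else 0) * (if b \<le> s then 0 else 1 :: real))"
    by (rule pc_comp2) (rule pc_comp[OF pc_le])+
  moreover have "(%s. indicator {a..<b} s :: real) = (%s. (if a \<le> s then 1 else 0) * (if b \<le> s then 0 else 1))"
    by (auto simp: fun_eq_iff)
  ultimately show ?thesis by simp
qed

text \<open>The value at \<open>s\<close> is a function of the set of those \<open>f \<in> F\<close>
  with \<open>f \<le> s\<close>, and there are finitely many such sets.\<close>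

lemma pc_finite_range:
  assumes "pc U"
  shows "finite (range U)"
proof -
  obtain F where F: "finite F" "\<And>s s'. (\<forall>f\<in>F. f \<le> s \<longleftrightarrow> f \<le> s') ==> U s = U s'"
    using assms unfolding pc_def by blast
  define k where "k s = {f \<in> F. f \<le> s}" for s
  have "U s = U s'" if "k s = k s'" for s s' by (rule F(2)) (use that in \<open>auto simp: k_def\<close>)
  then have "U s = (%A. U (SOME s. k s = A)) (k s)" for s by (metis (mono_tags, lifting) someI_ex)
  then have "range U \<subseteq> (%A. U (SOME s. k s = A)) ` Pow F" by (force simp: k_def)
  then show ?thesis using F(1) finite_subset by blast
qed

lemma pc_borel:
  fixes f :: "real => real"
  assumes "pc f"
  shows "f \<in> borel_measurable borel"
proof -
  obtain F where F: "finite F" "\<And>s s'. (\<forall>a\<in>F. a \<le> s \<longleftrightarrow> a \<le> s') ==> f s = f s'"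
    using assms unfolding pc_def by blast
  define k where "k s = {a \<in> F. a \<le> s}" for s
  define g where "g A = f (SOME s. k s = A)" for A
  have "f s = f s'" if "k s = k s'" for s s' by (rule F(2)) (use that in \<open>auto simp: k_def\<close>)
  then have fg: "f s = g (k s)" for s unfolding g_def by (metis (mono_tags, lifting) someI_ex)
  have meas: "{s. k s = A} \<in> sets borel" if "A \<in> Pow F" for A
  proof -
    have "{s. k s = A} = (\<Inter>a\<in>F. if a \<in> A then {a..} else {..<a})"
    proof (rule set_eqI)
      fix s
      have "k s = A \<longleftrightarrow> (\<forall>a\<in>F. a \<le> s \<longleftrightarrow> a \<in> A)" using that by (auto simp: k_def)
      moreover have "s \<in> (if a \<in> A then {a..} else {..<a}) \<longleftrightarrow> (a \<le> s \<longleftrightarrow> a \<in> A)" for a by auto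
      ultimately show "s \<in> {s. k s = A} \<longleftrightarrow> s \<in> (\<Inter>a\<in>F. if a \<in> A then {a..} else {..<a})" by (simp only: mem_Collect_eq INT_iff)
    qed
    also have "... \<in> sets borel" by (intro sets.countable_INT'') (auto simp: F(1) countable_finite)
    finally show ?thesis .
  qed
  have "f s = (\<Sum>A\<in>Pow F. indicator {s. k s = A} s * g A)" for s
  proof -
    have "(\<Sum>A\<in>Pow F. indicator {s. k s = A} s * g A) = (\<Sum>A\<in>Pow F. if A = k s then g (k s) else 0)"
      by (intro sum.cong) (auto simp: indicator_def)
    also have "... = g (k s)" using F(1) by (simp add: sum.delta') (auto simp: k_def)
    finally show ?thesis using fg by simp
  qed
  moreover have "(%s. \<Sum>A\<in>Pow F. indicator {s. k s = A} s * g A) \<in> borel_measurable borel"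
    by (intro borel_measurable_sum borel_measurable_times borel_measurable_indicator meas) auto
  ultimately show ?thesis by presburger
qed

lemma pc_locally_constant:
  assumes "pc U"
  shows "\<exists>F. finite F \<and> (\<forall>s. s \<notin> F --> (\<exists>delta>0. \<forall>s'. \<bar>s' - s\<bar> < delta --> U s' = U s))"
proof -
  obtain F where F: "finite F" "\<And>s s'. (\<forall>f\<in>F. f \<le> s \<longleftrightarrow> f \<le> s') ==> U s = U s'"
    using assms unfolding pc_def by blast
  have "\<exists>delta>0. \<forall>s'. \<bar>s' - s\<bar> < delta --> U s' = U s" if "s \<notin> F" for s
  proof -
    obtain delta where delta: "delta > 0" "\<forall>f\<in>F. f \<noteq> s --> delta \<le> dist s f"
      using finite_set_avoid[OF F(1), of s] by blast
    have "U s' = U s" if s': "\<bar>s' - s\<bar> < delta" for s'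
    proof (rule F(2), intro ballI)
      fix f assume "f \<in> F"
      then have "delta \<le> \<bar>s - f\<bar>" using delta(2) \<open>s \<notin> F\<close> by (auto simp: dist_real_def)
      then show "f \<le> s' \<longleftrightarrow> f \<le> s" using s' by linarith
    qed
    with delta(1) show ?thesis by blast
  qed
  with F(1) show ?thesis by blast
qed

section \<open>Lebesgue integration over the time interval\<close>

abbreviation LB :: "real => real measure" where
  "LB T \<equiv> lebesgue_on {0..T}"

abbreviation LI :: "real => (real => real) => real" where
  "LI T \<equiv> integral\<^sup>L (lebesgue_on {0..T})"

lemma LB_finite: "finite_measure (LB T)" by (rule finite_measure_lebesgue_on) simp

lemma borel_measurable_LB: "f \<in> borel_measurable borel ==> f \<in> borel_measurable (LB T)"
  by (intro measurable_restrict_space1 measurable_completion) simp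

lemma LB_integrable_bounded:
  fixes f :: "real => real"
  assumes "f \<in> borel_measurable (LB T)" "AE s in LB T. \<bar>f s\<bar> \<le> B"
  shows "integrable (LB T) f"
  by (rule finite_measure.integrable_const_bound[OF LB_finite, of _ B]) (use assms in auto)

lemma LB_const_integrable: "integrable (LB T) (%_. c :: real)" by (rule LB_integrable_bounded[of _ _ "\<bar>c\<bar>"]) auto

lemma LB_integral_const: "0 \<le> T ==> LI T (%_. c :: real) = T * c" by (simp add: measure_restrict_space)

lemma pc_integrable:
  fixes f :: "real => real"
  assumes "pc f"
  shows "integrable (LB T) f"
proof (rule LB_integrable_bounded[OF borel_measurable_LB[OF pc_borel[OF assms]]])
  show "AE s in LB T. \<bar>f s\<bar> \<le> (\<Sum>x\<in>range f. \<bar>x\<bar>)"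
    using member_le_sum[of "f _" "range f" abs] pc_finite_range[OF assms] by (intro AE_I2) auto
qed

lemma LB_AE_finite: "finite F ==> AE s in LB T. s \<notin> F"
proof -
  assume "finite F"
  then have "F \<in> null_sets lebesgue" by (simp add: finite_imp_null_set_lborel null_sets_completionI)
  then have "AE s in lebesgue. s \<notin> F" by (rule AE_not_in)
  then show ?thesis by (simp add: AE_restrict_space_iff) (auto elim: eventually_mono)
qed

text \<open>The spaces of processes are defined with the gauge integral, while the estimates use
  measurability and dominated convergence. For nonnegative integrands the two integrals
  agree.\<close>

lemma LB_has_integral:
  fixes f :: "real => real"
  assumes "\<And>s. s \<in> {0..T} ==> 0 \<le> f s"
  shows "(f has_integral r) {0..T} \<longleftrightarrow> integrable (LB T) f \<and> LI T f = r"
proof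
  assume L: "(f has_integral r) {0..T}"
  then have "f absolutely_integrable_on {0..T}" using assms nonnegative_absolutely_integrable_1 by blast
  then have i: "integrable (LB T) f" by (rule absolutely_integrable_imp_integrable) simp
  with L has_integral_integral_lebesgue_on[OF i] show "integrable (LB T) f \<and> LI T f = r"
    by (auto intro: has_integral_unique)
next
  assume R: "integrable (LB T) f \<and> LI T f = r"
  then show "(f has_integral r) {0..T}" using has_integral_integral_lebesgue_on[of "{0..T}" f] by simp
qed

text \<open>Convergence only almost everywhere is enough because Lebesgue measure is complete. The
  functions are extended by 0 to the whole line, where a modification on a null set of
  \<open>lebesgue\<close> keeps measurability.\<close>

lemma LB_measurable_limit:
  fixes g :: "real => real"
  assumes f: "\<And>j::nat. f j \<in> borel_measurable (LB T)" and l: "AE s in LB T. (%j. f j s) ----> g s"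
  shows "g \<in> borel_measurable (LB T)"
proof -
  define h where "h s = lim (%j. f j s)" for s
  have iff: "((%s. if s \<in> {0..T} then u s else 0) \<in> borel_measurable lebesgue) = (u \<in> borel_measurable (LB T))"
    for u :: "real => real" using borel_measurable_if_lebesgue_on[of "{0..T}" UNIV u] by (simp add: lebesgue_on_UNIV_eq)
  have "h \<in> borel_measurable (LB T)" unfolding h_def[abs_def] by (rule borel_measurable_lim_metric[OF f])
  then have m: "(%s. if s \<in> {0..T} then h s else 0) \<in> borel_measurable lebesgue" unfolding iff .
  have "AE s in LB T. h s = g s" using l by eventually_elim (simp add: h_def limI)
  then have "AE s in lebesgue. (if s \<in> {0..T} then h s else 0) = (if s \<in> {0..T} then g s else 0)"
    by (auto simp: AE_restrict_space_iff elim: eventually_mono)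
  then have "(%s. if s \<in> {0..T} then g s else 0) \<in> borel_measurable lebesgue" by (rule borel_measurable_AE[OF m])
  then show ?thesis by (simp only: iff)
qed

lemma LB_AE_subseq:
  fixes G :: "nat => real => real"
  assumes "\<And>j. integrable (LB T) (G j)" "\<And>j. AE s in LB T. 0 \<le> G j s"
    "(%j. LI T (G j)) ----> 0"
  shows "\<exists>r. strict_mono r \<and> (AE s in LB T. (%j. G (r j) s) ----> 0)"
proof (rule tendsto_L1_AE_subseq[OF assms(1)])
  have "LI T (%s. norm (G j s)) = LI T (G j)" for j
  proof (rule integral_cong_AE)
    show "AE s in LB T. norm (G j s) = G j s" using assms(2)[of j] by eventually_elim simp
  qed (use assms(1)[of j] in auto)
  then show "(%j. LI T (%s. norm (G j s))) ----> 0" using assms(3) by simp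
qed

section \<open>Step functions on uniform grids and Riemann sums\<close>

definition ustep :: "real => nat => (nat => 'a::real_vector) => real => 'a" where
  "ustep T l g s = (\<Sum>i<l. indicator {real i * T / real l..<real (Suc i) * T / real l} s *\<^sub>R g i)"

lemma ustep_eq:
  assumes "i < l" "0 < T" "s \<in> {real i * T / real l..<real (Suc i) * T / real l}"
  shows "ustep T l g s = g i"
proof -
  have "indicator {real j * T / real l..<real (Suc j) * T / real l} s *\<^sub>R g j = (if j = i then g i else 0)" for j
  proof (cases "j = i")
    case False
    have l: "0 < real l" using assms(1) by simp
    have "s \<notin> {real j * T / real l..<real (Suc j) * T / real l}"
    proof
      assume "s \<in> {real j * T / real l..<real (Suc j) * T / real l}"
      then have "real j * T < real (Suc i) * T" "real i * T < real (Suc j) * T"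
        using assms(3) l by (auto simp del: of_nat_Suc simp: divide_le_eq less_divide_eq)
      then have "j < Suc i" "i < Suc j" using assms(2) by (simp_all del: of_nat_Suc)
      then show False using False by simp
    qed
    with False show ?thesis by simp
  qed (use assms(3) in simp)
  then show ?thesis unfolding ustep_def using assms(1) by simp
qed

lemma grid_cell:
  assumes "0 < l" "0 < T" "0 \<le> s" "s < T"
  shows "\<exists>i<l. s \<in> {real i * T / real l..<real (Suc i) * T / real l}"
proof -
  define i where "i = nat \<lfloor>s * real l / T\<rfloor>"
  have 0: "0 \<le> s * real l / T" using assms by simp
  then have r: "real i = of_int \<lfloor>s * real l / T\<rfloor>" by (simp add: i_def)
  have "real i \<le> s * real l / T" "s * real l / T < real i + 1" unfolding r by linarith+
  then have a: "real i * T \<le> s * real l" "s * real l < real (Suc i) * T" using assms by (auto simp: field_simps)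
  have "real i * T < real l * T"
    using a(1) assms by (smt (verit, best) mult.commute mult_less_cancel_left_pos of_nat_0_less_iff)
  then have "i < l" using assms by simp
  moreover have "s \<in> {real i * T / real l..<real (Suc i) * T / real l}"
    using a assms by (auto simp del: of_nat_Suc simp: divide_le_eq less_divide_eq)
  ultimately show ?thesis by blast
qed

text \<open>Away from the finitely many jumps, and from \<open>T\<close>, which lies in no cell,
  \<open>U\<close> is constant near \<open>s\<close>. Once the mesh is small, the left end of the
  cell of \<open>s\<close> carries the same value.\<close>

lemma ustep_tendsto:
  assumes "pc U" "0 < T"
  shows "AE s in LB T. eventually (%l. ustep T l (%i. U (real i * T / real l)) s = U s) sequentially"
proof -
  obtain F where F: "finite F" "\<And>s. s \<notin> F ==> \<exists>delta>0. \<forall>s'. \<bar>s' - s\<bar> < delta --> U s' = U s"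
    using pc_locally_constant[OF assms(1)] by blast
  have "AE s in LB T. s \<notin> insert T F" using F(1) by (intro LB_AE_finite) simp
  moreover have "AE s in LB T. s \<in> {0..T}" by (rule AE_I2) simp
  ultimately show ?thesis
  proof eventually_elim
    case (elim s)
    obtain delta where delta: "delta > 0" "\<And>s'. \<bar>s' - s\<bar> < delta ==> U s' = U s" using F(2) elim by blast
    obtain N :: nat where N: "T / delta < real N" using reals_Archimedean2 by blast
    have "ustep T l (%i. U (real i * T / real l)) s = U s" if l: "max 1 N \<le> l" for l
    proof -
      obtain i where i: "i < l" "s \<in> {real i * T / real l..<real (Suc i) * T / real l}"
        using grid_cell[of l T s] elim l assms by auto
      have "T / real l < delta"
      proof -
        have "T < real N * delta" using N delta(1) by (simp add: pos_divide_less_eq)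
        also have "... \<le> real l * delta" using l delta(1) by simp
        finally show ?thesis using l by (simp add: pos_divide_less_eq mult.commute)
      qed
      moreover have "real (Suc i) * T / real l = real i * T / real l + T / real l"
        by (simp add: algebra_simps add_divide_distrib)
      ultimately have "\<bar>real i * T / real l - s\<bar> < delta" using i(2) by auto
      from delta(2)[OF this] show ?thesis by (simp only: ustep_eq[OF i(1) assms(2) i(2)])
    qed
    then show ?case unfolding eventually_sequentially by (intro exI[of _ "max 1 N"] allI impI)
  qed
qed

lemma ustep_range:
  assumes "0 < T" "s \<in> {0..T}" "0 < l"
  shows "s < T ==> \<exists>i<l. real i * T / real l \<in> {0..s} \<and> ustep T l g s = g i"
proof -
  assume "s < T"
  then obtain i where "i < l" "s \<in> {real i * T / real l..<real (Suc i) * T / real l}"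
    using grid_cell[of l T s] assms by auto
  then show ?thesis using ustep_eq[of i l T s g] assms by (intro exI[of _ i]) auto
qed

lemma LB_integral_indicator:
  assumes "0 \<le> a" "a \<le> b" "b \<le> T"
  shows "LI T (%s. indicator {a..<b} s * c) = (b - a) * (c :: real)"
    "integrable (LB T) (%s. indicator {a..<b} s * c)"
proof -
  have "measure (LB T) {a..<b} = b - a" using assms by (subst measure_restrict_space) (auto simp: measure_completion)
  moreover have "{a..<b} \<inter> {0..T} = {a..<b}" using assms by auto
  ultimately show "LI T (%s. indicator {a..<b} s * c) = (b - a) * c" by simp
  show "integrable (LB T) (%s. indicator {a..<b} s * c)" by (rule pc_integrable, rule pc_comp[OF pc_indicator_Ico])
qed

lemma integral_ustep:
  assumes "0 < T"
  shows "LI T (ustep T l g) = (\<Sum>i<l. T / real l * g i :: real)"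
proof -
  have e: "LI T (%s. indicator {real i * T / real l..<real (Suc i) * T / real l} s * g i) = T / real l * g i \<and>
     integrable (LB T) (%s. indicator {real i * T / real l..<real (Suc i) * T / real l} s * g i)"
    if "i < l" for i
  proof -
    have "0 < real l" using that by simp
    have "real (Suc i) * T \<le> real l * T" using that assms by simp
    then have 1: "real (Suc i) * T / real l \<le> T" using \<open>0 < real l\<close> by (simp add: pos_divide_le_eq mult.commute del: of_nat_Suc)
    have 2: "real i * T / real l \<le> real (Suc i) * T / real l" using \<open>0 < real l\<close> assms by (intro divide_right_mono mult_right_mono) auto
    have 3: "0 \<le> real i * T / real l" using assms by simp
    have "real (Suc i) * T / real l - real i * T / real l = T / real l" by (simp add: algebra_simps add_divide_distrib)
    then show ?thesis using LB_integral_indicator[OF 3 2 1, of "g i"] by simp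
  qed
  show ?thesis unfolding ustep_def[abs_def] real_scaleR_def by (subst Bochner_Integration.integral_sum) (use e in auto)
qed

lemma pc_ustep: "pc (ustep T l g)"
proof -
  have "pc (%s. \<Sum>i<m. indicator {real i * T / real l..<real (Suc i) * T / real l} s *\<^sub>R g i)" for m
  proof (induction m)
    case (Suc m)
    have "pc (%s. (\<Sum>i<m. indicator {real i * T / real l..<real (Suc i) * T / real l} s *\<^sub>R g i) +
        indicator {real m * T / real l..<real (Suc m) * T / real l} s *\<^sub>R g m)"
      by (rule pc_comp2[OF Suc pc_indicator_Ico])
    then show ?case by simp
  qed (simp add: pc_const)
  then show ?thesis unfolding ustep_def[abs_def] .
qed

text \<open>Dominated convergence: the Riemann sum is the integral of the sampled step function, and
  the sum of the finitely many absolute values of \<open>f\<close> is a majorant.\<close>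

lemma Riemann_sum_pc:
  fixes f :: "real => real"
  assumes "pc f" "0 < T"
  shows "(%l. \<Sum>i<l. T / real l * f (real i * T / real l)) ----> LI T f"
proof -
  define B where "B = (\<Sum>x\<in>range f. \<bar>x\<bar>)"
  have B: "\<bar>f s\<bar> \<le> B" for s
    unfolding B_def using member_le_sum[of "f s" "range f" abs] pc_finite_range[OF assms(1)] by auto
  have B0: "0 \<le> B" using B[of 0] by linarith
  have "(%l. LI T (ustep T l (%i. f (real i * T / real l)))) ----> LI T f"
  proof (rule integral_dominated_convergence[where w = "%_. B"])
    show "f \<in> borel_measurable (LB T)" by (rule borel_measurable_LB[OF pc_borel[OF assms(1)]])
    show "ustep T l (%i. f (real i * T / real l)) \<in> borel_measurable (LB T)" for l
      by (rule borel_measurable_LB[OF pc_borel[OF pc_ustep]])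
    show "AE s in LB T. (%l. ustep T l (%i. f (real i * T / real l)) s) ----> f s"
      using ustep_tendsto[OF assms] by eventually_elim (rule tendsto_eventually)
    show "AE s in LB T. norm (ustep T l (%i. f (real i * T / real l)) s) \<le> B" for l
    proof -
      have "AE s in LB T. s \<notin> {T}" by (rule LB_AE_finite) simp
      moreover have "AE s in LB T. s \<in> {0..T}" by (rule AE_I2) simp
      ultimately show ?thesis
      proof eventually_elim
        case (elim s)
        show ?case
        proof (cases "l = 0")
          case True then show ?thesis using B0 by (simp add: ustep_def)
        next
          case False
          then show ?thesis using ustep_range[OF assms(2), of s l "%i. f (real i * T / real l)"] elim B by auto
        qed
      qed
    qed
  qed (rule LB_const_integrable)
  then show ?thesis by (simp add: integral_ustep[OF assms(2)])
qed

section \<open>Processes\<close>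

locale G_time = G_setting E for E :: "('d::finite cpath => real) => real" +
  fixes T :: real
  assumes T_pos: "0 < T"
begin

text \<open>The integrand of the norm of \<open>MGbar\<close>, without the root. Its triangle
  inequality, stated uniformly for both exponents, costs a factor 2, the source of many numerical
  constants below.\<close>

definition gap :: "nat => ('d, 'v::euclidean_space) process => ('d, 'v) process => real => real" where
  "gap p eta eta' t = ds p (eta t) (eta' t) ^ p"

lemma Np_zero: "0 < p ==> Np p (%m w. 0) = 0" by (rule Np_eqI) (simp add: nr_const)

lemma ds_power_triangle:
  assumes "x \<in> LG E p" "y \<in> LG E p" "z \<in> LG E p" and p: "ok p"
  shows "ds p x z ^ p \<le> 2 * ds p x y ^ p + 2 * ds p y z ^ p"
proof -
  define a b where "a = ds p x y" and "b = ds p y z"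
  have ab: "0 \<le> a" "0 \<le> b" unfolding a_def b_def using assms by (auto intro: ds_nonneg)
  have "ds p x z ^ p \<le> (a + b) ^ p" unfolding a_def b_def by (intro power_mono ds_triangle ds_nonneg assms)
  also have "... \<le> 2 * a ^ p + 2 * b ^ p"
  proof (cases "p = 1")
    case False
    then have "p = 2" using p by (simp add: ok_def)
    then show ?thesis using sum_squares_ge_zero[of "a - b" 0] by (simp add: power2_eq_square algebra_simps)
  qed (use ab in simp)
  finally show ?thesis by (simp add: a_def b_def)
qed

lemma gap_commute: "gap p eta eta' = gap p eta' eta" by (simp add: gap_def fun_eq_iff ds_commute[of p "eta _"])

text \<open>Piecewise constant adapted processes without a fixed partition: stable under pointwise
  operations, and sampling leads back to \<open>MG0\<close>. Values in \<open>LG E p\<close> at all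
  real times, also outside \<open>{0..<T}\<close>, spare case distinctions.\<close>

definition padp :: "nat => ('d, 'v::euclidean_space) process => bool" where
  "padp p U \<longleftrightarrow> pc U \<and> (\<forall>s. U s \<in> LG E p) \<and> (\<forall>s\<in>{0..<T}. U s \<in> LG_upto E p s)"

lemma padp_LG: "padp p U ==> U s \<in> LG E p" by (simp add: padp_def)

lemma pc_gap: "padp p U ==> padp p v ==> pc (gap p U v)"
  using pc_comp2[of U v "%x y. ds p x y ^ p"] unfolding gap_def[abs_def] padp_def by simp

lemma LG_upto_lip2:
  fixes Phi :: "'v::euclidean_space => 'u::euclidean_space => 'z::euclidean_space"
  assumes x: "x \<in> LG_upto E p s" and y: "y \<in> LG_upto E p s" and p: "ok p"
    and Phi: "\<And>a b a' b'. norm (Phi a b - Phi a' b') \<le> L * (norm (a - a') + norm (b - b'))"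
  shows "(%m w. Phi (x m w) (y m w)) \<in> LG_upto E p s"
proof -
  have "plip (%z. Phi (fst z) (snd z))"
  proof (rule plip_lipschitz[of _ "2 * \<bar>L\<bar>"])
    fix a b :: "'v \<times> 'u"
    have "norm (Phi (fst a) (snd a) - Phi (fst b) (snd b)) \<le> L * (norm (fst (a - b)) + norm (snd (a - b)))"
      using Phi by simp
    also have "... \<le> \<bar>L\<bar> * (norm (a - b) + norm (a - b))"
      using norm_fst_le[of "fst (a - b)" "snd (a - b)"] norm_snd_le[of "snd (a - b)" "fst (a - b)"]
      unfolding prod.collapse by (intro mult_mono add_mono) auto
    finally show "norm (Phi (fst a) (snd a) - Phi (fst b) (snd b)) \<le> 2 * \<bar>L\<bar> * norm (a - b)" by simp
  qed
  then have "(%w. Phi (x m w) (y m w)) \<in> L_ip_upto s" for m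
    using x y L_ip_upto_plip2[of "x m" s "y m" Phi] unfolding LG_upto_iff by simp
  moreover have "(%m w. Phi (x m w) (y m w)) \<in> LG E p" by (rule LG_lip2[OF LG_upto_LG[OF x] LG_upto_LG[OF y] p Phi])
  ultimately show ?thesis unfolding LG_upto_iff by simp
qed

lemma padp_lip2:
  fixes Phi :: "'v::euclidean_space => 'u::euclidean_space => 'z::euclidean_space"
  assumes U: "padp p U" and v: "padp p v" and p: "ok p"
    and Phi: "\<And>a b a' b'. norm (Phi a b - Phi a' b') \<le> L * (norm (a - a') + norm (b - b'))"
  shows "padp p (%s m w. Phi (U s m w) (v s m w))"
  unfolding padp_def
proof (intro conjI allI ballI)
  show "pc (%s m w. Phi (U s m w) (v s m w))"
    using U v pc_comp2[of U v "%x y m w. Phi (x m w) (y m w)"] unfolding padp_def by simp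
  show "(%m w. Phi (U s m w) (v s m w)) \<in> LG E p" for s by (rule LG_lip2[OF padp_LG[OF U] padp_LG[OF v] p Phi])
  fix s assume "s \<in> {0..<T}"
  then show "(%m w. Phi (U s m w) (v s m w)) \<in> LG_upto E p s"
    using U v unfolding padp_def by (intro LG_upto_lip2[OF _ _ p Phi]) auto
qed

lemma LG_upto_scaleR: "x \<in> LG_upto E p s ==> ok p ==> (%m w. c *\<^sub>R x m w) \<in> LG_upto E p s"
  unfolding LG_upto_iff by (auto intro: LG_scaleR L_ip_upto_scaleR)

lemma LG_upto_const: "X \<in> L_ip_upto s ==> ok p ==> (%_. X) \<in> LG_upto E p s"
  unfolding LG_upto_iff by (auto intro: LG_const L_ip_upto_L_ip)

lemma LG_upto_mono: "s \<le> t ==> x \<in> LG_upto E p s ==> x \<in> LG_upto E p t"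
  unfolding LG_upto_iff using L_ip_upto_mono by blast

lemma padp_before:
  assumes "padp p U" "ok p"
  shows "padp p (%s m w. (if t \<le> s then 0 else 1) *\<^sub>R U s m w)"
  unfolding padp_def
proof (intro conjI allI ballI)
  have "pc U" using assms(1) by (simp add: padp_def)
  from pc_comp2[OF pc_le[of t] this, of "%b x m w. (if b then 0 else 1) *\<^sub>R x m w"]
  show "pc (%s m w. (if t \<le> s then 0 else 1) *\<^sub>R U s m w)" by simp
next
  show "(%m w. (if t \<le> s then 0 else 1) *\<^sub>R U s m w) \<in> LG E p" for s
    by (rule LG_scaleR[OF padp_LG[OF assms(1)] assms(2)])
  fix s assume "s \<in> {0..<T}"
  then show "(%m w. (if t \<le> s then 0 else 1) *\<^sub>R U s m w) \<in> LG_upto E p s"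
    using assms unfolding padp_def by (intro LG_upto_scaleR) auto
qed

section \<open>Step processes\<close>

lemma le_of_increments:
  fixes t :: "nat => real"
  assumes "\<And>k. k < N ==> t k < t (Suc k)" "i \<le> j" "j \<le> N"
  shows "t i \<le> t j"
  using assms(2,3)
proof (induction j)
  case (Suc j)
  then show ?case using assms(1)[of j] by (cases "i = Suc j") auto
qed simp

lemma step_rep_cell:
  assumes "step_rep E p T eta N t xi" "k < N" "s \<in> {t k..<t (Suc k)}"
  shows "eta s = xi k"
proof -
  have inc: "\<And>k. k < N ==> t k < t (Suc k)" and eq: "eta = (%s m w. \<Sum>k<N. indicator {t k..<t (Suc k)} s *\<^sub>R xi k m w)"
    using assms(1) unfolding step_rep_def by auto
  have le: "t i \<le> t j" if "i \<le> j" "j \<le> N" for i j by (rule le_of_increments[of N t]) (use inc that in auto)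
  have "s \<notin> {t j..<t (Suc j)}" if "j < N" "j \<noteq> k" for j
    using le[of "Suc j" k] le[of "Suc k" j] that assms(2,3) by (cases "j < k") auto
  then have "(\<Sum>j<N. indicator {t j..<t (Suc j)} s *\<^sub>R xi j m w) = (\<Sum>j<N. if j = k then xi k m w else 0)" for m w
    by (intro sum.cong) (use assms(3) in auto)
  then show ?thesis using assms(2) by (simp add: eq fun_eq_iff)
qed

lemma step_rep_find:
  assumes "step_rep E p T eta N t xi" "0 \<le> s" "s < T"
  shows "\<exists>k<N. s \<in> {t k..<t (Suc k)}"
proof -
  have t: "t 0 = 0" "t N = T" using assms(1) unfolding step_rep_def by auto
  define k where "k = (GREATEST k. k \<le> N \<and> t k \<le> s)"
  have k: "k \<le> N \<and> t k \<le> s" unfolding k_def by (rule GreatestI_nat[of _ 0 N]) (use assms t in auto)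
  have "\<not> t (Suc k) \<le> s" if "k < N"
  proof
    assume "t (Suc k) \<le> s"
    then have "Suc k \<le> k" unfolding k_def using that k_def by (intro Greatest_le_nat[of _ _ N]) auto
    then show False by simp
  qed
  moreover have "k \<noteq> N" using k t assms by auto
  ultimately show ?thesis using k by (intro exI[of _ k]) auto
qed

lemma step_rep_outside:
  assumes "step_rep E p T eta N t xi" "\<not> (0 \<le> s \<and> s < T)"
  shows "eta s = (%_ _. 0)"
proof -
  have t: "t 0 = 0" "t N = T" and inc: "\<And>k. k < N ==> t k < t (Suc k)"
    and eq: "eta = (%s m w. \<Sum>k<N. indicator {t k..<t (Suc k)} s *\<^sub>R xi k m w)"
    using assms(1) unfolding step_rep_def by auto
  have le: "t i \<le> t j" if "i \<le> j" "j \<le> N" for i j by (rule le_of_increments[of N t]) (use inc that in auto)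
  have "s \<notin> {t k..<t (Suc k)}" if "k < N" for k using le[of 0 k] le[of "Suc k" N] that assms(2) t by auto
  then show ?thesis unfolding eq by (intro ext sum.neutral ballI) simp
qed

lemma step_rep_padp:
  assumes r: "step_rep E p T eta N t xi" and p: "ok p"
  shows "padp p eta"
proof -
  have inc: "\<And>k. k < N ==> t k < t (Suc k)" and xi: "\<And>k. k < N ==> xi k \<in> LG_upto E p (t k)"
    using r unfolding step_rep_def by auto
  have "pc eta" unfolding pc_def
  proof (intro exI[of _ "t ` {..N}"] conjI allI impI)
    fix s s' assume same: "\<forall>f\<in>t ` {..N}. (f \<le> s) = (f \<le> s')"
    have eq: "eta = (%s m w. \<Sum>k<N. indicator {t k..<t (Suc k)} s *\<^sub>R xi k m w)"
      using r unfolding step_rep_def by auto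
    have ind: "indicator {t k..<t (Suc k)} s = (indicator {t k..<t (Suc k)} s' :: real)" if "k < N" for k
    proof -
      have "(t k \<le> s) = (t k \<le> s')" "(t (Suc k) \<le> s) = (t (Suc k) \<le> s')" using same that by auto
      then show ?thesis by (auto simp: indicator_def)
    qed
    show "eta s = eta s'" unfolding eq by (intro ext sum.cong refl) (simp only: ind lessThan_iff)
  qed simp
  moreover have "eta s \<in> LG_upto E p s" if s: "0 \<le> s" "s < T" for s
  proof -
    obtain k where k: "k < N" "s \<in> {t k..<t (Suc k)}" using step_rep_find[OF r s] by blast
    then have "eta s = xi k" by (rule step_rep_cell[OF r])
    then show ?thesis using xi[OF k(1)] LG_upto_mono[of "t k" s] k(2) by simp
  qed
  moreover have "eta s \<in> LG E p" if "\<not> (0 \<le> s \<and> s < T)" for s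
    using step_rep_outside[OF r that] LG_const[OF L_ip_const p] by simp
  ultimately show ?thesis unfolding padp_def using LG_upto_LG by (metis atLeastLessThan_iff)
qed

lemma MG0_padp: "eta \<in> MG0 E p T ==> ok p ==> padp p eta" unfolding MG0_def using step_rep_padp by blast

lemma ustep_step_rep:
  assumes "0 < l" "\<And>i. i < l ==> xi i \<in> LG_upto E p (real i * T / real l)"
  shows "step_rep E p T (%s m w. ustep T l (%i. xi i m w) s) l (%i. real i * T / real l) xi"
  unfolding step_rep_def ustep_def using assms T_pos by (auto simp: divide_strict_right_mono)

text \<open>Sampling at the left ends of the cells keeps the process adapted. At almost every time
  the sampled value eventually equals that of \<open>U\<close>, and only finitely many distances
  occur, which provides the bound for dominated convergence.\<close>

lemma gap_ustep_approx:
  assumes U: "padp p U" and p: "ok p"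
  shows "(%l. LI T (gap p (%s m w. ustep T (Suc l) (%i. U (real i * T / real (Suc l)) m w) s) U)) ----> 0"
proof -
  define H where "H l = (%s m w. ustep T l (%i. U (real i * T / real l) m w) s)" for l
  define B where "B = (\<Sum>x\<in>(%(a, b). ds p a b ^ p) ` (range U \<times> range U). \<bar>x\<bar>)"
  have fin: "finite ((%(a, b). ds p a b ^ p) ` (range U \<times> range U))"
    using pc_finite_range[of U] U by (simp add: padp_def)
  have B: "\<bar>ds p (U a) (U b) ^ p\<bar> \<le> B" for a b
  proof -
    have "ds p (U a) (U b) ^ p \<in> (%(a, b). ds p a b ^ p) ` (range U \<times> range U)"
      by (rule image_eqI[of _ _ "(U a, U b)"]) auto
    from member_le_sum[OF this _ fin, of abs] show ?thesis unfolding B_def by simp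
  qed
  have cell: "\<exists>i<l. H l s = U (real i * T / real l) \<and> s \<in> {real i * T / real l..<real (Suc i) * T / real l}"
    if s: "0 < l" "0 \<le> s" "s < T" for l s
  proof -
    obtain i where i: "i < l" "s \<in> {real i * T / real l..<real (Suc i) * T / real l}"
      using grid_cell[OF s(1) T_pos s(2,3)] by blast
    then have "H l s = U (real i * T / real l)" unfolding H_def by (simp add: fun_eq_iff ustep_eq[OF i(1) T_pos i(2)])
    with i show ?thesis by blast
  qed
  obtain F where F: "finite F" "\<And>s. s \<notin> F ==> \<exists>delta>0. \<forall>s'. \<bar>s' - s\<bar> < delta --> U s' = U s"
    using pc_locally_constant[of U] U unfolding padp_def by blast
  have ae: "AE s in LB T. s \<notin> insert T F \<and> s \<in> {0..T}"
    using LB_AE_finite[of "insert T F" T] F(1) AE_space[of "LB T"] by (auto elim: eventually_elim2)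
  have HL: "padp p (H (Suc l))" for l unfolding H_def
  proof (rule step_rep_padp[OF ustep_step_rep p])
    fix i assume i: "i < Suc l"
    have "real i * T < real (Suc l) * T" using i T_pos by simp
    then have "real i * T / real (Suc l) < T" by (simp add: pos_divide_less_eq mult.commute del: of_nat_Suc)
    then show "U (real i * T / real (Suc l)) \<in> LG_upto E p (real i * T / real (Suc l))"
      using U T_pos unfolding padp_def by simp
  qed simp
  have "(%l. LI T (gap p (H (Suc l)) U)) ----> LI T (%_. 0)"
  proof (rule integral_dominated_convergence[where w = "%_. B"])
    show "gap p (H (Suc l)) U \<in> borel_measurable (LB T)" for l by (intro borel_measurable_LB pc_borel pc_gap HL U)
    show "AE s in LB T. (%l. gap p (H (Suc l)) U s) ----> 0" using ae
    proof eventually_elim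
      case (elim s)
      obtain delta where delta: "delta > 0" "\<And>s'. \<bar>s' - s\<bar> < delta ==> U s' = U s" using F(2) elim by blast
      obtain N :: nat where N: "T / delta < real N" using reals_Archimedean2 by blast
      have "gap p (H (Suc l)) U s = 0" if l: "N \<le> l" for l
      proof -
        obtain i where i: "i < Suc l" "H (Suc l) s = U (real i * T / real (Suc l))"
            "s \<in> {real i * T / real (Suc l)..<real (Suc i) * T / real (Suc l)}" using cell[of "Suc l" s] elim by auto
        have "T / real (Suc l) < delta"
        proof -
          have "T < real N * delta" using N delta(1) by (simp add: pos_divide_less_eq)
          also have "... \<le> real (Suc l) * delta" using l delta(1) by simp
          finally show ?thesis by (simp add: pos_divide_less_eq mult.commute del: of_nat_Suc)
        qed
        moreover have "real (Suc i) * T / real (Suc l) = real i * T / real (Suc l) + T / real (Suc l)"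
          by (simp add: algebra_simps add_divide_distrib)
        ultimately have "\<bar>real i * T / real (Suc l) - s\<bar> < delta" using i(3) by auto
        from delta(2)[OF this] have "H (Suc l) s = U s" by (simp only: i(2))
        then show ?thesis using ds_self[OF ok_pos[OF p]] ok_pos[OF p] by (simp add: gap_def)
      qed
      then have "\<forall>\<^sub>F l in sequentially. gap p (H (Suc l)) U s = 0"
        unfolding eventually_sequentially by (intro exI[of _ N] allI impI)
      then show ?case by (rule tendsto_eventually)
    qed
    show "AE s in LB T. norm (gap p (H (Suc l)) U s) \<le> B" for l using ae
    proof eventually_elim
      case (elim s)
      obtain i where "H (Suc l) s = U (real i * T / real (Suc l))" using cell[of "Suc l" s] elim by auto
      then show ?case using B by (simp add: gap_def)
    qed
  qed (auto intro: LB_const_integrable)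
  then show ?thesis by (simp add: H_def)
qed

lemma padp_approx:
  assumes U: "padp p U" and p: "ok p" and "0 < eps"
  shows "\<exists>H\<in>MG0 E p T. LI T (gap p H U) < eps"
proof -
  obtain l where "norm (LI T (gap p (%s m w. ustep T (Suc l) (%i. U (real i * T / real (Suc l)) m w) s) U) - 0) < eps"
    using LIMSEQ_D[OF gap_ustep_approx[OF U p] \<open>0 < eps\<close>] by blast
  moreover have "(%s m w. ustep T (Suc l) (%i. U (real i * T / real (Suc l)) m w) s) \<in> MG0 E p T" unfolding MG0_def
  proof (intro CollectI exI, rule ustep_step_rep)
    fix i assume i: "i < Suc l"
    have "real i * T < real (Suc l) * T" using i T_pos by simp
    then have "real i * T / real (Suc l) < T" by (simp add: pos_divide_less_eq mult.commute del: of_nat_Suc)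
    then show "U (real i * T / real (Suc l)) \<in> LG_upto E p (real i * T / real (Suc l))"
      using U T_pos unfolding padp_def by simp
  qed simp
  ultimately show ?thesis by (intro bexI) (auto simp: abs_less_iff)
qed

section \<open>Integrability of gaps and membership in \<open>MGbar\<close>\<close>

lemma gap_nonneg: "eta t \<in> LG E p ==> eta' t \<in> LG E p ==> ok p ==> 0 \<le> gap p eta eta' t"
  unfolding gap_def by (intro zero_le_power ds_nonneg)

lemma gap_triangle:
  "eta t \<in> LG E p ==> eta' t \<in> LG E p ==> eta'' t \<in> LG E p ==> ok p ==>
   gap p eta eta'' t \<le> 2 * gap p eta eta' t + 2 * gap p eta' eta'' t" unfolding gap_def by (rule ds_power_triangle)

text \<open>Measurability of \<open>gap p v eta\<close> has to be extracted from the approximation: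
  along a subsequence the \<open>U j\<close> converge to \<open>eta\<close> at almost every time,
  and \<open>gap p v (U j)\<close> then converges to it. The convergence is expressed by majorants
  \<open>G j\<close> because \<open>gap p (U j) eta\<close> is not yet known to be
  integrable.\<close>

lemma gap_integrable_dom:
  assumes v: "padp p v" and eta: "\<And>t. t \<in> {0..T} ==> eta t \<in> LG E p" and U: "\<And>j. padp p (U j)" and p: "ok p"
    and G: "\<And>j. integrable (LB T) (G j)" "\<And>j. AE s in LB T. gap p (U j) eta s \<le> G j s"
      "(%j. LI T (G j)) ----> 0"
  shows "integrable (LB T) (gap p v eta)"
proof -
  have sp: "AE s in LB T. s \<in> {0..T}" using AE_space[of "LB T"] by simp
  have G0: "AE s in LB T. 0 \<le> G j s" for j
    using G(2)[of j] sp by eventually_elim (use gap_nonneg[OF padp_LG[OF U] eta p] in \<open>meson order_trans\<close>)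
  obtain r where r: "AE s in LB T. (%j. G (r j) s) ----> 0" using LB_AE_subseq[OF G(1) G0 G(3)] by blast
  have all: "AE s in LB T. \<forall>j. gap p (U j) eta s \<le> G j s" using G(2) by (simp add: AE_all_countable)
  have lim: "AE s in LB T. (%j. gap p v (U (r j)) s) ----> gap p v eta s" using r all sp
  proof eventually_elim
    case (elim s)
    have nn: "0 \<le> ds p (U j s) (eta s)" for j using elim by (intro ds_nonneg padp_LG[OF U] eta p) auto
    have "(%j. ds p (U (r j) s) (eta s) ^ p) ----> 0"
      by (rule real_tendsto_sandwich[where f = "%_. 0" and h = "%j. G (r j) s"])
         (use elim nn in \<open>auto simp: gap_def\<close>)
    then have "(%j. root p (ds p (U (r j) s) (eta s) ^ p)) ----> root p 0" by (rule tendsto_real_root)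
    then have d: "(%j. ds p (U (r j) s) (eta s)) ----> 0" by (simp add: real_root_power_cancel nn ok_pos[OF p])
    have "(%j. ds p (v s) (U (r j) s) - ds p (v s) (eta s)) ----> 0"
    proof (rule Lim_null_comparison[OF _ d], rule always_eventually, rule allI)
      fix j
      have L: "v s \<in> LG E p" "U (r j) s \<in> LG E p" "eta s \<in> LG E p"
        using elim by (auto intro: padp_LG[OF v] padp_LG[OF U] eta)
      show "norm (ds p (v s) (U (r j) s) - ds p (v s) (eta s)) \<le> ds p (U (r j) s) (eta s)"
        using ds_triangle[OF L(1,2,3) p] ds_triangle[OF L(1,3,2) p] ds_commute[of p "eta s" "U (r j) s"] by simp
    qed
    then have "(%j. ds p (v s) (U (r j) s)) ----> ds p (v s) (eta s)" by (rule LIM_zero_cancel)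
    then show ?case unfolding gap_def by (intro tendsto_power)
  qed
  have meas: "gap p v eta \<in> borel_measurable (LB T)"
    by (rule LB_measurable_limit[OF _ lim]) (intro borel_measurable_LB pc_borel pc_gap v U)
  show ?thesis
  proof (rule Bochner_Integration.integrable_bound[OF _ meas])
    show "integrable (LB T) (%s. 2 * gap p v (U 0) s + 2 * G 0 s)"
      by (intro Bochner_Integration.integrable_add integrable_mult_right G pc_integrable pc_gap v U)
    show "AE s in LB T. norm (gap p v eta s) \<le> norm (2 * gap p v (U 0) s + 2 * G 0 s)" using sp G(2)[of 0]
    proof eventually_elim
      case (elim s)
      have L: "v s \<in> LG E p" "U 0 s \<in> LG E p" "eta s \<in> LG E p" using elim by (auto intro: padp_LG[OF v] padp_LG[OF U] eta)
      show ?case using gap_triangle[of v s p "U 0" eta] gap_nonneg[of v s p eta] L p elim by auto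
    qed
  qed
qed

lemma MGbar_approx_iff:
  assumes "\<And>k. padp p (H k)" "\<And>t. t \<in> {0..T} ==> eta t \<in> LG E p" "ok p"
  shows "MGbar_approx E p T H eta \<longleftrightarrow>
    (\<forall>k. integrable (LB T) (gap p (H k) eta)) \<and> (%k. LI T (gap p (H k) eta)) ----> 0"
proof -
  have e: "Eext E (%m w. norm (H k t m w - eta t m w) ^ p) = gap p (H k) eta t" if "t \<in> {0..T}" for k t
    unfolding gap_def by (intro Eext_norm_power LG_diff padp_LG[OF assms(1)] assms that)
  have "((%t. Eext E (%m w. norm (H k t m w - eta t m w) ^ p)) has_integral r) {0..T} \<longleftrightarrow>
      integrable (LB T) (gap p (H k) eta) \<and> LI T (gap p (H k) eta) = r" for k r
  proof -
    have "((%t. Eext E (%m w. norm (H k t m w - eta t m w) ^ p)) has_integral r) {0..T} \<longleftrightarrow>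
        (gap p (H k) eta has_integral r) {0..T}" using e by (intro has_integral_cong) auto
    also have "... \<longleftrightarrow> integrable (LB T) (gap p (H k) eta) \<and> LI T (gap p (H k) eta) = r"
      by (rule LB_has_integral) (intro gap_nonneg padp_LG[OF assms(1)] assms)
    finally show ?thesis .
  qed
  then show ?thesis unfolding MGbar_approx_def
    by (simp add: fun_eq_iff[symmetric] ex_simps[symmetric]) (metis (no_types, lifting) ext)
qed

text \<open>An integrable majorant of the gap is asked for, so the criterion applies before the gap
  itself is known to be integrable. Step processes replace the piecewise constant ones by
  \<open>padp_approx\<close>, and \<open>gap_integrable_dom\<close> supplies integrability.\<close>

lemma MGbarI:
  assumes eta: "\<And>t. t \<in> {0..T} ==> eta t \<in> LG E p" and p: "ok p"
    and ex: "\<And>eps. 0 < eps ==> \<exists>U G. padp p U \<and> integrable (LB T) G \<and>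
      (AE s in LB T. gap p U eta s \<le> G s) \<and> LI T G < eps"
  shows "eta \<in> MGbar E p T"
proof -
  have "\<forall>k. \<exists>U G. padp p U \<and> integrable (LB T) G \<and> (AE s in LB T. gap p U eta s \<le> G s) \<and>
      LI T G < 1 / real (Suc k)" using ex by simp
  then obtain U where "\<forall>k. \<exists>G. padp p (U k) \<and> integrable (LB T) G \<and> (AE s in LB T. gap p (U k) eta s \<le> G s) \<and>
      LI T G < 1 / real (Suc k)" by (rule choice[THEN exE])
  then obtain G where wG: "\<forall>k. padp p (U k) \<and> integrable (LB T) (G k) \<and> (AE s in LB T. gap p (U k) eta s \<le> G k s) \<and>
      LI T (G k) < 1 / real (Suc k)" by (rule choice[THEN exE])
  then have U: "padp p (U k)" and G: "integrable (LB T) (G k)"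
    "AE s in LB T. gap p (U k) eta s \<le> G k s" "LI T (G k) < 1 / real (Suc k)" for k by auto
  have "\<forall>k. \<exists>H\<in>MG0 E p T. LI T (gap p H (U k)) < 1 / real (Suc k)" using padp_approx[OF U p] by simp
  then obtain H where "\<forall>k. H k \<in> MG0 E p T \<and> LI T (gap p (H k) (U k)) < 1 / real (Suc k)"
    unfolding Bex_def by (rule choice[THEN exE])
  then have H: "H k \<in> MG0 E p T" "LI T (gap p (H k) (U k)) < 1 / real (Suc k)" for k by auto
  have HP: "padp p (H k)" for k by (rule MG0_padp[OF H(1) p])
  define G' where "G' k s = 2 * gap p (H k) (U k) s + 2 * G k s" for k s
  have G'i: "integrable (LB T) (G' k)" for k unfolding G'_def[abs_def]
    by (intro Bochner_Integration.integrable_add integrable_mult_right G pc_integrable pc_gap HP U)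
  have sp: "AE s in LB T. s \<in> {0..T}" using AE_space[of "LB T"] by simp
  have le: "AE s in LB T. gap p (H k) eta s \<le> G' k s" for k using sp G(2)[of k]
  proof eventually_elim
    case (elim s)
    have L: "H k s \<in> LG E p" "U k s \<in> LG E p" "eta s \<in> LG E p" using elim by (auto intro: padp_LG[OF HP] padp_LG[OF U] eta)
    show ?case using gap_triangle[of "H k" s p "U k" eta] L p elim by (simp add: G'_def)
  qed
  have G'int: "LI T (G' k) \<le> 4 * (1 / real (Suc k))" for k
  proof -
    have "LI T (G' k) = 2 * LI T (gap p (H k) (U k)) + 2 * LI T (G k)" unfolding G'_def[abs_def]
      by (subst Bochner_Integration.integral_add) (auto intro!: integrable_mult_right G pc_integrable pc_gap HP U)
    then show ?thesis using G(3)[of k] H(2)[of k] by simp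
  qed
  have nn: "AE s in LB T. 0 \<le> gap p (H k) eta s" for k using sp by eventually_elim (intro gap_nonneg padp_LG[OF HP] eta p)
  have G'0: "0 \<le> LI T (G' k)" for k
  proof (rule integral_nonneg_AE)
    show "AE s in LB T. 0 \<le> G' k s" using nn[of k] le[of k] by eventually_elim simp
  qed
  have lim: "(%k. 4 * (1 / real (Suc k))) ----> 0" using tendsto_mult_left[OF LIMSEQ_Suc[OF lim_1_over_n], of 4] by simp
  have G'lim: "(%k. LI T (G' k)) ----> 0"
    by (rule real_tendsto_sandwich[OF _ _ tendsto_const lim]) (use G'0 G'int in \<open>auto intro!: always_eventually\<close>)
  have int: "integrable (LB T) (gap p (H k) eta)" for k by (rule gap_integrable_dom[OF HP eta HP p G'i le G'lim])
  have "(%k. LI T (gap p (H k) eta)) ----> 0"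
  proof (rule real_tendsto_sandwich[OF _ _ tendsto_const G'lim]; rule always_eventually; rule allI)
    fix k
    show "0 \<le> LI T (gap p (H k) eta)" by (rule integral_nonneg_AE[OF nn])
    show "LI T (gap p (H k) eta) \<le> LI T (G' k)" by (rule integral_mono_AE[OF int G'i le])
  qed
  then have "MGbar_approx E p T H eta" using int by (subst MGbar_approx_iff[OF HP eta p]) simp_all
  then show ?thesis unfolding MGbar_def using eta H(1) by auto
qed

lemma MGbar_LG: "eta \<in> MGbar E p T ==> t \<in> {0..T} ==> eta t \<in> LG E p" unfolding MGbar_def by blast

lemma MGbarE:
  assumes "eta \<in> MGbar E p T" "ok p"
  shows "\<exists>H. (\<forall>k. H k \<in> MG0 E p T) \<and> (\<forall>k. integrable (LB T) (gap p (H k) eta)) \<and>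
    (%k. LI T (gap p (H k) eta)) ----> 0"
proof -
  obtain H where H: "\<And>k. H k \<in> MG0 E p T" "MGbar_approx E p T H eta" using assms(1) unfolding MGbar_def by blast
  have "(\<forall>k. integrable (LB T) (gap p (H k) eta)) \<and> (%k. LI T (gap p (H k) eta)) ----> 0"
    using H(2) by (subst (asm) MGbar_approx_iff[OF MG0_padp[OF H(1) assms(2)] MGbar_LG[OF assms(1)] assms(2)])
  then show ?thesis using H(1) by (intro exI[of _ H]) simp
qed

lemma gap_integrable_padp:
  assumes "padp p v" "eta \<in> MGbar E p T" "ok p"
  shows "integrable (LB T) (gap p v eta)"
proof -
  obtain H where H: "\<And>k. H k \<in> MG0 E p T" "\<And>k. integrable (LB T) (gap p (H k) eta)"
    "(%k. LI T (gap p (H k) eta)) ----> 0" using MGbarE[OF assms(2,3)] by blast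
  show ?thesis
    by (rule gap_integrable_dom[OF assms(1) MGbar_LG[OF assms(2)] MG0_padp[OF H(1) assms(3)] assms(3) H(2) _ H(3)]) auto
qed

lemma MGbar_ex_padp:
  assumes "eta \<in> MGbar E p T" "ok p" "0 < eps"
  shows "\<exists>U\<in>MG0 E p T. padp p U \<and> integrable (LB T) (gap p U eta) \<and> LI T (gap p U eta) < eps"
proof -
  obtain H where H: "\<And>k. H k \<in> MG0 E p T" "\<And>k. integrable (LB T) (gap p (H k) eta)"
    "(%k. LI T (gap p (H k) eta)) ----> 0" using MGbarE[OF assms(1,2)] by blast
  obtain k where "norm (LI T (gap p (H k) eta) - 0) < eps" using LIMSEQ_D[OF H(3) assms(3)] by blast
  then have "LI T (gap p (H k) eta) < eps" by auto
  with H(1,2) MG0_padp[OF H(1) assms(2)] show ?thesis by blast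
qed

lemma ds_lip2:
  fixes Phi :: "'v::euclidean_space => 'u::euclidean_space => 'z::euclidean_space"
  assumes L: "x \<in> LG E p" "x' \<in> LG E p" "y \<in> LG E p" "y' \<in> LG E p" and p: "ok p"
    and Phi: "\<And>a b a' b'. norm (Phi a b - Phi a' b') \<le> L * (norm (a - a') + norm (b - b'))"
  shows "ds p (%m w. Phi (x m w) (y m w)) (%m w. Phi (x' m w) (y' m w)) \<le> \<bar>L\<bar> * (ds p x x' + ds p y y')"
proof -
  have n: "(%m w. norm (x m w - x' m w)) \<in> LG E p" "(%m w. norm (y m w - y' m w)) \<in> LG E p"
    by (intro LG_norm LG_diff L p)+
  have "ds p (%m w. Phi (x m w) (y m w)) (%m w. Phi (x' m w) (y' m w)) \<le>
      Np p (%m w. \<bar>L\<bar> *\<^sub>R (norm (x m w - x' m w) + norm (y m w - y' m w)))"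
  proof (rule Np_mono)
    fix m w
    have "norm (Phi (x m w) (y m w) - Phi (x' m w) (y' m w)) \<le>
        L * (norm (x m w - x' m w) + norm (y m w - y' m w))" by (rule Phi)
    also have "... \<le> \<bar>L\<bar> * (norm (x m w - x' m w) + norm (y m w - y' m w))" by (intro mult_right_mono) auto
    also have "... = norm (\<bar>L\<bar> *\<^sub>R (norm (x m w - x' m w) + norm (y m w - y' m w)))" by (simp add: abs_mult)
    finally show "norm (Phi (x m w) (y m w) - Phi (x' m w) (y' m w)) \<le>
        norm (\<bar>L\<bar> *\<^sub>R (norm (x m w - x' m w) + norm (y m w - y' m w)))" .
  qed (intro LG_diff LG_lip2[OF _ _ p Phi] LG_scaleR LG_add LG_norm L p)+
  also have "... = \<bar>L\<bar> * Np p (%m w. norm (x m w - x' m w) + norm (y m w - y' m w))"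
    using Np_scaleR[OF LG_add[OF n p] p, of "\<bar>L\<bar>"] by simp
  also have "... \<le> \<bar>L\<bar> * (ds p x x' + ds p y y')"
    using Np_triangle[OF n p] by (intro mult_left_mono) (simp_all add: Np_norm)
  finally show ?thesis .
qed

lemma MGbar_lip2:
  fixes Phi :: "'v::euclidean_space => 'u::euclidean_space => 'z::euclidean_space"
  assumes eta: "eta \<in> MGbar E p T" "eta' \<in> MGbar E p T" and p: "ok p"
    and Phi: "\<And>a b a' b'. norm (Phi a b - Phi a' b') \<le> L * (norm (a - a') + norm (b - b'))"
  shows "(%t m w. Phi (eta t m w) (eta' t m w)) \<in> MGbar E p T"
proof (rule MGbarI[OF _ p])
  show "(%m w. Phi (eta t m w) (eta' t m w)) \<in> LG E p" if "t \<in> {0..T}" for t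
    by (intro LG_lip2[OF _ _ p Phi] MGbar_LG[OF eta(1)] MGbar_LG[OF eta(2)] that)
  fix eps :: real assume e: "0 < eps"
  define c where "c = 2 * (\<bar>L\<bar> ^ p + 1)"
  have c: "0 < c" by (simp add: c_def add_nonneg_pos)
  then have d: "0 < eps / (2 * c)" using e by simp
  obtain U where U: "padp p U" "integrable (LB T) (gap p U eta)" "LI T (gap p U eta) < eps / (2 * c)"
    using MGbar_ex_padp[OF eta(1) p d] by blast
  obtain U' where U': "padp p U'" "integrable (LB T) (gap p U' eta')" "LI T (gap p U' eta') < eps / (2 * c)"
    using MGbar_ex_padp[OF eta(2) p d] by blast
  define G where "G s = c * (gap p U eta s + gap p U' eta' s)" for s
  have "LI T G = c * (LI T (gap p U eta) + LI T (gap p U' eta'))" unfolding G_def[abs_def] by (simp add: U(2) U'(2))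
  also have "... < c * (eps / (2 * c) + eps / (2 * c))" using c U(3) U'(3) by (intro mult_strict_left_mono add_strict_mono)
  also have "... = eps" using c by (simp add: field_simps)
  finally have "LI T G < eps" .
  moreover have "integrable (LB T) G" unfolding G_def[abs_def] by (simp add: U(2) U'(2))
  moreover have "padp p (%t m w. Phi (U t m w) (U' t m w))" by (rule padp_lip2[OF U(1) U'(1) p Phi])
  moreover have "AE s in LB T. gap p (%t m w. Phi (U t m w) (U' t m w)) (%t m w. Phi (eta t m w) (eta' t m w)) s \<le> G s"
  proof (rule AE_I2)
    fix s assume "s \<in> space (LB T)"
    then have s: "s \<in> {0..T}" by simp
    have LL: "U s \<in> LG E p" "eta s \<in> LG E p" "U' s \<in> LG E p" "eta' s \<in> LG E p"
      using s padp_LG U U' MGbar_LG eta by blast+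
    define a b where "a = ds p (U s) (eta s)" and "b = ds p (U' s) (eta' s)"
    have ab: "0 \<le> a" "0 \<le> b" unfolding a_def b_def by (intro ds_nonneg LL p)+
    have q: "(a + b) ^ p \<le> 2 * (a ^ p + b ^ p)"
    proof (cases "p = 1")
      case False
      then have "p = 2" using p by (simp add: ok_def)
      then show ?thesis using sum_squares_ge_zero[of "a - b" 0] by (simp add: power2_eq_square algebra_simps)
    qed (use ab in simp)
    have "gap p (%t m w. Phi (U t m w) (U' t m w)) (%t m w. Phi (eta t m w) (eta' t m w)) s \<le> (\<bar>L\<bar> * (a + b)) ^ p"
      unfolding gap_def a_def b_def by (intro power_mono ds_lip2[OF LL p Phi] ds_nonneg LG_lip2[OF _ _ p Phi] LL p)
    also have "... \<le> \<bar>L\<bar> ^ p * (2 * (a ^ p + b ^ p))"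
      unfolding power_mult_distrib by (intro mult_left_mono q) auto
    also have "... \<le> c * (a ^ p + b ^ p)" using ab by (simp add: c_def algebra_simps)
    finally show "gap p (%t m w. Phi (U t m w) (U' t m w)) (%t m w. Phi (eta t m w) (eta' t m w)) s \<le> G s"
      by (simp add: G_def gap_def a_def b_def)
  qed
  ultimately show "\<exists>U G. padp p U \<and> integrable (LB T) G \<and>
      (AE s in LB T. gap p U (%t m w. Phi (eta t m w) (eta' t m w)) s \<le> G s) \<and> LI T G < eps" by blast
qed

lemma padp_MGbar:
  assumes "padp p U" "ok p"
  shows "U \<in> MGbar E p T"
proof (rule MGbarI[OF padp_LG[OF assms(1)] assms(2)])
  fix eps :: real assume "0 < eps"
  have "gap p U U = (%_. 0)" using ok_pos[OF assms(2)] by (simp add: gap_def fun_eq_iff Np_zero)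
  then show "\<exists>v G. padp p v \<and> integrable (LB T) G \<and> (AE s in LB T. gap p v U s \<le> G s) \<and> LI T G < eps"
    using assms(1) \<open>0 < eps\<close> by (intro exI[of _ U] exI[of _ "%_. 0"]) auto
qed

lemma padp_const: "ok p ==> padp p (%_ _ _. c)"
  unfolding padp_def by (auto intro: pc_const LG_const L_ip_const LG_upto_const L_ip_upto_const)

lemma MGbar_diff: "eta \<in> MGbar E p T ==> eta' \<in> MGbar E p T ==> ok p ==> (%t m w. eta t m w - eta' t m w) \<in> MGbar E p T"
proof (rule MGbar_lip2[of eta p eta' "%a b. a - b" 1])
  fix a b a' b' :: 'a
  show "norm (a - b - (a' - b')) \<le> 1 * (norm (a - a') + norm (b - b'))"
    using norm_triangle_ineq4[of "a - a'" "b - b'"] by (simp add: algebra_simps)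
qed

text \<open>The gap of two processes is the gap between the zero process, which is piecewise
  constant, and their difference.\<close>

lemma gap_integrable:
  assumes "eta \<in> MGbar E p T" "eta' \<in> MGbar E p T" "ok p"
  shows "integrable (LB T) (gap p eta eta')"
proof -
  have "gap p eta eta' = gap p (%_ _ _. 0) (%t m w. eta t m w - eta' t m w)"
    unfolding gap_commute[of p "%_ _ _. 0"] by (simp add: gap_def fun_eq_iff)
  then show ?thesis using gap_integrable_padp[OF padp_const[OF assms(3)] MGbar_diff[OF assms], of 0] assms(3) by simp
qed

text \<open>The approximant is cut at \<open>t\<close> by a half-open interval, to stay piecewise
  constant in the sense of \<open>pc\<close>, the process by a closed one. The cuts differ at the
  single time \<open>t\<close>.\<close>

lemma MGbar_restrict:
  assumes eta: "eta \<in> MGbar E p T" and p: "ok p"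
  shows "restrict_upto t eta \<in> MGbar E p T"
proof (rule MGbarI[OF _ p])
  show R: "restrict_upto t eta s \<in> LG E p" if "s \<in> {0..T}" for s
    unfolding restrict_upto_def by (intro LG_scaleR MGbar_LG[OF eta] that p)
  fix eps :: real assume "0 < eps"
  then obtain U where U: "padp p U" "integrable (LB T) (gap p U eta)" "LI T (gap p U eta) < eps"
    using MGbar_ex_padp[OF eta p] by blast
  have "AE s in LB T. s \<notin> {t} \<and> s \<in> {0..T}"
    using LB_AE_finite[of "{t}" T] AE_space[of "LB T"] by (auto elim: eventually_elim2)
  then have "AE s in LB T. gap p (%s m w. (if t \<le> s then 0 else 1) *\<^sub>R U s m w) (restrict_upto t eta) s \<le> gap p U eta s"
  proof eventually_elim
    case (elim s)
    have "0 \<le> gap p U eta s" using elim by (intro gap_nonneg padp_LG[OF U(1)] MGbar_LG[OF eta] p) auto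
    then show ?case using elim ok_pos[OF p] by (auto simp: gap_def restrict_upto_def Np_zero zero_power)
  qed
  with U padp_before[OF U(1) p] show "\<exists>U G. padp p U \<and> integrable (LB T) G \<and>
      (AE s in LB T. gap p U (restrict_upto t eta) s \<le> G s) \<and> LI T G < eps" by blast
qed

lemma padp_2_1: "padp 2 U ==> padp 1 U" unfolding padp_def LG_upto_iff using LG_2_1 by blast

text \<open>\<open>\<surd>x \<le> theta + x / theta\<close> replaces Hoelder's inequality in time.\<close>

lemma gap_1_le_2:
  assumes "eta t \<in> LG E 2" "eta' t \<in> LG E 2" "0 < theta"
  shows "gap 1 eta eta' t \<le> theta + gap 2 eta eta' t / theta"
proof -
  define a where "a = ds 2 (eta t) (eta' t)"
  have a: "0 \<le> a" unfolding a_def by (intro ds_nonneg assms) simp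
  have "gap 1 eta eta' t \<le> a" using Np_1_le[OF LG_diff[OF assms(1,2)]] by (simp add: gap_def a_def)
  also have "a \<le> theta + a^2 / theta"
  proof (cases "a \<le> theta")
    case True
    then have "0 \<le> a^2 / theta" using assms(3) by simp
    with True show ?thesis by linarith
  next
    case False
    then have "a * theta \<le> a * a" using a by (intro mult_left_mono) auto
    then have "a \<le> a^2 / theta" using assms(3) by (simp add: field_simps power2_eq_square)
    then show ?thesis using assms(3) by linarith
  qed
  finally show ?thesis by (simp add: gap_def a_def)
qed

lemma MGbar_2_1:
  assumes eta: "eta \<in> MGbar E 2 T"
  shows "eta \<in> MGbar E 1 T"
proof (rule MGbarI)
  show "eta t \<in> LG E 1" if "t \<in> {0..T}" for t using MGbar_LG[OF eta that] by (rule LG_2_1)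
  fix eps :: real assume e: "0 < eps"
  \<comment> \<open>Makes \<open>theta * T\<close> half of \<open>eps\<close>; the accuracy of
    \<open>U\<close> is then chosen so that division by \<open>theta\<close> leaves less than the
    other half.\<close>
  define theta where "theta = eps / (2 * T)"
  have theta: "0 < theta" using e T_pos by (simp add: theta_def)
  obtain U where U: "padp 2 U" "integrable (LB T) (gap 2 U eta)" "LI T (gap 2 U eta) < theta * eps / 2"
    using MGbar_ex_padp[OF eta, of "theta * eps / 2"] theta e by auto
  define G where "G s = theta + gap 2 U eta s / theta" for s
  have Gi: "integrable (LB T) G" unfolding G_def[abs_def]
    by (intro Bochner_Integration.integrable_add integrable_divide U LB_const_integrable)
  have "LI T G = theta * T + LI T (gap 2 U eta) / theta"
    unfolding G_def[abs_def] Bochner_Integration.integral_add[OF LB_const_integrable integrable_divide[OF U(2)]]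
    using LB_integral_const[of T theta] T_pos by simp
  also have "... < theta * T + (theta * eps / 2) / theta"
    using U(3) theta by (intro add_strict_left_mono divide_strict_right_mono)
  also have "... = eps" using theta T_pos by (simp add: theta_def)
  finally have "LI T G < eps" .
  moreover have "AE s in LB T. gap 1 U eta s \<le> G s"
    by (rule AE_I2) (use gap_1_le_2[OF padp_LG[OF U(1)] MGbar_LG[OF eta] theta] in \<open>simp add: G_def\<close>)
  ultimately show "\<exists>U G. padp 1 U \<and> integrable (LB T) G \<and> (AE s in LB T. gap 1 U eta s \<le> G s) \<and> LI T G < eps"
    using padp_2_1[OF U(1)] Gi by blast
qed simp

end

section \<open>Stochastic integrals as limits of sums over uniform grids\<close>

context G_time
begin

section \<open>Uniform grids\<close>

definition rr :: "nat => nat => real" where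
  "rr l i = real i * T / real l"

lemma rr_0 [simp]: "rr l 0 = 0" by (simp add: rr_def)

lemma rr_nonneg [simp]: "0 \<le> rr l i" using T_pos by (simp add: rr_def)

lemma rr_Suc_diff: "rr l (Suc i) - rr l i = T / real l" by (simp add: rr_def algebra_simps add_divide_distrib)

lemma rr_mono: "i \<le> j ==> rr l i \<le> rr l j"
  using T_pos by (auto simp: rr_def intro!: divide_right_mono mult_right_mono)

lemma rr_less_Suc: "0 < l ==> rr l i < rr l (Suc i)" using rr_Suc_diff[of l i] T_pos by (simp add: algebra_simps)

lemma rr_end [simp]: "0 < l ==> rr l l = T" by (simp add: rr_def)

lemma rr_less_T: "i < l ==> rr l i < T" using rr_less_Suc[of l i] rr_mono[of "Suc i" l l] by simp

text \<open>The number of grid points below \<open>a\<close>, which is also the index of the first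
  grid point at or after \<open>a\<close>.\<close>

definition cl :: "nat => real => nat" where
  "cl l a = nat \<lceil>a * real l / T\<rceil>"

lemma cl_iff: "0 < l ==> i < cl l a \<longleftrightarrow> rr l i < a"
proof -
  assume l: "0 < l"
  have "i < cl l a \<longleftrightarrow> int i < \<lceil>a * real l / T\<rceil>" unfolding cl_def by linarith
  also have "... \<longleftrightarrow> real i < a * real l / T" by (simp add: less_ceiling_iff)
  also have "... \<longleftrightarrow> rr l i < a" using T_pos l by (simp add: rr_def pos_less_divide_eq pos_divide_less_eq)
  finally show ?thesis .
qed

lemma cl_le: "a \<le> T ==> cl l a \<le> l"
proof (cases "l = 0")
  case False
  assume "a \<le> T"
  then have "\<not> l < cl l a" using False by (subst cl_iff) auto
  then show ?thesis by simp
qed (simp add: cl_def)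

lemma cl_mono: "a \<le> b ==> cl l a \<le> cl l b"
  unfolding cl_def using T_pos by (intro nat_mono ceiling_mono divide_right_mono mult_right_mono) auto

lemma rr_cl_ge: "0 < l ==> a \<le> rr l (cl l a)" using cl_iff[of l "cl l a" a] by simp

lemma rr_cl_less: "0 < l ==> 0 \<le> a ==> rr l (cl l a) < a + T / real l"
proof (cases "cl l a")
  case (Suc i)
  assume "0 < l"
  then have "rr l i < a" using cl_iff[of l i a] Suc by simp
  then show ?thesis using rr_Suc_diff[of l i] Suc by simp
qed (use T_pos in \<open>simp add: add_nonneg_pos\<close>)

text \<open>The number \<open>l\<close> of cells is at the same time the index in the sequence that
  represents an element of the completion, so \<open>S D u\<close> stands for the limit of the grid
  sums.\<close>

definition S :: "(nat => nat => 'd cpath => real) => (real => 'd cpath => 'v::euclidean_space) => ('d, 'v) rv" where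
  "S D u l w = (\<Sum>i<l. D l i w *\<^sub>R u (rr l i) w)"

definition Dt :: "nat => nat => 'd cpath => real" where
  "Dt l i w = T / real l"

definition Db :: "real^'d => nat => nat => 'd cpath => real" where
  "Db a l i w = a \<bullet> (BM (rr l (Suc i)) w - BM (rr l i) w)"

definition Dq :: "real^'d => nat => nat => 'd cpath => real" where
  "Dq a l i w = (Db a l i w)^2"

definition adp :: "(real => 'd cpath => 'v::euclidean_space) => bool" where
  "adp u \<longleftrightarrow> (\<forall>s\<in>{0..<T}. u s \<in> L_ip_upto s)"

definition sadp :: "(real => 'd cpath => 'v::euclidean_space) => bool" where
  "sadp u \<longleftrightarrow> pc u \<and> (\<forall>s. u s \<in> L_ip) \<and> adp u"

abbreviation cst :: "(real => 'd cpath => 'v::euclidean_space) => ('d, 'v) process" where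
  "cst u \<equiv> (%s _. u s)"

definition el :: "real => real => ('d cpath => 'v::euclidean_space) => real => 'd cpath => 'v" where
  "el a b x s w = indicator {a..<b} s *\<^sub>R x w"

text \<open>The coefficients lie in \<open>L_ip\<close> itself, so grid sums are formed path by
  path. The intervals may overlap and leave gaps, which makes truncation at a time easy.\<close>

definition simp_proc :: "(real => 'd cpath => 'v::euclidean_space) => bool" where
  "simp_proc u \<longleftrightarrow> (\<exists>N a b x. (\<forall>k<N::nat. 0 \<le> a k \<and> a k \<le> b k \<and> b k \<le> T \<and> x k \<in> L_ip_upto (a k)) \<and>
     u = (%s w. \<Sum>k<N. el (a k) (b k) (x k) s w))"

section \<open>Measurability and moments of increments\<close>

lemma BM_L_ip_upto: "0 \<le> t ==> t \<le> s ==> (%w. BM t w) \<in> L_ip_upto s" using L_ip_upto_BM[of t s] by simp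

lemma inner_increment_L_ip_upto:
  assumes "0 \<le> s" "s \<le> t" "t \<le> r"
  shows "(%w. a \<bullet> (BM t w - BM s w)) \<in> L_ip_upto r"
  by (intro L_ip_upto_inner L_ip_upto_const L_ip_upto_diff BM_L_ip_upto) (use assms in auto)

lemma Db_L_ip_upto: "Db a l i \<in> L_ip_upto (rr l (Suc i))"
  unfolding Db_def[abs_def] by (rule inner_increment_L_ip_upto) (auto intro: rr_mono)

lemma Dq_L_ip_upto: "Dq a l i \<in> L_ip_upto (rr l (Suc i))"
  unfolding Dq_def[abs_def] by (rule L_ip_upto_power[OF Db_L_ip_upto])

lemma moment:
  assumes "0 < k"
  shows "\<exists>c\<ge>0. \<forall>X s t. X \<in> L_ip_upto s --> (\<forall>w. 0 \<le> X w) --> 0 \<le> s --> s \<le> t -->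
      E (%w. X w * (a \<bullet> (BM t w - BM s w)) ^ (2 * k)) \<le> c * (t - s) ^ k * E X"
proof -
  obtain c where c: "0 \<le> c" "\<And>X s t. X \<in> L_ip_upto s ==> (\<forall>w. 0 \<le> X w) ==> 0 \<le> s ==> s < t ==>
      E (%w. X w * (a \<bullet> (BM t w - BM s w)) ^ (2 * k)) \<le> c * (t - s) ^ k * E X" using E_moment[of a k] by blast
  have "E (%w. X w * (a \<bullet> (BM t w - BM s w)) ^ (2 * k)) \<le> c * (t - s) ^ k * E X"
    if "X \<in> L_ip_upto s" "\<forall>w. 0 \<le> X w" "0 \<le> s" "s \<le> t" for X s t
    using c(2)[OF that(1-3), of t] that(4) assms by (cases "s = t") (auto simp: zero_power E_const)
  with c(1) show ?thesis by blast
qed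

lemma nr_moment:
  assumes "0 < k"
  shows "\<exists>c\<ge>0. \<forall>(X :: 'd cpath => 'v::euclidean_space) s t. X \<in> L_ip_upto s --> 0 \<le> s --> s \<le> t -->
      (nr 2 (%w. (a \<bullet> (BM t w - BM s w)) ^ k *\<^sub>R X w))\<^sup>2 \<le> c * (t - s) ^ k * (nr 2 X)^2"
proof -
  obtain c where c: "0 \<le> c" "\<And>X s t. X \<in> L_ip_upto s ==> (\<forall>w. 0 \<le> X w) ==> 0 \<le> s ==> s \<le> t ==>
      E (%w. X w * (a \<bullet> (BM t w - BM s w)) ^ (2 * k)) \<le> c * (t - s) ^ k * E X"
    using moment[OF assms, of a] by blast
  have "(nr 2 (%w. (a \<bullet> (BM t w - BM s w)) ^ k *\<^sub>R X w))^2 \<le> c * (t - s) ^ k * (nr 2 X)^2"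
    if X: "X \<in> L_ip_upto s" and st: "0 \<le> s" "s \<le> t" for X :: "'d cpath => 'v" and s t
  proof -
    have XL: "X \<in> L_ip" by (rule L_ip_upto_L_ip[OF X])
    have dL: "(%w. (a \<bullet> (BM t w - BM s w)) ^ k) \<in> L_ip"
      by (rule L_ip_power[OF L_ip_upto_L_ip[OF inner_increment_L_ip_upto[OF st order_refl]]])
    have "(nr 2 (%w. (a \<bullet> (BM t w - BM s w)) ^ k *\<^sub>R X w))^2 =
        E (%w. (norm ((a \<bullet> (BM t w - BM s w)) ^ k *\<^sub>R X w))\<^sup>2)" by (rule nr_2[OF L_ip_scale_by[OF dL XL]])
    also have "... = E (%w. (norm (X w))\<^sup>2 * (a \<bullet> (BM t w - BM s w)) ^ (2 * k))"
    proof -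
      have "(norm (y ^ k *\<^sub>R x))^2 = (norm x)^2 * y ^ (2 * k)" for y :: real and x :: 'v
        unfolding norm_scaleR power_mult_distrib power2_abs power_mult[symmetric] by (simp add: mult.commute)
      then show ?thesis by simp
    qed
    also have "... \<le> c * (t - s) ^ k * E (%w. (norm (X w))\<^sup>2)"
      by (rule c(2)[OF L_ip_upto_power[OF L_ip_upto_norm[OF X]] _ st]) simp
    also have "E (%w. (norm (X w))\<^sup>2) = (nr 2 X)^2" by (rule nr_2[OF XL, symmetric])
    finally show ?thesis .
  qed
  with c(1) show ?thesis by blast
qed

text \<open>For \<open>p = 1\<close> this is the second moment of the increment, for
  \<open>p = 2\<close> the root of the fourth. In both cases a squared increment acts on the past
  like the elapsed time, which puts \<open>Dq\<close> on a par with \<open>Dt\<close>.\<close>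

lemma nr_square_increment:
  assumes p: "ok p"
  shows "\<exists>c\<ge>0. \<forall>(X :: 'd cpath => 'v::euclidean_space) s t. X \<in> L_ip_upto s --> 0 \<le> s --> s \<le> t -->
      nr p (%w. (a \<bullet> (BM t w - BM s w))\<^sup>2 *\<^sub>R X w) \<le> c * (t - s) * nr p X"
proof (cases "p = 1")
  case True
  obtain c where c: "0 \<le> c" "\<And>X s t. X \<in> L_ip_upto s ==> (\<forall>w. 0 \<le> X w) ==> 0 \<le> s ==> s \<le> t ==>
      E (%w. X w * (a \<bullet> (BM t w - BM s w)) ^ (2 * 1)) \<le> c * (t - s) ^ 1 * E X"
    using moment[OF zero_less_one, of a] by blast
  have "nr p (%w. (a \<bullet> (BM t w - BM s w))\<^sup>2 *\<^sub>R X w) \<le> c * (t - s) * nr p X"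
    if X: "X \<in> L_ip_upto s" and st: "0 \<le> s" "s \<le> t" for X :: "'d cpath => 'v" and s t
    using c(2)[OF L_ip_upto_norm[OF X] _ st] True by (simp add: nr_def mult.commute)
  with c(1) show ?thesis by blast
next
  case False
  then have p2: "p = 2" using p by (simp add: ok_def)
  obtain c where c: "0 \<le> c" "\<And>(X :: 'd cpath => 'v) s t. X \<in> L_ip_upto s ==> 0 \<le> s ==> s \<le> t ==>
      (nr 2 (%w. (a \<bullet> (BM t w - BM s w)) ^ 2 *\<^sub>R X w))\<^sup>2 \<le> c * (t - s) ^ 2 * (nr 2 X)^2"
    using nr_moment[of 2 a, where ?'v = 'v, OF zero_less_numeral] by blast
  have "nr p (%w. (a \<bullet> (BM t w - BM s w))\<^sup>2 *\<^sub>R X w) \<le> sqrt c * (t - s) * nr p X"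
    if X: "X \<in> L_ip_upto s" and st: "0 \<le> s" "s \<le> t" for X :: "'d cpath => 'v" and s t
  proof (rule power2_le_imp_le)
    show "(nr p (%w. (a \<bullet> (BM t w - BM s w))\<^sup>2 *\<^sub>R X w))^2 \<le> (sqrt c * (t - s) * nr p X)^2"
      using c(2)[OF X st] c(1) by (simp add: p2 power_mult_distrib)
    show "0 \<le> sqrt c * (t - s) * nr p X" using c(1) st nr_nonneg[OF L_ip_upto_L_ip[OF X]] by simp
  qed
  then show ?thesis using c(1) by (intro exI[of _ "sqrt c"]) auto
qed

lemma nr_increment:
  "\<exists>c\<ge>0. \<forall>(X :: 'd cpath => 'v::euclidean_space) s t. X \<in> L_ip_upto s --> 0 \<le> s --> s \<le> t -->
      (nr 2 (%w. (a \<bullet> (BM t w - BM s w)) *\<^sub>R X w))\<^sup>2 \<le> c * (t - s) * (nr 2 X)^2"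
  using nr_moment[of 1 a, where ?'v = 'v] by simp

text \<open>What the construction of an integral asks of \<open>D\<close>: increments are known at
  the end of their cell, the sums obey an estimate uniform in the grid, and for simple processes the
  sums converge. The type argument records the value type, over which the definition cannot
  quantify.\<close>

definition integrator :: "nat => (nat => nat => 'd cpath => real) => 'v::euclidean_space itself => real => bool" where
  "integrator p D (_ :: 'v itself) C \<longleftrightarrow> ok p \<and> 0 \<le> C \<and>
     (\<forall>l i. i < l --> D l i \<in> L_ip_upto (rr l (Suc i))) \<and>
     (\<forall>(u :: real => 'd cpath => 'v) l. adp u -->
        nr p (S D u l) ^ p \<le> C * (\<Sum>i<l. T / real l * nr p (u (rr l i)) ^ p)) \<and>
     (\<forall>u :: real => 'd cpath => 'v. simp_proc u --> S D u \<in> LG E p)"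

lemma integrator_ok: "integrator p D TYPE('v::euclidean_space) C ==> ok p" unfolding integrator_def by blast

lemma adp_grid: "adp u ==> i < l ==> u (rr l i) \<in> L_ip_upto (rr l i)" unfolding adp_def using rr_less_T[of i l] by simp

lemma S_term_L_ip_upto:
  assumes "D l i \<in> L_ip_upto (rr l (Suc i))" "adp u" "i < l"
  shows "(%w. D l i w *\<^sub>R u (rr l i) w) \<in> L_ip_upto (rr l (Suc i))"
  by (rule L_ip_upto_scale_by[OF assms(1)])
     (use adp_grid[OF assms(2,3)] L_ip_upto_mono[OF rr_mono[of i "Suc i" l]] in auto)

lemma S_L_ip:
  assumes "\<And>i. i < l ==> D l i \<in> L_ip_upto (rr l (Suc i))" "adp u"
  shows "S D u l \<in> L_ip"
  unfolding S_def[abs_def] by (rule L_ip_sum) (use L_ip_upto_L_ip[OF S_term_L_ip_upto[of D l _ u]] assms in auto)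

lemma S_diff: "S D u l w - S D v l w = S D (%s w. u s w - v s w) l w"
  unfolding S_def by (simp add: scaleR_diff_right sum_subtractf)

lemma adp_diff: "adp u ==> adp v ==> adp (%s w. u s w - v s w)" unfolding adp_def by (auto intro: L_ip_upto_diff)

lemma sum_square_le:
  fixes a :: "nat => real"
  shows "(\<Sum>i<l. a i)^2 \<le> real l * (\<Sum>i<l. (a i)\<^sup>2)"
  using Cauchy_Schwarz_ineq_sum[of "%_. 1" a "{..<l}"] by simp

text \<open>Jensen's inequality in time: \<open>(\<Sum> \<Delta> c n\<^sub>i)\<^sup>p \<le> c\<^sup>p T\<^sup>p\<^sup>-\<^sup>1 \<Sum> \<Delta> n\<^sub>i\<^sup>p\<close>.\<close>

lemma estimate_of_term_bound:
  assumes p: "ok p" and c: "0 \<le> c" and D: "\<And>l i. i < l ==> D l i \<in> L_ip_upto (rr l (Suc i))"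
    and b: "\<And>l i. i < l ==> nr p (%w. D l i w *\<^sub>R u (rr l i) w) \<le> c * (T / real l) * nr p (u (rr l i))"
    and u: "adp (u :: real => 'd cpath => 'v::euclidean_space)"
  shows "nr p (S D u l) ^ p \<le> (c + c^2 * T) * (\<Sum>i<l. T / real l * nr p (u (rr l i)) ^ p)"
proof -
  have L: "(%w. D l i w *\<^sub>R u (rr l i) w) \<in> L_ip" if "i < l" for i
    by (rule L_ip_upto_L_ip[OF S_term_L_ip_upto[of D l i u]]) (use D u that in auto)
  define n where "n i = nr p (u (rr l i))" for i
  have n0: "0 \<le> n i" if "i < l" for i unfolding n_def by (rule nr_nonneg[OF L_ip_upto_L_ip[OF adp_grid[OF u that]]])
  have "nr p (S D u l) \<le> (\<Sum>i<l. nr p (%w. D l i w *\<^sub>R u (rr l i) w))"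
    unfolding S_def[abs_def] by (rule nr_sum) (use L p in auto)
  also have "... \<le> (\<Sum>i<l. c * (T / real l) * n i)" unfolding n_def by (rule sum_mono) (use b in auto)
  finally have 1: "nr p (S D u l) \<le> (\<Sum>i<l. c * (T / real l) * n i)" .
  have sum0: "0 \<le> (\<Sum>i<l. T / real l * n i ^ p)" using T_pos n0 by (intro sum_nonneg mult_nonneg_nonneg) auto
  have S0: "0 \<le> nr p (S D u l)" by (rule nr_nonneg[OF S_L_ip]) (use D u in auto)
  \<comment> \<open>Exponent 1 produces the factor \<open>c\<close>, exponent 2 the factor
    \<open>c^2 * T\<close>; their sum serves both.\<close>
  show ?thesis
  proof (cases "p = 1")
    case True
    have "nr p (S D u l) ^ p \<le> c * (\<Sum>i<l. T / real l * n i ^ p)" using 1 True by (simp add: sum_distrib_left mult_ac)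
    also have "... \<le> (c + c^2 * T) * (\<Sum>i<l. T / real l * n i ^ p)"
      by (intro mult_right_mono sum0) (use T_pos in auto)
    finally show ?thesis by (simp add: n_def)
  next
    case False
    then have p2: "p = 2" using p by (simp add: ok_def)
    have "nr p (S D u l) ^ p \<le> (\<Sum>i<l. c * (T / real l) * n i)^2"
      unfolding p2 by (rule power_mono[OF 1[unfolded p2] S0[unfolded p2]])
    also have "... \<le> real l * (\<Sum>i<l. (c * (T / real l) * n i)\<^sup>2)" by (rule sum_square_le)
    also have "... = (c^2 * T) * (\<Sum>i<l. T / real l * n i ^ p)"
      by (cases "l = 0") (auto simp: sum_distrib_left p2 power2_eq_square field_simps)
    also have "... \<le> (c + c^2 * T) * (\<Sum>i<l. T / real l * n i ^ p)" by (intro mult_right_mono sum0) (use c in auto)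
    finally show ?thesis by (simp add: n_def)
  qed
qed

lemma Dt_estimate:
  assumes p: "ok p" and u: "adp (u :: real => 'd cpath => 'v::euclidean_space)"
  shows "nr p (S Dt u l) ^ p \<le> (1 + 1^2 * T) * (\<Sum>i<l. T / real l * nr p (u (rr l i)) ^ p)"
proof (rule estimate_of_term_bound[OF p _ _ _ u])
  show "Dt l i \<in> L_ip_upto (rr l (Suc i))" for l i unfolding Dt_def[abs_def] by (rule L_ip_upto_const)
  fix l i :: nat assume i: "i < l"
  show "nr p (%w. Dt l i w *\<^sub>R u (rr l i) w) \<le> 1 * (T / real l) * nr p (u (rr l i))"
    unfolding Dt_def using nr_scaleR[OF L_ip_upto_L_ip[OF adp_grid[OF u i]] ok_pos[OF p], of "T / real l"] T_pos by simp
qed simp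

lemma Dq_estimate:
  assumes p: "ok p"
  shows "\<exists>C\<ge>0. \<forall>(u :: real => 'd cpath => 'v::euclidean_space) l. adp u -->
     nr p (S (Dq a) u l) ^ p \<le> C * (\<Sum>i<l. T / real l * nr p (u (rr l i)) ^ p)"
proof -
  obtain c where c: "0 \<le> c" "\<And>(X :: 'd cpath => 'v) s t. X \<in> L_ip_upto s ==> 0 \<le> s ==> s \<le> t ==>
      nr p (%w. (a \<bullet> (BM t w - BM s w))\<^sup>2 *\<^sub>R X w) \<le> c * (t - s) * nr p X"
    using nr_square_increment[OF p, of a, where ?'v = 'v] by blast
  have "nr p (S (Dq a) u l) ^ p \<le> (c + c^2 * T) * (\<Sum>i<l. T / real l * nr p (u (rr l i)) ^ p)"
    if u: "adp u" for u :: "real => 'd cpath => 'v" and l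
  proof (rule estimate_of_term_bound[OF p c(1) Dq_L_ip_upto _ u])
    fix l i :: nat assume i: "i < l"
    show "nr p (%w. Dq a l i w *\<^sub>R u (rr l i) w) \<le> c * (T / real l) * nr p (u (rr l i))"
      using c(2)[OF adp_grid[OF u i] rr_nonneg rr_mono[of i "Suc i" l]] by (simp add: Dq_def Db_def rr_Suc_diff)
  qed
  moreover have "0 \<le> c + c^2 * T" using c(1) T_pos by simp
  ultimately show ?thesis by blast
qed

text \<open>Ito's inequality: the cross terms vanish because increments have zero mean given the past.\<close>

lemma Db_estimate:
  "\<exists>C\<ge>0. \<forall>(u :: real => 'd cpath => 'v::euclidean_space) l. adp u -->
     (nr 2 (S (Db a) u l))\<^sup>2 \<le> C * (\<Sum>i<l. T / real l * (nr 2 (u (rr l i)))^2)"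
proof -
  obtain c where c: "0 \<le> c" "\<And>(X :: 'd cpath => 'v) s t. X \<in> L_ip_upto s ==> 0 \<le> s ==> s \<le> t ==>
      (nr 2 (%w. (a \<bullet> (BM t w - BM s w)) *\<^sub>R X w))\<^sup>2 \<le> c * (t - s) * (nr 2 X)^2"
    using nr_increment[of a, where ?'v = 'v] by blast
  have "(nr 2 (S (Db a) u l))^2 \<le> c * (\<Sum>i<l. T / real l * (nr 2 (u (rr l i)))^2)"
    if u: "adp u" for u :: "real => 'd cpath => 'v" and l
  proof -
    define P where "P m w = (\<Sum>i<m. Db a l i w *\<^sub>R u (rr l i) w)" for m w
    have PL: "P m \<in> L_ip_upto (rr l m)" if "m \<le> l" for m unfolding P_def[abs_def]
    proof (rule L_ip_upto_sum)
      fix i assume i: "i \<in> {..<m}"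
      then have "(%w. Db a l i w *\<^sub>R u (rr l i) w) \<in> L_ip_upto (rr l (Suc i))"
        by (intro S_term_L_ip_upto[of "Db a" l i u] Db_L_ip_upto u) (use that in auto)
      moreover have "rr l (Suc i) \<le> rr l m" by (rule rr_mono) (use i in auto)
      ultimately show "(%w. Db a l i w *\<^sub>R u (rr l i) w) \<in> L_ip_upto (rr l m)" using L_ip_upto_mono by blast
    qed
    have "(nr 2 (P m))^2 \<le> c * (\<Sum>i<m. T / real l * (nr 2 (u (rr l i)))^2)" if "m \<le> l" for m using that
    proof (induction m)
      case 0
      then show ?case by (simp add: P_def[abs_def] nr_const)
    next
      case (Suc m)
      then have m: "m < l" by simp
      define Y where "Y w = Db a l m w *\<^sub>R u (rr l m) w" for w
      \<comment> \<open>The coefficient of the new increment in the mixed term. It is known at the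
        start of the cell, as \<open>E_mean\<close> requires.\<close>
      define Z where "Z w = 2 * (P m w \<bullet> u (rr l m) w)" for w
      have uL: "u (rr l m) \<in> L_ip_upto (rr l m)" by (rule adp_grid[OF u m])
      have Zu: "Z \<in> L_ip_upto (rr l m)" unfolding Z_def[abs_def]
        by (intro L_ip_upto_mult L_ip_upto_const L_ip_upto_inner PL uL) (use m in auto)
      have YL: "Y \<in> L_ip" unfolding Y_def[abs_def]
        by (rule L_ip_upto_L_ip[OF S_term_L_ip_upto[of "Db a" l m u, OF Db_L_ip_upto u m]])
      have PmL: "P m \<in> L_ip" by (rule L_ip_upto_L_ip[OF PL]) (use m in auto)
      have DL: "Db a l m \<in> L_ip" by (rule L_ip_upto_L_ip[OF Db_L_ip_upto])
      have ZD: "(%w. Z w * Db a l m w) \<in> L_ip" by (rule L_ip_mult[OF L_ip_upto_L_ip[OF Zu] DL])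
      have PS: "P (Suc m) = (%w. P m w + Y w)" by (simp add: P_def[abs_def] Y_def)
      have "(nr 2 (P (Suc m)))^2 = E (%w. (norm (P m w + Y w))\<^sup>2)" unfolding PS by (rule nr_2[OF L_ip_add[OF PmL YL]])
      also have "... = E (%w. ((norm (P m w))^2 + (norm (Y w))^2) + Z w * Db a l m w)"
      proof -
        have "(norm (P m w + Y w))^2 = ((norm (P m w))^2 + (norm (Y w))^2) + 2 * (P m w \<bullet> Y w)" for w
          by (simp only: power2_norm_eq_inner) (simp add: inner_add inner_commute)
        moreover have "2 * (P m w \<bullet> Y w) = Z w * Db a l m w" for w by (simp add: Y_def Z_def mult_ac)
        ultimately show ?thesis by simp
      qed
      also have "... \<le> E (%w. (norm (P m w))\<^sup>2 + (norm (Y w))^2) + E (%w. Z w * Db a l m w)"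
        by (intro E_add ZD L_ip_add L_ip_power L_ip_norm PmL YL)
      also have "E (%w. Z w * Db a l m w) = 0" unfolding Db_def by (rule E_mean[OF Zu rr_nonneg rr_less_Suc]) (use m in simp)
      also have "E (%w. (norm (P m w))\<^sup>2 + (norm (Y w))^2) \<le> E (%w. (norm (P m w))\<^sup>2) + E (%w. (norm (Y w))\<^sup>2)"
        by (intro E_add L_ip_power L_ip_norm PmL YL)
      also have "... = (nr 2 (P m))^2 + (nr 2 Y)^2" by (simp add: nr_2 PmL YL)
      also have "(nr 2 Y)^2 \<le> c * (T / real l) * (nr 2 (u (rr l m)))^2"
        using c(2)[OF uL rr_nonneg rr_mono[of m "Suc m" l]] unfolding Y_def[abs_def] Db_def rr_Suc_diff by simp
      also have "(nr 2 (P m))^2 \<le> c * (\<Sum>i<m. T / real l * (nr 2 (u (rr l i)))^2)" by (rule Suc.IH) (use m in simp)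
      finally show ?case by (simp add: algebra_simps)
    qed
    from this[OF order_refl] show ?thesis by (simp add: S_def[abs_def] P_def[abs_def])
  qed
  with c(1) show ?thesis by blast
qed

section \<open>Grid sums of elementary processes\<close>

lemma el_adp:
  assumes "x \<in> L_ip_upto a" "0 \<le> a"
  shows "adp (el a b x)"
  unfolding adp_def
proof
  fix s assume "s \<in> {0..<T}"
  show "el a b x s \<in> L_ip_upto s"
  proof (cases "s \<in> {a..<b}")
    case True
    then have "x \<in> L_ip_upto s" using assms(1) L_ip_upto_mono[of a s] by auto
    then show ?thesis using True by (simp add: el_def[abs_def])
  next
    case False
    then show ?thesis by (simp add: el_def[abs_def] L_ip_upto_const)
  qed
qed

lemma el_L_ip: "x \<in> L_ip ==> el a b x s \<in> L_ip" unfolding el_def[abs_def] by (rule L_ip_scaleR)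

lemma pc_el: "pc (el a b x)"
  unfolding el_def[abs_def] using pc_comp[OF pc_indicator_Ico[of a b], of "%r w. r *\<^sub>R x w"] by simp

lemma pc_sum:
  fixes g :: "nat => real => 'b => 'v::real_vector"
  assumes "\<And>k. k < N ==> pc (g k)"
  shows "pc (%s w. \<Sum>k<N. g k s w)"
  using assms
proof (induction N)
  case (Suc N)
  have "pc (%s w. \<Sum>k<N. g k s w)" "pc (g N)" using Suc by auto
  from pc_comp2[OF this, of "%f h w. f w + h w"] show ?case by simp
qed (simp add: pc_const)

lemma simp_sadp:
  assumes "simp_proc u"
  shows "sadp u"
proof -
  obtain N :: nat and a b x where h: "\<And>k. k < N ==> 0 \<le> a k \<and> a k \<le> b k \<and> b k \<le> T \<and> x k \<in> L_ip_upto (a k)"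
    and u: "u = (%s w. \<Sum>k<N. el (a k) (b k) (x k) s w)"
    using assms unfolding simp_proc_def by blast
  have "pc u" unfolding u by (rule pc_sum[OF pc_el])
  moreover have "u s \<in> L_ip" for s
    unfolding u by (rule L_ip_sum) (use h in \<open>auto intro!: el_L_ip intro: L_ip_upto_L_ip\<close>)
  moreover have "adp u" unfolding adp_def u
  proof (intro ballI L_ip_upto_sum)
    fix s k assume "s \<in> {0..<T}" "k \<in> {..<N}"
    then show "el (a k) (b k) (x k) s \<in> L_ip_upto s" using el_adp[of "x k" "a k" "b k"] h unfolding adp_def by auto
  qed
  ultimately show ?thesis by (simp add: sadp_def)
qed

lemma sadp_padp: "sadp u ==> ok p ==> padp p (cst u)" unfolding sadp_def padp_def adp_def
  using pc_comp[of u "%x (_::nat). x"] by (auto intro: LG_const LG_upto_const)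

lemma simp_padp: "simp_proc u ==> ok p ==> padp p (cst u)" by (rule sadp_padp[OF simp_sadp])

lemma simp_adp: "simp_proc u ==> adp u" using simp_sadp by (auto simp: sadp_def)

text \<open>A grid point lies in \<open>{a..<b}\<close> exactly if its index lies between
  \<open>cl l a\<close> and \<open>cl l b\<close>, so these increments remain, all with the same
  factor.\<close>

lemma S_el:
  assumes "0 \<le> a" "a \<le> b" "b \<le> T"
  shows "S D (el a b x) l w = (\<Sum>i\<in>{cl l a..<cl l b}. D l i w) *\<^sub>R x w"
proof (cases "l = 0")
  case True
  then show ?thesis by (simp add: S_def cl_def)
next
  case False
  then have l: "0 < l" by simp
  have "(rr l i \<in> {a..<b}) = (i \<in> {cl l a..<cl l b})" for i using cl_iff[OF l, of i a] cl_iff[OF l, of i b] by auto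
  then have "S D (el a b x) l w = (\<Sum>i<l. if i \<in> {cl l a..<cl l b} then D l i w *\<^sub>R x w else 0)"
    unfolding S_def el_def by (intro sum.cong refl) (simp add: indicator_def)
  also have "... = (\<Sum>i\<in>{..<l} \<inter> {cl l a..<cl l b}. D l i w *\<^sub>R x w)"
    by (simp only: sum.inter_restrict[OF finite_lessThan])
  also have "{..<l} \<inter> {cl l a..<cl l b} = {cl l a..<cl l b}" using cl_le[OF assms(3), of l] by auto
  finally show ?thesis by (simp only: scaleR_sum_left)
qed

lemma S_sum_el:
  "S D (%s w. \<Sum>k<N. el (a k) (b k) (x k) s w) = (%l w. \<Sum>k<N. S D (el (a k) (b k) (x k)) l w)"
  unfolding S_def by (intro ext) (simp only: scaleR_sum_right sum.swap[of _ "{..<N}"])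

text \<open>How grid sums become elements of the completion: once the single sums are known to
  converge to \<open>I\<close>, the sequence of sums is itself a representative of
  \<open>I\<close>.\<close>

lemma LG_of_approx:
  assumes x: "\<And>l. x l \<in> L_ip" and I: "I \<in> LG E p" and p: "ok p"
    and lim: "(%l. ds p (%_. x l) I) ----> 0"
  shows "x \<in> LG E p" "ds p x I = 0"
proof -
  have c: "(%_. x l) \<in> LG E p" for l by (rule LG_const[OF x p])
  show xL: "x \<in> LG E p"
  proof (rule LG_I[OF x p])
    fix eps :: real assume "0 < eps"
    then obtain M where M: "\<forall>l\<ge>M. norm (ds p (%_. x l) I - 0) < eps / 2"
      using LIMSEQ_D[OF lim, of "eps / 2"] by auto
    have "nr p (%w. x m w - x l w) < eps" if "M \<le> m" "M \<le> l" for m l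
    proof -
      have "ds p (%_. x m) (%_. x l) \<le> ds p (%_. x m) I + ds p I (%_. x l)" by (rule ds_triangle[OF c I c p])
      moreover have "ds p (%_. x m) I < eps / 2" "ds p (%_. x l) I < eps / 2" using M that by (auto simp: abs_less_iff)
      ultimately show ?thesis using ds_commute[of p I "%_. x l"] by (simp add: ds_const)
    qed
    then show "\<exists>M. \<forall>m\<ge>M. \<forall>l\<ge>M. nr p (%w. x m w - x l w) < eps" by blast
  qed
  have "(%l. ds p (%_. x l) I + ds p (%_. x l) x) ----> 0 + 0" by (intro tendsto_add lim ds_initial_tendsto xL p)
  moreover have "ds p x I \<le> ds p (%_. x l) I + ds p (%_. x l) x" for l
    using ds_triangle[OF xL c[of l] I p] ds_commute[of p x "%_. x l"] by simp
  ultimately have "ds p x I \<le> 0" by (intro LIMSEQ_le_const) auto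
  then show "ds p x I = 0" using ds_nonneg[OF xL I p] by simp
qed

lemma LG_of_nr_lim:
  assumes "\<And>l. x l \<in> L_ip" "X \<in> L_ip" "ok p" "(%l. nr p (%w. x l w - X w)) ----> 0"
  shows "x \<in> LG E p" "ds p x (%_. X) = 0"
  using LG_of_approx[OF assms(1) LG_const[OF assms(2,3)] assms(3)] assms(4) by (simp_all add: ds_const)

lemma inverse_l_tendsto: "(%l. c / real l) ----> 0" using tendsto_mult_left[OF lim_1_over_n, of c] by simp

text \<open>The sum is the distance between the first grid points at or after \<open>a\<close> and
  \<open>b\<close>, each of which is off by less than \<open>T / l\<close>.\<close>

lemma Dt_el:
  assumes x: "x \<in> L_ip_upto a" and ab: "0 \<le> a" "a \<le> b" "b \<le> T"
  shows "S Dt (el a b x) \<in> LG E 2" "ds 2 (S Dt (el a b x)) (%_ w. (b - a) *\<^sub>R x w) = 0"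
proof -
  have xL: "x \<in> L_ip" by (rule L_ip_upto_L_ip[OF x])
  have eq: "S Dt (el a b x) l w = (rr l (cl l b) - rr l (cl l a)) *\<^sub>R x w" for l w
    unfolding S_el[OF ab] Dt_def rr_def using cl_mono[OF ab(2), of l]
    by (simp add: of_nat_diff left_diff_distrib diff_divide_distrib)
  have L: "S Dt (el a b x) l \<in> L_ip" for l using L_ip_scaleR[OF xL] by (simp add: eq[abs_def])
  have lim: "(%l. nr 2 (%w. S Dt (el a b x) l w - (b - a) *\<^sub>R x w)) ----> 0"
  proof (rule Lim_null_comparison)
    show "(%l. (2 * T / real l) * nr 2 x) ----> 0"
      using tendsto_mult_right[OF inverse_l_tendsto[of "2 * T"], of "nr 2 x"] by simp
    show "\<forall>\<^sub>F l in sequentially. norm (nr 2 (%w. S Dt (el a b x) l w - (b - a) *\<^sub>R x w)) \<le> (2 * T / real l) * nr 2 x"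
      unfolding eventually_sequentially
    proof (intro exI[of _ 1] allI impI)
      fix l :: nat assume "1 \<le> l"
      then have l: "0 < l" by simp
      define r where "r = rr l (cl l b) - rr l (cl l a) - (b - a)"
      have "\<bar>r\<bar> \<le> 2 * T / real l"
        unfolding r_def using rr_cl_ge[OF l, of a] rr_cl_ge[OF l, of b] rr_cl_less[OF l, of a] rr_cl_less[OF l, of b] ab
        by (simp add: abs_le_iff)
      moreover have "(%w. S Dt (el a b x) l w - (b - a) *\<^sub>R x w) = (%w. r *\<^sub>R x w)"
        by (simp add: eq r_def scaleR_diff_left fun_eq_iff)
      ultimately show "norm (nr 2 (%w. S Dt (el a b x) l w - (b - a) *\<^sub>R x w)) \<le> (2 * T / real l) * nr 2 x"
        using nr_scaleR[OF xL, of 2 r] nr_nonneg[OF xL, of 2]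
          mult_right_mono[of "\<bar>r\<bar>" "2 * T / real l" "nr 2 x"] by (simp add: abs_mult)
    qed
  qed
  show "S Dt (el a b x) \<in> LG E 2" "ds 2 (S Dt (el a b x)) (%_ w. (b - a) *\<^sub>R x w) = 0"
    by (rule LG_of_nr_lim[OF L L_ip_scaleR[OF xL] ok2 lim])+
qed

text \<open>The grid point following \<open>s\<close> is less than \<open>T / l\<close> away, and
  the second moment of the increment in between is at most proportional to that; the factor
  \<open>x\<close> belongs to the past of this increment.\<close>

lemma increment_grid_tendsto:
  assumes x: "x \<in> L_ip_upto s" and s: "0 \<le> s"
  shows "(%l. nr 2 (%w. (e \<bullet> (BM (rr l (cl l s)) w - BM s w)) *\<^sub>R x w :: 'v::euclidean_space)) ----> 0"
proof -
  obtain c where c: "0 \<le> c" "\<And>(X :: 'd cpath => 'v) s t. X \<in> L_ip_upto s ==> 0 \<le> s ==> s \<le> t ==>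
      (nr 2 (%w. (e \<bullet> (BM t w - BM s w)) *\<^sub>R X w))\<^sup>2 \<le> c * (t - s) * (nr 2 X)^2"
    using nr_increment[of e, where ?'v = 'v] by blast
  define f where "f l = nr 2 (%w. (e \<bullet> (BM (rr l (cl l s)) w - BM s w)) *\<^sub>R x w)" for l
  have "(%l. (f l)\<^sup>2) ----> 0"
  proof (rule Lim_null_comparison)
    show "(%l. (c * (nr 2 x)^2 * T) / real l) ----> 0" by (rule inverse_l_tendsto)
    show "\<forall>\<^sub>F l in sequentially. norm ((f l)^2) \<le> (c * (nr 2 x)^2 * T) / real l"
      unfolding eventually_sequentially
    proof (intro exI[of _ 1] allI impI)
      fix l :: nat assume "1 \<le> l"
      then have l: "0 < l" by simp
      have "(f l)^2 \<le> c * (rr l (cl l s) - s) * (nr 2 x)^2" unfolding f_def by (rule c(2)[OF x s rr_cl_ge[OF l]])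
      also have "... \<le> c * (T / real l) * (nr 2 x)^2"
        using rr_cl_less[OF l s] c(1) by (intro mult_right_mono mult_left_mono) auto
      finally show "norm ((f l)^2) \<le> (c * (nr 2 x)^2 * T) / real l" by (simp add: mult_ac)
    qed
  qed
  then have "(%l. sqrt ((f l)^2)) ----> sqrt 0" by (rule tendsto_real_sqrt)
  then have "(%l. \<bar>f l\<bar>) ----> 0" by simp
  then have "f ----> 0" by (simp add: tendsto_rabs_zero_iff)
  then show ?thesis by (simp add: f_def[abs_def])
qed

text \<open>Telescoping leaves a single increment between the grid points following \<open>a\<close>
  and \<open>b\<close>. The two corrections tend to 0 by
  \<open>increment_grid_tendsto\<close>.\<close>

lemma Db_el:
  assumes x: "x \<in> L_ip_upto a" and ab: "0 \<le> a" "a \<le> b" "b \<le> T"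
  shows "S (Db e) (el a b x) \<in> LG E 2"
    "ds 2 (S (Db e) (el a b x)) (%_ w. (e \<bullet> (BM b w - BM a w)) *\<^sub>R x w) = 0"
proof -
  have xb: "x \<in> L_ip_upto b" using x L_ip_upto_mono[OF ab(2)] by blast
  have xL: "x \<in> L_ip" by (rule L_ip_upto_L_ip[OF x])
  have eq: "S (Db e) (el a b x) l w = (e \<bullet> (BM (rr l (cl l b)) w - BM (rr l (cl l a)) w)) *\<^sub>R x w" for l w
  proof -
    have "(\<Sum>i\<in>{cl l a..<cl l b}. Db e l i w) = e \<bullet> BM (rr l (cl l b)) w - e \<bullet> BM (rr l (cl l a)) w"
      unfolding Db_def inner_diff_right
      using sum_Suc_diff'[OF cl_mono[OF ab(2), of l], of "%i. e \<bullet> BM (rr l i) w"] by simp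
    then show ?thesis unfolding S_el[OF ab] by (simp add: inner_diff_right)
  qed
  have BL: "(%w. e \<bullet> (BM s w - BM t w)) \<in> L_ip" if "0 \<le> s" "0 \<le> t" for s t
    by (intro L_ip_inner L_ip_const L_ip_diff) (use that L_ip_BM in auto)
  have L: "S (Db e) (el a b x) l \<in> L_ip" for l
    using L_ip_scale_by[OF BL[OF rr_nonneg rr_nonneg] xL] by (simp add: eq[abs_def])
  have YL: "(%w. (e \<bullet> (BM b w - BM a w)) *\<^sub>R x w) \<in> L_ip" by (rule L_ip_scale_by[OF BL xL]) (use ab in auto)
  define f where "f s l = (%w. (e \<bullet> (BM (rr l (cl l s)) w - BM s w)) *\<^sub>R x w)" for s l
  have fL: "f s l \<in> L_ip" if "0 \<le> s" for s l unfolding f_def by (rule L_ip_scale_by[OF BL xL]) (use that in auto)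
  have lim: "(%l. nr 2 (%w. S (Db e) (el a b x) l w - (e \<bullet> (BM b w - BM a w)) *\<^sub>R x w)) ----> 0"
  proof (rule Lim_null_comparison)
    show "(%l. nr 2 (f b l) + nr 2 (f a l)) ----> 0"
      using tendsto_add[OF increment_grid_tendsto[OF xb, of e] increment_grid_tendsto[OF x, of e]] ab unfolding f_def by simp
    show "\<forall>\<^sub>F l in sequentially. norm (nr 2 (%w. S (Db e) (el a b x) l w - (e \<bullet> (BM b w - BM a w)) *\<^sub>R x w))
        \<le> nr 2 (f b l) + nr 2 (f a l)"
    proof (rule always_eventually, rule allI)
      fix l
      have "(%w. S (Db e) (el a b x) l w - (e \<bullet> (BM b w - BM a w)) *\<^sub>R x w) = (%w. f b l w - f a l w)"
        by (simp add: eq f_def inner_diff_right scaleR_diff_left fun_eq_iff)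
      moreover have "nr 2 (%w. f b l w - f a l w) \<le> nr 2 (f b l) + nr 2 (f a l)"
        using nr_triangle[OF fL[of b l] L_ip_minus[OF fL[of a l]], of 2] ab by (simp add: nr_minus)
      moreover have "0 \<le> nr 2 (%w. f b l w - f a l w)" by (rule nr_nonneg[OF L_ip_diff[OF fL fL]]) (use ab in auto)
      ultimately show "norm (nr 2 (%w. S (Db e) (el a b x) l w - (e \<bullet> (BM b w - BM a w)) *\<^sub>R x w))
        \<le> nr 2 (f b l) + nr 2 (f a l)" by simp
    qed
  qed
  show "S (Db e) (el a b x) \<in> LG E 2"
    "ds 2 (S (Db e) (el a b x)) (%_ w. (e \<bullet> (BM b w - BM a w)) *\<^sub>R x w) = 0"
    by (rule LG_of_nr_lim[OF L YL ok2 lim])+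
qed

lemma S_simp_LG:
  fixes u :: "real => 'd cpath => 'v::euclidean_space"
  assumes u: "simp_proc u" and p: "ok p"
    and el: "\<And>a b (x :: 'd cpath => 'v). x \<in> L_ip_upto a ==> 0 \<le> a ==> a \<le> b ==> b \<le> T ==> S D (el a b x) \<in> LG E p"
  shows "S D u \<in> LG E p"
proof -
  obtain N :: nat and a b x where h: "\<And>k. k < N ==> 0 \<le> a k \<and> a k \<le> b k \<and> b k \<le> T \<and> x k \<in> L_ip_upto (a k)"
    and u: "u = (%s w. \<Sum>k<N. el (a k) (b k) (x k) s w)"
    using u unfolding simp_proc_def by blast
  have "(%l w. \<Sum>k\<in>{..<N}. S D (el (a k) (b k) (x k)) l w) \<in> LG E p" by (rule LG_sum[OF _ p]) (use el h in auto)
  then show ?thesis unfolding u S_sum_el .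
qed

lemma LG_2_p: "x \<in> LG E 2 ==> ok p ==> x \<in> LG E p" using LG_2_1 by (auto simp: ok_def)

lemma integrator_Dt: "ok p ==> integrator p Dt TYPE('v::euclidean_space) (1 + 1^2 * T)" unfolding integrator_def
proof (intro conjI allI impI)
  assume p: "ok p"
  show "ok p" by fact
  show "0 \<le> 1 + 1^2 * T" using T_pos by simp
  show "Dt l i \<in> L_ip_upto (rr l (Suc i))" for l i unfolding Dt_def[abs_def] by (rule L_ip_upto_const)
  show "nr p (S Dt u l) ^ p \<le> (1 + 1^2 * T) * (\<Sum>i<l. T / real l * nr p (u (rr l i)) ^ p)"
    if "adp u" for u :: "real => 'd cpath => 'v" and l by (rule Dt_estimate[OF p that])
  show "S Dt u \<in> LG E p" if "simp_proc u" for u :: "real => 'd cpath => 'v"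
    by (rule S_simp_LG[OF that p]) (rule LG_2_p[OF Dt_el(1) p])
qed

lemma integrator_Db: "\<exists>C. integrator 2 (Db e) TYPE('v::euclidean_space) C"
proof -
  obtain C where C: "0 \<le> C" "\<And>(u :: real => 'd cpath => 'v) l. adp u ==>
     (nr 2 (S (Db e) u l))\<^sup>2 \<le> C * (\<Sum>i<l. T / real l * (nr 2 (u (rr l i)))^2)"
    using Db_estimate[of e, where ?'v = 'v] by blast
  have "integrator 2 (Db e) TYPE('v) C" unfolding integrator_def
  proof (intro conjI allI impI)
    show "S (Db e) u \<in> LG E 2" if "simp_proc u" for u :: "real => 'd cpath => 'v"
      by (rule S_simp_LG[OF that ok2]) (rule Db_el(1))
  qed (use C in \<open>auto intro: Db_L_ip_upto\<close>)
  then show ?thesis by blast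
qed

lemma Riemann_gap:
  assumes "sadp u" "sadp v" "ok p"
  shows "(%l. \<Sum>i<l. T / real l * nr p (%w. u (rr l i) w - v (rr l i) w) ^ p)
    ----> LI T (gap p (cst u) (cst v))"
proof -
  have g: "gap p (cst u) (cst v) t = nr p (%w. u t w - v t w) ^ p" for t by (simp add: gap_def ds_const)
  have "pc (gap p (cst u) (cst v))" by (rule pc_gap[OF sadp_padp[OF assms(1,3)] sadp_padp[OF assms(2,3)]])
  from Riemann_sum_pc[OF this T_pos] show ?thesis by (simp add: g rr_def)
qed

text \<open>The grid estimate for the difference of the processes, in the limit: the Riemann sums on
  the right converge to the time integral.\<close>

lemma S_ds_le:
  fixes u v :: "real => 'd cpath => 'v::euclidean_space"
  assumes i: "integrator p D TYPE('v) C" and u: "simp_proc u" and v: "simp_proc v"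
  shows "ds p (S D u) (S D v) ^ p \<le> C * LI T (gap p (cst u) (cst v))"
proof -
  have p: "ok p" using integrator_ok[OF i] .
  have L: "S D u \<in> LG E p" "S D v \<in> LG E p" using i u v unfolding integrator_def by auto
  show ?thesis
  proof (rule LIMSEQ_le)
    show "(%l. nr p (%w. S D u l w - S D v l w) ^ p) ----> ds p (S D u) (S D v) ^ p"
      by (intro tendsto_power Np_tendsto LG_diff L p)
    show "(%l. C * (\<Sum>i<l. T / real l * nr p (%w. u (rr l i) w - v (rr l i) w) ^ p))
        ----> C * LI T (gap p (cst u) (cst v))" by (intro tendsto_mult_left Riemann_gap simp_sadp u v p)
    have "adp (%s w. u s w - v s w)" by (intro adp_diff simp_adp u v)
    then have "nr p (S D (%s w. u s w - v s w) l) ^ p \<le>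
        C * (\<Sum>i<l. T / real l * nr p (%w. u (rr l i) w - v (rr l i) w) ^ p)" for l
      using i unfolding integrator_def by blast
    then show "\<exists>N. \<forall>l\<ge>N. nr p (%w. S D u l w - S D v l w) ^ p \<le>
        C * (\<Sum>i<l. T / real l * nr p (%w. u (rr l i) w - v (rr l i) w) ^ p)" by (simp add: S_diff)
  qed
qed

section \<open>Integrals of general processes\<close>

definition simp_approx :: "nat => (nat => real => 'd cpath => 'v::euclidean_space) => ('d, 'v) process => bool" where
  "simp_approx p u eta \<longleftrightarrow> (\<forall>k. simp_proc (u k)) \<and> (%k. LI T (gap p (cst (u k)) eta)) ----> 0"

text \<open>The common form of all integrals. It is a relation since an element of the completion
  has many representatives.\<close>

definition SI :: "nat => (nat => nat => 'd cpath => real) => ('d, 'v::euclidean_space) process => ('d, 'v) rv => bool" where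
  "SI p D eta I \<longleftrightarrow> I \<in> LG E p \<and> (\<exists>u. simp_approx p u eta \<and> (%k. ds p (S D (u k)) I) ----> 0)"

lemma simp_step:
  assumes r: "step_rep E p T H N t xi"
  shows "simp_proc (%s. H s m)"
proof -
  have t: "t 0 = 0" "t N = T" and inc: "\<And>k. k < N ==> t k < t (Suc k)" and xi: "\<And>k. k < N ==> xi k \<in> LG_upto E p (t k)"
    and eq: "H = (%s m w. \<Sum>k<N. indicator {t k..<t (Suc k)} s *\<^sub>R xi k m w)"
    using r unfolding step_rep_def by auto
  have le: "t i \<le> t j" if "i \<le> j" "j \<le> N" for i j by (rule le_of_increments[of N t]) (use inc that in auto)
  have "0 \<le> t k \<and> t k \<le> t (Suc k) \<and> t (Suc k) \<le> T \<and> xi k m \<in> L_ip_upto (t k)" if "k < N" for k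
    using le[of 0 k] le[of k "Suc k"] le[of "Suc k" N] that t xi[OF that] by (auto simp: LG_upto_iff)
  then show ?thesis unfolding simp_proc_def
    by (intro exI[of _ N] exI[of _ t] exI[of _ "%k. t (Suc k)"] exI[of _ "%k. xi k m"])
       (simp add: eq el_def fun_eq_iff)
qed

text \<open>A piecewise constant process takes finitely many values, so one index serves all
  times.\<close>

lemma gap_initial_small:
  assumes H: "padp p H" and p: "ok p" and e: "0 < eps"
  shows "\<exists>M. \<forall>m\<ge>M. \<forall>s. gap p (%s _. H s m) H s < eps"
proof -
  have fin: "finite (range H)" using H pc_finite_range by (auto simp: padp_def)
  have r0: "0 < root p eps" using e ok_pos[OF p] by simp
  have "\<forall>x\<in>range H. \<exists>M. \<forall>m\<ge>M. ds p (%_. x m) x < root p eps"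
    using LG_approx[OF padp_LG[OF H] p r0] by auto
  then obtain M where M: "\<forall>x\<in>range H. \<forall>m\<ge>M x. ds p (%_. x m) x < root p eps" by (rule bchoice[THEN exE])
  define K where "K = Max (M ` range H)"
  have "gap p (%s _. H s m) H s < eps" if "K \<le> m" for m s
  proof -
    have "M (H s) \<le> K" unfolding K_def by (rule Max_ge) (use fin in auto)
    then have 1: "ds p (%_. H s m) (H s) < root p eps" using M that by auto
    have "0 \<le> ds p (%_. H s m) (H s)" by (rule ds_nonneg[OF LG_const[OF LG_L_ip[OF padp_LG[OF H]] p] padp_LG[OF H] p])
    then have "ds p (%_. H s m) (H s) ^ p < root p eps ^ p" by (rule power_strict_mono[OF 1 _ ok_pos[OF p]])
    also have "... = eps" using e ok_pos[OF p] by simp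
    finally show ?thesis by (simp add: gap_def)
  qed
  then show ?thesis by blast
qed

lemma padp_initial:
  assumes "padp p H" "ok p"
  shows "padp p (%s _. H s m)"
proof -
  have "pc H" using assms by (simp add: padp_def)
  from pc_comp[OF this, of "%x (_::nat). x m"] show ?thesis
    using assms unfolding padp_def by (auto intro: LG_const LG_L_ip LG_upto_const simp: LG_upto_iff)
qed

lemma gap_initial_integral:
  assumes H: "padp p H" and p: "ok p" and e: "0 < eps"
  shows "\<exists>M. \<forall>m\<ge>M. LI T (gap p (%s _. H s m) H) < eps"
proof -
  define d where "d = eps / (2 * T)"
  have d: "0 < d" using e T_pos by (simp add: d_def)
  obtain M where M: "\<forall>m\<ge>M. \<forall>s. gap p (%s _. H s m) H s < d" using gap_initial_small[OF H p d] by blast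
  have "LI T (gap p (%s _. H s m) H) < eps" if "M \<le> m" for m
  proof -
    have "LI T (gap p (%s _. H s m) H) \<le> LI T (%_. d)"
      by (rule integral_mono_AE[OF pc_integrable[OF pc_gap[OF padp_initial[OF H p] H]] LB_const_integrable])
         (use M that less_imp_le in \<open>auto intro!: AE_I2\<close>)
    also have "... = T * d" using T_pos by (intro LB_integral_const) simp
    also have "... < eps" using e T_pos by (simp add: d_def)
    finally show ?thesis .
  qed
  then show ?thesis by blast
qed

lemma gap_integral_triangle:
  assumes "padp p u" "padp p v" "eta \<in> MGbar E p T" "ok p"
  shows "LI T (gap p u eta) \<le> 2 * LI T (gap p u v) + 2 * LI T (gap p v eta)"
proof -
  have i: "integrable (LB T) (gap p u v)" "integrable (LB T) (gap p v eta)" "integrable (LB T) (gap p u eta)"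
    by (rule pc_integrable[OF pc_gap[OF assms(1,2)]], rule gap_integrable_padp[OF assms(2-4)],
        rule gap_integrable_padp[OF assms(1,3,4)])
  have "LI T (gap p u eta) \<le> LI T (%s. 2 * gap p u v s + 2 * gap p v eta s)"
  proof (rule integral_mono_AE[OF i(3)])
    show "integrable (LB T) (%s. 2 * gap p u v s + 2 * gap p v eta s)" using i by simp
    show "AE s in LB T. gap p u eta s \<le> 2 * gap p u v s + 2 * gap p v eta s"
    proof (rule AE_I2)
      fix s assume "s \<in> space (LB T)"
      then show "gap p u eta s \<le> 2 * gap p u v s + 2 * gap p v eta s"
        using gap_triangle[of u s p v eta] padp_LG[OF assms(1)] padp_LG[OF assms(2)] MGbar_LG[OF assms(3)] assms(4) by simp
    qed
  qed
  also have "... = 2 * LI T (gap p u v) + 2 * LI T (gap p v eta)" using i by simp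
  finally show ?thesis .
qed

lemma gap_integral_nonneg:
  assumes "\<And>t. t \<in> {0..T} ==> eta t \<in> LG E p" "\<And>t. t \<in> {0..T} ==> eta' t \<in> LG E p" "ok p"
  shows "0 \<le> LI T (gap p eta eta')"
  by (rule integral_nonneg_AE) (use gap_nonneg[of eta _ p eta'] assms in \<open>auto intro!: AE_I2\<close>)

text \<open>The coefficients of a step process lie in the completion. All are replaced by the term
  of their Cauchy sequences at one common index; the result is a simple process and, with constant
  sequences as coefficients, still a step process in the sense of the definitions.\<close>

lemma step_approx_exists:
  assumes eta: "eta \<in> MGbar E p T" and p: "ok p"
  shows "\<exists>u. simp_approx p u eta \<and> (\<forall>k. \<exists>N t x. step_rep E p T (cst (u k)) N t (%k _. x k))"
proof -
  have "\<exists>u. (\<exists>N t x. step_rep E p T (cst u) N t (%k _. x k)) \<and> simp_proc u \<and>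
      LI T (gap p (cst u) eta) < 1 / real (Suc k)" for k
  proof -
    \<comment> \<open>Each of the two errors is doubled by the triangle inequality for
      \<open>gap\<close>, hence a quarter.\<close>
    define eps where "eps = 1 / real (Suc k) / 4"
    have e: "0 < eps" by (simp add: eps_def)
    obtain H where H: "H \<in> MG0 E p T" "padp p H" "LI T (gap p H eta) < eps" using MGbar_ex_padp[OF eta p e] by blast
    obtain N t xi where r: "step_rep E p T H N t xi" using H(1) unfolding MG0_def by blast
    obtain M where M: "\<forall>m\<ge>M. LI T (gap p (%s _. H s m) H) < eps" using gap_initial_integral[OF H(2) p e] by blast
    have "LI T (gap p (%s _. H s M) eta) \<le>
        2 * LI T (gap p (%s _. H s M) H) + 2 * LI T (gap p H eta)"
      by (rule gap_integral_triangle[OF padp_initial[OF H(2) p] H(2) eta p])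
    also have "... < 2 * eps + 2 * eps" using M H(3) by (intro add_strict_mono) auto
    also have "2 * eps + 2 * eps = 1 / real (Suc k)" by (simp add: eps_def del: of_nat_Suc)
    finally have "LI T (gap p (%s _. H s M) eta) < 1 / real (Suc k)" .
    moreover have "step_rep E p T (%s _. H s M) N t (%k _. xi k M)"
    proof -
      have "(%_. xi k M) \<in> LG_upto E p (t k)" if "k < N" for k
        by (rule LG_upto_const[OF _ p]) (use r that in \<open>auto simp: step_rep_def LG_upto_iff\<close>)
      then show ?thesis using r unfolding step_rep_def by simp
    qed
    ultimately show ?thesis using simp_step[OF r, of M]
      by (intro exI[of _ "%s. H s M"] conjI exI[of _ N] exI[of _ t] exI[of _ "%k. xi k M"])
  qed
  then have "\<forall>k. \<exists>u. (\<exists>N t x. step_rep E p T (cst u) N t (%k _. x k)) \<and> simp_proc u \<and>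
      LI T (gap p (cst u) eta) < 1 / real (Suc k)" by blast
  then obtain u where u: "\<forall>k. (\<exists>N t x. step_rep E p T (cst (u k)) N t (%k _. x k)) \<and> simp_proc (u k) \<and>
      LI T (gap p (cst (u k)) eta) < 1 / real (Suc k)" by (rule choice[THEN exE])
  have "(%k. LI T (gap p (cst (u k)) eta)) ----> 0"
  proof (rule Lim_null_comparison[OF _ LIMSEQ_Suc[OF lim_1_over_n]], rule always_eventually, rule allI)
    fix k
    have "0 \<le> LI T (gap p (cst (u k)) eta)"
      by (rule gap_integral_nonneg[OF padp_LG[OF simp_padp] MGbar_LG[OF eta] p]) (use u p in auto)
    then show "norm (LI T (gap p (cst (u k)) eta)) \<le> 1 / real (Suc k)" using u by (simp add: less_imp_le del: of_nat_Suc)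
  qed
  then show ?thesis using u unfolding simp_approx_def by (intro exI[of _ u]) auto
qed

lemma simp_approx_ds_tendsto:
  fixes eta :: "('d, 'v::euclidean_space) process"
  assumes i: "integrator p D TYPE('v) C" and eta: "eta \<in> MGbar E p T"
    and u: "simp_approx p u eta" and v: "simp_approx p v eta" and e: "0 < eps"
  shows "\<exists>M. \<forall>k\<ge>M. \<forall>l\<ge>M. ds p (S D (u k)) (S D (v l)) < eps"
proof -
  have p: "ok p" using integrator_ok[OF i] .
  have C: "0 \<le> C" using i unfolding integrator_def by auto
  have us: "simp_proc (u k)" "simp_proc (v k)" for k using u v unfolding simp_approx_def by auto
  define g h where "g k = LI T (gap p (cst (u k)) eta)" and "h k = LI T (gap p (cst (v k)) eta)" for k
  have lim: "g ----> 0" "h ----> 0" using u v unfolding simp_approx_def g_def h_def by auto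
  \<comment> \<open>Four such errors times \<open>C\<close> have to stay below
    \<open>eps ^ p\<close>; \<open>C + 1\<close> allows for \<open>C = 0\<close>.\<close>
  define delta where "delta = eps ^ p / (4 * (C + 1))"
  have d: "0 < delta" using e C by (simp add: delta_def)
  obtain M where M: "\<forall>k\<ge>M. norm (g k - 0) < delta" using LIMSEQ_D[OF lim(1) d] by blast
  obtain M' where M': "\<forall>k\<ge>M'. norm (h k - 0) < delta" using LIMSEQ_D[OF lim(2) d] by blast
  have "ds p (S D (u k)) (S D (v l)) < eps" if "max M M' \<le> k" "max M M' \<le> l" for k l
  proof -
    have "LI T (gap p (cst (u k)) (cst (v l))) \<le> 2 * g k + 2 * LI T (gap p eta (cst (v l)))"
    proof -
      have iu: "integrable (LB T) (gap p (cst (u k)) eta)" "integrable (LB T) (gap p eta (cst (v l)))"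
        using gap_integrable_padp[OF simp_padp[OF us(1) p] eta p] gap_integrable_padp[OF simp_padp[OF us(2) p] eta p]
        by (auto simp: gap_commute[of p eta])
      have "LI T (gap p (cst (u k)) (cst (v l))) \<le>
          LI T (%s. 2 * gap p (cst (u k)) eta s + 2 * gap p eta (cst (v l)) s)"
      proof (rule integral_mono_AE[OF pc_integrable[OF pc_gap[OF simp_padp[OF us(1) p] simp_padp[OF us(2) p]]]])
        show "integrable (LB T) (%s. 2 * gap p (cst (u k)) eta s + 2 * gap p eta (cst (v l)) s)" using iu by simp
        show "AE s in LB T. gap p (cst (u k)) (cst (v l)) s \<le> 2 * gap p (cst (u k)) eta s + 2 * gap p eta (cst (v l)) s"
        proof (rule AE_I2)
          fix s assume "s \<in> space (LB T)"
          then show "gap p (cst (u k)) (cst (v l)) s \<le> 2 * gap p (cst (u k)) eta s + 2 * gap p eta (cst (v l)) s"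
            using gap_triangle[of "cst (u k)" s p eta "cst (v l)"] padp_LG[OF simp_padp[OF us(1) p]]
              padp_LG[OF simp_padp[OF us(2) p]] MGbar_LG[OF eta] p by simp
        qed
      qed
      then show ?thesis using iu by (simp add: g_def)
    qed
    also have "... = 2 * g k + 2 * h l" by (simp add: h_def gap_commute[of p eta])
    also have "... < 2 * delta + 2 * delta" using M M' that by (intro add_strict_mono) (auto simp: abs_less_iff)
    finally have lt: "LI T (gap p (cst (u k)) (cst (v l))) < 4 * delta" by simp
    have "ds p (S D (u k)) (S D (v l)) ^ p \<le> C * LI T (gap p (cst (u k)) (cst (v l)))" by (rule S_ds_le[OF i us])
    also have "... \<le> C * (4 * delta)" using lt C by (intro mult_left_mono) auto
    also have "... < (C + 1) * (4 * delta)" using d by simp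
    also have "... = eps ^ p" using C by (simp add: delta_def field_simps)
    finally show ?thesis using e by (simp add: power_less_imp_less_base)
  qed
  then show ?thesis by blast
qed

lemma integrator_LG:
  fixes u :: "nat => real => 'd cpath => 'v::euclidean_space"
  shows "integrator p D TYPE('v) C ==> simp_approx p u eta ==> S D (u k) \<in> LG E p"
  unfolding integrator_def simp_approx_def by auto

lemma SI_exists:
  fixes eta :: "('d, 'v::euclidean_space) process"
  assumes i: "integrator p D TYPE('v) C" and eta: "eta \<in> MGbar E p T"
  shows "\<exists>I. SI p D eta I"
proof -
  have p: "ok p" using integrator_ok[OF i] .
  obtain u where u: "simp_approx p u eta" using step_approx_exists[OF eta p] by blast
  have "\<exists>z\<in>LG E p. (%k. ds p (S D (u k)) z) ----> 0"
    by (rule LG_complete[OF integrator_LG[OF i u] p simp_approx_ds_tendsto[OF i eta u u]])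
  then show ?thesis unfolding SI_def using u by blast
qed

lemma SI_LG: "SI p D eta I ==> I \<in> LG E p" unfolding SI_def by blast

text \<open>The integrals of two approximating sequences come together, so the sequence hidden in
  \<open>SI\<close> can be exchanged for any other.\<close>

lemma SI_seq:
  fixes eta :: "('d, 'v::euclidean_space) process"
  assumes i: "integrator p D TYPE('v) C" and eta: "eta \<in> MGbar E p T" and I: "SI p D eta I" and v: "simp_approx p v eta"
  shows "(%k. ds p (S D (v k)) I) ----> 0"
proof -
  have p: "ok p" using integrator_ok[OF i] .
  have IL: "I \<in> LG E p" by (rule SI_LG[OF I])
  obtain u where u: "simp_approx p u eta" "(%k. ds p (S D (u k)) I) ----> 0" using I unfolding SI_def by blast
  show ?thesis
  proof (rule LIMSEQ_I)
    fix eps :: real assume e: "0 < eps"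
    then obtain M where M: "\<forall>k\<ge>M. \<forall>l\<ge>M. ds p (S D (v k)) (S D (u l)) < eps / 2"
      using simp_approx_ds_tendsto[OF i eta v u(1), of "eps / 2"] by auto
    obtain M' where M': "\<forall>k\<ge>M'. norm (ds p (S D (u k)) I - 0) < eps / 2" using LIMSEQ_D[OF u(2), of "eps / 2"] e by auto
    have "norm (ds p (S D (v k)) I - 0) < eps" if "M \<le> k" for k
    proof -
      define l where "l = max M M'"
      have "ds p (S D (v k)) I \<le> ds p (S D (v k)) (S D (u l)) + ds p (S D (u l)) I"
        by (rule ds_triangle[OF integrator_LG[OF i v] integrator_LG[OF i u(1)] IL p])
      moreover have "ds p (S D (v k)) (S D (u l)) < eps / 2" using M that by (simp add: l_def)
      moreover have "ds p (S D (u l)) I < eps / 2" using M'[rule_format, of l] by (simp add: l_def abs_less_iff)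
      moreover have "0 \<le> ds p (S D (v k)) I" by (rule ds_nonneg[OF integrator_LG[OF i v] IL p])
      ultimately show ?thesis by simp
    qed
    then show "\<exists>M. \<forall>k\<ge>M. norm (ds p (S D (v k)) I - 0) < eps" by blast
  qed
qed

lemma ds_tendsto:
  assumes x: "\<And>k. x k \<in> LG E p" "X \<in> LG E p" "(%k. ds p (x k) X) ----> 0"
    and y: "\<And>k. y k \<in> LG E p" "Y \<in> LG E p" "(%k. ds p (y k) Y) ----> 0" and p: "ok p"
  shows "(%k. ds p (x k) (y k)) ----> ds p X Y"
proof (rule LIM_zero_cancel, rule Lim_null_comparison)
  show "(%k. ds p (x k) X + ds p (y k) Y) ----> 0" using tendsto_add[OF x(3) y(3)] by simp
  show "\<forall>\<^sub>F k in sequentially. norm (ds p (x k) (y k) - ds p X Y) \<le> ds p (x k) X + ds p (y k) Y"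
  proof (rule always_eventually, rule allI)
    fix k
    have "ds p (x k) (y k) \<le> ds p (x k) X + ds p X (y k)" by (rule ds_triangle[OF x(1,2) y(1) p])
    moreover have "ds p X (y k) \<le> ds p X Y + ds p Y (y k)" by (rule ds_triangle[OF x(2) y(2,1) p])
    moreover have "ds p X Y \<le> ds p X (x k) + ds p (x k) Y" by (rule ds_triangle[OF x(2,1) y(2) p])
    moreover have "ds p (x k) Y \<le> ds p (x k) (y k) + ds p (y k) Y" by (rule ds_triangle[OF x(1) y(1,2) p])
    ultimately show "norm (ds p (x k) (y k) - ds p X Y) \<le> ds p (x k) X + ds p (y k) Y"
      using ds_commute[of p X "x k"] ds_commute[of p Y "y k"] by (simp add: abs_le_iff)
  qed
qed

text \<open>Passage to the limit in \<open>S_ds_le\<close>. The way from \<open>u k\<close> through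
  \<open>eta\<close> and \<open>eta'\<close> to \<open>v k\<close> uses the triangle inequality for
  \<open>gap\<close> twice, whence the weights 2, 4, 4 and the factor 4.\<close>

lemma SI_est:
  fixes eta eta' :: "('d, 'v::euclidean_space) process"
  assumes i: "integrator p D TYPE('v) C" and eta: "eta \<in> MGbar E p T" "eta' \<in> MGbar E p T"
    and I: "SI p D eta I" "SI p D eta' I'"
  shows "ds p I I' ^ p \<le> 4 * C * LI T (gap p eta eta')"
proof -
  have p: "ok p" using integrator_ok[OF i] .
  have C: "0 \<le> C" using i unfolding integrator_def by auto
  obtain u where u: "simp_approx p u eta" "(%k. ds p (S D (u k)) I) ----> 0" using I(1) unfolding SI_def by blast
  obtain v where v: "simp_approx p v eta'" "(%k. ds p (S D (v k)) I') ----> 0" using I(2) unfolding SI_def by blast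
  have us: "padp p (cst (u k))" "padp p (cst (v k))" "simp_proc (u k)" "simp_proc (v k)" for k
    using u v p unfolding simp_approx_def by (auto intro: simp_padp)
  define g h where "g k = LI T (gap p (cst (u k)) eta)" and "h k = LI T (gap p (cst (v k)) eta')" for k
  define m where "m = LI T (gap p eta eta')"
  have lim: "g ----> 0" "h ----> 0" using u v unfolding simp_approx_def g_def h_def by auto
  have bound: "ds p (S D (u k)) (S D (v k)) ^ p \<le> C * (2 * g k + 4 * h k + 4 * m)" for k
  proof -
    have int: "integrable (LB T) (gap p (cst (u k)) eta)" "integrable (LB T) (gap p (cst (v k)) eta')"
      "integrable (LB T) (gap p eta eta')"
      by (rule gap_integrable_padp[OF us(1) eta(1) p], rule gap_integrable_padp[OF us(2) eta(2) p],
          rule gap_integrable[OF eta p])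
    have "LI T (gap p (cst (u k)) (cst (v k))) \<le>
        LI T (%s. 2 * gap p (cst (u k)) eta s + 4 * gap p (cst (v k)) eta' s + 4 * gap p eta eta' s)"
    proof (rule integral_mono_AE[OF pc_integrable[OF pc_gap[OF us(1,2)]]])
      show "integrable (LB T) (%s. 2 * gap p (cst (u k)) eta s + 4 * gap p (cst (v k)) eta' s + 4 * gap p eta eta' s)"
        using int by simp
      show "AE s in LB T. gap p (cst (u k)) (cst (v k)) s \<le>
          2 * gap p (cst (u k)) eta s + 4 * gap p (cst (v k)) eta' s + 4 * gap p eta eta' s"
      proof (rule AE_I2)
        fix s assume "s \<in> space (LB T)"
        then have s: "eta s \<in> LG E p" "eta' s \<in> LG E p" using MGbar_LG eta by auto
        show "gap p (cst (u k)) (cst (v k)) s \<le>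
            2 * gap p (cst (u k)) eta s + 4 * gap p (cst (v k)) eta' s + 4 * gap p eta eta' s"
          using gap_triangle[of "cst (u k)" s p eta "cst (v k)"] gap_triangle[of eta s p eta' "cst (v k)"]
            padp_LG[OF us(1)] padp_LG[OF us(2)] s p gap_commute[of p eta' "cst (v k)"] by simp
      qed
    qed
    also have "... = 2 * g k + 4 * h k + 4 * m" using int by (simp add: g_def h_def m_def)
    finally have "C * LI T (gap p (cst (u k)) (cst (v k))) \<le> C * (2 * g k + 4 * h k + 4 * m)"
      by (rule mult_left_mono[OF _ C])
    then show ?thesis using S_ds_le[OF i us(3,4), of k k] by linarith
  qed
  have "ds p I I' ^ p \<le> C * (2 * 0 + 4 * 0 + 4 * m)"
  proof (rule LIMSEQ_le)
    show "(%k. ds p (S D (u k)) (S D (v k)) ^ p) ----> ds p I I' ^ p"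
      by (intro tendsto_power ds_tendsto[OF integrator_LG[OF i u(1)] SI_LG[OF I(1)] u(2)
            integrator_LG[OF i v(1)] SI_LG[OF I(2)] v(2) p])
    show "(%k. C * (2 * g k + 4 * h k + 4 * m)) ----> C * (2 * 0 + 4 * 0 + 4 * m)"
      by (intro tendsto_mult_left tendsto_add lim tendsto_const)
  qed (use bound in auto)
  then show ?thesis by (simp add: m_def mult_ac)
qed

lemma SI_unique:
  fixes eta :: "('d, 'v::euclidean_space) process"
  assumes i: "integrator p D TYPE('v) C" and eta: "eta \<in> MGbar E p T" and I: "SI p D eta I" "SI p D eta I'"
  shows "ds p I I' = 0"
proof -
  have p: "ok p" using integrator_ok[OF i] .
  have "gap p eta eta = (%_. 0)" using ok_pos[OF p] by (simp add: gap_def fun_eq_iff Np_zero zero_power)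
  then have "ds p I I' ^ p \<le> 0" using SI_est[OF i eta eta I] by simp
  moreover have "0 \<le> ds p I I'" by (rule ds_nonneg[OF SI_LG[OF I(1)] SI_LG[OF I(2)] p])
  ultimately show ?thesis using zero_less_power[of "ds p I I'" p] by linarith
qed

lemma simp_approx_2_1:
  assumes eta: "eta \<in> MGbar E 2 T" and u: "simp_approx 2 u eta"
  shows "simp_approx 1 u eta"
proof -
  have us: "simp_proc (u k)" for k using u unfolding simp_approx_def by auto
  have eta1: "eta \<in> MGbar E 1 T" by (rule MGbar_2_1[OF eta])
  define g where "g k = LI T (gap 2 (cst (u k)) eta)" for k
  have lim: "g ----> 0" using u unfolding simp_approx_def g_def by auto
  have bound: "LI T (gap 1 (cst (u k)) eta) \<le> T * theta + g k / theta" if "0 < theta" for k theta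
  proof -
    have int: "integrable (LB T) (gap 2 (cst (u k)) eta)" "integrable (LB T) (gap 1 (cst (u k)) eta)"
      by (rule gap_integrable_padp[OF simp_padp[OF us ok2] eta ok2],
          rule gap_integrable_padp[OF simp_padp[OF us ok1] eta1 ok1])
    have "LI T (gap 1 (cst (u k)) eta) \<le> LI T (%s. theta + gap 2 (cst (u k)) eta s / theta)"
    proof (rule integral_mono_AE[OF int(2)])
      show "integrable (LB T) (%s. theta + gap 2 (cst (u k)) eta s / theta)"
        by (intro Bochner_Integration.integrable_add integrable_divide int LB_const_integrable)
      show "AE s in LB T. gap 1 (cst (u k)) eta s \<le> theta + gap 2 (cst (u k)) eta s / theta"
        by (rule AE_I2) (use gap_1_le_2[OF padp_LG[OF simp_padp[OF us ok2]] MGbar_LG[OF eta] that] in simp)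
    qed
    also have "... = T * theta + g k / theta"
      unfolding Bochner_Integration.integral_add[OF LB_const_integrable integrable_divide[OF int(1)]]
      using LB_integral_const[of T theta] T_pos by (simp add: g_def)
    finally show ?thesis .
  qed
  have "(%k. LI T (gap 1 (cst (u k)) eta)) ----> 0"
  proof (rule LIMSEQ_I)
    fix eps :: real assume e: "0 < eps"
    define theta where "theta = eps / (2 * T)"
    have t: "0 < theta" using e T_pos by (simp add: theta_def)
    have "0 < theta * eps / 2" using t e by simp
    then obtain M where M: "\<forall>k\<ge>M. norm (g k - 0) < theta * eps / 2" using LIMSEQ_D[OF lim] by blast
    have "norm (LI T (gap 1 (cst (u k)) eta) - 0) < eps" if "M \<le> k" for k
    proof -
      have "g k / theta < (theta * eps / 2) / theta" using M that t by (intro divide_strict_right_mono) (auto simp: abs_less_iff)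
      moreover have "(theta * eps / 2) / theta = eps / 2" using t by simp
      moreover have "T * theta = eps / 2" using T_pos by (simp add: theta_def)
      ultimately have "T * theta + g k / theta < eps" by linarith
      moreover have "0 \<le> LI T (gap 1 (cst (u k)) eta)"
        by (rule gap_integral_nonneg[OF padp_LG[OF simp_padp[OF us ok1]] MGbar_LG[OF eta1] ok1])
      ultimately show ?thesis using bound[OF t, of k] by simp
    qed
    then show "\<exists>M. \<forall>k\<ge>M. norm (LI T (gap 1 (cst (u k)) eta) - 0) < eps" by blast
  qed
  then show ?thesis using us unfolding simp_approx_def by blast
qed

text \<open>The fixed point is found with integrals in L^2, while the definitions of the integrals
  \<open>dt\<close> and those against the quadratic variation refer to L^1. Approximation in the
  stronger norm implies that in the weaker one.\<close>

lemma SI_2_1: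
  fixes eta :: "('d, 'v::euclidean_space) process"
  assumes i: "integrator 2 D TYPE('v) C" and eta: "eta \<in> MGbar E 2 T" and I: "SI 2 D eta I"
  shows "SI 1 D eta I"
proof -
  obtain u where u: "simp_approx 2 u eta" "(%k. ds 2 (S D (u k)) I) ----> 0" using I unfolding SI_def by blast
  have L: "S D (u k) \<in> LG E 2" for k by (rule integrator_LG[OF i u(1)])
  have IL: "I \<in> LG E 2" by (rule SI_LG[OF I])
  have "(%k. ds 1 (S D (u k)) I) ----> 0"
  proof (rule Lim_null_comparison[OF _ u(2)], rule always_eventually, rule allI)
    fix k
    have "0 \<le> ds 1 (S D (u k)) I" by (rule ds_nonneg[OF LG_2_1[OF L] LG_2_1[OF IL] ok1])
    then show "norm (ds 1 (S D (u k)) I) \<le> ds 2 (S D (u k)) I" using Np_1_le[OF LG_diff[OF L IL ok2] ok2, of k] by simp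
  qed
  then show ?thesis unfolding SI_def using LG_2_1[OF IL] simp_approx_2_1[OF eta u(1)] by blast
qed

end

section \<open>The integrals of the stochastic differential equation\<close>

context G_time
begin

section \<open>Comparison with the approximations in the definitions\<close>

lemma gap_integral_triangle_MGbar:
  assumes "eta \<in> MGbar E p T" "eta' \<in> MGbar E p T" "eta'' \<in> MGbar E p T" "ok p"
  shows "LI T (gap p eta eta'') \<le> 2 * LI T (gap p eta eta') + 2 * LI T (gap p eta' eta'')"
proof -
  have i: "integrable (LB T) (gap p eta eta')" "integrable (LB T) (gap p eta' eta'')" "integrable (LB T) (gap p eta eta'')"
    using gap_integrable assms by blast+
  have "LI T (gap p eta eta'') \<le> LI T (%s. 2 * gap p eta eta' s + 2 * gap p eta' eta'' s)"
  proof (rule integral_mono_AE[OF i(3)])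
    show "integrable (LB T) (%s. 2 * gap p eta eta' s + 2 * gap p eta' eta'' s)" using i by simp
    show "AE s in LB T. gap p eta eta'' s \<le> 2 * gap p eta eta' s + 2 * gap p eta' eta'' s"
    proof (rule AE_I2)
      fix s assume "s \<in> space (LB T)"
      then show "gap p eta eta'' s \<le> 2 * gap p eta eta' s + 2 * gap p eta' eta'' s"
        using gap_triangle[of eta s p eta' eta''] MGbar_LG[OF assms(1), of s] MGbar_LG[OF assms(2), of s]
          MGbar_LG[OF assms(3), of s] assms(4) by simp
    qed
  qed
  also have "... = 2 * LI T (gap p eta eta') + 2 * LI T (gap p eta' eta'')" using i by simp
  finally show ?thesis .
qed

text \<open>A process with finitely many values spends the time \<open>c v\<close> at the value
  \<open>v\<close>; the time integral is a finite sum, and subadditivity moves \<open>E\<close>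
  inside. This comparison of norms is behind the inclusion of \<open>MGbar\<close> in
  \<open>MG\<close>.\<close>

lemma E_time_integral_le:
  fixes U :: "real => 'd cpath => 'v::euclidean_space"
  assumes U: "pc U" "\<And>s. U s \<in> L_ip" and p: "ok p"
  shows "E (%w. integral {0..T} (%t. norm (U t w) ^ p)) \<le> LI T (%t. nr p (U t) ^ p)"
proof -
  define c where "c v = LI T (%t. if U t = v then 1 else 0 :: real)" for v
  have ci: "integrable (LB T) (%t. if U t = v then 1 else 0 :: real)" for v
    by (rule pc_integrable[OF pc_comp[OF U(1), of "%x. if x = v then 1 else 0"]])
  have c0: "0 \<le> c v" for v unfolding c_def by (rule integral_nonneg_AE) auto
  have fin: "finite (range U)" by (rule pc_finite_range[OF U(1)])
  have rep: "LI T (%t. g (U t)) = (\<Sum>v\<in>range U. c v * g v)" for g :: "_ => real"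
  proof -
    have "g (U t) = (\<Sum>v\<in>range U. (if U t = v then 1 else 0) * g v)" for t
      using fin by (simp add: if_distrib[of "%x. x * g _"] cong: if_cong)
    then have "LI T (%t. g (U t)) = LI T (%t. \<Sum>v\<in>range U. (if U t = v then 1 else 0) * g v)" by presburger
    also have "... = (\<Sum>v\<in>range U. LI T (%t. (if U t = v then 1 else 0) * g v))"
      by (rule Bochner_Integration.integral_sum) (rule integrable_mult_left[OF ci])
    also have "... = (\<Sum>v\<in>range U. c v * g v)" by (simp only: c_def integral_mult_left_zero)
    finally show ?thesis .
  qed
  have int: "integral {0..T} (%t. norm (U t w) ^ p) = (\<Sum>v\<in>range U. c v * norm (v w) ^ p)" for w
  proof -
    have "integrable (LB T) (%t. norm (U t w) ^ p)" by (rule pc_integrable[OF pc_comp[OF U(1), of "%x. norm (x w) ^ p"]])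
    from has_integral_integral_lebesgue_on[OF this]
    have "integral {0..T} (%t. norm (U t w) ^ p) = LI T (%t. norm (U t w) ^ p)" by (intro integral_unique) simp
    then show ?thesis using rep[of "%x. norm (x w) ^ p"] by simp
  qed
  have vL: "v \<in> L_ip" if "v \<in> range U" for v using that U(2) by auto
  have "E (%w. \<Sum>v\<in>range U. c v * norm (v w) ^ p) \<le> (\<Sum>v\<in>range U. E (%w. c v * norm (v w) ^ p))"
    by (rule E_sum) (intro L_ip_mult L_ip_const norm_power_L_ip vL)
  also have "... = (\<Sum>v\<in>range U. c v * nr p v ^ p)"
    by (intro sum.cong refl) (simp add: E_scale norm_power_L_ip vL c0 nr_power ok_pos[OF p])
  also have "... = LI T (%t. nr p (U t) ^ p)" by (rule rep[symmetric])
  finally show ?thesis by (simp only: int)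
qed

lemma Eext_const: "Eext E (%_. X) = E X" unfolding Eext_def by (rule limI) simp

lemma step_approx_MG_of:
  assumes eta: "eta \<in> MGbar E p T" and p: "ok p" and u: "simp_approx p u eta"
    and r: "\<And>k. \<exists>N t x. step_rep E p T (cst (u k)) N t (%k _. x k)"
  shows "MG_of E p T eta (%k. cst (u k))"
proof -
  have us: "simp_proc (u k)" for k using u unfolding simp_approx_def by auto
  have up: "padp p (cst (u k))" for k by (rule simp_padp[OF us p])
  have lim: "(%k. LI T (gap p (cst (u k)) eta)) ----> 0" using u unfolding simp_approx_def by auto
  have MG0: "cst (u k) \<in> MG0 E p T" for k using r[of k] unfolding MG0_def by auto
  have "MGbar_approx E p T (%k. cst (u k)) eta"
    using lim gap_integrable_padp[OF up eta p] by (subst MGbar_approx_iff[OF up MGbar_LG[OF eta] p]) simp_all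
  moreover have "(%k. cst (u k)) \<in> MG E p T" unfolding MG_def
  proof (intro CollectI conjI allI impI MG0)
    fix eps :: real assume e: "0 < eps"
    then obtain M where M: "\<forall>k\<ge>M. norm (LI T (gap p (cst (u k)) eta) - 0) < eps / 4"
      using LIMSEQ_D[OF lim, of "eps / 4"] by auto
    have "Eext E (%m w. integral {0..T} (%t. norm (u k t w - u l t w) ^ p)) < eps" if kl: "M \<le> k" "M \<le> l" for k l
    proof -
      have "pc (%t w. u k t w - u l t w)"
        using pc_comp2[of "u k" "u l" "%x y w. x w - y w"] simp_sadp[OF us] by (simp add: sadp_def)
      moreover have "(%w. u k t w - u l t w) \<in> L_ip" for t
        using simp_sadp[OF us] by (auto simp: sadp_def intro: L_ip_diff)
      ultimately have "E (%w. integral {0..T} (%t. norm (u k t w - u l t w) ^ p)) \<le>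
          LI T (%t. nr p (%w. u k t w - u l t w) ^ p)" by (rule E_time_integral_le[OF _ _ p])
      also have "... = LI T (gap p (cst (u k)) (cst (u l)))" by (simp add: gap_def[abs_def] ds_const)
      also have "... \<le> 2 * LI T (gap p (cst (u k)) eta) + 2 * LI T (gap p eta (cst (u l)))"
        by (rule gap_integral_triangle_MGbar[OF padp_MGbar[OF up p] eta padp_MGbar[OF up p] p])
      also have "... < 2 * (eps / 4) + 2 * (eps / 4)"
        using M[rule_format, OF kl(1)] M[rule_format, OF kl(2)] gap_commute[of p eta "cst (u l)"]
        by (intro add_strict_mono) (auto simp: abs_less_iff)
      finally show ?thesis by (simp add: Eext_const)
    qed
    then show "\<exists>M. \<forall>k\<ge>M. \<forall>l\<ge>M. Eext E (%m w. integral {0..T} (%t. norm (u k t w - u l t w) ^ p)) < eps"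
      by blast
  qed
  ultimately show ?thesis unfolding MG_of_def using eta by blast
qed

lemma MG_of_D:
  assumes "MG_of E p T eta H" "ok p"
  shows "eta \<in> MGbar E p T" "H k \<in> MG0 E p T" "(%k. LI T (gap p (H k) eta)) ----> 0"
proof -
  show eta: "eta \<in> MGbar E p T" and "H k \<in> MG0 E p T" using assms(1) unfolding MG_of_def MG_def by auto
  have "padp p (H k)" for k by (rule MG0_padp[OF _ assms(2)]) (use assms(1) in \<open>auto simp: MG_of_def MG_def\<close>)
  from MGbar_approx_iff[where H = H and eta = eta and p = p, OF this MGbar_LG[OF eta] assms(2)]
  show "(%k. LI T (gap p (H k) eta)) ----> 0" using assms(1) unfolding MG_of_def by blast
qed

text \<open>Step processes have coefficients in the completion. For the \<open>k\<close>-th one an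
  index \<open>m k\<close> is chosen at which both the process and its integral are within
  \<open>1 / real (Suc k)\<close> of the given ones; this yields an approximation by simple
  processes.\<close>

lemma SI_of_steps:
  fixes eta :: "('d, 'v::euclidean_space) process"
  assumes i: "integrator p D TYPE('v) C" and mg: "MG_of E p T eta H"
    and J: "\<And>k. J k \<in> LG E p" and I: "I \<in> LG E p" and JI: "LG_tendsto E p J I"
    and conv: "\<And>k. (%m. ds p (S D (%s. H k s m)) (J k)) ----> 0"
  shows "SI p D eta I"
proof -
  have p: "ok p" using integrator_ok[OF i] .
  note mgD = MG_of_D[OF mg p]
  have JI: "(%k. ds p (J k) I) ----> 0" using JI by (simp only: LG_tendsto_iff[OF J I p])
  have HP: "padp p (H k)" for k by (rule MG0_padp[OF mgD(2) p])
  have simp_m: "simp_proc (%s. H k s m)" for k m using mgD(2)[of k] simp_step unfolding MG0_def by blast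
  have "\<exists>m. LI T (gap p (%s _. H k s m) (H k)) < 1 / real (Suc k) \<and>
      ds p (S D (%s. H k s m)) (J k) < 1 / real (Suc k)" for k
  proof -
    have e: "0 < 1 / real (Suc k)" by simp
    obtain M where M: "\<forall>m\<ge>M. LI T (gap p (%s _. H k s m) (H k)) < 1 / real (Suc k)"
      using gap_initial_integral[OF HP p e] by blast
    obtain M' where M': "\<forall>m\<ge>M'. norm (ds p (S D (%s. H k s m)) (J k) - 0) < 1 / real (Suc k)"
      using LIMSEQ_D[OF conv e] by blast
    show ?thesis using M[rule_format, of "max M M'"] M'[rule_format, of "max M M'"]
      by (intro exI[of _ "max M M'"]) (simp add: abs_less_iff)
  qed
  then have "\<forall>k. \<exists>m. LI T (gap p (%s _. H k s m) (H k)) < 1 / real (Suc k) \<and>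
      ds p (S D (%s. H k s m)) (J k) < 1 / real (Suc k)" by blast
  then obtain m where m: "\<forall>k. LI T (gap p (%s _. H k s (m k)) (H k)) < 1 / real (Suc k) \<and>
      ds p (S D (%s. H k s (m k))) (J k) < 1 / real (Suc k)" by (rule choice[THEN exE])
  define u where "u k = (%s. H k s (m k))" for k
  have us: "simp_proc (u k)" for k unfolding u_def by (rule simp_m)
  have up: "padp p (cst (u k))" for k by (rule simp_padp[OF us p])
  have SL: "S D (u k) \<in> LG E p" for k using i us unfolding integrator_def by auto
  have lim: "(%k. 1 / real (Suc k)) ----> 0" by (rule LIMSEQ_Suc[OF lim_1_over_n])
  have "(%k. LI T (gap p (cst (u k)) eta)) ----> 0"
  proof (rule Lim_null_comparison)
    show "(%k. 2 * (1 / real (Suc k)) + 2 * LI T (gap p (H k) eta)) ----> 0"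
      using tendsto_add[OF tendsto_mult_left[OF lim, of 2] tendsto_mult_left[OF mgD(3), of 2]] by simp
    show "\<forall>\<^sub>F k in sequentially. norm (LI T (gap p (cst (u k)) eta)) \<le>
        2 * (1 / real (Suc k)) + 2 * LI T (gap p (H k) eta)"
    proof (rule always_eventually, rule allI)
      fix k
      have "LI T (gap p (cst (u k)) eta) \<le>
          2 * LI T (gap p (cst (u k)) (H k)) + 2 * LI T (gap p (H k) eta)" by (rule gap_integral_triangle[OF up HP mgD(1) p])
      moreover have "LI T (gap p (cst (u k)) (H k)) < 1 / real (Suc k)" using m by (simp add: u_def)
      moreover have "0 \<le> LI T (gap p (cst (u k)) eta)"
        by (rule gap_integral_nonneg[OF padp_LG[OF up] MGbar_LG[OF mgD(1)] p])
      ultimately show "norm (LI T (gap p (cst (u k)) eta)) \<le>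
        2 * (1 / real (Suc k)) + 2 * LI T (gap p (H k) eta)" by (simp del: of_nat_Suc)
    qed
  qed
  then have "simp_approx p u eta" using us unfolding simp_approx_def by blast
  moreover have "(%k. ds p (S D (u k)) I) ----> 0"
  proof (rule Lim_null_comparison)
    show "(%k. 1 / real (Suc k) + ds p (J k) I) ----> 0" using tendsto_add[OF lim JI] by simp
    show "\<forall>\<^sub>F k in sequentially. norm (ds p (S D (u k)) I) \<le> 1 / real (Suc k) + ds p (J k) I"
    proof (rule always_eventually, rule allI)
      fix k
      have "ds p (S D (u k)) I \<le> ds p (S D (u k)) (J k) + ds p (J k) I" by (rule ds_triangle[OF SL J I p])
      moreover have "ds p (S D (u k)) (J k) < 1 / real (Suc k)" using m by (simp add: u_def)
      moreover have "0 \<le> ds p (S D (u k)) I" by (rule ds_nonneg[OF SL I p])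
      ultimately show "norm (ds p (S D (u k)) I) \<le> 1 / real (Suc k) + ds p (J k) I" by (simp del: of_nat_Suc)
    qed
  qed
  ultimately show ?thesis unfolding SI_def using I by blast
qed

lemma ds_sum_le:
  assumes "\<And>k. k \<in> A ==> x k \<in> LG E p" "\<And>k. k \<in> A ==> y k \<in> LG E p" "ok p"
  shows "ds p (%m w. \<Sum>k\<in>A. x k m w) (%m w. \<Sum>k\<in>A. y k m w) \<le> (\<Sum>k\<in>A. ds p (x k) (y k))"
proof -
  have "(%m w. x k m w - y k m w) \<in> LG E p" if "k \<in> A" for k
    by (rule LG_diff[OF assms(1,2) assms(3)]) (use that in auto)
  from Np_sum[of A "%k m w. x k m w - y k m w" p, OF this assms(3)] show ?thesis by (simp add: sum_subtractf)
qed

lemma step_rep_facts: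
  assumes "step_rep E p T H N t xi"
  shows "t 0 = 0" "t N = T" "\<And>k. k < N ==> 0 \<le> t k" "\<And>k. k < N ==> t k \<le> t (Suc k)" "\<And>k. k < N ==> t (Suc k) \<le> T"
    "\<And>k. k < N ==> xi k \<in> LG_upto E p (t k)" "\<And>k m. k < N ==> xi k m \<in> L_ip_upto (t k)"
    "\<And>m. (%s. H s m) = (%s w. \<Sum>k<N. el (t k) (t (Suc k)) (xi k m) s w)"
proof -
  have t: "t 0 = 0" "t N = T" and inc: "\<And>k. k < N ==> t k < t (Suc k)" and xi: "\<And>k. k < N ==> xi k \<in> LG_upto E p (t k)"
    and eq: "H = (%s m w. \<Sum>k<N. indicator {t k..<t (Suc k)} s *\<^sub>R xi k m w)"
    using assms unfolding step_rep_def by auto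
  have le: "t i \<le> t j" if "i \<le> j" "j \<le> N" for i j by (rule le_of_increments[of N t]) (use inc that in auto)
  show "t 0 = 0" "t N = T" by fact+
  show "0 \<le> t k" "t k \<le> t (Suc k)" "t (Suc k) \<le> T" "xi k \<in> LG_upto E p (t k)" "xi k m \<in> L_ip_upto (t k)" if "k < N" for k m
    using le[of 0 k] le[of k "Suc k"] le[of "Suc k" N] that t xi[OF that] by (auto simp: LG_upto_iff)
  show "(%s. H s m) = (%s w. \<Sum>k<N. el (t k) (t (Suc k)) (xi k m) s w)" for m by (simp add: eq el_def fun_eq_iff)
qed

lemma S_step_ds_zero:
  assumes r: "step_rep E p T H N t xi" and p: "ok p" and q: "ok q"
    and L: "\<And>k m. k < N ==> S D (el (t k) (t (Suc k)) (xi k m)) \<in> LG E q"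
    and Y: "\<And>k m. k < N ==> Y k m \<in> L_ip"
    and z: "\<And>k m. k < N ==> ds q (S D (el (t k) (t (Suc k)) (xi k m))) (%_. Y k m) = 0"
  shows "ds q (S D (%s. H s m)) (%_ w. \<Sum>k<N. Y k m w) = 0"
proof -
  have "ds q (%l w. \<Sum>k<N. S D (el (t k) (t (Suc k)) (xi k m)) l w) (%l w. \<Sum>k<N. (%_. Y k m) l w) \<le>
      (\<Sum>k<N. ds q (S D (el (t k) (t (Suc k)) (xi k m))) (%_. Y k m))"
  proof (rule ds_sum_le[OF _ _ q])
    fix k assume "k \<in> {..<N}"
    then show "S D (el (t k) (t (Suc k)) (xi k m)) \<in> LG E q" "(%_. Y k m) \<in> LG E q" using L LG_const[OF Y q] by auto
  qed
  also have "... = 0" using z by simp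
  finally have "ds q (S D (%s. H s m)) (%_ w. \<Sum>k<N. Y k m w) \<le> 0" unfolding step_rep_facts(8)[OF r] S_sum_el by simp
  moreover have "0 \<le> ds q (S D (%s. H s m)) (%_ w. \<Sum>k<N. Y k m w)" unfolding step_rep_facts(8)[OF r] S_sum_el
    by (rule ds_nonneg[OF LG_sum[OF _ q] LG_const[OF L_ip_sum q] q]) (use L Y in auto)
  ultimately show ?thesis by simp
qed

text \<open>The \<open>m\<close>-th process integrates to the \<open>m\<close>-th term of
  \<open>J\<close>, and the terms of \<open>J\<close> converge to \<open>J\<close>.\<close>

lemma ds_zero_initial:
  assumes "\<And>m. S D (h m) \<in> LG E p" "J \<in> LG E p" "ok p" "\<And>m. ds p (S D (h m)) (%_. J m) = 0"
  shows "(%m. ds p (S D (h m)) J) ----> 0"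
proof (rule Lim_null_comparison[OF _ ds_initial_tendsto[OF assms(2,3)]], rule always_eventually, rule allI)
  fix m
  have "ds p (S D (h m)) J \<le> ds p (S D (h m)) (%_. J m) + ds p (%_. J m) J"
    by (rule ds_triangle[OF assms(1) LG_const[OF LG_L_ip[OF assms(2)] assms(3)] assms(2,3)])
  then show "norm (ds p (S D (h m)) J) \<le> ds p (%_. J m) J" using assms(4) ds_nonneg[OF assms(1,2,3)] by simp
qed

lemma ds_zero_shift:
  assumes "x \<in> LG E p" "y \<in> LG E p" "z \<in> LG E p" "ok p" "ds p x y = 0"
  shows "ds p x z = ds p y z"
  using ds_triangle[OF assms(1,2,3,4)] ds_triangle[OF assms(2,1,3,4)] ds_commute[of p x y] assms(5) by simp

subsection \<open>The integral with respect to time\<close>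

lemma step_int_dt_LG:
  assumes "step_rep E 1 T H N t xi"
  shows "(%m w. \<Sum>k<N. (t (Suc k) - t k) *\<^sub>R xi k m w) \<in> LG E 1"
  by (rule LG_sum[OF LG_scaleR[OF LG_upto_LG]]) (use step_rep_facts(6)[OF assms] in auto)

lemma step_int_dt_ds:
  assumes r: "step_rep E 1 T H N t xi"
  shows "ds 1 (S Dt (%s. H s m)) (%_ w. \<Sum>k<N. (t (Suc k) - t k) *\<^sub>R xi k m w) = 0"
proof (rule S_step_ds_zero[OF r ok1 ok1])
  fix k m assume k: "k < N"
  note f = step_rep_facts(3-5,7)[OF r k]
  have e: "S Dt (el (t k) (t (Suc k)) (xi k m)) \<in> LG E 2"
    "ds 2 (S Dt (el (t k) (t (Suc k)) (xi k m))) (%_ w. (t (Suc k) - t k) *\<^sub>R xi k m w) = 0"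
    by (rule Dt_el[OF f(4,1,2,3)])+
  show "S Dt (el (t k) (t (Suc k)) (xi k m)) \<in> LG E 1" by (rule LG_2_1[OF e(1)])
  show YL: "(%w. (t (Suc k) - t k) *\<^sub>R xi k m w) \<in> L_ip" by (rule L_ip_scaleR[OF L_ip_upto_L_ip[OF f(4)]])
  have c: "(%_ w. (t (Suc k) - t k) *\<^sub>R xi k m w) \<in> LG E 2" by (rule LG_const[OF YL ok2])
  show "ds 1 (S Dt (el (t k) (t (Suc k)) (xi k m))) (%_ w. (t (Suc k) - t k) *\<^sub>R xi k m w) = 0"
    using Np_1_le[OF LG_diff[OF e(1) c ok2] ok2] e(2)
      ds_nonneg[OF LG_2_1[OF e(1)] LG_2_1[OF c] ok1] by simp
qed

text \<open>From left to right, \<open>SI_of_steps\<close> reduces coefficients in the completion to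
  members of \<open>L_ip\<close>. From right to left, the approximants from
  \<open>step_approx_exists\<close> are already step processes, with integrals at distance 0 from
  their grid sums.\<close>

lemma has_int_dt_iff:
  fixes eta :: "('d, 'v::euclidean_space) process"
  assumes eta: "eta \<in> MGbar E 1 T"
  shows "has_int_dt E T eta I \<longleftrightarrow> SI 1 Dt eta I"
proof
  assume "has_int_dt E T eta I"
  then obtain H J where I: "I \<in> LG E 1" and mg: "MG_of E 1 T eta H" and J: "\<And>k. step_int_dt E T (H k) (J k)"
    and JI: "LG_tendsto E 1 J I" unfolding has_int_dt_def by blast
  have JL: "J k \<in> LG E 1" for k
  proof -
    obtain N t xi where r: "step_rep E 1 T (H k) N t xi" and Jk: "J k = (%m w. \<Sum>k<N. (t (Suc k) - t k) *\<^sub>R xi k m w)"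
      using J[of k] unfolding step_int_dt_def by blast
    show ?thesis unfolding Jk by (rule step_int_dt_LG[OF r])
  qed
  show "SI 1 Dt eta I"
  proof (rule SI_of_steps[OF integrator_Dt[OF ok1] mg JL I JI])
    fix k
    obtain N t xi where r: "step_rep E 1 T (H k) N t xi" and Jk: "J k = (%m w. \<Sum>k<N. (t (Suc k) - t k) *\<^sub>R xi k m w)"
      using J[of k] unfolding step_int_dt_def by blast
    show "(%m. ds 1 (S Dt (%s. H k s m)) (J k)) ----> 0"
    proof (rule ds_zero_initial[OF _ JL ok1])
      show "S Dt (%s. H k s m) \<in> LG E 1" for m
        using integrator_Dt[OF ok1, where ?'v = 'v] simp_step[OF r] unfolding integrator_def by blast
      show "ds 1 (S Dt (%s. H k s m)) (%_. J k m) = 0" for m unfolding Jk by (rule step_int_dt_ds[OF r])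
    qed
  qed
next
  assume I: "SI 1 Dt eta I"
  obtain u where u: "simp_approx 1 u eta" and r: "\<forall>k. \<exists>N t x. step_rep E 1 T (cst (u k)) N t (%k _. x k)"
    using step_approx_exists[OF eta ok1] by blast
  have "\<exists>J. step_int_dt E T (cst (u k)) J \<and> J \<in> LG E 1 \<and> ds 1 (S Dt (u k)) J = 0" for k
  proof -
    obtain N t x where rk: "step_rep E 1 T (cst (u k)) N t (%k _. x k)" using r by blast
    show ?thesis
    proof (intro exI conjI)
      show "step_int_dt E T (cst (u k)) (%m w. \<Sum>k<N. (t (Suc k) - t k) *\<^sub>R x k w)"
        unfolding step_int_dt_def by (intro exI conjI) (rule rk, rule refl)
      show "(%m w. \<Sum>k<N. (t (Suc k) - t k) *\<^sub>R x k w) \<in> LG E 1" by (rule step_int_dt_LG[OF rk])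
      show "ds 1 (S Dt (u k)) (%m w. \<Sum>k<N. (t (Suc k) - t k) *\<^sub>R x k w) = 0" using step_int_dt_ds[OF rk] by simp
    qed
  qed
  then have "\<forall>k. \<exists>J. step_int_dt E T (cst (u k)) J \<and> J \<in> LG E 1 \<and> ds 1 (S Dt (u k)) J = 0" by blast
  then obtain J where J: "\<forall>k. step_int_dt E T (cst (u k)) (J k) \<and> J k \<in> LG E 1 \<and> ds 1 (S Dt (u k)) (J k) = 0"
    by (rule choice[THEN exE])
  have int: "integrator 1 Dt TYPE('v) (1 + 1^2 * T)" by (rule integrator_Dt) simp
  have IL: "I \<in> LG E 1" by (rule SI_LG[OF I])
  have "ds 1 (J k) I = ds 1 (S Dt (u k)) I" for k
  proof -
    have a: "J k \<in> LG E 1" and b: "ds 1 (S Dt (u k)) (J k) = 0" using J by blast+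
    show ?thesis by (rule ds_zero_shift[OF integrator_LG[OF int u] a IL ok1 b, symmetric])
  qed
  then have "(%k. ds 1 (J k) I) ----> 0" using SI_seq[OF int eta I u] by simp
  then have "LG_tendsto E 1 J I" using J IL by (subst LG_tendsto_iff) auto
  moreover have "MG_of E 1 T eta (%k. cst (u k))" by (rule step_approx_MG_of[OF eta ok1 u]) (use r in blast)
  ultimately show "has_int_dt E T eta I"
    unfolding has_int_dt_def using IL J by (intro conjI exI[of _ "%k. cst (u k)"] exI[of _ J]) auto
qed

subsection \<open>The integral with respect to Brownian motion\<close>

text \<open>Multiplication by an increment is not Lipschitz. The termwise product is a Cauchy
  sequence nevertheless, because the coefficients lie in the past of the increment and the second
  moment of the product is bounded by that of the coefficient.\<close>

lemma LG_increment:
  assumes x: "x \<in> LG_upto E 2 s" and st: "0 \<le> s" "s \<le> t"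
  shows "(%m w. (a \<bullet> BM t w - a \<bullet> BM s w) *\<^sub>R x m w :: 'v::euclidean_space) \<in> LG E 2"
proof (rule LG_I[OF _ ok2])
  obtain c where c: "0 \<le> c" "\<And>(X :: 'd cpath => 'v) s t. X \<in> L_ip_upto s ==> 0 \<le> s ==> s \<le> t ==>
      (nr 2 (%w. (a \<bullet> (BM t w - BM s w)) *\<^sub>R X w))\<^sup>2 \<le> c * (t - s) * (nr 2 X)^2"
    using nr_increment[of a, where ?'v = 'v] by blast
  have xL: "x m \<in> L_ip_upto s" for m using x by (simp add: LG_upto_iff)
  have BL: "(%w. a \<bullet> (BM t w - BM s w)) \<in> L_ip"
    by (rule L_ip_upto_L_ip[OF inner_increment_L_ip_upto[OF st order_refl]])
  show L: "(%w. (a \<bullet> BM t w - a \<bullet> BM s w) *\<^sub>R x m w) \<in> L_ip" for m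
    using L_ip_scale_by[OF BL L_ip_upto_L_ip[OF xL]] by (simp add: inner_diff_right)
  fix eps :: real assume e: "0 < eps"
  define k where "k = sqrt (c * (t - s)) + 1"
  have k: "0 < k" using c(1) st by (simp add: k_def add_nonneg_pos)
  obtain M where M: "\<forall>m\<ge>M. \<forall>l\<ge>M. nr 2 (%w. x m w - x l w) < eps / k"
    using LG_Cauchy[OF LG_upto_LG[OF x] ok2, of "eps / k"] e k by auto
  have "nr 2 (%w. (a \<bullet> BM t w - a \<bullet> BM s w) *\<^sub>R x m w - (a \<bullet> BM t w - a \<bullet> BM s w) *\<^sub>R x l w) < eps"
    if "M \<le> m" "M \<le> l" for m l
  proof -
    define n where "n = nr 2 (%w. x m w - x l w)"
    have n: "0 \<le> n" "n < eps / k"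
      using M that nr_nonneg[OF L_ip_upto_L_ip[OF L_ip_upto_diff[OF xL xL]]] by (auto simp: n_def)
    have "(nr 2 (%w. (a \<bullet> (BM t w - BM s w)) *\<^sub>R (x m w - x l w)))^2 \<le> c * (t - s) * n^2"
      unfolding n_def by (rule c(2)[OF L_ip_upto_diff[OF xL xL] st])
    also have "... = (sqrt (c * (t - s)) * n)^2" using c(1) st by (simp add: power_mult_distrib)
    also have "... \<le> (k * n)^2" using n c(1) st by (intro power_mono mult_right_mono) (auto simp: k_def)
    finally have "nr 2 (%w. (a \<bullet> (BM t w - BM s w)) *\<^sub>R (x m w - x l w)) \<le> k * n"
      by (rule power2_le_imp_le) (use n k in simp)
    also have "... < eps" using n(2) k by (simp add: pos_less_divide_eq mult.commute)
    finally show ?thesis by (simp add: scaleR_diff_right inner_diff_right)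
  qed
  then show "\<exists>M. \<forall>m\<ge>M. \<forall>l\<ge>M. nr 2 (%w. (a \<bullet> BM t w - a \<bullet> BM s w) *\<^sub>R x m w - (a \<bullet> BM t w - a \<bullet> BM s w) *\<^sub>R x l w) < eps"
    by blast
qed

lemma step_int_dB_LG:
  assumes r: "step_rep E 2 T H N t xi"
  shows "(%m w. \<Sum>k<N. (a \<bullet> BM (t (Suc k)) w - a \<bullet> BM (t k) w) *\<^sub>R xi k m w) \<in> LG E 2"
  by (rule LG_sum[OF LG_increment]) (use step_rep_facts[OF r] in auto)

lemma step_int_dB_ds:
  assumes r: "step_rep E 2 T H N t xi"
  shows "ds 2 (S (Db a) (%s. H s m)) (%_ w. \<Sum>k<N. (a \<bullet> BM (t (Suc k)) w - a \<bullet> BM (t k) w) *\<^sub>R xi k m w) = 0"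
proof (rule S_step_ds_zero[OF r ok2 ok2])
  fix k m assume k: "k < N"
  note f = step_rep_facts(3-5,7)[OF r k]
  show "S (Db a) (el (t k) (t (Suc k)) (xi k m)) \<in> LG E 2" by (rule Db_el(1)[OF f(4,1,2,3)])
  have BL: "(%w. a \<bullet> (BM (t (Suc k)) w - BM (t k) w)) \<in> L_ip"
    by (rule L_ip_upto_L_ip[OF inner_increment_L_ip_upto[OF f(1,2) order_refl]])
  show "(%w. (a \<bullet> BM (t (Suc k)) w - a \<bullet> BM (t k) w) *\<^sub>R xi k m w) \<in> L_ip"
    using L_ip_scale_by[OF BL L_ip_upto_L_ip[OF f(4)]] by (simp add: inner_diff_right)
  show "ds 2 (S (Db a) (el (t k) (t (Suc k)) (xi k m))) (%_ w. (a \<bullet> BM (t (Suc k)) w - a \<bullet> BM (t k) w) *\<^sub>R xi k m w) = 0"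
    using Db_el(2)[OF f(4,1,2,3), of a] by (simp add: inner_diff_right)
qed

lemma has_int_dB_iff:
  fixes eta :: "('d, 'v::euclidean_space) process"
  assumes eta: "eta \<in> MGbar E 2 T"
  shows "has_int_dB E T a eta I \<longleftrightarrow> SI 2 (Db a) eta I"
proof -
  obtain C where int: "integrator 2 (Db a) TYPE('v) C" using integrator_Db by blast
  show ?thesis
  proof
    assume "has_int_dB E T a eta I"
    then obtain H J where I: "I \<in> LG E 2" and mg: "MG_of E 2 T eta H" and J: "\<And>k. step_int_dB E T a (H k) (J k)"
      and JI: "LG_tendsto E 2 J I" unfolding has_int_dB_def by blast
    have JL: "J k \<in> LG E 2" for k
    proof -
      obtain N t xi where r: "step_rep E 2 T (H k) N t xi"
        and Jk: "J k = (%m w. \<Sum>k<N. (a \<bullet> BM (t (Suc k)) w - a \<bullet> BM (t k) w) *\<^sub>R xi k m w)"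
        using J[of k] unfolding step_int_dB_def by blast
      show ?thesis unfolding Jk by (rule step_int_dB_LG[OF r])
    qed
    show "SI 2 (Db a) eta I"
    proof (rule SI_of_steps[OF int mg JL I JI])
      fix k
      obtain N t xi where r: "step_rep E 2 T (H k) N t xi"
        and Jk: "J k = (%m w. \<Sum>k<N. (a \<bullet> BM (t (Suc k)) w - a \<bullet> BM (t k) w) *\<^sub>R xi k m w)"
        using J[of k] unfolding step_int_dB_def by blast
      show "(%m. ds 2 (S (Db a) (%s. H k s m)) (J k)) ----> 0"
      proof (rule ds_zero_initial[OF _ JL ok2])
        show "S (Db a) (%s. H k s m) \<in> LG E 2" for m using int simp_step[OF r] unfolding integrator_def by blast
        show "ds 2 (S (Db a) (%s. H k s m)) (%_. J k m) = 0" for m unfolding Jk by (rule step_int_dB_ds[OF r])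
      qed
    qed
  next
    assume I: "SI 2 (Db a) eta I"
    obtain u where u: "simp_approx 2 u eta" and r: "\<forall>k. \<exists>N t x. step_rep E 2 T (cst (u k)) N t (%k _. x k)"
      using step_approx_exists[OF eta ok2] by blast
    have "\<exists>J. step_int_dB E T a (cst (u k)) J \<and> J \<in> LG E 2 \<and> ds 2 (S (Db a) (u k)) J = 0" for k
    proof -
      obtain N t x where rk: "step_rep E 2 T (cst (u k)) N t (%k _. x k)" using r by blast
      show ?thesis
      proof (intro exI conjI)
        show "step_int_dB E T a (cst (u k)) (%m w. \<Sum>k<N. (a \<bullet> BM (t (Suc k)) w - a \<bullet> BM (t k) w) *\<^sub>R x k w)"
          unfolding step_int_dB_def by (intro exI conjI) (rule rk, rule refl)
        show "(%m w. \<Sum>k<N. (a \<bullet> BM (t (Suc k)) w - a \<bullet> BM (t k) w) *\<^sub>R x k w) \<in> LG E 2" by (rule step_int_dB_LG[OF rk])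
        show "ds 2 (S (Db a) (u k)) (%m w. \<Sum>k<N. (a \<bullet> BM (t (Suc k)) w - a \<bullet> BM (t k) w) *\<^sub>R x k w) = 0"
          using step_int_dB_ds[OF rk, of a] by simp
      qed
    qed
    then have "\<forall>k. \<exists>J. step_int_dB E T a (cst (u k)) J \<and> J \<in> LG E 2 \<and> ds 2 (S (Db a) (u k)) J = 0" by blast
    then obtain J where J: "\<forall>k. step_int_dB E T a (cst (u k)) (J k) \<and> J k \<in> LG E 2 \<and> ds 2 (S (Db a) (u k)) (J k) = 0"
      by (rule choice[THEN exE])
    have IL: "I \<in> LG E 2" by (rule SI_LG[OF I])
    have "ds 2 (J k) I = ds 2 (S (Db a) (u k)) I" for k
    proof -
      have a: "J k \<in> LG E 2" and b: "ds 2 (S (Db a) (u k)) (J k) = 0" using J by blast+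
      show ?thesis by (rule ds_zero_shift[OF integrator_LG[OF int u] a IL ok2 b, symmetric])
    qed
    then have "(%k. ds 2 (J k) I) ----> 0" using SI_seq[OF int eta I u] by simp
    then have "LG_tendsto E 2 J I" using J IL by (subst LG_tendsto_iff) auto
    moreover have "MG_of E 2 T eta (%k. cst (u k))" by (rule step_approx_MG_of[OF eta ok2 u]) (use r in blast)
    ultimately show "has_int_dB E T a eta I"
      unfolding has_int_dB_def using IL J by (intro conjI exI[of _ "%k. cst (u k)"] exI[of _ J]) auto
  qed
qed

subsection \<open>The quadratic variation\<close>

text \<open>A concrete version of the quadratic variation, again with the size of the grid as index.
  By \<open>is_QV_ds\<close> it can replace any other version.\<close>

definition Q :: "real^'d => real => ('d, real) rv" where
  "Q a t l w = (\<Sum>i<cl l t. Dq a l i w)"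

text \<open>Samples of the component of \<open>B\<close> along \<open>a\<close> at the left ends of
  the cells, cut off at \<open>t\<close>: the coefficients of the step processes that approximate
  the integrand in the definition of the quadratic variation.\<close>

definition Bs :: "real^'d => real => nat => nat => 'd cpath => real" where
  "Bs a t l i w = (if rr l i < t then a \<bullet> BM (rr l i) w else 0)"

definition Bstep :: "real^'d => real => nat => real => 'd cpath => real" where
  "Bstep a t l s w = ustep T l (%i. Bs a t l i w) s"

lemma Bs_L_ip_upto: "Bs a t l i \<in> L_ip_upto (rr l i)" unfolding Bs_def[abs_def]
  using L_ip_upto_inner[OF L_ip_upto_const L_ip_upto_BM[OF rr_nonneg order_refl], of a]
  by (cases "rr l i < t") (simp_all add: L_ip_upto_const)

lemma Bstep_step_rep: "0 < l ==> step_rep E 2 T (cst (Bstep a t l)) l (rr l) (%i _. Bs a t l i)"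
  unfolding Bstep_def[abs_def] rr_def[abs_def]
  by (rule ustep_step_rep) (use LG_upto_const[OF Bs_L_ip_upto ok2] in \<open>auto simp: rr_def\<close>)

lemma BM_variance: "\<exists>c\<ge>0. \<forall>s t. 0 \<le> s --> s \<le> t --> (nr 2 (%w. a \<bullet> BM t w - a \<bullet> BM s w))^2 \<le> c * (t - s)"
proof -
  obtain c where c: "0 \<le> c" "\<And>(X :: 'd cpath => real) s t. X \<in> L_ip_upto s ==> 0 \<le> s ==> s \<le> t ==>
      (nr 2 (%w. (a \<bullet> (BM t w - BM s w)) *\<^sub>R X w))\<^sup>2 \<le> c * (t - s) * (nr 2 X)^2"
    using nr_increment[of a, where ?'v = real] by blast
  have "(nr 2 (%w. a \<bullet> BM t w - a \<bullet> BM s w))^2 \<le> c * (t - s)" if "0 \<le> s" "s \<le> t" for s t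
    using c(2)[OF L_ip_upto_const[of 1] that] nr_const[of 2 "1::real"] by (simp add: inner_diff_right)
  with c(1) show ?thesis by blast
qed

lemma inner_BM_L_ip: "0 \<le> t ==> (%w. a \<bullet> BM t w) \<in> L_ip" by (rule L_ip_inner[OF L_ip_const L_ip_BM])

text \<open>Before \<open>t\<close> the error is at most the variance over one cell. In the cell
  that contains \<open>t\<close> the sample survives after \<open>t\<close>, where the process is
  already 0; the crude bound \<open>c * T\<close> is good enough there since the cell has length
  \<open>T / l\<close>.\<close>

lemma Bstep_gap_bound:
  assumes t: "t \<in> {0..T}"
  shows "\<exists>c\<ge>0. \<forall>l>0. AE s in LB T. gap 2 (cst (Bstep a t l)) (restrict_upto t (%s m w. a \<bullet> BM s w)) s \<le>
     c * T / real l + indicator {t..<min T (t + T / real l)} s * (c * T)"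
proof -
  obtain c where c: "0 \<le> c" "\<And>s t. 0 \<le> s ==> s \<le> t ==> (nr 2 (%w. a \<bullet> BM t w - a \<bullet> BM s w))^2 \<le> c * (t - s)"
    using BM_variance[of a] by blast
  have "AE s in LB T. gap 2 (cst (Bstep a t l)) (restrict_upto t (%s m w. a \<bullet> BM s w)) s \<le>
     c * T / real l + indicator {t..<min T (t + T / real l)} s * (c * T)" if l: "0 < l" for l
  proof -
    have "AE s in LB T. s \<notin> {t, T} \<and> s \<in> {0..T}"
      using LB_AE_finite[of "{t, T}" T] AE_space[of "LB T"] by (auto elim: eventually_elim2)
    then show ?thesis
    proof eventually_elim
      case (elim s)
      then obtain i where i: "i < l" "s \<in> {real i * T / real l..<real (Suc i) * T / real l}"
        using grid_cell[OF l T_pos, of s] by auto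
      have B: "Bstep a t l s = Bs a t l i" unfolding Bstep_def by (simp add: fun_eq_iff ustep_eq[OF i(1) T_pos i(2)])
      have r: "rr l i \<le> s" "s < rr l i + T / real l" using i(2) rr_Suc_diff[of l i] by (auto simp: rr_def)
      have g: "gap 2 (cst (Bstep a t l)) (restrict_upto t (%s m w. a \<bullet> BM s w)) s =
          (nr 2 (%w. Bs a t l i w - indicator {0..t} s *\<^sub>R (a \<bullet> BM s w)))\<^sup>2"
        by (simp add: gap_def restrict_upto_def B Np_const)
      have cT: "0 \<le> c * T / real l" "0 \<le> c * T" using c(1) T_pos by auto
      consider "s < t" | "t < s" "rr l i < t" | "t < s" "\<not> rr l i < t" using elim by fastforce
      then show ?case
      proof cases
        case 1
        then have "gap 2 (cst (Bstep a t l)) (restrict_upto t (%s m w. a \<bullet> BM s w)) s =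
            (nr 2 (%w. a \<bullet> BM s w - a \<bullet> BM (rr l i) w))\<^sup>2"
          unfolding g using elim r nr_commute[of 2 "%w. a \<bullet> BM s w"] by (simp add: Bs_def)
        also have "... \<le> c * (s - rr l i)" by (rule c(2)) (use r in auto)
        also have "... \<le> c * (T / real l)" using r c(1) by (intro mult_left_mono) auto
        finally show ?thesis using 1 by simp
      next
        case 2
        then have "gap 2 (cst (Bstep a t l)) (restrict_upto t (%s m w. a \<bullet> BM s w)) s =
            (nr 2 (%w. a \<bullet> BM (rr l i) w - a \<bullet> BM 0 w))\<^sup>2"
          unfolding g by (simp add: Bs_def BM_at_nonpos)
        also have "... \<le> c * (rr l i - 0)" by (rule c(2)) auto
        also have "... \<le> c * T" using rr_less_T[OF i(1)] c(1) by (intro mult_left_mono) auto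
        finally have le: "gap 2 (cst (Bstep a t l)) (restrict_upto t (%s m w. a \<bullet> BM s w)) s \<le> c * T" .
        have "s \<in> {t..<min T (t + T / real l)}" using 2 r elim by auto
        then have "indicator {t..<min T (t + T / real l)} s = (1::real)" by simp
        then show ?thesis using le cT(1) by (simp only: mult_1)
      next
        case 3
        then have "gap 2 (cst (Bstep a t l)) (restrict_upto t (%s m w. a \<bullet> BM s w)) s = 0"
          unfolding g by (simp add: Bs_def nr_const)
        then show ?thesis using cT by (simp add: indicator_def)
      qed
    qed
  qed
  with c(1) show ?thesis by blast
qed

lemma Bstep_approx:
  assumes t: "t \<in> {0..T}"
  shows "restrict_upto t (%s m w. a \<bullet> BM s w) \<in> MGbar E 2 T"
    "simp_approx 2 (%k. Bstep a t (Suc k)) (restrict_upto t (%s m w. a \<bullet> BM s w))"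
proof -
  define eta where "eta = restrict_upto t (%s m w. a \<bullet> BM s w)"
  obtain c where c: "0 \<le> c" "\<And>l. 0 < l ==> AE s in LB T. gap 2 (cst (Bstep a t l)) eta s \<le>
     c * T / real l + indicator {t..<min T (t + T / real l)} s * (c * T)"
    using Bstep_gap_bound[OF t, of a] unfolding eta_def by blast
  define G where "G k s = c * T / real (Suc k) + indicator {t..<min T (t + T / real (Suc k))} s * (c * T)" for k s
  have tb: "0 \<le> t" "t \<le> min T (t + T / real (Suc k))" "min T (t + T / real (Suc k)) \<le> T" for k
    using t T_pos by auto
  have Gi: "integrable (LB T) (G k)" for k
    unfolding G_def[abs_def] by (intro Bochner_Integration.integrable_add LB_const_integrable LB_integral_indicator(2)[OF tb])
  have Gint: "LI T (G k) \<le> (2 * c * T * T) / real (Suc k)" for k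
  proof -
    have "LI T (G k) = T * (c * T / real (Suc k)) + (min T (t + T / real (Suc k)) - t) * (c * T)"
      unfolding G_def[abs_def] Bochner_Integration.integral_add[OF LB_const_integrable LB_integral_indicator(2)[OF tb]]
        LB_integral_indicator(1)[OF tb] using T_pos LB_integral_const[of T "c * T / real (Suc k)"] by simp
    also have "... \<le> T * (c * T / real (Suc k)) + (T / real (Suc k)) * (c * T)"
      using c(1) T_pos by (intro add_left_mono mult_right_mono) auto
    also have "... = (2 * c * T * T) / real (Suc k)" by (simp add: field_simps del: of_nat_Suc)
    finally show ?thesis .
  qed
  have lim: "(%k. (2 * c * T * T) / real (Suc k)) ----> 0" by (rule LIMSEQ_Suc[OF inverse_l_tendsto])
  have us: "simp_proc (Bstep a t (Suc k))" for k using simp_step[OF Bstep_step_rep[of "Suc k" a t]] by simp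
  have up: "padp 2 (cst (Bstep a t (Suc k)))" for k by (rule simp_padp[OF us]) simp
  have etaL: "eta s \<in> LG E 2" if "s \<in> {0..T}" for s
    unfolding eta_def restrict_upto_def by (intro LG_scaleR LG_const inner_BM_L_ip) (use that in auto)
  have mg: "eta \<in> MGbar E 2 T"
  proof (rule MGbarI[OF etaL ok2])
    fix eps :: real assume "0 < eps"
    then obtain k where k: "norm ((2 * c * T * T) / real (Suc k) - 0) < eps" using LIMSEQ_D[OF lim] by blast
    then have "(2 * c * T * T) / real (Suc k) < eps" by (simp only: diff_zero real_norm_def abs_less_iff)
    then have "LI T (G k) < eps" using Gint[of k] by linarith
    moreover have "AE s in LB T. gap 2 (cst (Bstep a t (Suc k))) eta s \<le> G k s" unfolding G_def by (rule c(2)) simp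
    ultimately show "\<exists>U G. padp 2 U \<and> integrable (LB T) G \<and> (AE s in LB T. gap 2 U eta s \<le> G s) \<and> LI T G < eps"
      using up Gi by blast
  qed
  then show "restrict_upto t (%s m w. a \<bullet> BM s w) \<in> MGbar E 2 T" by (simp add: eta_def)
  have "(%k. LI T (gap 2 (cst (Bstep a t (Suc k))) eta)) ----> 0"
  proof (rule Lim_null_comparison[OF _ lim], rule always_eventually, rule allI)
    fix k
    have "LI T (gap 2 (cst (Bstep a t (Suc k))) eta) \<le> LI T (G k)"
    proof (rule integral_mono_AE[OF gap_integrable_padp[OF up mg ok2] Gi])
      show "AE s in LB T. gap 2 (cst (Bstep a t (Suc k))) eta s \<le> G k s" unfolding G_def by (rule c(2)) simp
    qed
    moreover have "0 \<le> LI T (gap 2 (cst (Bstep a t (Suc k))) eta)"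
      by (rule gap_integral_nonneg[OF padp_LG[OF up] etaL ok2])
    ultimately show "norm (LI T (gap 2 (cst (Bstep a t (Suc k))) eta)) \<le> (2 * c * T * T) / real (Suc k)"
      using Gint[of k] by (simp del: of_nat_Suc)
  qed
  then show "simp_approx 2 (%k. Bstep a t (Suc k)) (restrict_upto t (%s m w. a \<bullet> BM s w))"
    using us unfolding simp_approx_def eta_def by blast
qed

text \<open>Summation by parts: \<open>2 \<Sum> b\<^sub>i (b\<^sub>i\<^sub>+\<^sub>1 - b\<^sub>i) = b\<^sub>M\<^sup>2 - \<Sum> (b\<^sub>i\<^sub>+\<^sub>1 - b\<^sub>i)^2\<close>.\<close>

lemma Q_eq:
  assumes l: "0 < l" and t: "t \<in> {0..T}"
  shows "Q a t l w = (a \<bullet> BM (rr l (cl l t)) w)^2 - 2 * (\<Sum>i<l. Db a l i w * Bs a t l i w)"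
proof -
  define b where "b i = a \<bullet> BM (rr l i) w" for i
  have D: "Db a l i w = b (Suc i) - b i" for i by (simp add: Db_def b_def inner_diff_right)
  have "(\<Sum>i<l. Db a l i w * Bs a t l i w) = (\<Sum>i<l. if i < cl l t then (b (Suc i) - b i) * b i else 0)"
    by (intro sum.cong refl) (simp add: Bs_def cl_iff[OF l] D b_def)
  also have "... = (\<Sum>i\<in>{i. i < l \<and> i < cl l t}. (b (Suc i) - b i) * b i)"
    by (simp add: sum.inter_filter[symmetric] lessThan_def)
  also have "{i. i < l \<and> i < cl l t} = {..<cl l t}" using cl_le[of t l] t by auto
  finally have 1: "(\<Sum>i<l. Db a l i w * Bs a t l i w) = (\<Sum>i<cl l t. (b (Suc i) - b i) * b i)" .
  have "(\<Sum>i<M. (b (Suc i) - b i)\<^sup>2) = (b M)^2 - (b 0)^2 - 2 * (\<Sum>i<M. (b (Suc i) - b i) * b i)" for M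
    by (induction M) (simp_all add: power2_eq_square algebra_simps)
  moreover have "b 0 = 0" by (simp add: b_def BM_at_nonpos)
  moreover have "Q a t l w = (\<Sum>i<cl l t. (b (Suc i) - b i)\<^sup>2)" by (simp add: Q_def Dq_def D)
  ultimately show ?thesis unfolding 1 by (simp add: b_def)
qed

text \<open>With \<open>d\<close> the increment from \<open>t\<close> to the following grid point
  and \<open>b\<close> the value at \<open>t\<close>, the difference of the squares is
  \<open>2 * b * d + d^2\<close>. Both summands tend to 0 by the moments of
  \<open>d\<close>.\<close>

lemma square_grid_tendsto:
  assumes t: "0 \<le> t"
  shows "(%l. nr 2 (%w. (a \<bullet> BM (rr l (cl l t)) w)\<^sup>2 - (a \<bullet> BM t w)^2)) ----> 0"
proof -
  define d where "d l w = a \<bullet> (BM (rr l (cl l t)) w - BM t w)" for l w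
  have dL: "d l \<in> L_ip" for l unfolding d_def[abs_def]
    by (rule L_ip_inner[OF L_ip_const L_ip_diff[OF L_ip_BM[OF rr_nonneg] L_ip_BM[OF t]]])
  have bu: "(%w. 2 * (a \<bullet> BM t w)) \<in> L_ip_upto t"
    by (intro L_ip_upto_mult L_ip_upto_const L_ip_upto_inner BM_L_ip_upto) (use t in auto)
  have bL: "(%w. 2 * (a \<bullet> BM t w)) \<in> L_ip" by (rule L_ip_upto_L_ip[OF bu])
  have l1: "(%l. nr 2 (%w. d l w *\<^sub>R (2 * (a \<bullet> BM t w)))) ----> 0"
    unfolding d_def by (rule increment_grid_tendsto[OF bu t])
  obtain c where c: "0 \<le> c" "\<And>(X :: 'd cpath => real) s t. X \<in> L_ip_upto s ==> 0 \<le> s ==> s \<le> t ==>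
      nr 2 (%w. (a \<bullet> (BM t w - BM s w))\<^sup>2 *\<^sub>R X w) \<le> c * (t - s) * nr 2 X"
    using nr_square_increment[of 2 a, where ?'v = real, OF ok2] by blast
  have d2L: "(%w. (d l w)\<^sup>2) \<in> L_ip" for l by (rule L_ip_power[OF dL])
  have l2: "(%l. nr 2 (%w. (d l w)\<^sup>2)) ----> 0"
  proof (rule Lim_null_comparison[OF _ inverse_l_tendsto[of "c * T"]])
    show "\<forall>\<^sub>F l in sequentially. norm (nr 2 (%w. (d l w)\<^sup>2)) \<le> c * T / real l"
      unfolding eventually_sequentially
    proof (intro exI[of _ 1] allI impI)
      fix l :: nat assume "1 \<le> l"
      then have l: "0 < l" by simp
      have "nr 2 (%w. (d l w)\<^sup>2) \<le> c * (rr l (cl l t) - t) * 1"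
        using c(2)[OF L_ip_upto_const[of 1] t rr_cl_ge[OF l]] nr_const[of 2 "1::real"] by (simp add: d_def)
      also have "... \<le> c * (T / real l) * 1" using rr_cl_less[OF l t] c(1) by (intro mult_right_mono mult_left_mono) auto
      finally show "norm (nr 2 (%w. (d l w)\<^sup>2)) \<le> c * T / real l" using nr_nonneg[OF d2L, of 2 l] by simp
    qed
  qed
  show ?thesis
  proof (rule Lim_null_comparison)
    show "(%l. nr 2 (%w. d l w *\<^sub>R (2 * (a \<bullet> BM t w))) + nr 2 (%w. (d l w)\<^sup>2)) ----> 0"
      using tendsto_add[OF l1 l2] by simp
    show "\<forall>\<^sub>F l in sequentially. norm (nr 2 (%w. (a \<bullet> BM (rr l (cl l t)) w)\<^sup>2 - (a \<bullet> BM t w)^2)) \<le>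
        nr 2 (%w. d l w *\<^sub>R (2 * (a \<bullet> BM t w))) + nr 2 (%w. (d l w)\<^sup>2)"
    proof (rule always_eventually, rule allI)
      fix l
      have L1: "(%w. d l w *\<^sub>R (2 * (a \<bullet> BM t w))) \<in> L_ip" by (rule L_ip_scale_by[OF dL bL])
      have eq: "(%w. (a \<bullet> BM (rr l (cl l t)) w)\<^sup>2 - (a \<bullet> BM t w)^2) =
          (%w. d l w *\<^sub>R (2 * (a \<bullet> BM t w)) + (d l w)^2)"
        by (simp add: d_def inner_diff_right power2_eq_square algebra_simps fun_eq_iff)
      show "norm (nr 2 (%w. (a \<bullet> BM (rr l (cl l t)) w)\<^sup>2 - (a \<bullet> BM t w)^2)) \<le>
        nr 2 (%w. d l w *\<^sub>R (2 * (a \<bullet> BM t w))) + nr 2 (%w. (d l w)\<^sup>2)"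
        unfolding eq using nr_triangle[OF L1 d2L ok2] nr_nonneg[OF L_ip_add[OF L1 d2L], of 2] by simp
    qed
  qed
qed

text \<open>By \<open>Q_eq\<close> the sum of squares is a square minus twice a grid sum. The square
  converges to the one at \<open>t\<close>, the grid sum to the stochastic integral.\<close>

lemma Q_converges:
  assumes t: "t \<in> {0..T}" and I: "SI 2 (Db a) (restrict_upto t (%s m w. a \<bullet> BM s w)) I"
  shows "Q a t \<in> LG E 2" "ds 2 (Q a t) (%m w. (a \<bullet> BM t w)\<^sup>2 - 2 * I m w) = 0"
proof -
  obtain C where int: "integrator 2 (Db a) TYPE(real) C" using integrator_Db by blast
  define z where "z k w = (\<Sum>i<Suc k. Db a (Suc k) i w * Bs a t (Suc k) i w)" for k w
  define u where "u k = Bstep a t (Suc k)" for k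
  have IL: "I \<in> LG E 2" by (rule SI_LG[OF I])
  have SL: "S (Db a) (u k) \<in> LG E 2" for k unfolding u_def by (rule integrator_LG[OF int Bstep_approx(2)[OF t]])
  have zL: "z k \<in> L_ip" for k unfolding z_def[abs_def]
    by (intro L_ip_sum L_ip_mult L_ip_upto_L_ip[OF Db_L_ip_upto] L_ip_upto_L_ip[OF Bs_L_ip_upto])
  \<comment> \<open>The sampled process is constant on the cells of the very grid that defines
    \<open>z k\<close>, so its integral is this single function.\<close>
  have z0: "ds 2 (S (Db a) (u k)) (%_. z k) = 0" for k using step_int_dB_ds[OF Bstep_step_rep[of "Suc k" a t], of a]
    unfolding u_def z_def[abs_def] Db_def by (simp add: inner_diff_right del: sum.lessThan_Suc)
  have zI: "(%k. ds 2 (%_. z k) I) ----> 0" using SI_seq[OF int Bstep_approx(1)[OF t] I Bstep_approx(2)[OF t]]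
      ds_zero_shift[OF SL LG_const[OF zL ok2] IL ok2 z0] by (simp add: u_def)
  define W where "W = (%m w. (a \<bullet> BM t w)\<^sup>2 - 2 * I m w)"
  have b2: "(%w. (a \<bullet> BM s w)\<^sup>2) \<in> L_ip" if "0 \<le> s" for s by (rule L_ip_power[OF inner_BM_L_ip[OF that]])
  have t0: "0 \<le> t" using t by simp
  have I2: "(%m w. 2 * I m w) \<in> LG E 2" using LG_scaleR[OF IL, of 2] by simp
  have W: "W \<in> LG E 2" unfolding W_def by (rule LG_diff[OF LG_const[OF b2[OF t0]] I2]) auto
  have QL: "Q a t l \<in> L_ip" for l unfolding Q_def[abs_def] by (intro L_ip_sum L_ip_upto_L_ip[OF Dq_L_ip_upto])
  have "(%k. ds 2 (%_. Q a t (Suc k)) W) ----> 0"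
  proof (rule Lim_null_comparison)
    show "(%k. nr 2 (%w. (a \<bullet> BM (rr (Suc k) (cl (Suc k) t)) w)\<^sup>2 - (a \<bullet> BM t w)^2) + 2 * ds 2 (%_. z k) I) ----> 0"
      using tendsto_add[OF LIMSEQ_Suc[OF square_grid_tendsto[OF t0, of a]] tendsto_mult_left[OF zI, of 2]] by simp
    show "\<forall>\<^sub>F k in sequentially. norm (ds 2 (%_. Q a t (Suc k)) W) \<le>
        nr 2 (%w. (a \<bullet> BM (rr (Suc k) (cl (Suc k) t)) w)\<^sup>2 - (a \<bullet> BM t w)^2) + 2 * ds 2 (%_. z k) I"
    proof (rule always_eventually, rule allI)
      fix k
      define X where "X w = (a \<bullet> BM (rr (Suc k) (cl (Suc k) t)) w)^2 - (a \<bullet> BM t w)^2" for w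
      have XL: "X \<in> L_ip" unfolding X_def[abs_def] by (intro L_ip_diff b2 t0 rr_nonneg)
      have dL: "(%m w. z k w - I m w) \<in> LG E 2" by (rule LG_diff[OF LG_const[OF zL] IL]) auto
      have eq: "(%m w. Q a t (Suc k) w - W m w) = (%m w. X w + (-2) *\<^sub>R (z k w - I m w))"
        using Q_eq[of "Suc k" t a] t by (simp add: X_def W_def z_def fun_eq_iff del: sum.lessThan_Suc)
      have "ds 2 (%_. Q a t (Suc k)) W \<le> Np 2 (%_. X) + Np 2 (%m w. (-2) *\<^sub>R (z k w - I m w))"
        unfolding eq by (rule Np_triangle[OF LG_const[OF XL] LG_scaleR[OF dL]]) auto
      also have "... = nr 2 X + 2 * ds 2 (%_. z k) I" using Np_scaleR[OF dL, of "-2"] by (simp add: Np_const)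
      finally show "norm (ds 2 (%_. Q a t (Suc k)) W) \<le>
        nr 2 (%w. (a \<bullet> BM (rr (Suc k) (cl (Suc k) t)) w)\<^sup>2 - (a \<bullet> BM t w)^2) + 2 * ds 2 (%_. z k) I"
        using ds_nonneg[OF LG_const[OF QL ok2] W ok2, of "Suc k"] unfolding X_def[abs_def] by simp
    qed
  qed
  then have "(%l. ds 2 (%_. Q a t l) W) ----> 0" by (rule LIMSEQ_imp_Suc)
  from LG_of_approx[OF QL W ok2 this]
  show "Q a t \<in> LG E 2" "ds 2 (Q a t) (%m w. (a \<bullet> BM t w)\<^sup>2 - 2 * I m w) = 0" by (simp_all add: W_def)
qed

lemma Q_LG: "t \<in> {0..T} ==> Q a t \<in> LG E 2"
proof -
  assume t: "t \<in> {0..T}"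
  obtain C where int: "integrator 2 (Db a) TYPE(real) C" using integrator_Db by blast
  obtain I where "SI 2 (Db a) (restrict_upto t (%s m w. a \<bullet> BM s w)) I"
    using SI_exists[OF int Bstep_approx(1)[OF t]] by blast
  then show ?thesis by (rule Q_converges(1)[OF t])
qed

lemma is_QV_Q: "is_QV E T a (Q a)" unfolding is_QV_def
proof (intro ballI conjI Q_LG)
  fix t assume t: "t \<in> {0..T}"
  obtain C where int: "integrator 2 (Db a) TYPE(real) C" using integrator_Db by blast
  obtain I where I: "SI 2 (Db a) (restrict_upto t (%s m w. a \<bullet> BM s w)) I"
    using SI_exists[OF int Bstep_approx(1)[OF t]] by blast
  have t0: "0 \<le> t" using t by simp
  have W: "(%m w. (a \<bullet> BM t w)\<^sup>2 - 2 * I m w) \<in> LG E 2"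
    using LG_diff[OF LG_const[OF L_ip_power[OF inner_BM_L_ip[OF t0]]] LG_scaleR[OF SI_LG[OF I], of 2]] by simp
  show "\<exists>I. has_int_dB E T a (restrict_upto t (%s m w. a \<bullet> BM s w)) I \<and>
      LG_eq E 2 (Q a t) (%m w. (a \<bullet> BM t w)\<^sup>2 - 2 * I m w)"
    using I has_int_dB_iff[OF Bstep_approx(1)[OF t], where I = I] LG_eq_iff[OF Q_LG[OF t] W ok2]
      Q_converges(2)[OF t I] by (intro exI[of _ I]) simp
qed

text \<open>\<open>Q_converges\<close> holds for every version \<open>I\<close> of the integral, in
  particular for the one that comes with \<open>q\<close>.\<close>

lemma is_QV_ds:
  assumes q: "is_QV E T a q" and t: "t \<in> {0..T}"
  shows "q t \<in> LG E 2" "ds 2 (q t) (Q a t) = 0"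
proof -
  obtain I where qL: "q t \<in> LG E 2" and h: "has_int_dB E T a (restrict_upto t (%s m w. a \<bullet> BM s w)) I"
    and e: "LG_eq E 2 (q t) (%m w. (a \<bullet> BM t w)\<^sup>2 - 2 * I m w)"
    using q t unfolding is_QV_def by blast
  have I: "SI 2 (Db a) (restrict_upto t (%s m w. a \<bullet> BM s w)) I"
    using h has_int_dB_iff[OF Bstep_approx(1)[OF t]] by blast
  have t0: "0 \<le> t" using t by simp
  have W: "(%m w. (a \<bullet> BM t w)\<^sup>2 - 2 * I m w) \<in> LG E 2"
    using LG_diff[OF LG_const[OF L_ip_power[OF inner_BM_L_ip[OF t0]]] LG_scaleR[OF SI_LG[OF I], of 2]] by simp
  have "ds 2 (q t) (%m w. (a \<bullet> BM t w)\<^sup>2 - 2 * I m w) = 0" using e by (simp only: LG_eq_iff[OF qL W ok2])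
  from ds_zero_shift[OF qL W Q_LG[OF t] ok2 this]
  show "ds 2 (q t) (Q a t) = 0" using Q_converges(2)[OF t I] ds_commute[of 2 "Q a t"] by simp
  show "q t \<in> LG E 2" by fact
qed

end

context G_time
begin

subsection \<open>The integral with respect to the quadratic variation\<close>

text \<open>By the Cauchy-Schwarz inequality, multiplication by a fixed member of
  \<open>L_ip\<close> is continuous from L^2 to L^1.\<close>

lemma LG_scale_const:
  fixes x :: "'d cpath => 'v::euclidean_space"
  assumes y: "y \<in> LG E 2" and x: "x \<in> L_ip"
  shows "(%l w. y l w *\<^sub>R x w) \<in> LG E 1"
proof (rule LG_I[OF _ ok1])
  have yL: "y l \<in> L_ip" for l by (rule LG_L_ip[OF y])
  show "(%w. y l w *\<^sub>R x w) \<in> L_ip" for l by (rule L_ip_scale_by[OF yL x])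
  fix eps :: real assume e: "0 < eps"
  have n0: "0 \<le> nr 2 x" by (rule nr_nonneg[OF x])
  have d: "0 < eps / (nr 2 x + 1)" using e n0 by simp
  obtain M where M: "\<forall>m\<ge>M. \<forall>l\<ge>M. nr 2 (%w. y m w - y l w) < eps / (nr 2 x + 1)"
    using LG_Cauchy[OF y ok2 d] by blast
  have "nr 1 (%w. y m w *\<^sub>R x w - y l w *\<^sub>R x w) < eps" if "M \<le> m" "M \<le> l" for m l
  proof -
    have "nr 1 (%w. (y m w - y l w) *\<^sub>R x w) \<le> nr 2 (%w. y m w - y l w) * nr 2 x"
      by (rule nr_1_scale_by[OF L_ip_diff[OF yL yL] x])
    also have "... \<le> eps / (nr 2 x + 1) * nr 2 x" by (rule mult_right_mono[OF less_imp_le n0]) (use M that in blast)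
    also have "... < eps" using e n0 by (simp add: field_simps)
    finally show ?thesis by (simp add: scaleR_diff_left)
  qed
  then show "\<exists>M. \<forall>m\<ge>M. \<forall>l\<ge>M. nr 1 (%w. y m w *\<^sub>R x w - y l w *\<^sub>R x w) < eps" by blast
qed

lemma ds_scale_const:
  fixes x :: "'d cpath => 'v::euclidean_space"
  assumes y: "y \<in> LG E 2" "y' \<in> LG E 2" and x: "x \<in> L_ip"
  shows "ds 1 (%l w. y l w *\<^sub>R x w) (%l w. y' l w *\<^sub>R x w) \<le> ds 2 y y' * nr 2 x"
proof (rule LIMSEQ_le)
  show "(%l. nr 1 (%w. y l w *\<^sub>R x w - y' l w *\<^sub>R x w)) ---->
      ds 1 (%l w. y l w *\<^sub>R x w) (%l w. y' l w *\<^sub>R x w)"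
    by (rule Np_tendsto[OF LG_diff[OF LG_scale_const[OF y(1) x] LG_scale_const[OF y(2) x]]]) auto
  show "(%l. nr 2 (%w. y l w - y' l w) * nr 2 x) ----> ds 2 y y' * nr 2 x"
    by (intro tendsto_mult_right Np_tendsto LG_diff y ok2)
  have "nr 1 (%w. y l w *\<^sub>R x w - y' l w *\<^sub>R x w) \<le> nr 2 (%w. y l w - y' l w) * nr 2 x" for l
    using nr_1_scale_by[OF L_ip_diff[OF LG_L_ip[OF y(1)] LG_L_ip[OF y(2)]] x, of l l] by (simp add: scaleR_diff_left)
  then show "\<exists>N. \<forall>l\<ge>N. nr 1 (%w. y l w *\<^sub>R x w - y' l w *\<^sub>R x w) \<le> nr 2 (%w. y l w - y' l w) * nr 2 x"
    by blast
qed

lemma Dq_el_eq: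
  assumes "0 \<le> s" "s \<le> t" "t \<le> T"
  shows "S (Dq a) (el s t x) = (%l w. (Q a t l w - Q a s l w) *\<^sub>R x w)"
proof -
  have "(\<Sum>i\<in>{cl l s..<cl l t}. Dq a l i w) = Q a t l w - Q a s l w" for l w
    using sum.atLeastLessThan_concat[OF le0 cl_mono[OF assms(2), of l], of "%i. Dq a l i w"]
    unfolding Q_def by (simp add: lessThan_atLeast0)
  then show ?thesis by (simp add: fun_eq_iff S_el[OF assms])
qed

text \<open>
  Convergence in \<open>L\<^sup>1\<close> and bounded fourth moments give convergence in \<open>L\<^sup>2\<close>, by
  \<open>|W|\<^sup>2 \<le> N |W| + |W|\<^sup>4 / N^2\<close>.
\<close>

lemma LG_2_of_fourth_moment:
  assumes Z1: "Z \<in> LG E 1" and K: "\<And>l. nr 2 (%w. (norm (Z l w))\<^sup>2) \<le> K"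
  shows "Z \<in> LG E 2"
proof (rule LG_I[OF LG_L_ip[OF Z1] ok2])
  have ZL: "Z l \<in> L_ip" for l by (rule LG_L_ip[OF Z1])
  have Z2L: "(%w. (norm (Z l w))\<^sup>2) \<in> L_ip" for l by (rule norm_power_L_ip[OF ZL])
  have K0: "0 \<le> K" using nr_nonneg[OF Z2L, of 2 0] K[of 0] by linarith
  have four: "E (%w. norm (Z l w) ^ 4) \<le> K^2" for l
  proof -
    have "E (%w. norm (Z l w) ^ 4) = (nr 2 (%w. (norm (Z l w))\<^sup>2))^2"
      unfolding nr_2[OF Z2L] by (simp add: power_mult[symmetric])
    also have "... \<le> K^2" by (rule power_mono[OF K nr_nonneg[OF Z2L]])
    finally show ?thesis .
  qed
  fix eps :: real assume e: "0 < eps"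
  \<comment> \<open>With this \<open>N\<close> the fourth moments contribute
    \<open>16 * K^2 / N^2\<close>, at most half of \<open>eps^2\<close>; the other half is left for
    \<open>N\<close> times the L^1 distance.\<close>
  define N where "N = (6 * K + 1) / eps"
  have N: "0 < N" using K0 e by (simp add: N_def add_nonneg_pos)
  have d: "0 < eps^2 / (2 * N)" using e N by simp
  obtain M where M: "\<forall>m\<ge>M. \<forall>l\<ge>M. nr 1 (%w. Z m w - Z l w) < eps^2 / (2 * N)"
    using LG_Cauchy[OF Z1 ok1 d] by blast
  have "nr 2 (%w. Z m w - Z l w) < eps" if ml: "M \<le> m" "M \<le> l" for m l
  proof -
    have WL: "(%w. Z m w - Z l w) \<in> L_ip" by (rule L_ip_diff[OF ZL ZL])
    \<comment> \<open>The fourth power of the difference is at most 8 times the sum of the fourth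
      powers, by convexity.\<close>
    have pt: "(norm (Z m w - Z l w))^2 \<le> N * norm (Z m w - Z l w) + (8 / N^2) * (norm (Z m w) ^ 4 + norm (Z l w) ^ 4)" for w
    proof -
      define U a b where "U = norm (Z m w - Z l w)" and "a = norm (Z m w)" and "b = norm (Z l w)"
      have nn: "0 \<le> U" "0 \<le> a" "0 \<le> b" "U \<le> a + b" by (auto simp: U_def a_def b_def norm_triangle_ineq4)
      have "U^2 \<le> (a + b)^2" using nn by (intro power_mono) auto
      also have "... \<le> 2 * (a^2 + b^2)" using sum_squares_ge_zero[of "a - b" 0] by (simp add: power2_eq_square algebra_simps)
      finally have "U^2 \<le> 2 * (a^2 + b^2)" .
      then have "(U^2)^2 \<le> (2 * (a^2 + b^2))^2" by (intro power_mono) auto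
      also have "... \<le> 8 * ((a^2)^2 + (b^2)^2)"
        using sum_squares_ge_zero[of "a^2 - b^2" 0] by (simp add: power2_eq_square algebra_simps)
      finally have w4: "U ^ 4 \<le> 8 * (a ^ 4 + b ^ 4)" by (simp add: power_mult[symmetric])
      have "U^2 \<le> N * U + U ^ 4 / N^2"
      proof (cases "U \<le> N")
        case True
        then have "U^2 \<le> N * U" using nn by (simp add: power2_eq_square mult_right_mono)
        moreover have "0 \<le> U ^ 4 / N^2" by simp
        ultimately show ?thesis by linarith
      next
        case False
        then have "N^2 \<le> U^2" using N by (intro power_mono) auto
        then have "U^2 * N^2 \<le> U^2 * U^2" by (intro mult_left_mono) auto
        then have "U^2 \<le> U ^ 4 / N^2" using N by (simp add: pos_le_divide_eq power_add[symmetric])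
        moreover have "0 \<le> N * U" using N nn by simp
        ultimately show ?thesis by linarith
      qed
      also have "U ^ 4 / N^2 \<le> 8 * (a ^ 4 + b ^ 4) / N^2" by (intro divide_right_mono w4) simp
      finally show ?thesis by (simp add: U_def a_def b_def)
    qed
    have L1: "(%w. N * norm (Z m w - Z l w)) \<in> L_ip" by (intro L_ip_intros ZL)
    have L2: "(%w. norm (Z m w) ^ 4 + norm (Z l w) ^ 4) \<in> L_ip" by (intro L_ip_intros ZL)
    have L3: "(%w. (8 / N^2) * (norm (Z m w) ^ 4 + norm (Z l w) ^ 4)) \<in> L_ip" by (intro L_ip_intros ZL)
    have "(nr 2 (%w. Z m w - Z l w))^2 = E (%w. (norm (Z m w - Z l w))\<^sup>2)" by (rule nr_2[OF WL])
    also have "... \<le> E (%w. N * norm (Z m w - Z l w) + (8 / N^2) * (norm (Z m w) ^ 4 + norm (Z l w) ^ 4))"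
      by (rule E_mono[OF norm_power_L_ip[OF WL] L_ip_add[OF L1 L3] pt])
    also have "... \<le> E (%w. N * norm (Z m w - Z l w)) + E (%w. (8 / N^2) * (norm (Z m w) ^ 4 + norm (Z l w) ^ 4))"
      by (rule E_add[OF L1 L3])
    also have "E (%w. N * norm (Z m w - Z l w)) = N * nr 1 (%w. Z m w - Z l w)"
      unfolding nr_1 by (rule E_scale[OF L_ip_norm[OF WL]]) (use N in simp)
    also have "E (%w. (8 / N^2) * (norm (Z m w) ^ 4 + norm (Z l w) ^ 4)) = (8 / N^2) * E (%w. norm (Z m w) ^ 4 + norm (Z l w) ^ 4)"
      by (rule E_scale[OF L2]) simp
    also have "(8 / N^2) * E (%w. norm (Z m w) ^ 4 + norm (Z l w) ^ 4) \<le> (8 / N^2) * (K^2 + K^2)"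
    proof (rule mult_left_mono)
      show "E (%w. norm (Z m w) ^ 4 + norm (Z l w) ^ 4) \<le> K^2 + K^2"
        using E_add[OF norm_power_L_ip[OF ZL] norm_power_L_ip[OF ZL], of m 4 l 4] four[of m] four[of l] by linarith
    qed simp
    finally have "(nr 2 (%w. Z m w - Z l w))^2 \<le> N * nr 1 (%w. Z m w - Z l w) + (8 / N^2) * (K^2 + K^2)" by simp
    also have "... < N * (eps^2 / (2 * N)) + eps^2 / 2"
    proof (rule add_less_le_mono)
      show "N * nr 1 (%w. Z m w - Z l w) < N * (eps^2 / (2 * N))" using M ml N by (intro mult_strict_left_mono) auto
      have "(8 / N^2) * (K^2 + K^2) = eps^2 * (16 * K^2 / (6 * K + 1)^2)" by (simp add: N_def power_divide)
      also have "... \<le> eps^2 * (1 / 2)"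
      proof (rule mult_left_mono)
        have "32 * K^2 \<le> (6 * K + 1)^2" using K0 by (simp add: power2_eq_square algebra_simps)
        then show "16 * K^2 / (6 * K + 1)^2 \<le> 1 / 2" using K0 by (simp add: divide_le_eq)
      qed simp
      finally show "(8 / N^2) * (K^2 + K^2) \<le> eps^2 / 2" by simp
    qed
    also have "... = eps^2" using N by simp
    finally show ?thesis by (rule power2_less_imp_less) (use e in simp)
  qed
  then show "\<exists>M. \<forall>m\<ge>M. \<forall>l\<ge>M. nr 2 (%w. Z m w - Z l w) < eps" by blast
qed

text \<open>For two cells the later squared increment is estimated first, the earlier one being part
  of its past; for a single cell the fourth power is controlled by the eighth moment. Either way the
  bound is of the order of the squared cell length.\<close>

lemma Dq_product_bound:
  "\<exists>C\<ge>0. \<forall>y s l i j. y \<in> L_ip_upto s --> s \<le> rr l i --> s \<le> rr l j -->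
     nr 2 (%w. Dq a l i w * Dq a l j w * (y w :: real)) \<le> C * (T / real l)^2 * nr 2 y"
proof -
  obtain c where c: "0 \<le> c" "\<And>(X :: 'd cpath => real) s t. X \<in> L_ip_upto s ==> 0 \<le> s ==> s \<le> t ==>
      nr 2 (%w. (a \<bullet> (BM t w - BM s w))\<^sup>2 *\<^sub>R X w) \<le> c * (t - s) * nr 2 X"
    using nr_square_increment[of 2 a, where ?'v = real, OF ok2] by blast
  obtain c4 where c4: "0 \<le> c4" "\<And>(X :: 'd cpath => real) s t. X \<in> L_ip_upto s ==> 0 \<le> s ==> s \<le> t ==>
      (nr 2 (%w. (a \<bullet> (BM t w - BM s w)) ^ 4 *\<^sub>R X w))\<^sup>2 \<le> c4 * (t - s) ^ 4 * (nr 2 X)^2"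
    using nr_moment[of 4 a, where ?'v = real, OF zero_less_numeral] by blast
  have D: "nr 2 (%w. Dq a l i w * y w) \<le> c * (T / real l) * nr 2 y" if "y \<in> L_ip_upto (rr l i)" for y :: "'d cpath => real" and l i
    using c(2)[OF that rr_nonneg rr_mono[of i "Suc i" l]] by (simp add: Dq_def Db_def rr_Suc_diff)
  have T0: "0 \<le> T / real l" for l using T_pos by simp
  have lt: "nr 2 (%w. Dq a l i w * Dq a l j w * y w) \<le> c^2 * (T / real l)^2 * nr 2 y"
    if y: "y \<in> L_ip_upto s" "s \<le> rr l i" and ij: "i < j" for y :: "'d cpath => real" and s l i j
  proof -
    have yi: "y \<in> L_ip_upto (rr l i)" using y L_ip_upto_mono by blast
    have "y \<in> L_ip_upto (rr l (Suc i))" using yi L_ip_upto_mono[OF rr_mono[of i "Suc i" l]] by auto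
    then have "(%w. Dq a l i w * y w) \<in> L_ip_upto (rr l (Suc i))" by (rule L_ip_upto_mult[OF Dq_L_ip_upto])
    then have Dy: "(%w. Dq a l i w * y w) \<in> L_ip_upto (rr l j)"
      using L_ip_upto_mono[OF rr_mono[of "Suc i" j l]] ij by auto
    have "nr 2 (%w. Dq a l j w * (Dq a l i w * y w)) \<le> c * (T / real l) * nr 2 (%w. Dq a l i w * y w)" by (rule D[OF Dy])
    also have "... \<le> c * (T / real l) * (c * (T / real l) * nr 2 y)"
      using D[OF yi] by (rule mult_left_mono) (rule mult_nonneg_nonneg[OF c(1) T0])
    finally show ?thesis by (simp add: power2_eq_square mult_ac)
  qed
  have eq: "nr 2 (%w. Dq a l i w * Dq a l i w * y w) \<le> sqrt c4 * (T / real l)^2 * nr 2 y"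
    if y: "y \<in> L_ip_upto s" "s \<le> rr l i" for y :: "'d cpath => real" and s l i
  proof (rule power2_le_imp_le)
    have yi: "y \<in> L_ip_upto (rr l i)" using y L_ip_upto_mono by blast
    have "(%w. Dq a l i w * Dq a l i w * y w) = (%w. (a \<bullet> (BM (rr l (Suc i)) w - BM (rr l i) w)) ^ 4 *\<^sub>R y w)"
      by (simp add: Dq_def Db_def fun_eq_iff power_add[symmetric])
    then have "(nr 2 (%w. Dq a l i w * Dq a l i w * y w))^2 \<le> c4 * (T / real l) ^ 4 * (nr 2 y)^2"
      using c4(2)[OF yi rr_nonneg rr_mono[of i "Suc i" l]] by (simp add: rr_Suc_diff)
    also have "... = (sqrt c4 * (T / real l)^2 * nr 2 y)^2"
      using c4(1) by (simp add: power_mult_distrib power_mult[symmetric] del: power_divide)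
    finally show "(nr 2 (%w. Dq a l i w * Dq a l i w * y w))^2 \<le> (sqrt c4 * (T / real l)^2 * nr 2 y)^2" .
    show "0 \<le> sqrt c4 * (T / real l)^2 * nr 2 y" using c4(1) nr_nonneg[OF L_ip_upto_L_ip[OF y(1)]] by simp
  qed
  define C where "C = c^2 + sqrt c4"
  have "nr 2 (%w. Dq a l i w * Dq a l j w * y w) \<le> C * (T / real l)^2 * nr 2 y"
    if y: "y \<in> L_ip_upto s" "s \<le> rr l i" "s \<le> rr l j" for y :: "'d cpath => real" and s l i j
  proof -
    have n: "0 \<le> (T / real l)^2 * nr 2 y" using nr_nonneg[OF L_ip_upto_L_ip[OF y(1)]] by simp
    have a1: "c^2 * (T / real l)^2 * nr 2 y \<le> C * (T / real l)^2 * nr 2 y"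
      using mult_right_mono[OF _ n, of "c^2" C] c4(1) by (simp add: C_def mult.assoc)
    have a2: "sqrt c4 * (T / real l)^2 * nr 2 y \<le> C * (T / real l)^2 * nr 2 y"
      using mult_right_mono[OF _ n, of "sqrt c4" C] by (simp add: C_def mult.assoc)
    consider "i < j" | "i = j" | "j < i" by linarith
    then show ?thesis
    proof cases
      case 1 then show ?thesis using lt[OF y(1,2) 1] a1 by linarith
    next
      case 2 then show ?thesis using eq[OF y(1,2)] a2 by simp
    next
      case 3 then show ?thesis using lt[OF y(1,3) 3] a1 by (simp add: mult_ac)
    qed
  qed
  moreover have "0 \<le> C" using c4(1) by (simp add: C_def)
  ultimately show ?thesis by blast
qed

text \<open>Convergence in L^1 comes from that of \<open>Q\<close>. For the upgrade to L^2, the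
  squared sum is expanded into at most \<open>l^2\<close> products, each of order
  \<open>(T / l)^2\<close>, so the fourth moments stay bounded in \<open>l\<close>.\<close>

lemma Dq_el:
  fixes x :: "'d cpath => 'v::euclidean_space"
  assumes x: "x \<in> L_ip_upto s" and st: "0 \<le> s" "s \<le> t" "t \<le> T"
  shows "S (Dq a) (el s t x) \<in> LG E 2"
proof -
  have xL: "x \<in> L_ip" by (rule L_ip_upto_L_ip[OF x])
  have Z1: "S (Dq a) (el s t x) \<in> LG E 1"
    unfolding Dq_el_eq[OF st] by (intro LG_scale_const LG_diff Q_LG xL) (use st in auto)
  obtain C where C: "0 \<le> C" "\<And>y s l i j. y \<in> L_ip_upto s ==> s \<le> rr l i ==> s \<le> rr l j ==>
     nr 2 (%w. Dq a l i w * Dq a l j w * (y w :: real)) \<le> C * (T / real l)^2 * nr 2 y"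
    using Dq_product_bound[of a] by blast
  define y where "y w = (norm (x w))^2" for w
  have yu: "y \<in> L_ip_upto s" unfolding y_def[abs_def] by (rule L_ip_upto_power[OF L_ip_upto_norm[OF x]])
  have y0: "0 \<le> nr 2 y" by (rule nr_nonneg[OF L_ip_upto_L_ip[OF yu]])
  have "nr 2 (%w. (norm (S (Dq a) (el s t x) l w))\<^sup>2) \<le> C * T^2 * nr 2 y" for l
  proof -
    define I where "I = {cl l s..<cl l t}"
    have L: "(%w. Dq a l i w * Dq a l j w * y w) \<in> L_ip" for i j
      by (intro L_ip_mult L_ip_upto_L_ip[OF Dq_L_ip_upto] L_ip_upto_L_ip[OF yu])
    have "(%w. (norm (S (Dq a) (el s t x) l w))\<^sup>2) = (%w. \<Sum>i\<in>I. \<Sum>j\<in>I. Dq a l i w * Dq a l j w * y w)"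
    proof
      fix w
      have "(norm (S (Dq a) (el s t x) l w))^2 = (\<Sum>i\<in>I. Dq a l i w)^2 * y w"
        unfolding S_el[OF st] I_def y_def by (simp add: power_mult_distrib)
      also have "... = (\<Sum>i\<in>I. \<Sum>j\<in>I. Dq a l i w * Dq a l j w * y w)"
        unfolding power2_eq_square sum_product by (simp only: sum_distrib_right)
      finally show "(norm (S (Dq a) (el s t x) l w))^2 = (\<Sum>i\<in>I. \<Sum>j\<in>I. Dq a l i w * Dq a l j w * y w)" .
    qed
    then have "nr 2 (%w. (norm (S (Dq a) (el s t x) l w))\<^sup>2) = nr 2 (%w. \<Sum>i\<in>I. \<Sum>j\<in>I. Dq a l i w * Dq a l j w * y w)"
      by simp
    also have "... \<le> (\<Sum>i\<in>I. nr 2 (%w. \<Sum>j\<in>I. Dq a l i w * Dq a l j w * y w))"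
      by (rule nr_sum) (auto intro: L_ip_sum L)
    also have "... \<le> (\<Sum>i\<in>I. \<Sum>j\<in>I. nr 2 (%w. Dq a l i w * Dq a l j w * y w))"
      by (intro sum_mono nr_sum L ok2)
    also have "... \<le> (\<Sum>i\<in>I. \<Sum>j\<in>I. C * (T / real l)^2 * nr 2 y)"
    proof (intro sum_mono C(2)[OF yu])
      fix i assume "i \<in> I"
      then have i: "cl l s \<le> i" "i < cl l t" by (auto simp: I_def)
      then have "0 < l" using cl_le[OF st(3), of l] by simp
      then show "s \<le> rr l i" using cl_iff[of l i s] i by simp
    next
      fix i assume "i \<in> I"
      then have i: "cl l s \<le> i" "i < cl l t" by (auto simp: I_def)
      then have "0 < l" using cl_le[OF st(3), of l] by simp
      then show "s \<le> rr l i" using cl_iff[of l i s] i by simp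
    qed
    also have "... = (real (card I) * real (card I)) * (C * (T / real l)^2 * nr 2 y)" by simp
    also have "... \<le> (real l * real l) * (C * (T / real l)^2 * nr 2 y)"
    proof (rule mult_right_mono)
      have "card I \<le> l" using cl_le[OF st(3), of l] by (simp add: I_def)
      then show "real (card I) * real (card I) \<le> real l * real l" by (intro mult_mono) auto
    qed (use C(1) y0 in simp)
    also have "... \<le> C * T^2 * nr 2 y" using C(1) y0 by (cases "l = 0") (auto simp: power2_eq_square)
    finally show ?thesis .
  qed
  then show ?thesis by (rule LG_2_of_fourth_moment[OF Z1])
qed

lemma integrator_Dq:
  assumes p: "ok p"
  shows "\<exists>C. integrator p (Dq a) TYPE('v::euclidean_space) C"
proof -
  obtain C where C: "0 \<le> C" "\<And>(u :: real => 'd cpath => 'v) l. adp u ==>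
     nr p (S (Dq a) u l) ^ p \<le> C * (\<Sum>i<l. T / real l * nr p (u (rr l i)) ^ p)"
    using Dq_estimate[OF p, of a, where ?'v = 'v] by blast
  have "integrator p (Dq a) TYPE('v) C" unfolding integrator_def
  proof (intro conjI allI impI)
    show "S (Dq a) u \<in> LG E p" if "simp_proc u" for u :: "real => 'd cpath => 'v"
      by (rule S_simp_LG[OF that p]) (rule LG_2_p[OF Dq_el p])
  qed (use C p in \<open>auto intro: Dq_L_ip_upto\<close>)
  then show ?thesis by blast
qed

text \<open>The definition admits any version \<open>q\<close> of the quadratic variation and
  multiplies by means of \<open>LG_prod\<close>. As \<open>q\<close> and \<open>Q a\<close> agree in
  L^2, their products with a member of \<open>L_ip\<close> agree in L^1, and the grid sums are
  exactly the products with \<open>Q a\<close>. Conversely \<open>Q a\<close> serves as the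
  version.\<close>

lemma has_int_dQV_iff:
  fixes eta :: "('d, 'v::euclidean_space) process"
  assumes eta: "eta \<in> MGbar E 1 T"
  shows "has_int_dQV E T a eta I \<longleftrightarrow> SI 1 (Dq a) eta I"
proof -
  obtain C where int: "integrator 1 (Dq a) TYPE('v) C" using integrator_Dq[OF ok1] by blast
  show ?thesis
  proof
    assume "has_int_dQV E T a eta I"
    then obtain q H J where I: "I \<in> LG E 1" and q: "is_QV E T a q" and mg: "MG_of E 1 T eta H"
      and J: "\<And>k. step_int_dQV E T q (H k) (J k)" and JI: "LG_tendsto E 1 J I"
      unfolding has_int_dQV_def by blast
    have step: "J k \<in> LG E 1 \<and> (%m. ds 1 (S (Dq a) (%s. H k s m)) (J k)) ----> 0" for k
    proof -
      obtain N t xi Z where r: "step_rep E 1 T (H k) N t xi"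
        and Z: "\<And>k. k < N ==> LG_prod E (xi k) (%m w. q (t (Suc k)) m w - q (t k) m w) (Z k)"
        and Jk: "J k = (%m w. \<Sum>k<N. Z k m w)"
        using J[of k] unfolding step_int_dQV_def by blast
      have ZL: "Z k \<in> LG E 1" if "k < N" for k using Z[OF that] unfolding LG_prod_def by blast
      have JL: "J k \<in> LG E 1" unfolding Jk by (rule LG_sum) (use ZL in auto)
      have SL: "S (Dq a) (el (t k) (t (Suc k)) (xi k m)) \<in> LG E 1" if "k < N" for k m
        using LG_2_1[OF Dq_el] step_rep_facts[OF r] that by blast
      have trm: "(%m. ds 1 (S (Dq a) (el (t k) (t (Suc k)) (xi k m))) (Z k)) ----> 0" if k: "k < N" for k
      proof -
        note f = step_rep_facts(3-5,7)[OF r k]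
        have t1: "t k \<in> {0..T}" "t (Suc k) \<in> {0..T}" using f(1-3) by auto
        define y where "y = (%m w. q (t (Suc k)) m w - q (t k) m w)"
        define y' where "y' = (%m w. Q a (t (Suc k)) m w - Q a (t k) m w)"
        have yL: "y \<in> LG E 2" unfolding y_def by (intro LG_diff is_QV_ds(1)[OF q] t1 ok2)
        have y'L: "y' \<in> LG E 2" unfolding y'_def by (intro LG_diff Q_LG t1 ok2)
        have "ds 2 y' y \<le> ds 2 (Q a (t (Suc k))) (q (t (Suc k))) + ds 2 (Q a (t k)) (q (t k))"
        proof -
          have "ds 2 y' y \<le> \<bar>1\<bar> * (ds 2 (Q a (t (Suc k))) (q (t (Suc k))) + ds 2 (Q a (t k)) (q (t k)))"
            unfolding y_def y'_def
          proof (rule ds_lip2[OF Q_LG[OF t1(2)] is_QV_ds(1)[OF q t1(2)] Q_LG[OF t1(1)] is_QV_ds(1)[OF q t1(1)] ok2,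
                of "%a b. a - b" 1])
            show "norm (a - b - (a' - b')) \<le> 1 * (norm (a - a') + norm (b - b'))" for a b a' b' :: real
              using norm_triangle_ineq4[of "a - a'" "b - b'"] by (simp add: algebra_simps)
          qed
          then show ?thesis by simp
        qed
        also have "... = 0" using is_QV_ds(2)[OF q t1(1)] is_QV_ds(2)[OF q t1(2)] ds_commute[of 2 "Q a (t k)" "q (t k)"]
            ds_commute[of 2 "Q a (t (Suc k))" "q (t (Suc k))"] by simp
        finally have y0: "ds 2 y' y \<le> 0" .
        have xiL: "xi k m \<in> L_ip" for m using step_rep_facts(7)[OF r k] by (rule L_ip_upto_L_ip)
        have yxL: "(%l w. y l w *\<^sub>R xi k m w) \<in> LG E 1" "(%l w. y' l w *\<^sub>R xi k m w) \<in> LG E 1" for m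
          by (rule LG_scale_const[OF yL xiL], rule LG_scale_const[OF y'L xiL])
        have z: "ds 1 (%l w. y' l w *\<^sub>R xi k m w) (%l w. y l w *\<^sub>R xi k m w) = 0" for m
        proof -
          have "ds 1 (%l w. y' l w *\<^sub>R xi k m w) (%l w. y l w *\<^sub>R xi k m w) \<le> ds 2 y' y * nr 2 (xi k m)"
            by (rule ds_scale_const[OF y'L yL xiL])
          also have "... \<le> 0" using y0 nr_nonneg[OF xiL] by (rule mult_nonpos_nonneg)
          finally show ?thesis using ds_nonneg[OF yxL(2,1) ok1] by (simp add: antisym)
        qed
        have lim: "(%m. ds 1 (%l w. y l w *\<^sub>R xi k m w) (Z k)) ----> 0"
        proof -
          have "(%m. Eext E (%l w. norm (y l w *\<^sub>R xi k m w - Z k l w))) ----> 0"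
            using Z[OF k] unfolding LG_prod_def y_def by blast
          moreover have "Eext E (%l w. norm (y l w *\<^sub>R xi k m w - Z k l w)) = ds 1 (%l w. y l w *\<^sub>R xi k m w) (Z k)" for m
            using Eext_norm_power[OF LG_diff[OF yxL(1) ZL[OF k] ok1] ok1, of m] by simp
          ultimately show ?thesis by simp
        qed
        have "ds 1 (S (Dq a) (el (t k) (t (Suc k)) (xi k m))) (Z k) = ds 1 (%l w. y l w *\<^sub>R xi k m w) (Z k)" for m
          unfolding Dq_el_eq[OF f(1-3)] using ds_zero_shift[OF yxL(2,1) ZL[OF k] ok1 z] by (simp add: y'_def)
        then show ?thesis using lim by simp
      qed
      have "(%m. ds 1 (S (Dq a) (%s. H k s m)) (J k)) ----> 0"
      proof (rule Lim_null_comparison)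
        show "(%m. \<Sum>k<N. ds 1 (S (Dq a) (el (t k) (t (Suc k)) (xi k m))) (Z k)) ----> 0"
          using tendsto_sum[of "{..<N}" "%k m. ds 1 (S (Dq a) (el (t k) (t (Suc k)) (xi k m))) (Z k)" "%_. 0"] trm by simp
        show "\<forall>\<^sub>F m in sequentially. norm (ds 1 (S (Dq a) (%s. H k s m)) (J k)) \<le>
            (\<Sum>k<N. ds 1 (S (Dq a) (el (t k) (t (Suc k)) (xi k m))) (Z k))"
        proof (rule always_eventually, rule allI)
          fix m
          have "ds 1 (S (Dq a) (%s. H k s m)) (J k) \<le> (\<Sum>k<N. ds 1 (S (Dq a) (el (t k) (t (Suc k)) (xi k m))) (Z k))"
            unfolding step_rep_facts(8)[OF r] S_sum_el Jk by (rule ds_sum_le[OF _ _ ok1]) (use SL ZL in auto)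
          moreover have "S (Dq a) (%s. H k s m) \<in> LG E 1" using int simp_step[OF r] unfolding integrator_def by blast
          ultimately show "norm (ds 1 (S (Dq a) (%s. H k s m)) (J k)) \<le>
            (\<Sum>k<N. ds 1 (S (Dq a) (el (t k) (t (Suc k)) (xi k m))) (Z k))" using ds_nonneg[OF _ JL ok1] by simp
        qed
      qed
      with JL show ?thesis by blast
    qed
    show "SI 1 (Dq a) eta I" by (rule SI_of_steps[OF int mg _ I JI]) (use step in auto)
  next
    assume I: "SI 1 (Dq a) eta I"
    obtain u where u: "simp_approx 1 u eta" and r: "\<forall>k. \<exists>N t x. step_rep E 1 T (cst (u k)) N t (%k _. x k)"
      using step_approx_exists[OF eta ok1] by blast
    have J: "step_int_dQV E T (Q a) (cst (u k)) (S (Dq a) (u k))" for k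
    proof -
      obtain N t x where rk: "step_rep E 1 T (cst (u k)) N t (%k _. x k)" using r by blast
      define Z where "Z k = (%l w. (Q a (t (Suc k)) l w - Q a (t k) l w) *\<^sub>R x k w)" for k
      have "LG_prod E (%_. x k) (%m w. Q a (t (Suc k)) m w - Q a (t k) m w) (Z k)" if k: "k < N" for k
      proof -
        note f = step_rep_facts(3-5)[OF rk k]
        have xL: "x k \<in> L_ip" using step_rep_facts(7)[OF rk k] by (rule L_ip_upto_L_ip)
        have "Z k \<in> LG E 1" unfolding Z_def by (intro LG_scale_const LG_diff Q_LG xL) (use f in auto)
        moreover have "Eext E (%l w. norm ((Q a (t (Suc k)) l w - Q a (t k) l w) *\<^sub>R x k w - Z k l w)) = 0"
          by (simp add: Z_def Eext_const E_const)
        ultimately show ?thesis unfolding LG_prod_def by simp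
      qed
      moreover have "S (Dq a) (u k) = (%m w. \<Sum>k<N. Z k m w)"
      proof -
        have "u k = (%s w. \<Sum>k<N. el (t k) (t (Suc k)) (x k) s w)" using step_rep_facts(8)[OF rk] by simp
        then have "S (Dq a) (u k) = (%l w. \<Sum>k<N. S (Dq a) (el (t k) (t (Suc k)) (x k)) l w)" by (simp only: S_sum_el)
        also have "... = (%m w. \<Sum>k<N. Z k m w)"
          by (intro ext sum.cong refl) (simp add: Dq_el_eq[OF step_rep_facts(3-5)[OF rk]] Z_def)
        finally show ?thesis .
      qed
      ultimately show ?thesis unfolding step_int_dQV_def using rk by blast
    qed
    have IL: "I \<in> LG E 1" by (rule SI_LG[OF I])
    have "LG_tendsto E 1 (%k. S (Dq a) (u k)) I"
      using SI_seq[OF int eta I u] by (subst LG_tendsto_iff[OF integrator_LG[OF int u] IL]) auto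
    moreover have "MG_of E 1 T eta (%k. cst (u k))" by (rule step_approx_MG_of[OF eta ok1 u]) (use r in blast)
    ultimately show "has_int_dQV E T a eta I" unfolding has_int_dQV_def using IL J is_QV_Q[of a]
      by (intro conjI exI[of _ "Q a"] exI[of _ "%k. cst (u k)"] exI[of _ "%k. S (Dq a) (u k)"]) auto
  qed
qed

end

section \<open>Substitution into random fields\<close>

definition pts :: "nat => 'v::euclidean_space" where
  "pts = (SOME p. p 0 = 0 \<and> (\<forall>x e. 0 < e --> (\<exists>i. norm (x - p i) < e)))"

text \<open>A countable dense set is enumerated with 0 put in front. Starting at 0 makes the
  distance to the first points at most the norm, which serves as majorant in the limits
  below.\<close>

lemma pts: "pts 0 = (0 :: 'v::euclidean_space)" "0 < e ==> \<exists>i. norm (x - (pts i :: 'v)) < e"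
proof -
  obtain D :: "'v set" where D: "countable D" "\<And>X. open X ==> X \<noteq> {} ==> \<exists>d\<in>D. d \<in> X"
    using countable_dense_setE by blast
  then have Dne: "D \<noteq> {}" using open_UNIV by blast
  define p where "p i = (case i of 0 => 0 | Suc j => from_nat_into D j)" for i
  have "\<exists>i. norm (x - p i) < e" if e: "0 < e" for x e
  proof -
    obtain d where d: "d \<in> D" "d \<in> ball x e" using D(2)[of "ball x e"] e by auto
    then obtain j where "d = from_nat_into D j" using from_nat_into_surj[OF D(1)] by metis
    then have "norm (x - p (Suc j)) < e" using d by (simp add: p_def dist_norm)
    then show ?thesis by blast
  qed
  then have "\<exists>p :: nat => 'v. p 0 = 0 \<and> (\<forall>x e. 0 < e --> (\<exists>i. norm (x - p i) < e))"
    by (intro exI[of _ p]) (simp add: p_def)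
  from someI_ex[OF this] show "pts 0 = (0 :: 'v)" "0 < e ==> \<exists>i. norm (x - (pts i :: 'v)) < e"
    unfolding pts_def by blast+
qed

primrec mind :: "nat => 'v::euclidean_space => real" where
  "mind 0 x = norm (x - pts 0)"
| "mind (Suc N) x = min (mind N x) (norm (x - pts (Suc N)))"

lemma mind_nonneg: "0 \<le> mind N x" by (induction N) auto

lemma mind_le: "i \<le> N ==> mind N x \<le> norm (x - pts i)" by (induction N) (auto simp: le_Suc_eq min_le_iff_disj)

lemma mind_attained: "\<exists>i\<le>N. mind N x = norm (x - pts i)"
proof (induction N)
  case (Suc N)
  then obtain i where "i \<le> N" "mind N x = norm (x - pts i)" by blast
  then show ?case by (cases "mind N x \<le> norm (x - pts (Suc N))") (auto simp: min_def intro: exI[of _ i])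
qed simp

lemma mind_antimono: "M \<le> N ==> mind N x \<le> mind M x" by (induction N rule: dec_induct) auto

lemma mind_le_norm: "mind N x \<le> norm x" using mind_le[of 0 N x] by (simp add: pts(1))

lemma mind_lipschitz: "norm (mind N x - mind N y) \<le> 1 * norm (x - y)"
proof -
  have *: "mind N x \<le> mind N y + norm (x - y)" for x y :: 'a
  proof -
    obtain i where i: "i \<le> N" "mind N y = norm (y - pts i)" using mind_attained by blast
    have "mind N x \<le> norm (x - pts i)" by (rule mind_le[OF i(1)])
    also have "... \<le> norm (y - pts i) + norm (x - y)" using norm_triangle_ineq[of "y - pts i" "x - y"] by simp
    finally show ?thesis using i by simp
  qed
  show ?thesis using *[of x y] *[of y x] by (simp add: norm_minus_commute abs_le_iff)
qed

text \<open>Compactness of the ball: finitely many of the open \<open>eps\<close>-balls around the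
  dense points cover it.\<close>

lemma mind_uniform:
  fixes R :: real
  assumes "0 < eps"
  shows "\<exists>N. \<forall>x :: 'v::euclidean_space. norm x \<le> R --> mind N x \<le> eps"
proof -
  have cov: "cball (0 :: 'v) R \<subseteq> (\<Union>i\<in>UNIV. ball (pts i) eps)"
  proof
    fix x :: 'v
    obtain i where "norm (x - pts i) < eps" using pts(2)[OF assms] by blast
    then have "x \<in> ball (pts i) eps" by (simp add: dist_norm norm_minus_commute)
    then show "x \<in> (\<Union>i\<in>UNIV. ball (pts i) eps)" by blast
  qed
  obtain C where C: "C \<subseteq> UNIV" "finite C" "cball (0 :: 'v) R \<subseteq> (\<Union>i\<in>C. ball (pts i) eps)"
    by (rule compactE_image[where C = UNIV and f = "%i. ball (pts i :: 'v) eps", OF compact_cball _ cov]) (rule open_ball, blast)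
  obtain N where N: "\<And>i. i \<in> C ==> i \<le> N" using C(2) unfolding finite_nat_set_iff_bounded_le by blast
  have "mind N x \<le> eps" if "norm x \<le> R" for x :: 'v
  proof -
    have "x \<in> cball 0 R" using that by simp
    then have "x \<in> (\<Union>i\<in>C. ball (pts i) eps)" using C(3) by blast
    then obtain i where "i \<in> C" "x \<in> ball (pts i) eps" by blast
    then have i: "i \<in> C" "norm (x - pts i) < eps" by (simp_all add: dist_norm norm_minus_commute)
    then show ?thesis using mind_le[OF N[OF i(1)], of x] by simp
  qed
  then show ?thesis by blast
qed

section \<open>Componentwise McShane extension\<close>

definition vmax :: "real^'n => real^'n => real^'n" where
  "vmax u v = (\<chi> k. max (u $ k) (v $ k))"

lemma vmax_nth [simp]: "vmax u v $ k = max (u $ k) (v $ k)" by (simp add: vmax_def)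

lemma vmax_lipschitz: "norm (vmax u v - vmax u' v') \<le> real CARD('n) * (norm (u - u') + norm (v - v'))"
  for u v u' v' :: "real^'n::finite"
proof -
  have "norm (vmax u v - vmax u' v') \<le> (\<Sum>k\<in>UNIV. \<bar>(vmax u v - vmax u' v') $ k\<bar>)" by (rule norm_le_l1_cart)
  also have "... \<le> (\<Sum>k\<in>(UNIV :: 'n set). norm (u - u') + norm (v - v'))"
  proof (rule sum_mono)
    fix k :: 'n
    have "\<bar>(vmax u v - vmax u' v') $ k\<bar> \<le> \<bar>(u - u') $ k\<bar> + \<bar>(v - v') $ k\<bar>" by simp
    also have "... \<le> norm (u - u') + norm (v - v')" by (intro add_mono component_le_norm_cart)
    finally show "\<bar>(vmax u v - vmax u' v') $ k\<bar> \<le> norm (u - u') + norm (v - v')" .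
  qed
  finally show ?thesis by simp
qed

text \<open>
  The componentwise McShane extension, from the first \<open>N + 1\<close> points of a dense sequence, of a map
  that takes the value \<open>a i\<close> at \<open>pts i\<close>. It is Lipschitz in the data, so it acts on the completions.
\<close>

definition cone :: "real => 'v::euclidean_space => real^'n => 'v => real^'n" where
  "cone K p a x = a - (K * norm (x - p)) *\<^sub>R 1"

primrec mcshane :: "real => (nat => real^'n) => 'v::euclidean_space => nat => real^'n" where
  "mcshane K a x 0 = cone K (pts 0) (a 0) x"
| "mcshane K a x (Suc N) = vmax (mcshane K a x N) (cone K (pts (Suc N)) (a (Suc N)) x)"

lemma cone_nth [simp]: "cone K p a x $ k = a $ k - K * norm (x - p)" by (simp add: cone_def)

lemma cone_lipschitz:
  fixes a a' :: "real^'n::finite"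
  shows "norm (cone K p a x - cone K p a' x') \<le> (1 + \<bar>K\<bar> * norm (1 :: real^'n)) * (norm (a - a') + norm (x - x'))"
proof -
  have "cone K p a x - cone K p a' x' = (a - a') - (K * (norm (x - p) - norm (x' - p))) *\<^sub>R 1"
    by (simp add: cone_def scaleR_diff_left right_diff_distrib)
  then have "norm (cone K p a x - cone K p a' x') \<le> norm (a - a') + \<bar>K * (norm (x - p) - norm (x' - p))\<bar> * norm (1 :: real^'n)"
    using norm_triangle_ineq4[of "a - a'" "(K * (norm (x - p) - norm (x' - p))) *\<^sub>R (1 :: real^'n)"] by simp
  also have "\<bar>K * (norm (x - p) - norm (x' - p))\<bar> \<le> \<bar>K\<bar> * norm (x - x')"
    unfolding abs_mult using norm_triangle_ineq3[of "x - p" "x' - p"] by (intro mult_left_mono) auto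
  finally have "norm (cone K p a x - cone K p a' x') \<le> norm (a - a') + \<bar>K\<bar> * norm (x - x') * norm (1 :: real^'n)"
    by (simp add: mult_right_mono)
  also have "... \<le> (1 + \<bar>K\<bar> * norm (1 :: real^'n)) * (norm (a - a') + norm (x - x'))"
    by (simp add: algebra_simps)
  finally show ?thesis .
qed

lemma mcshane_ge: "i \<le> N ==> a i $ k - K * norm (x - pts i) \<le> mcshane K a x N $ k"
  by (induction N) (auto simp: le_Suc_eq le_max_iff_disj)

lemma mcshane_attained: "\<exists>i\<le>N. mcshane K a x N $ k = a i $ k - K * norm (x - pts i)"
proof (induction N)
  case (Suc N)
  then obtain i where "i \<le> N" "mcshane K a x N $ k = a i $ k - K * norm (x - pts i)" by blast
  then show ?case by (cases "mcshane K a x N $ k \<le> a (Suc N) $ k - K * norm (x - pts (Suc N))")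
      (auto simp: max_def intro: exI[of _ i])
qed simp

text \<open>The data satisfy the Lipschitz condition only up to errors \<open>e i\<close>. From
  above, the index where the maximum is attained is used; from below, the point nearest to
  \<open>x\<close>, at the price of \<open>mind N x\<close>. Passing from components to the norm
  costs the factor \<open>CARD('n)\<close>.\<close>

lemma mcshane_bound:
  fixes a :: "nat => real^'n::finite" and c :: "real^'n"
  assumes K: "0 \<le> K" and e: "\<And>i. i \<le> N ==> norm (a i - c) \<le> K * norm (pts i - y) + e i" "\<And>i. 0 \<le> e i"
  shows "norm (mcshane K a x N - c) \<le> real CARD('n) * (K * norm (x - y) + 2 * K * mind N x + (\<Sum>i\<le>N. e i))"
proof -
  have le: "e i \<le> (\<Sum>i\<le>N. e i)" if "i \<le> N" for i by (rule member_le_sum) (use that e(2) in auto)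
  have m0: "0 \<le> K * mind N x" by (rule mult_nonneg_nonneg[OF K mind_nonneg])
  have c: "\<bar>(mcshane K a x N - c) $ k\<bar> \<le> K * norm (x - y) + 2 * K * mind N x + (\<Sum>i\<le>N. e i)" for k
  proof -
    obtain i where i: "i \<le> N" "mcshane K a x N $ k = a i $ k - K * norm (x - pts i)" using mcshane_attained by blast
    obtain j where j: "j \<le> N" "mind N x = norm (x - pts j)" using mind_attained by blast
    have ck: "\<bar>a i $ k - c $ k\<bar> \<le> K * norm (pts i - y) + e i" if "i \<le> N" for i
      using component_le_norm_cart[of "a i - c" k] e(1)[OF that] by simp
    have tri1: "K * norm (pts i - y) \<le> K * (norm (x - pts i) + norm (x - y))"
      using norm_triangle_ineq4[of "x - y" "x - pts i"] K by (intro mult_left_mono) auto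
    have tri2: "K * norm (pts j - y) \<le> K * (norm (x - pts j) + norm (x - y))"
      using norm_triangle_ineq4[of "x - y" "x - pts j"] K by (intro mult_left_mono) auto
    have "mcshane K a x N $ k - c $ k \<le> K * norm (x - y) + (\<Sum>i\<le>N. e i)"
      using i ck[OF i(1)] tri1 le[OF i(1)] by (simp add: distrib_left)
    moreover have "c $ k - mcshane K a x N $ k \<le> K * norm (x - y) + 2 * K * mind N x + (\<Sum>i\<le>N. e i)"
      using mcshane_ge[OF j(1), of a k K x] j(2) ck[OF j(1)] tri2 le[OF j(1)] by (simp add: distrib_left)
    ultimately show ?thesis using m0 by (simp add: abs_le_iff)
  qed
  have "norm (mcshane K a x N - c) \<le> (\<Sum>k\<in>UNIV. \<bar>(mcshane K a x N - c) $ k\<bar>)" by (rule norm_le_l1_cart)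
  also have "... \<le> (\<Sum>k\<in>(UNIV :: 'n set). K * norm (x - y) + 2 * K * mind N x + (\<Sum>i\<le>N. e i))"
    by (intro sum_mono c)
  finally show ?thesis by simp
qed

section \<open>Substitution into a field at a fixed time\<close>

context G_setting
begin

text \<open>Inequalities in the completion are verified term by term and path by path, up to
  finitely many errors whose expectations tend to 0. In the applications these errors are positive
  parts of inequalities known already.\<close>

lemma LG_le_dom:
  fixes e :: "nat => ('d, real) rv"
  assumes u: "\<And>m. u m \<in> L_ip" and v: "\<And>m. v m \<in> L_ip" and e: "\<And>k m. k \<in> A ==> e k m \<in> L_ip"
    and A: "finite A" and lim: "\<And>k. k \<in> A ==> (%m. E (e k m)) ----> 0"
    and c: "0 \<le> c" and le: "\<And>m w. u m w \<le> v m w + c * (\<Sum>k\<in>A. e k m w)" and e0: "\<And>k m w. k \<in> A ==> 0 \<le> e k m w"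
  shows "LG_le E u v"
proof -
  have uvL: "(%w. max 0 (u m w - v m w)) \<in> L_ip" for m by (intro L_ip_max L_ip_const L_ip_diff u v)
  have sL: "(%w. \<Sum>k\<in>A. e k m w) \<in> L_ip" for m by (rule L_ip_sum[OF e])
  have up: "E (%w. max 0 (u m w - v m w)) \<le> c * (\<Sum>k\<in>A. E (e k m))" for m
  proof -
    have "E (%w. max 0 (u m w - v m w)) \<le> E (%w. c * (\<Sum>k\<in>A. e k m w))"
    proof (rule E_mono[OF uvL L_ip_mult[OF L_ip_const sL]])
      fix w
      have "0 \<le> c * (\<Sum>k\<in>A. e k m w)" using c e0 by (intro mult_nonneg_nonneg sum_nonneg)
      then show "max 0 (u m w - v m w) \<le> c * (\<Sum>k\<in>A. e k m w)" using le[of m w] by simp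
    qed
    also have "... = c * E (%w. \<Sum>k\<in>A. e k m w)" by (rule E_scale[OF sL c])
    also have "... \<le> c * (\<Sum>k\<in>A. E (e k m))" by (intro mult_left_mono E_sum e c)
    finally show ?thesis .
  qed
  have "(%m. c * (\<Sum>k\<in>A. E (e k m))) ----> c * (\<Sum>k\<in>A. 0)" by (intro tendsto_mult_left tendsto_sum lim)
  then have l0: "(%m. c * (\<Sum>k\<in>A. E (e k m))) ----> 0" by simp
  have "0 \<le> E (%w. max 0 (u m w - v m w))" for m by (rule E_nonneg[OF uvL]) simp
  then show ?thesis unfolding LG_le_def by (intro tendsto_sandwich[OF _ _ tendsto_const l0]) (use up in auto)
qed

definition pos_part :: "('d, real) rv => ('d, real) rv => ('d, real) rv" where
  "pos_part u v m w = max 0 (u m w - v m w)"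

lemma pos_part_LG: "u \<in> LG E p ==> v \<in> LG E p ==> ok p ==> pos_part u v \<in> LG E p" unfolding pos_part_def[abs_def]
  by (rule LG_lip2[of u p v "%a b. max 0 (a - b)" 1]) auto

lemma pos_part_nonneg: "0 \<le> pos_part u v m w" by (simp add: pos_part_def)

lemma pos_part_ge: "u m w \<le> v m w + pos_part u v m w" by (simp add: pos_part_def)

lemma LG_le_pos_part: "LG_le E u v ==> (%m. E (pos_part u v m)) ----> 0" by (simp add: LG_le_def pos_part_def[abs_def])

text \<open>\<open>LG_le\<close> is a statement in L^1. For elements of L^2 the positive part lies
  in L^2, and \<open>Np_2_zero\<close> makes it vanish there.\<close>

lemma LG_le_iff:
  assumes "u \<in> LG E 2" "v \<in> LG E 2"
  shows "LG_le E u v \<longleftrightarrow> Np 2 (pos_part u v) = 0"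
proof -
  have L: "pos_part u v \<in> LG E 2" by (rule pos_part_LG[OF assms ok2])
  have t: "(%m. E (%w. max 0 (u m w - v m w))) ----> Np 1 (pos_part u v)"
  proof -
    have "nr 1 (pos_part u v m) = E (%w. max 0 (u m w - v m w))" for m unfolding nr_1 pos_part_def by simp
    then show ?thesis using Np_tendsto[OF LG_2_1[OF L] ok1] by (simp only:)
  qed
  have "LG_le E u v \<longleftrightarrow> Np 1 (pos_part u v) = 0" unfolding LG_le_def
  proof
    assume "(%m. E (%w. max 0 (u m w - v m w))) ----> 0"
    then show "Np 1 (pos_part u v) = 0" by (rule LIMSEQ_unique[OF t])
  next
    assume "Np 1 (pos_part u v) = 0"
    then show "(%m. E (%w. max 0 (u m w - v m w))) ----> 0" using t by (simp only:)
  qed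
  also have "... \<longleftrightarrow> Np 2 (pos_part u v) = 0"
    using Np_2_zero[OF L] Np_1_le[OF L ok2] Np_nonneg[OF LG_2_1[OF L] ok1] by linarith
  finally show ?thesis .
qed

lemma LG_le_Np:
  assumes u: "u \<in> LG E 2" and v: "v \<in> LG E 2" and le: "LG_le E u v" and u0: "\<And>m w. 0 \<le> u m w"
  shows "Np 2 u \<le> Np 2 v"
proof -
  have L: "pos_part u v \<in> LG E 2" by (rule pos_part_LG[OF u v ok2])
  have "Np 2 u \<le> Np 2 (%m w. norm (v m w) + pos_part u v m w)"
  proof (rule Np_mono[OF u LG_add[OF LG_norm[OF v] L] ok2])
    fix m w show "norm (u m w) \<le> norm (norm (v m w) + pos_part u v m w)"
      using u0[of m w] pos_part_ge[of u m w v] pos_part_nonneg[of u v m w] by simp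
  qed simp_all
  also have "... \<le> Np 2 (%m w. norm (v m w)) + Np 2 (pos_part u v)" by (rule Np_triangle[OF LG_norm[OF v] L]) simp_all
  also have "... = Np 2 v" unfolding Np_norm using le LG_le_iff[OF u v] by simp
  finally show ?thesis .
qed

lemma LG_mind: "X \<in> LG E p ==> ok p ==> (%m w. mind N (X m w)) \<in> LG E p"
  by (rule LG_lip[of X p "mind N" 1, OF _ _ mind_lipschitz])

text \<open>Since \<open>mind N\<close> is Lipschitz with constant 1 for every \<open>N\<close>,
  \<open>X\<close> may be replaced by a close term \<open>X M\<close> in \<open>L_ip\<close>. On a
  large ball \<open>mind N\<close> is uniformly small; outside it is at most the norm, and the
  fourth moment of \<open>X M\<close> controls the contribution.\<close>

lemma Np_mind_tendsto:
  fixes X :: "('d, 'v::euclidean_space) rv"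
  assumes X: "X \<in> LG E 2"
  shows "(%N. Np 2 (%m w. mind N (X m w))) ----> 0"
proof (rule LIMSEQ_I)
  fix r :: real assume r: "0 < r"
  define eps where "eps = r / 4"
  have e: "0 < eps" using r by (simp add: eps_def)
  obtain M where M: "ds 2 (%_. X M) X < eps" using LG_approx[OF X ok2 e] by blast
  have XL: "X M \<in> L_ip" by (rule LG_L_ip[OF X])
  have X4: "(%w. norm (X M w) ^ 4) \<in> L_ip" by (rule norm_power_L_ip[OF XL])
  define F where "F = E (%w. norm (X M w) ^ 4)"
  have F0: "0 \<le> F" unfolding F_def by (rule E_nonneg[OF X4]) simp
  \<comment> \<open>Makes the fourth moment divided by \<open>R^2\<close> at most
    \<open>eps^2\<close>; the summand 1 avoids a radius 0.\<close>
  define R where "R = sqrt (F + 1) / eps"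
  have R0: "0 < R" using F0 e by (simp add: R_def add_nonneg_pos)
  have R2: "F / R^2 \<le> eps^2"
  proof -
    have "R^2 = (F + 1) / eps^2" using F0 by (simp add: R_def power_divide)
    then have "F / R^2 = eps^2 * (F / (F + 1))" by simp
    also have "... \<le> eps^2 * 1" using F0 by (intro mult_left_mono) auto
    finally show ?thesis by simp
  qed
  obtain N0 where N0: "\<And>x :: 'v. norm x \<le> R ==> mind N0 x \<le> eps" using mind_uniform[OF e, of R] by blast
  have "norm (Np 2 (%m w. mind N (X m w)) - 0) < r" if N: "N0 \<le> N" for N
  proof -
    have mL: "(%w. mind N (X M w)) \<in> L_ip" by (rule L_ip_plip[OF XL plip_lipschitz[OF mind_lipschitz]])
    have mLG: "(%m w. mind N (X m w)) \<in> LG E 2" by (rule LG_mind[OF X ok2])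
    have pt: "(norm (mind N x))^2 \<le> eps^2 + (1 / R^2) * norm x ^ 4" for x :: 'v
    proof (cases "norm x \<le> R")
      case True
      have "mind N x \<le> eps" using N0[OF True] mind_antimono[OF N, of x] by simp
      then have "(mind N x)^2 \<le> eps^2" using mind_nonneg by (intro power_mono)
      moreover have "0 \<le> (1 / R^2) * norm x ^ 4" by simp
      ultimately show ?thesis unfolding real_norm_def power2_abs by linarith
    next
      case False
      have "(mind N x)^2 \<le> (norm x)^2" by (intro power_mono mind_le_norm mind_nonneg)
      moreover have "(norm x)^2 * R^2 \<le> (norm x)^2 * (norm x)^2" using False R0 by (intro mult_left_mono power_mono) auto
      then have "(norm x)^2 \<le> (1 / R^2) * norm x ^ 4" using R0 by (simp add: pos_le_divide_eq power_add[symmetric])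
      moreover have "0 \<le> eps^2" by simp
      ultimately show ?thesis unfolding real_norm_def power2_abs by linarith
    qed
    have L2: "(%w. (1 / R^2) * norm (X M w) ^ 4) \<in> L_ip" by (rule L_ip_mult[OF L_ip_const X4])
    have "(nr 2 (%w. mind N (X M w)))^2 = E (%w. (norm (mind N (X M w)))\<^sup>2)" by (rule nr_2[OF mL])
    also have "... \<le> E (%w. eps\<^sup>2 + (1 / R^2) * norm (X M w) ^ 4)"
      by (rule E_mono[OF norm_power_L_ip[OF mL] L_ip_add[OF L_ip_const L2] pt])
    also have "... \<le> E (%w. eps\<^sup>2) + E (%w. (1 / R^2) * norm (X M w) ^ 4)" by (rule E_add[OF L_ip_const L2])
    also have "... = eps^2 + F / R^2" using E_scale[OF X4, of "1 / R^2"] by (simp add: E_const F_def)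
    also have "... \<le> (2 * eps)^2"
    proof -
      have "(2 * eps)^2 = 4 * eps^2" by (simp add: power_mult_distrib)
      then show ?thesis using R2 zero_le_power2[of eps] by linarith
    qed
    finally have nrb: "nr 2 (%w. mind N (X M w)) \<le> 2 * eps" by (rule power2_le_imp_le) (use e in simp)
    have "Np 2 (%m w. mind N (X m w)) \<le> Np 2 (%m w. mind N (X M w)) + ds 2 (%m w. mind N (X m w)) (%m w. mind N (X M w))"
      by (rule Np_le_ds[OF mLG LG_const[OF mL ok2] ok2])
    also have "ds 2 (%m w. mind N (X m w)) (%m w. mind N (X M w)) \<le> ds 2 X (%_. X M)"
    proof (rule Np_mono[OF LG_diff[OF mLG LG_const[OF mL]] LG_diff[OF X LG_const[OF XL]]])
      show "norm (mind N (X m w) - mind N (X M w)) \<le> norm (X m w - X M w)" for m w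
        using mind_lipschitz[of N "X m w" "X M w"] by simp
    qed simp_all
    finally have "Np 2 (%m w. mind N (X m w)) \<le> 2 * eps + eps" using nrb M by (simp add: Np_const ds_commute[of 2 X])
    moreover have "0 \<le> Np 2 (%m w. mind N (X m w))" by (rule Np_nonneg[OF mLG ok2])
    ultimately show ?thesis using r by (simp add: eps_def)
  qed
  then show "\<exists>no. \<forall>N\<ge>no. norm (Np 2 (%m w. mind N (X m w)) - 0) < r" by blast
qed

text \<open>Two candidates are compared at the point of the finite grid that is nearest to \<open>X\<close>.\<close>

lemma compare_on_grid:
  fixes X :: "('d, 'v::euclidean_space) rv" and Y Y' :: "('d, 'u::euclidean_space) rv"
  assumes X: "X \<in> LG E 2" and Y: "Y \<in> LG E 2" "Y' \<in> LG E 2" and f: "\<And>i. f i \<in> LG E 2"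
    and Z: "Z \<in> LG E 2" "Z' \<in> LG E 2"
    and le: "\<And>i. i \<le> N ==> LG_le E (%m w. norm (Y m w - f i m w)) (%m w. A * norm (X m w - pts i) + Z m w)"
    and le': "\<And>i. i \<le> N ==> LG_le E (%m w. norm (Y' m w - f i m w)) (%m w. A' * norm (X m w - pts i) + Z' m w)"
  shows "ds 2 Y Y' \<le> \<bar>A + A'\<bar> * Np 2 (%m w. mind N (X m w)) + Np 2 Z + Np 2 Z'"
proof -
  define u where "u i m w = norm (Y m w - f i m w)" for i m w
  define v where "v i m w = A * norm (X m w - pts i) + Z m w" for i m w
  define u' where "u' i m w = norm (Y' m w - f i m w)" for i m w
  define v' where "v' i m w = A' * norm (X m w - pts i) + Z' m w" for i m w
  have XpL: "(%m w. c * norm (X m w - pts i)) \<in> LG E 2" for c i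
    using LG_scaleR[OF LG_norm[OF LG_diff[OF X LG_const[OF L_ip_const, of 2 "pts i"]]], of c] by simp
  have uL: "u i \<in> LG E 2" "u' i \<in> LG E 2" for i unfolding u_def u'_def by (intro LG_norm LG_diff Y f ok2)+
  have vL: "v i \<in> LG E 2" "v' i \<in> LG E 2" for i unfolding v_def v'_def by (intro LG_add XpL Z ok2)+
  define e where "e i m w = pos_part (u i) (v i) m w + pos_part (u' i) (v' i) m w" for i m w
  have ppL: "pos_part (u i) (v i) m \<in> L_ip" "pos_part (u' i) (v' i) m \<in> L_ip" for i m
    by (rule LG_L_ip[OF pos_part_LG[OF uL(1) vL(1) ok2]], rule LG_L_ip[OF pos_part_LG[OF uL(2) vL(2) ok2]])
  have eL: "e i m \<in> L_ip" for i m unfolding e_def[abs_def] by (rule L_ip_add[OF ppL])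
  have e0: "0 \<le> e i m w" for i m w by (simp add: e_def pos_part_nonneg)
  have elim: "(%m. E (e i m)) ----> 0" if "i \<le> N" for i
  proof (rule tendsto_sandwich[OF _ _ tendsto_const])
    show "(%m. E (pos_part (u i) (v i) m) + E (pos_part (u' i) (v' i) m)) ----> 0"
      using tendsto_add[OF LG_le_pos_part[OF le[OF that]] LG_le_pos_part[OF le'[OF that]]]
      unfolding u_def v_def u'_def v'_def by simp
    show "\<forall>\<^sub>F m in sequentially. 0 \<le> E (e i m)" using E_nonneg[OF eL e0] by simp
    show "\<forall>\<^sub>F m in sequentially. E (e i m) \<le> E (pos_part (u i) (v i) m) + E (pos_part (u' i) (v' i) m)"
      unfolding e_def[abs_def] using E_add[OF ppL] by simp
  qed
  define U where "U m w = (A + A') * mind N (X m w) + (Z m w + Z' m w)" for m w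
  have mL: "(%m w. mind N (X m w)) \<in> LG E 2" by (rule LG_mind[OF X ok2])
  have mcL: "(%m w. (A + A') * mind N (X m w)) \<in> LG E 2" using LG_scaleR[OF mL ok2, of "A + A'"] by simp
  have ZL: "(%m w. Z m w + Z' m w) \<in> LG E 2" by (rule LG_add[OF Z ok2])
  have wL: "U \<in> LG E 2" unfolding U_def[abs_def] by (rule LG_add[OF mcL ZL ok2])
  have DL: "(%m w. norm (Y m w - Y' m w)) \<in> LG E 2" by (intro LG_norm LG_diff Y ok2)
  have "LG_le E (%m w. norm (Y m w - Y' m w)) U"
  proof (rule LG_le_dom[where A = "{..N}" and e = e and c = 1])
    fix m w
    obtain i where i: "i \<le> N" "mind N (X m w) = norm (X m w - pts i)" using mind_attained by blast
    have "norm (Y m w - Y' m w) \<le> u i m w + u' i m w"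
      unfolding u_def u'_def using norm_triangle_ineq4[of "Y m w - f i m w" "Y' m w - f i m w"] by simp
    also have "... \<le> v i m w + v' i m w + e i m w"
      unfolding e_def using pos_part_ge[of "u i" m w "v i"] pos_part_ge[of "u' i" m w "v' i"] by linarith
    also have "v i m w + v' i m w = U m w" unfolding v_def v'_def U_def i(2) by (simp add: algebra_simps)
    also have "e i m w \<le> (\<Sum>i\<le>N. e i m w)" by (rule member_le_sum) (use i e0 in auto)
    finally show "norm (Y m w - Y' m w) \<le> U m w + 1 * (\<Sum>i\<le>N. e i m w)" by simp
  qed (use LG_L_ip[OF DL] LG_L_ip[OF wL] eL elim e0 in auto)
  then have "Np 2 (%m w. norm (Y m w - Y' m w)) \<le> Np 2 U" by (rule LG_le_Np[OF DL wL]) simp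
  then have "ds 2 Y Y' \<le> Np 2 U" by (simp only: Np_norm)
  also have "... \<le> Np 2 (%m w. (A + A') * mind N (X m w)) + Np 2 (%m w. Z m w + Z' m w)"
    unfolding U_def[abs_def] by (rule Np_triangle[OF mcL ZL ok2])
  also have "Np 2 (%m w. (A + A') * mind N (X m w)) = \<bar>A + A'\<bar> * Np 2 (%m w. mind N (X m w))"
    using Np_scaleR[OF mL ok2, of "A + A'"] by simp
  finally show ?thesis using Np_triangle[OF Z ok2] by simp
qed

text \<open>After the second condition is moved from \<open>X'\<close> to \<open>X\<close>, both
  constants multiply only the distance of \<open>X\<close> from the grid, whose norm tends to 0.
  What remains is the cost of the move, \<open>\<bar>A'\<bar>\<close> times the distance of
  \<open>X\<close> and \<open>X'\<close>.\<close>

lemma subst_compare: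
  fixes X X' :: "('d, real^'n::finite) rv"
  assumes X: "X \<in> LG E 2" "X' \<in> LG E 2" and Y: "Y \<in> LG E 2" "Y' \<in> LG E 2" and f: "\<And>x. f x \<in> LG E 2"
    and s: "\<And>x. LG_le E (%m w. norm (Y m w - f x m w)) (%m w. A * norm (X m w - x))"
    and s': "\<And>x. LG_le E (%m w. norm (Y' m w - f x m w)) (%m w. A' * norm (X' m w - x))"
  shows "ds 2 Y Y' \<le> \<bar>A'\<bar> * ds 2 X X'"
proof -
  define Z' where "Z' m w = \<bar>A'\<bar> * norm (X m w - X' m w)" for m w
  have DL: "(%m w. norm (X m w - X' m w)) \<in> LG E 2" by (intro LG_norm LG_diff X ok2)
  have Z'L: "Z' \<in> LG E 2" unfolding Z'_def[abs_def] using LG_scaleR[OF DL ok2, of "\<bar>A'\<bar>"] by simp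
  have Z': "Np 2 Z' = \<bar>A'\<bar> * ds 2 X X'"
    unfolding Z'_def[abs_def] using Np_scaleR[OF DL ok2, of "\<bar>A'\<bar>"] by (simp add: Np_norm)
  have ZL: "(%m w. 0 :: real) \<in> LG E 2" by (rule LG_const[OF L_ip_const ok2])
  have Z: "Np 2 (%m w. 0 :: real) = 0" by (simp add: Np_const nr_const)
  have le': "LG_le E (%m w. norm (Y' m w - f x m w)) (%m w. \<bar>A'\<bar> * norm (X m w - x) + Z' m w)" for x
  proof -
    define u where "u = (%m w. norm (Y' m w - f x m w))"
    define v where "v = (%m w. A' * norm (X' m w - x))"
    have xL: "(%m w. c * norm (V m w - x)) \<in> LG E 2" if "V \<in> LG E 2" for c and V :: "('d, real^'n) rv"
      using LG_scaleR[OF LG_norm[OF LG_diff[OF that LG_const[OF L_ip_const, of 2 x]]], of c] by simp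
    have uL: "u \<in> LG E 2" unfolding u_def by (intro LG_norm LG_diff Y f ok2)
    have vL: "v \<in> LG E 2" unfolding v_def by (rule xL[OF X(2)])
    have rL: "(%m w. \<bar>A'\<bar> * norm (X m w - x) + Z' m w) \<in> LG E 2" by (intro LG_add xL X Z'L ok2)
    have "LG_le E u (%m w. \<bar>A'\<bar> * norm (X m w - x) + Z' m w)"
    proof (rule LG_le_dom[where A = "{0}" and e = "%_. pos_part u v" and c = 1])
      fix m w
      have "v m w \<le> \<bar>A'\<bar> * norm (X' m w - x)" unfolding v_def by (intro mult_right_mono) auto
      also have "... \<le> \<bar>A'\<bar> * (norm (X m w - x) + norm (X m w - X' m w))"
        using norm_triangle_ineq4[of "X m w - x" "X m w - X' m w"] by (intro mult_left_mono) auto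
      finally have "v m w \<le> \<bar>A'\<bar> * norm (X m w - x) + Z' m w" unfolding Z'_def by (simp add: distrib_left)
      then show "u m w \<le> \<bar>A'\<bar> * norm (X m w - x) + Z' m w + 1 * (\<Sum>k\<in>{0}. pos_part u v m w)"
        using pos_part_ge[of u m w v] by simp
    next
      show "(%m. E (pos_part u v m)) ----> 0" unfolding u_def v_def by (rule LG_le_pos_part[OF s'])
    qed (use LG_L_ip[OF uL] LG_L_ip[OF rL] LG_L_ip[OF pos_part_LG[OF uL vL]] pos_part_nonneg in auto)
    then show ?thesis by (simp add: u_def)
  qed
  have b: "ds 2 Y Y' \<le> \<bar>A + \<bar>A'\<bar>\<bar> * Np 2 (%m w. mind N (X m w)) + 0 + \<bar>A'\<bar> * ds 2 X X'" for N
    using compare_on_grid[of X Y Y' "%i. f (pts i)" "%_ _. 0" Z' N A "\<bar>A'\<bar>", OF X(1) Y f ZL Z'L] s le' Z Z' by simp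
  have "(%N. \<bar>A + \<bar>A'\<bar>\<bar> * Np 2 (%m w. mind N (X m w)) + 0 + \<bar>A'\<bar> * ds 2 X X') ----> \<bar>A + \<bar>A'\<bar>\<bar> * 0 + 0 + \<bar>A'\<bar> * ds 2 X X'"
    by (intro tendsto_intros Np_mind_tendsto X)
  then have "(%N. \<bar>A + \<bar>A'\<bar>\<bar> * Np 2 (%m w. mind N (X m w)) + 0 + \<bar>A'\<bar> * ds 2 X X') ----> \<bar>A'\<bar> * ds 2 X X'"
    by simp
  then show ?thesis by (rule LIMSEQ_le_const) (use b in blast)
qed

text \<open>The random data \<open>f (pts i)\<close> and the random point \<open>X\<close> enter a
  deterministic map that is Lipschitz in finitely many arguments. So this is meaningful termwise, in
  contrast to \<open>f(X)\<close> itself.\<close>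

definition approx_subst :: "real => (real^'n => ('d, real^'n) rv) => ('d, real^'n) rv => nat => ('d, real^'n::finite) rv" where
  "approx_subst K f X N m w = mcshane K (%i. f (pts i) m w) (X m w) N"

lemma approx_subst_LG:
  fixes X :: "('d, real^'n::finite) rv"
  assumes X: "X \<in> LG E 2" and f: "\<And>x. f x \<in> LG E 2"
  shows "approx_subst K f X N \<in> LG E 2"
proof -
  have c: "(%m w. cone K p (f q m w) (X m w)) \<in> LG E 2" for p q by (rule LG_lip2[OF f X ok2 cone_lipschitz])
  have "(%m w. mcshane K (%i. f (pts i) m w) (X m w) N) \<in> LG E 2"
  proof (induction N)
    case (Suc N)
    show ?case unfolding mcshane.simps by (rule LG_lip2[OF Suc c ok2 vmax_lipschitz])
  qed (use c in simp)
  then show ?thesis unfolding approx_subst_def[abs_def] .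
qed

lemma approx_subst_le:
  fixes X :: "('d, real^'n::finite) rv"
  assumes X: "X \<in> LG E 2" and f: "\<And>x. f x \<in> LG E 2" and K: "0 \<le> K" and lip: "lipschitz_field E K f"
  shows "LG_le E (%m w. norm (approx_subst K f X N m w - f y m w))
    (%m w. real CARD('n) * K * norm (X m w - y) + 2 * real CARD('n) * K * mind N (X m w))"
proof -
  define e where "e i = pos_part (%m w. norm (f (pts i) m w - f y m w)) (%m w. K * norm (pts i - y))" for i
  have L1: "(%m w. norm (approx_subst K f X N m w - f y m w)) \<in> LG E 2" by (intro LG_norm LG_diff approx_subst_LG X f ok2)
  have nL: "(%m w. norm (X m w - y)) \<in> LG E 2" by (intro LG_norm LG_diff LG_const L_ip_const X ok2)
  have L2: "(%m w. real CARD('n) * K * norm (X m w - y) + 2 * real CARD('n) * K * mind N (X m w)) \<in> LG E 2"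
    using LG_add[OF LG_scaleR[OF nL, of "real CARD('n) * K"] LG_scaleR[OF LG_mind[OF X, of N], of "2 * real CARD('n) * K"]] by simp
  show ?thesis
  proof (rule LG_le_dom[where A = "{..N}" and e = e and c = "real CARD('n)"])
    fix m w
    have "norm (f (pts i) m w - f y m w) \<le> K * norm (pts i - y) + e i m w" for i unfolding e_def by (rule pos_part_ge)
    then have "norm (approx_subst K f X N m w - f y m w) \<le>
        real CARD('n) * (K * norm (X m w - y) + 2 * K * mind N (X m w) + (\<Sum>i\<le>N. e i m w))"
      unfolding approx_subst_def by (intro mcshane_bound[OF K]) (auto simp: e_def pos_part_nonneg)
    then show "norm (approx_subst K f X N m w - f y m w) \<le>
        real CARD('n) * K * norm (X m w - y) + 2 * real CARD('n) * K * mind N (X m w) + real CARD('n) * (\<Sum>i\<le>N. e i m w)"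
      by (simp add: algebra_simps)
  next
    fix k m
    have "pos_part (%m w. norm (f (pts k) m w - f y m w)) (%m w. K * norm (pts k - y)) \<in> LG E 2"
      by (intro pos_part_LG LG_norm LG_diff f LG_const L_ip_const ok2)
    then show "e k m \<in> L_ip" unfolding e_def by (rule LG_L_ip)
    show "(%m. E (e k m)) ----> 0"
      unfolding e_def by (rule LG_le_pos_part) (use lip in \<open>simp add: lipschitz_field_def\<close>)
  qed (use LG_L_ip[OF L1] LG_L_ip[OF L2] in \<open>auto simp: e_def pos_part_nonneg\<close>)
qed

text \<open>The 6 collects a 2 from the comparison on the grid and a 2 from each of the two
  remainders.\<close>

lemma approx_subst_Cauchy:
  fixes X :: "('d, real^'n::finite) rv"
  assumes X: "X \<in> LG E 2" and f: "\<And>x. f x \<in> LG E 2" and K: "0 \<le> K" and lip: "lipschitz_field E K f" and "N \<le> M"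
  shows "ds 2 (approx_subst K f X M) (approx_subst K f X N) \<le> 6 * real CARD('n) * K * Np 2 (%m w. mind N (X m w))"
proof -
  define c where "c = real CARD('n) * K"
  have c0: "0 \<le> c" using K by (simp add: c_def)
  have mL: "(%m w. mind J (X m w)) \<in> LG E 2" for J by (rule LG_mind[OF X ok2])
  have ZL: "(%m w. 2 * c * mind J (X m w)) \<in> LG E 2" for J using LG_scaleR[OF mL ok2, of "2 * c"] by simp
  have Z: "Np 2 (%m w. 2 * c * mind J (X m w)) = 2 * c * Np 2 (%m w. mind J (X m w))" for J
    using Np_scaleR[OF mL ok2, of "2 * c" J] c0 by simp
  have le: "LG_le E (%m w. norm (approx_subst K f X J m w - f (pts i) m w)) (%m w. c * norm (X m w - pts i) + 2 * c * mind J (X m w))" for J i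
    using approx_subst_le[OF X f K lip, of J "pts i"] by (simp add: c_def mult.assoc)
  have "Np 2 (%m w. mind M (X m w)) \<le> Np 2 (%m w. mind N (X m w))"
    by (rule Np_mono[OF mL mL ok2]) (simp add: mind_nonneg mind_antimono[OF \<open>N \<le> M\<close>])
  then have mm: "c * Np 2 (%m w. mind M (X m w)) \<le> c * Np 2 (%m w. mind N (X m w))" using c0 by (rule mult_left_mono)
  have "ds 2 (approx_subst K f X M) (approx_subst K f X N) \<le> \<bar>c + c\<bar> * Np 2 (%m w. mind N (X m w)) +
      Np 2 (%m w. 2 * c * mind M (X m w)) + Np 2 (%m w. 2 * c * mind N (X m w))"
    by (rule compare_on_grid[where f = "%i. f (pts i)"]) (intro X approx_subst_LG f ZL le)+
  also have "... \<le> 6 * c * Np 2 (%m w. mind N (X m w))" unfolding Z using mm c0 by (simp add: algebra_simps)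
  finally show ?thesis by (simp add: c_def mult.assoc)
qed

text \<open>Completeness with a rate: the bound on the distance to all later terms passes to the
  limit.\<close>

lemma LG_limit:
  fixes x :: "nat => ('d, 'v::euclidean_space) rv"
  assumes x: "\<And>m. x m \<in> LG E 2" and near: "\<And>m k. m \<le> k ==> ds 2 (x k) (x m) \<le> b m" and b: "b ----> 0"
  shows "\<exists>z\<in>LG E 2. (%m. ds 2 (x m) z) ----> 0 \<and> (\<forall>m. ds 2 (x m) z \<le> b m)"
proof -
  have "\<exists>z\<in>LG E 2. (%k. ds 2 (x k) z) ----> 0"
  proof (rule LG_complete[OF x ok2])
    fix eps :: real assume "0 < eps"
    then have "\<forall>\<^sub>F m in sequentially. b m < eps" using order_tendstoD(2)[OF b] by blast
    then obtain J where J: "\<And>m. J \<le> m ==> b m < eps" unfolding eventually_sequentially by blast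
    have "ds 2 (x k) (x l) < eps" if "J \<le> k" "J \<le> l" for k l
      using near[of l k] near[of k l] J[OF that(1)] J[OF that(2)] ds_commute[of 2 "x k" "x l"] by (cases "l \<le> k") auto
    then show "\<exists>M. \<forall>k\<ge>M. \<forall>l\<ge>M. ds 2 (x k) (x l) < eps" by blast
  qed
  then obtain z where z: "z \<in> LG E 2" "(%k. ds 2 (x k) z) ----> 0" by blast
  have "ds 2 (x m) z \<le> b m" for m
  proof (rule LIMSEQ_le_const)
    show "(%k. b m + ds 2 (x k) z) ----> b m" using tendsto_add[OF tendsto_const z(2), of "b m"] by simp
    have "ds 2 (x m) z \<le> b m + ds 2 (x k) z" if "m \<le> k" for k
      using near[OF that] ds_triangle[OF x x z(1) ok2, of m k] ds_commute[of 2 "x k" "x m"] by linarith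
    then show "\<exists>J. \<forall>k\<ge>J. ds 2 (x m) z \<le> b m + ds 2 (x k) z" by blast
  qed
  with z show ?thesis by blast
qed

text \<open>The limit of the approximants; in their estimate the remainder with \<open>mind\<close>
  disappears. The rate is kept in the conclusion because it controls the approximation of processes
  at all times together.\<close>

lemma subst_exists:
  fixes X :: "('d, real^'n::finite) rv"
  assumes X: "X \<in> LG E 2" and f: "\<And>x. f x \<in> LG E 2" and K: "0 \<le> K" and lip: "lipschitz_field E K f"
  shows "\<exists>Y\<in>LG E 2. (\<forall>N. ds 2 (approx_subst K f X N) Y \<le> 6 * real CARD('n) * K * Np 2 (%m w. mind N (X m w))) \<and>
    (\<forall>x. LG_le E (%m w. norm (Y m w - f x m w)) (%m w. real CARD('n) * K * norm (X m w - x)))"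
proof -
  define c where "c = 6 * real CARD('n) * K"
  have c0: "0 \<le> c" using K by (simp add: c_def)
  define mu where "mu N = Np 2 (%m w. mind N (X m w))" for N
  have mL: "(%m w. mind J (X m w)) \<in> LG E 2" for J by (rule LG_mind[OF X ok2])
  have AL: "approx_subst K f X N \<in> LG E 2" for N by (rule approx_subst_LG[OF X f])
  have lim: "(%N. c * mu N) ----> 0" using tendsto_mult_left[OF Np_mind_tendsto[OF X], of c] by (simp add: mu_def)
  have C: "ds 2 (approx_subst K f X M) (approx_subst K f X N) \<le> c * mu N" if "N \<le> M" for M N
    unfolding c_def mu_def by (rule approx_subst_Cauchy[OF X f K lip that])
  obtain Y where YL: "Y \<in> LG E 2" and Y: "(%N. ds 2 (approx_subst K f X N) Y) ----> 0"
    and near: "\<And>N. ds 2 (approx_subst K f X N) Y \<le> c * mu N"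
    using LG_limit[OF AL C lim] by blast
  have le: "LG_le E (%m w. norm (Y m w - f x m w)) (%m w. real CARD('n) * K * norm (X m w - x))" for x
  proof -
    define n where "n = real CARD('n) * K"
    have n0: "0 \<le> n" using K by (simp add: n_def)
    define u where "u = (%m w. norm (Y m w - f x m w))"
    define v where "v = (%m w. n * norm (X m w - x))"
    define a where "a N = (%m w. norm (approx_subst K f X N m w - f x m w))" for N
    define b where "b N = (%m w. n * norm (X m w - x) + 2 * n * mind N (X m w))" for N
    have nL: "(%m w. norm (X m w - x)) \<in> LG E 2" by (intro LG_norm LG_diff LG_const L_ip_const X ok2)
    have uL: "u \<in> LG E 2" unfolding u_def by (intro LG_norm LG_diff YL f ok2)
    have vL: "v \<in> LG E 2" unfolding v_def using LG_scaleR[OF nL ok2, of n] by simp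
    have m2L: "(%m w. 2 * n * mind N (X m w)) \<in> LG E 2" for N using LG_scaleR[OF mL ok2, of "2 * n"] by simp
    have aL: "a N \<in> LG E 2" for N unfolding a_def by (intro LG_norm LG_diff AL f ok2)
    have bL: "b N \<in> LG E 2" for N unfolding b_def using LG_add[OF vL m2L ok2] by (simp add: v_def)
    have abz: "Np 2 (pos_part (a N) (b N)) = 0" for N
      using approx_subst_le[OF X f K lip, of N x] unfolding LG_le_iff[OF aL bL, symmetric]
      by (simp add: a_def b_def n_def mult.assoc)
    have pL: "pos_part (a N) (b N) \<in> LG E 2" for N by (rule pos_part_LG[OF aL bL ok2])
    have DL: "(%m w. norm (approx_subst K f X N m w - Y m w)) \<in> LG E 2" for N by (intro LG_norm LG_diff AL YL ok2)
    have bound: "Np 2 (pos_part u v) \<le> ds 2 (approx_subst K f X N) Y + (2 * n) * mu N" for N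
    proof -
      have "Np 2 (pos_part u v) \<le> Np 2 (%m w. norm (approx_subst K f X N m w - Y m w) + (2 * n * mind N (X m w) + pos_part (a N) (b N) m w))"
      proof (rule Np_mono[OF pos_part_LG[OF uL vL] LG_add[OF DL LG_add[OF m2L pL]]])
        fix m w
        have r0: "0 \<le> 2 * n * mind N (X m w)" using n0 mind_nonneg[of N "X m w"] by simp
        have "u m w \<le> norm (approx_subst K f X N m w - Y m w) + a N m w" unfolding u_def a_def
          using norm_triangle_ineq4[of "approx_subst K f X N m w - f x m w" "approx_subst K f X N m w - Y m w"] by simp
        also have "a N m w \<le> v m w + 2 * n * mind N (X m w) + pos_part (a N) (b N) m w"
          using pos_part_ge[of "a N" m w "b N"] by (simp add: b_def v_def)
        finally have "u m w - v m w \<le> norm (approx_subst K f X N m w - Y m w) + (2 * n * mind N (X m w) + pos_part (a N) (b N) m w)"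
          by simp
        then have "pos_part u v m w \<le> norm (approx_subst K f X N m w - Y m w) + (2 * n * mind N (X m w) + pos_part (a N) (b N) m w)"
          using r0 pos_part_nonneg[of "a N" "b N" m w] by (simp add: pos_part_def[of u v])
        then show "norm (pos_part u v m w) \<le> norm (norm (approx_subst K f X N m w - Y m w) + (2 * n * mind N (X m w) + pos_part (a N) (b N) m w))"
          using pos_part_nonneg[of u v m w] by simp
      qed simp_all
      also have "... \<le> ds 2 (approx_subst K f X N) Y + (Np 2 (%m w. 2 * n * mind N (X m w)) + Np 2 (pos_part (a N) (b N)))"
        using Np_triangle[OF DL[of N] LG_add[OF m2L[of N] pL[of N] ok2] ok2] Np_triangle[OF m2L[of N] pL[of N] ok2]
        by (simp add: Np_norm)
      also have "Np 2 (%m w. 2 * n * mind N (X m w)) = (2 * n) * mu N"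
        using Np_scaleR[OF mL ok2, of "2 * n" N] n0 by (simp add: mu_def)
      finally show ?thesis using abz by simp
    qed
    have "(%N. ds 2 (approx_subst K f X N) Y + (2 * n) * mu N) ----> 0 + (2 * n) * 0"
      unfolding mu_def by (intro tendsto_add Y tendsto_mult_left Np_mind_tendsto X)
    then have "(%N. ds 2 (approx_subst K f X N) Y + (2 * n) * mu N) ----> 0" by simp
    then have "Np 2 (pos_part u v) \<le> 0" by (rule LIMSEQ_le_const) (use bound in blast)
    then have "Np 2 (pos_part u v) = 0" using Np_nonneg[OF pos_part_LG[OF uL vL ok2] ok2] by simp
    then show ?thesis using LG_le_iff[OF uL vL] by (simp add: u_def v_def n_def)
  qed
  show ?thesis using YL near le by (auto simp: c_def mu_def)
qed

text \<open>The constants in \<open>is_subst\<close> are unspecified and may differ. The version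
  \<open>Z\<close> of \<open>f(X')\<close> from \<open>subst_exists\<close>, with its known
  constant, is at distance 0 from \<open>Y'\<close> and yields the estimate against
  \<open>Y\<close>.\<close>

lemma subst_lipschitz:
  fixes X X' :: "('d, real^'n::finite) rv"
  assumes X: "X \<in> LG E 2" "X' \<in> LG E 2" and Y: "Y \<in> LG E 2" "Y' \<in> LG E 2" and f: "\<And>x. f x \<in> LG E 2"
    and K: "0 \<le> K" and lip: "lipschitz_field E K f" and s: "is_subst E f X Y" "is_subst E f X' Y'"
  shows "ds 2 Y Y' \<le> real CARD('n) * K * ds 2 X X'"
proof -
  obtain Z where Z: "Z \<in> LG E 2" "\<And>x. LG_le E (%m w. norm (Z m w - f x m w)) (%m w. real CARD('n) * K * norm (X' m w - x))"
    using subst_exists[OF X(2) f K lip] by blast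
  obtain A where A: "\<And>x. LG_le E (%m w. norm (Y m w - f x m w)) (%m w. A * norm (X m w - x))"
    using s(1) unfolding is_subst_def by blast
  obtain A' where A': "\<And>x. LG_le E (%m w. norm (Y' m w - f x m w)) (%m w. A' * norm (X' m w - x))"
    using s(2) unfolding is_subst_def by blast
  have "ds 2 Z Y' \<le> \<bar>A'\<bar> * ds 2 X' X'" by (rule subst_compare[OF X(2,2) Z(1) Y(2) f Z(2) A'])
  moreover have "ds 2 Y Z \<le> \<bar>real CARD('n) * K\<bar> * ds 2 X X'" by (rule subst_compare[OF X Y(1) Z(1) f A Z(2)])
  ultimately show ?thesis using ds_triangle[OF Y(1) Z(1) Y(2) ok2] K ds_self[of 2 X'] by simp
qed

end

section \<open>Substitution into processes\<close>

context G_time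
begin

lemma approx_subst_MGbar:
  fixes X :: "('d, real^'n::finite) process"
  assumes X: "X \<in> MGbar E 2 T" and f: "\<And>x. (%t. f t x) \<in> MGbar E 2 T"
  shows "(%t. approx_subst K (f t) (X t) N) \<in> MGbar E 2 T"
proof -
  have c: "(%t m w. cone K p (f t q m w) (X t m w)) \<in> MGbar E 2 T" for p q by (rule MGbar_lip2[OF f X ok2 cone_lipschitz])
  have "(%t m w. mcshane K (%i. f t (pts i) m w) (X t m w) N) \<in> MGbar E 2 T"
  proof (induction N)
    case (Suc N)
    show ?case unfolding mcshane.simps by (rule MGbar_lip2[OF Suc c ok2 vmax_lipschitz])
  qed (use c in simp)
  then show ?thesis unfolding approx_subst_def[abs_def] .
qed

text \<open>The substitution is chosen separately at each time, so membership in
  \<open>MGbar\<close> has to be recovered. The error of the \<open>N\<close>-th approximant is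
  bounded by the distance of \<open>X t\<close> from the grid points; this tends to 0 at each time
  and is dominated by the norm of \<open>X t\<close>.\<close>

lemma subst_process_exists:
  fixes X :: "('d, real^'n::finite) process"
  assumes X: "X \<in> MGbar E 2 T" and f: "\<And>x. (%t. f t x) \<in> MGbar E 2 T" and K: "0 \<le> K"
    and lip: "\<And>t. t \<in> {0..T} ==> lipschitz_field E K (f t)"
  shows "\<exists>beta. is_subst_process E T f X beta"
proof -
  have XL: "X t \<in> LG E 2" if "t \<in> {0..T}" for t by (rule MGbar_LG[OF X that])
  have fL: "f t x \<in> LG E 2" if "t \<in> {0..T}" for t x using MGbar_LG[OF f that] by simp
  define mu where "mu N t = Np 2 (%m w. mind N (X t m w))" for N t
  define c where "c = 6 * real CARD('n) * K"
  have c0: "0 \<le> c" using K by (simp add: c_def)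
  have "\<forall>t. \<exists>Y. t \<in> {0..T} --> Y \<in> LG E 2 \<and> (\<forall>N. ds 2 (approx_subst K (f t) (X t) N) Y \<le> c * mu N t) \<and> is_subst E (f t) (X t) Y"
    unfolding is_subst_def c_def mu_def using subst_exists[OF XL fL K lip] by blast
  from choice[OF this] obtain beta where beta: "\<And>t. t \<in> {0..T} ==> beta t \<in> LG E 2"
    "\<And>t N. t \<in> {0..T} ==> ds 2 (approx_subst K (f t) (X t) N) (beta t) \<le> c * mu N t"
    "\<And>t. t \<in> {0..T} ==> is_subst E (f t) (X t) (beta t)" by blast
  have zM: "(%_ _ _. 0 :: 'v::euclidean_space) \<in> MGbar E 2 T" by (rule padp_MGbar[OF padp_const]) simp_all
  have mM: "(%t m w. mind N (X t m w)) \<in> MGbar E 2 T" for N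
  proof (rule MGbar_lip2[OF X X ok2, of "%a b. mind N a" 1])
    show "norm (mind N a - mind N a') \<le> 1 * (norm (a - a') + norm (b - b'))" for a a' b b' :: "real^'n"
      by (rule order_trans[OF mind_lipschitz]) simp
  qed
  \<comment> \<open>Written as a gap against the zero process, the squared error bound is integrable
    in time.\<close>
  have mueq: "(mu N t)^2 = gap 2 (%t m w. mind N (X t m w)) (%_ _ _. 0) t" for N t by (simp add: gap_def mu_def)
  have muint: "integrable (LB T) (%t. (mu N t)\<^sup>2)" for N
    using gap_integrable[OF mM zM ok2, of N] by (simp add: mueq[abs_def])
  have Xint: "integrable (LB T) (%t. (Np 2 (X t))\<^sup>2)" using gap_integrable[OF X zM ok2] by (simp add: gap_def[abs_def])
  have mulim: "(%N. LI T (%t. (mu N t)\<^sup>2)) ----> LI T (%t. 0)"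
  proof (rule integral_dominated_convergence[where w = "%t. (Np 2 (X t))\<^sup>2"])
    show "AE t in LB T. (%N. (mu N t)\<^sup>2) ----> 0"
    proof (rule AE_I2)
      fix t assume "t \<in> space (LB T)"
      then have "(%N. (mu N t)\<^sup>2) ----> 0^2" unfolding mu_def by (intro tendsto_power Np_mind_tendsto XL) simp
      then show "(%N. (mu N t)\<^sup>2) ----> 0" by simp
    qed
    show "AE t in LB T. norm ((mu N t)^2) \<le> (Np 2 (X t))^2" for N
    proof (rule AE_I2)
      fix t assume "t \<in> space (LB T)"
      then have t: "t \<in> {0..T}" by simp
      have "mu N t \<le> Np 2 (X t)" unfolding mu_def
        by (rule Np_mono[OF LG_mind[OF XL[OF t]] XL[OF t]]) (simp_all add: mind_nonneg mind_le_norm)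
      moreover have "0 \<le> mu N t" unfolding mu_def by (rule Np_nonneg[OF LG_mind[OF XL[OF t]]]) simp_all
      ultimately show "norm ((mu N t)^2) \<le> (Np 2 (X t))^2" by simp
    qed
  qed (use muint Xint in auto)
  have "beta \<in> MGbar E 2 T"
  proof (rule MGbarI[OF beta(1) ok2])
    fix eps :: real assume e: "0 < eps"
    have "(%N. (2 * c^2) * LI T (%t. (mu N t)\<^sup>2)) ----> (2 * c^2) * 0" using mulim by (intro tendsto_mult_left) simp
    then have "\<forall>\<^sub>F N in sequentially. (2 * c^2) * LI T (%t. (mu N t)\<^sup>2) < eps / 2"
      by (rule order_tendstoD(2)) (use e in simp)
    then obtain N where N: "(2 * c^2) * LI T (%t. (mu N t)\<^sup>2) < eps / 2" unfolding eventually_sequentially by blast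
    define Y where "Y = (%t. approx_subst K (f t) (X t) N)"
    have YM: "Y \<in> MGbar E 2 T" unfolding Y_def by (rule approx_subst_MGbar[OF X f])
    obtain U where U: "padp 2 U" "integrable (LB T) (gap 2 U Y)" "LI T (gap 2 U Y) < eps / 4"
      using MGbar_ex_padp[OF YM ok2, of "eps / 4"] e by auto
    define G where "G t = 2 * gap 2 U Y t + (2 * c^2) * (mu N t)^2" for t
    have Gi: "integrable (LB T) G" unfolding G_def using U(2) muint by simp
    have "AE t in LB T. gap 2 U beta t \<le> G t"
    proof (rule AE_I2)
      fix t assume "t \<in> space (LB T)"
      then have t: "t \<in> {0..T}" by simp
      have "gap 2 U beta t \<le> 2 * gap 2 U Y t + 2 * gap 2 Y beta t"
        by (rule gap_triangle[of U t 2 Y beta, OF padp_LG[OF U(1)] MGbar_LG[OF YM t] beta(1)[OF t] ok2])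
      moreover have "gap 2 Y beta t \<le> (c * mu N t)^2" unfolding gap_def
        using beta(2)[OF t, of N] ds_nonneg[OF MGbar_LG[OF YM t] beta(1)[OF t] ok2] unfolding Y_def by (intro power_mono)
      ultimately show "gap 2 U beta t \<le> G t" unfolding G_def by (simp add: power_mult_distrib)
    qed
    moreover have "LI T G = 2 * LI T (gap 2 U Y) + (2 * c^2) * LI T (%t. (mu N t)\<^sup>2)"
      unfolding G_def using U(2) muint by simp
    ultimately show "\<exists>U G. padp 2 U \<and> integrable (LB T) G \<and> (AE s in LB T. gap 2 U beta s \<le> G s) \<and> LI T G < eps"
      using U N Gi by (intro exI[of _ U] exI[of _ G]) auto
  qed
  then show ?thesis unfolding is_subst_process_def using beta(3) by blast
qed

lemma subst_process_gap:
  fixes X X' :: "('d, real^'n::finite) process"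
  assumes X: "X \<in> MGbar E 2 T" "X' \<in> MGbar E 2 T" and f: "\<And>x. (%t. f t x) \<in> MGbar E 2 T" and K: "0 \<le> K"
    and lip: "\<And>t. t \<in> {0..T} ==> lipschitz_field E K (f t)"
    and s: "is_subst_process E T f X beta" "is_subst_process E T f X' beta'" and t: "t \<in> {0..T}"
  shows "gap 2 beta beta' t \<le> (real CARD('n) * K)^2 * gap 2 X X' t"
proof -
  have L: "X t \<in> LG E 2" "X' t \<in> LG E 2" "beta t \<in> LG E 2" "beta' t \<in> LG E 2"
    using MGbar_LG[OF _ t] X s unfolding is_subst_process_def by auto
  have fL: "f t x \<in> LG E 2" for x using MGbar_LG[OF f t] by simp
  have "ds 2 (beta t) (beta' t) \<le> real CARD('n) * K * ds 2 (X t) (X' t)"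
    by (rule subst_lipschitz[OF L fL K lip[OF t]]) (use s t in \<open>auto simp: is_subst_process_def\<close>)
  then have "(ds 2 (beta t) (beta' t))^2 \<le> (real CARD('n) * K * ds 2 (X t) (X' t))^2"
    using ds_nonneg[OF L(3,4) ok2] by (intro power_mono)
  then show ?thesis by (simp add: gap_def power_mult_distrib)
qed

end

section \<open>The integral as a process\<close>

context G_time
begin

lemma MGbar_uniform_limit:
  assumes eta: "\<And>t. t \<in> {0..T} ==> eta t \<in> LG E 2" and h: "\<And>k::nat. h k \<in> MGbar E 2 T"
    and b: "\<And>k t. t \<in> {0..T} ==> gap 2 (h k) eta t \<le> delta k" and delta: "delta ----> 0"
  shows "eta \<in> MGbar E 2 T"
proof (rule MGbarI[OF eta ok2])
  fix eps :: real assume e: "0 < eps"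
  have "(%k. T * (2 * delta k)) ----> T * (2 * 0)" by (intro tendsto_mult_left delta)
  then have "\<forall>\<^sub>F k in sequentially. T * (2 * delta k) < eps / 2" by (rule order_tendstoD(2)) (use e in simp)
  then obtain k where k: "T * (2 * delta k) < eps / 2" unfolding eventually_sequentially by blast
  obtain U where U: "padp 2 U" "integrable (LB T) (gap 2 U (h k))" "LI T (gap 2 U (h k)) < eps / 4"
    using MGbar_ex_padp[OF h ok2, of "eps / 4" k] e by auto
  define G where "G t = 2 * gap 2 U (h k) t + 2 * delta k" for t
  have Gi: "integrable (LB T) G" unfolding G_def by (intro Bochner_Integration.integrable_add integrable_mult_right U(2) LB_const_integrable)
  have "AE t in LB T. gap 2 U eta t \<le> G t"
  proof (rule AE_I2)
    fix t assume "t \<in> space (LB T)"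
    then have t: "t \<in> {0..T}" by simp
    have "gap 2 U eta t \<le> 2 * gap 2 U (h k) t + 2 * gap 2 (h k) eta t"
      by (rule gap_triangle[of U t 2 "h k" eta, OF padp_LG[OF U(1)] MGbar_LG[OF h t] eta[OF t] ok2])
    then show "gap 2 U eta t \<le> G t" unfolding G_def using b[OF t, of k] by linarith
  qed
  moreover have "LI T G = 2 * LI T (gap 2 U (h k)) + T * (2 * delta k)"
    unfolding G_def using U(2) LB_const_integrable[of T "2 * delta k"] LB_integral_const[of T "2 * delta k"] T_pos
    by (subst Bochner_Integration.integral_add) auto
  ultimately show "\<exists>U G. padp 2 U \<and> integrable (LB T) G \<and> (AE s in LB T. gap 2 U eta s \<le> G s) \<and> LI T G < eps"
    using U k Gi by (intro exI[of _ U] exI[of _ G]) auto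
qed

text \<open>The cut excludes \<open>t\<close>, so a simple process stays simple; it differs from
  \<open>restrict_upto\<close> only at time \<open>t\<close>.\<close>

definition trunc :: "real => (real => 'd cpath => 'v::euclidean_space) => real => 'd cpath => 'v" where
  "trunc t u s w = (if s < t then u s w else 0)"

lemma simp_trunc:
  assumes "simp_proc u" "t \<in> {0..T}"
  shows "simp_proc (trunc t u)"
proof -
  obtain N :: nat and a b x where h: "\<And>k. k < N ==> 0 \<le> a k \<and> a k \<le> b k \<and> b k \<le> T \<and> x k \<in> L_ip_upto (a k)"
    and u: "u = (%s w. \<Sum>k<N. el (a k) (b k) (x k) s w)"
    using assms(1) unfolding simp_proc_def by blast
  \<comment> \<open>The outer maximum turns an interval that starts after \<open>t\<close> into an
    empty one.\<close>
  define b' where "b' k = max (a k) (min (b k) t)" for k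
  have "trunc t u = (%s w. \<Sum>k<N. el (a k) (b' k) (x k) s w)"
  proof (intro ext)
    fix s w
    have "(if s < t then el (a k) (b k) (x k) s w else 0) = el (a k) (b' k) (x k) s w" for k
      unfolding el_def b'_def by (auto simp: indicator_def)
    then show "trunc t u s w = (\<Sum>k<N. el (a k) (b' k) (x k) s w)" unfolding trunc_def u by (auto intro: sum.cong)
  qed
  moreover have "0 \<le> a k \<and> a k \<le> b' k \<and> b' k \<le> T \<and> x k \<in> L_ip_upto (a k)" if "k < N" for k
    using h[OF that] by (auto simp: b'_def)
  ultimately show ?thesis unfolding simp_proc_def by blast
qed

text \<open>The last cell that starts before \<open>t\<close> may reach beyond \<open>t\<close>, so
  the grid sum is certain to be known only at \<open>t + T / l\<close>. For \<open>t \<le> 0\<close>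
  it is 0.\<close>

lemma S_trunc_L_ip_upto:
  assumes u: "simp_proc u" and t: "t \<in> {0..T}" and D: "\<And>i. i < l ==> D l i \<in> L_ip_upto (rr l (Suc i))"
    and r: "t \<le> 0 \<or> t + T / real l \<le> r"
  shows "S D (trunc t u) l \<in> L_ip_upto r"
proof -
  have "(%w. D l i w *\<^sub>R trunc t u (rr l i) w) \<in> L_ip_upto r" if i: "i < l" for i
  proof (cases "rr l i < t")
    case True
    then have "t + T / real l \<le> r" using r rr_nonneg[of l i] by linarith
    then have "rr l (Suc i) \<le> r" using True rr_Suc_diff[of l i] by linarith
    moreover have "(%w. D l i w *\<^sub>R trunc t u (rr l i) w) \<in> L_ip_upto (rr l (Suc i))"
      by (rule S_term_L_ip_upto[of D l i "trunc t u", OF D[OF i] simp_adp[OF simp_trunc[OF u t]] i])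
    ultimately show ?thesis using L_ip_upto_mono by blast
  next
    case False
    then show ?thesis by (simp add: trunc_def L_ip_upto_const)
  qed
  then show ?thesis unfolding S_def[abs_def] by (intro L_ip_upto_sum) simp
qed

lemma SI_trunc:
  assumes i: "integrator 2 D TYPE('v::euclidean_space) C" and u: "simp_proc (u :: real => 'd cpath => 'v)"
  shows "SI 2 D (cst u) (S D u)"
proof -
  have L: "S D u \<in> LG E 2" using i u unfolding integrator_def by blast
  have "gap 2 (cst u) (cst u) = (%_. 0)" by (simp add: gap_def[abs_def] Np_zero)
  then have "simp_approx 2 (%_. u) (cst u)" unfolding simp_approx_def using u by simp
  moreover have "(%k::nat. ds 2 (S D u) (S D u)) ----> 0" by (simp only: ds_self[of 2] zero_less_numeral tendsto_const)
  ultimately show ?thesis unfolding SI_def using L by blast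
qed

text \<open>The norms of the finitely many values of \<open>u\<close> have a common bound
  \<open>b\<close>, so the integral between \<open>s\<close> and \<open>t\<close> has squared norm
  at most a multiple of \<open>t - s\<close>.\<close>

lemma S_trunc_increment:
  assumes i: "integrator 2 D TYPE('v::euclidean_space) C" and u: "simp_proc (u :: real => 'd cpath => 'v)"
  shows "\<exists>B\<ge>0. \<forall>s t. 0 \<le> s --> s \<le> t --> t \<le> T -->
    (ds 2 (S D (trunc s u)) (S D (trunc t u)))\<^sup>2 \<le> B * (t - s)"
proof -
  have C0: "0 \<le> C" using i unfolding integrator_def by blast
  have sa: "pc u" "u s \<in> L_ip" for s using simp_sadp[OF u] unfolding sadp_def by auto
  define b where "b = (\<Sum>x\<in>range u. nr 2 x)"
  have n0: "0 \<le> nr 2 (u s)" for s by (rule nr_nonneg[OF sa(2)])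
  have b: "nr 2 (u s) \<le> b" for s unfolding b_def by (rule member_le_sum) (use n0 pc_finite_range[OF sa(1)] in auto)
  have "(ds 2 (S D (trunc s u)) (S D (trunc t u)))^2 \<le> (C * b^2) * (t - s)" if st: "0 \<le> s" "s \<le> t" "t \<le> T" for s t
  proof -
    have tr: "simp_proc (trunc s u)" "simp_proc (trunc t u)" using simp_trunc[OF u] st by auto
    have g: "gap 2 (cst (trunc s u)) (cst (trunc t u)) r \<le> indicator {s..<t} r * b^2" for r
    proof -
      have "(%w. trunc s u r w - trunc t u r w) = (%w. (- indicator {s..<t} r) *\<^sub>R u r w)"
        using st(2) by (auto simp: trunc_def fun_eq_iff indicator_def)
      then have "gap 2 (cst (trunc s u)) (cst (trunc t u)) r = (nr 2 (%w. (- indicator {s..<t} r) *\<^sub>R u r w))^2"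
        unfolding gap_def Np_const by simp
      also have "... = indicator {s..<t} r * (nr 2 (u r))^2"
        using nr_scaleR[OF sa(2), of 2 "- indicator {s..<t} r" r] by (simp add: power_mult_distrib indicator_def)
      also have "... \<le> indicator {s..<t} r * b^2" by (intro mult_left_mono power_mono b n0) simp
      finally show ?thesis .
    qed
    have "(ds 2 (S D (trunc s u)) (S D (trunc t u)))^2 \<le> C * LI T (gap 2 (cst (trunc s u)) (cst (trunc t u)))"
      by (rule S_ds_le[OF i tr])
    also have "... \<le> C * LI T (%r. indicator {s..<t} r * b^2)"
    proof (intro mult_left_mono C0 integral_mono)
      show "integrable (LB T) (gap 2 (cst (trunc s u)) (cst (trunc t u)))" by (intro pc_integrable pc_gap simp_padp tr ok2)
    qed (use g LB_integral_indicator(2)[OF st] in auto)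
    finally show ?thesis unfolding LB_integral_indicator(1)[OF st] by (simp add: mult_ac)
  qed
  then show ?thesis using C0 by (intro exI[of _ "C * b^2"]) auto
qed

text \<open>Grid sums look ahead by up to one cell and thus do not form an adapted process. In the
  cell starting at \<open>rr l j\<close> the integral up to the previous grid point is used, summed
  over a grid with at least \<open>l\<close> cells: it is known at \<open>rr l j\<close>, and by
  continuity in time the delay of at most two cells costs little.\<close>

lemma S_trunc_MGbar:
  fixes u :: "real => 'd cpath => 'v::euclidean_space"
  assumes i: "integrator 2 D TYPE('v) C" and u: "simp_proc u"
  shows "(%t. if t \<in> {0..T} then S D (trunc t u) else (%_ _. 0)) \<in> MGbar E 2 T"
proof (rule MGbarI[OF _ ok2])
  let ?J = "%t. if t \<in> {0..T} then S D (trunc t u) else (%_ _. 0)"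
  have JL: "S D (trunc t u) \<in> LG E 2" if "t \<in> {0..T}" for t
    using i simp_trunc[OF u that] unfolding integrator_def by blast
  show "?J t \<in> LG E 2" if "t \<in> {0..T}" for t using JL[OF that] that by simp
  have D: "D l j \<in> L_ip_upto (rr l (Suc j))" if "j < l" for l j using i that unfolding integrator_def by blast
  obtain B where B: "0 \<le> B" "\<And>s t. 0 \<le> s ==> s \<le> t ==> t \<le> T ==>
      (ds 2 (S D (trunc s u)) (S D (trunc t u)))\<^sup>2 \<le> B * (t - s)" using S_trunc_increment[OF i u] by blast
  fix eps :: real assume e: "0 < eps"
  \<comment> \<open>The gap will be at most \<open>4 * delta\<close>, so its time integral is at
    most half of \<open>eps\<close>.\<close>
  define delta where "delta = eps / (8 * T)"
  have d: "0 < delta" using e T_pos by (simp add: delta_def)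
  have "(%l. (B * 2 * T) / real l) ----> 0" by (rule inverse_l_tendsto)
  then have "\<forall>\<^sub>F l in sequentially. (B * 2 * T) / real l < delta" by (rule order_tendstoD(2)[OF _ d])
  then have "\<forall>\<^sub>F l in sequentially. (B * 2 * T) / real l < delta \<and> 0 < l"
    using eventually_gt_at_top[of 0] by (rule eventually_conj)
  then obtain l where l: "(B * 2 * T) / real l < delta" "0 < l" unfolding eventually_sequentially by blast
  \<comment> \<open>For \<open>j = 0\<close> the predecessor is again 0, where the truncated
    integral vanishes.\<close>
  have grid: "rr l (j - 1) \<in> {0..T}" if "j < l" for j using rr_less_T[of "j - 1" l] that by (simp add: less_imp_le)
  have "\<forall>j. \<exists>L. j < l --> l \<le> L \<and> ds 2 (%_. S D (trunc (rr l (j - 1)) u) L) (S D (trunc (rr l (j - 1)) u)) < sqrt delta"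
  proof (intro allI)
    fix j show "\<exists>L. j < l --> l \<le> L \<and> ds 2 (%_. S D (trunc (rr l (j - 1)) u) L) (S D (trunc (rr l (j - 1)) u)) < sqrt delta"
    proof (cases "j < l")
      case True
      obtain M where "\<forall>m\<ge>M. ds 2 (%_. S D (trunc (rr l (j - 1)) u) m) (S D (trunc (rr l (j - 1)) u)) < sqrt delta"
        using LG_approx[OF JL[OF grid[OF True]] ok2, of "sqrt delta"] d by auto
      then show ?thesis by (intro exI[of _ "max M l"]) simp
    qed simp
  qed
  from choice[OF this] obtain L where L: "\<And>j. j < l ==> l \<le> L j"
    "\<And>j. j < l ==> ds 2 (%_. S D (trunc (rr l (j - 1)) u) (L j)) (S D (trunc (rr l (j - 1)) u)) < sqrt delta" by blast
  define xi where "xi j = (%_::nat. S D (trunc (rr l (j - 1)) u) (L j))" for j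
  define U where "U = (%s m w. ustep T l (%j. xi j m w) s)"
  have xi: "xi j \<in> LG_upto E 2 (rr l j)" if j: "j < l" for j
  proof -
    have "S D (trunc (rr l (j - 1)) u) (L j) \<in> L_ip_upto (rr l j)"
    proof (rule S_trunc_L_ip_upto[OF u grid[OF j] D])
      show "rr l (j - 1) \<le> 0 \<or> rr l (j - 1) + T / real (L j) \<le> rr l j"
      proof (cases j)
        case (Suc j')
        have "T / real (L j) \<le> T / real l" using L(1)[OF j] l(2) T_pos by (intro divide_left_mono) auto
        then show ?thesis using rr_Suc_diff[of l j'] Suc by simp
      qed simp
    qed
    then show ?thesis unfolding xi_def by (rule LG_upto_const[OF _ ok2])
  qed
  have "step_rep E 2 T U l (%j. real j * T / real l) xi"
    unfolding U_def by (rule ustep_step_rep[OF l(2)]) (use xi in \<open>simp add: rr_def\<close>)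
  then have wp: "padp 2 U" by (rule step_rep_padp) simp
  have "AE s in LB T. s \<notin> {T} \<and> s \<in> {0..T}"
    using LB_AE_finite[of "{T}" T] AE_space[of "LB T"] by (auto elim: eventually_elim2)
  then have "AE s in LB T. gap 2 U ?J s \<le> 4 * delta"
  proof eventually_elim
    case (elim s)
    then have s: "0 \<le> s" "s < T" "s \<in> {0..T}" by auto
    obtain j where j: "j < l" "s \<in> {real j * T / real l..<real (Suc j) * T / real l}"
      using grid_cell[OF l(2) T_pos s(1,2)] by blast
    have sj: "rr l j \<le> s" "s < rr l (Suc j)" using j(2) by (auto simp: rr_def)
    have ws: "U s = xi j" unfolding U_def by (intro ext ustep_eq[OF j(1) T_pos j(2)])
    define r where "r = rr l (j - 1)"
    have r: "0 \<le> r" "r \<le> s" "r \<in> {0..T}" unfolding r_def using rr_mono[of "j - 1" j l] sj(1) grid[OF j(1)] by auto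
    have sr: "s - r \<le> 2 * T / real l"
    proof -
      have "0 \<le> T / real l" "2 * T / real l = T / real l + T / real l" using T_pos by auto
      then show ?thesis using sj(2) rr_Suc_diff[of l j] rr_Suc_diff[of l "j - 1"] unfolding r_def by (cases j) auto
    qed
    have "gap 2 U ?J s = (ds 2 (xi j) (S D (trunc s u)))^2" using ws s(3) by (simp add: gap_def)
    also have "... \<le> 2 * (ds 2 (xi j) (S D (trunc r u)))^2 + 2 * (ds 2 (S D (trunc r u)) (S D (trunc s u)))^2"
      by (rule ds_power_triangle[OF LG_upto_LG[OF xi[OF j(1)]] JL[OF r(3)] JL[OF s(3)] ok2])
    also have "(ds 2 (S D (trunc r u)) (S D (trunc s u)))^2 \<le> B * (s - r)" using r s by (intro B(2)) auto
    also have "B * (s - r) \<le> delta" using mult_left_mono[OF sr B(1)] l(1) by (simp add: mult_ac)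
    also have "(ds 2 (xi j) (S D (trunc r u)))^2 \<le> (sqrt delta)^2"
      using L(2)[OF j(1)] ds_nonneg[OF LG_upto_LG[OF xi[OF j(1)]] JL[OF r(3)] ok2]
      unfolding xi_def r_def by (intro power_mono) auto
    finally show ?case using d by simp
  qed
  moreover have "LI T (%_. 4 * delta) < eps"
    unfolding LB_integral_const[OF less_imp_le[OF T_pos]] using T_pos e by (simp add: delta_def)
  ultimately show "\<exists>U G. padp 2 U \<and> integrable (LB T) G \<and> (AE s in LB T. gap 2 U ?J s \<le> G s) \<and> LI T G < eps"
    using wp LB_const_integrable by (intro exI[of _ U] exI[of _ "%_. 4 * delta"] conjI)
qed

lemma gap_restrict:
  "gap 2 (restrict_upto t eta) (restrict_upto t eta') s = indicator {0..t} s * gap 2 eta eta' s"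
  by (auto simp: gap_def restrict_upto_def indicator_def Np_zero)

text \<open>Restriction to \<open>{0..t}\<close> does not increase the gap, so by
  \<open>SI_est\<close> the integrals of the simple approximants up to \<open>t\<close> converge
  uniformly in \<open>t\<close>.\<close>

lemma SI_process_MGbar:
  fixes eta :: "('d, 'v::euclidean_space) process"
  assumes i: "integrator 2 D TYPE('v) C" and eta: "eta \<in> MGbar E 2 T"
    and I: "\<And>t. t \<in> {0..T} ==> SI 2 D (restrict_upto t eta) (I t)"
  shows "I \<in> MGbar E 2 T"
proof -
  have C0: "0 \<le> C" using i unfolding integrator_def by blast
  obtain u where u: "simp_approx 2 u eta" using step_approx_exists[OF eta ok2] by blast
  then have us: "simp_proc (u k)" for k unfolding simp_approx_def by blast
  define J where "J k t = (if t \<in> {0..T} then S D (trunc t (u k)) else (%_ _. 0))" for k t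
  define delta where "delta k = 4 * C * LI T (gap 2 (cst (u k)) eta)" for k
  show ?thesis
  proof (rule MGbar_uniform_limit[where h = J and delta = delta])
    show "I t \<in> LG E 2" if "t \<in> {0..T}" for t by (rule SI_LG[OF I[OF that]])
    show "J k \<in> MGbar E 2 T" for k unfolding J_def[abs_def] by (rule S_trunc_MGbar[OF i us])
    show "delta ----> 0" unfolding delta_def using u tendsto_mult_left[of _ 0 sequentially "4 * C"] unfolding simp_approx_def by simp
    fix k t assume t: "t \<in> {0..T}"
    have tr: "simp_proc (trunc t (u k))" by (rule simp_trunc[OF us t])
    have tM: "cst (trunc t (u k)) \<in> MGbar E 2 T" by (rule padp_MGbar[OF simp_padp[OF tr ok2] ok2])
    have uM: "cst (u k) \<in> MGbar E 2 T" by (rule padp_MGbar[OF simp_padp[OF us ok2] ok2])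
    have rM: "restrict_upto t eta \<in> MGbar E 2 T" by (rule MGbar_restrict[OF eta ok2])
    have "gap 2 (J k) I t = (ds 2 (S D (trunc t (u k))) (I t))^2" using t by (simp add: gap_def J_def)
    also have "... \<le> 4 * C * LI T (gap 2 (cst (trunc t (u k))) (restrict_upto t eta))"
      by (rule SI_est[OF i tM rM SI_trunc[OF i tr] I[OF t]])
    also have "... \<le> delta k" unfolding delta_def
    proof (intro mult_left_mono integral_mono_AE gap_integrable tM uM rM eta ok2)
      have "AE s in LB T. s \<notin> {t} \<and> s \<in> {0..T}"
        using LB_AE_finite[of "{t}" T] AE_space[of "LB T"] by (auto elim: eventually_elim2)
      then show "AE s in LB T. gap 2 (cst (trunc t (u k))) (restrict_upto t eta) s \<le> gap 2 (cst (u k)) eta s"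
      proof eventually_elim
        case (elim s)
        have "0 \<le> gap 2 (cst (u k)) eta s" using elim by (intro gap_nonneg MGbar_LG[OF uM] MGbar_LG[OF eta] ok2) auto
        then show ?case using elim by (cases "s < t") (simp_all add: gap_def restrict_upto_def trunc_def Np_zero)
      qed
    qed (use C0 in simp)
    finally show "gap 2 (J k) I t \<le> delta k" .
  qed
qed

section \<open>An iterated integral inequality\<close>

lemma LB_integral_exp:
  assumes a: "0 < a" and t: "t \<in> {0..T}"
  shows "integrable (LB T) (%s. indicator {0..t} s * exp (a * s))"
    "LI T (%s. indicator {0..t} s * exp (a * s)) \<le> exp (a * t) / a"
proof -
  have "((%s. exp (a * s)) has_integral exp (a * t) / a - exp (a * 0) / a) {0..t}"
  proof (rule fundamental_theorem_of_calculus)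
    show "((%s. exp (a * s) / a) has_vector_derivative exp (a * s)) (at s within {0..t})" for s
      unfolding has_real_derivative_iff_has_vector_derivative[symmetric] by (rule derivative_eq_intros refl | use a in simp)+
  qed (use t in simp)
  moreover have "(%s. if s \<in> {0..t} then exp (a * s) else 0) = (%s. indicator {0..t} s * exp (a * s))"
    by (auto simp: fun_eq_iff indicator_def)
  ultimately have "((%s. indicator {0..t} s * exp (a * s)) has_integral exp (a * t) / a - exp (a * 0) / a) {0..T}"
    using t has_integral_restrict[of "{0..t}" "{0..T}" "%s. exp (a * s)"] by simp
  then have "integrable (LB T) (%s. indicator {0..t} s * exp (a * s)) \<and>
      LI T (%s. indicator {0..t} s * exp (a * s)) = exp (a * t) / a - exp (a * 0) / a" by (subst (asm) LB_has_integral) auto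
  then show "integrable (LB T) (%s. indicator {0..t} s * exp (a * s))"
    "LI T (%s. indicator {0..t} s * exp (a * s)) \<le> exp (a * t) / a" using a by auto
qed

text \<open>Induction with an exponential weight: \<open>kappa\<close> times the integral of
  \<open>exp (4 * kappa * s)\<close> up to \<open>t\<close> is at most a quarter of
  \<open>exp (4 * kappa * t)\<close>. It starts at \<open>g 1\<close> because \<open>g 0\<close> is
  integrable but not bounded in time.\<close>

lemma iterated_bound:
  fixes g :: "nat => real => real"
  assumes kappa: "0 < kappa" and g: "\<And>m. integrable (LB T) (g m)" "\<And>m t. t \<in> {0..T} ==> 0 \<le> g m t"
    and step: "\<And>m t. t \<in> {0..T} ==> g (Suc m) t \<le> kappa * LI T (%s. indicator {0..t} s * g m s)"
    and t: "t \<in> {0..T}"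
  shows "g (Suc m) t \<le> kappa * LI T (g 0) * exp (4 * kappa * t) * (1/4) ^ m"
  using t
proof (induction m arbitrary: t)
  case 0
  have gi: "integrable (LB T) (%s. indicator {0..t} s * g 0 s)"
  proof -
    have "integrable (LB T) (%s. g 0 s * indicator {0..t} s)"
      by (rule integrable_real_mult_indicator[OF _ g(1)]) (use 0 in \<open>auto simp: sets_restrict_space_iff\<close>)
    then show ?thesis by (simp add: mult.commute)
  qed
  have M0: "0 \<le> LI T (g 0)" by (rule integral_nonneg_AE, rule AE_I2) (simp add: g(2))
  have "g (Suc 0) t \<le> kappa * LI T (%s. indicator {0..t} s * g 0 s)" by (rule step[OF 0])
  also have "... \<le> kappa * LI T (g 0)"
    by (intro mult_left_mono integral_mono gi g(1)) (use kappa g(2) in \<open>auto simp: indicator_def\<close>)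
  also have "... \<le> kappa * LI T (g 0) * exp (4 * kappa * t)"
    using mult_left_mono[of 1 "exp (4 * kappa * t)" "kappa * LI T (g 0)"] kappa M0 0 by simp
  finally show ?case by simp
next
  case (Suc m)
  define c where "c = kappa * LI T (g 0) * (1/4) ^ m"
  have M0: "0 \<le> LI T (g 0)" by (rule integral_nonneg_AE, rule AE_I2) (simp add: g(2))
  have c0: "0 \<le> c" using kappa M0 by (simp add: c_def)
  have gi: "integrable (LB T) (%s. indicator {0..t} s * g (Suc m) s)"
  proof -
    have "integrable (LB T) (%s. g (Suc m) s * indicator {0..t} s)"
      by (rule integrable_real_mult_indicator[OF _ g(1)]) (use Suc in \<open>auto simp: sets_restrict_space_iff\<close>)
    then show ?thesis by (simp add: mult.commute)
  qed
  have ei: "integrable (LB T) (%s. c * (indicator {0..t} s * exp (4 * kappa * s)))"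
    using LB_integral_exp(1)[of "4 * kappa" t] kappa Suc.prems by simp
  have "g (Suc (Suc m)) t \<le> kappa * LI T (%s. indicator {0..t} s * g (Suc m) s)" by (rule step[OF Suc.prems])
  also have "... \<le> kappa * LI T (%s. c * (indicator {0..t} s * exp (4 * kappa * s)))"
  proof (intro mult_left_mono integral_mono gi ei)
    fix s assume "s \<in> space (LB T)"
    then have "g (Suc m) s \<le> c * exp (4 * kappa * s)" using Suc.IH[of s] by (simp add: c_def mult_ac)
    then show "indicator {0..t} s * g (Suc m) s \<le> c * (indicator {0..t} s * exp (4 * kappa * s))" by (simp add: indicator_def)
  qed (use kappa in simp)
  also have "... \<le> kappa * (c * (exp (4 * kappa * t) / (4 * kappa)))"
  proof -
    have "LI T (%s. indicator {0..t} s * exp (4 * kappa * s)) \<le> exp (4 * kappa * t) / (4 * kappa)"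
      using LB_integral_exp(2)[of "4 * kappa" t] kappa Suc.prems by simp
    then have "kappa * (c * LI T (%s. indicator {0..t} s * exp (4 * kappa * s))) \<le> kappa * (c * (exp (4 * kappa * t) / (4 * kappa)))"
      using kappa c0 by (intro mult_left_mono) auto
    then show ?thesis by (simp only: integral_mult_right_zero)
  qed
  also have "... = kappa * LI T (g 0) * exp (4 * kappa * t) * (1/4) ^ Suc m" using kappa by (simp add: c_def)
  finally show ?case .
qed

text \<open>Successive distances are summed; the 2 is the value of the geometric series with ratio
  1/2.\<close>

lemma geometric_limit:
  fixes x :: "nat => ('d, 'v::euclidean_space) rv"
  assumes x: "\<And>m. x m \<in> LG E 2" and b: "\<And>m. ds 2 (x (Suc m)) (x m) \<le> c * (1/2) ^ m"
  shows "\<exists>z\<in>LG E 2. \<forall>m. ds 2 (x m) z \<le> 2 * c * (1/2) ^ m"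
proof -
  have "0 \<le> ds 2 (x (Suc 0)) (x 0)" by (rule ds_nonneg[OF x x ok2])
  then have c0: "0 \<le> c" using b[of 0] by simp
  have step: "ds 2 (x (m + j)) (x m) \<le> 2 * c * (1/2) ^ m * (1 - (1/2) ^ j)" for m j
  proof (induction j)
    case 0
    then show ?case by (simp add: Np_zero)
  next
    case (Suc j)
    have "ds 2 (x (m + Suc j)) (x m) \<le> ds 2 (x (Suc (m + j))) (x (m + j)) + ds 2 (x (m + j)) (x m)"
      using ds_triangle[where x = "x (Suc (m + j))" and y = "x (m + j)" and z = "x m", OF x x x ok2] by simp
    also have "... \<le> c * (1/2) ^ (m + j) + 2 * c * (1/2) ^ m * (1 - (1/2) ^ j)" by (intro add_mono b Suc)
    also have "... = 2 * c * (1/2) ^ m * (1 - (1/2) ^ Suc j)" by (simp add: power_add algebra_simps)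
    finally show ?case .
  qed
  have near: "ds 2 (x k) (x m) \<le> 2 * c * (1/2) ^ m" if "m \<le> k" for m k
  proof -
    have "2 * c * (1/2) ^ m * (1 - (1/2) ^ (k - m)) \<le> 2 * c * (1/2) ^ m * 1" using c0 by (intro mult_left_mono) auto
    then show ?thesis using step[of m "k - m"] that by simp
  qed
  have lim: "(%m. 2 * c * (1/2 :: real) ^ m) ----> 0"
    using tendsto_mult_left[OF LIMSEQ_power_zero[of "1/2 :: real"], of "2 * c"] by simp
  show ?thesis using LG_limit[OF x near lim] by blast
qed

end

section \<open>Picard iteration\<close>

text \<open>An equation with finitely many integral terms, each with its own integrator, weight and
  field. One fixed point argument then covers all kinds of integrals.\<close>

locale G_equation = G_time E T for E :: "('d::finite cpath => real) => real" and T +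
  fixes A :: "'k set" and D :: "'k => nat => nat => 'd cpath => real" and C wt :: "'k => real"
    and f :: "'k => real => real^'n::finite => ('d, real^'n) rv" and K :: real and X0 :: "real^'n"
  assumes A: "finite A" and K: "0 \<le> K"
    and D: "\<And>k. k \<in> A ==> integrator 2 (D k) TYPE(real^'n) (C k)"
    and f: "\<And>k x. k \<in> A ==> (%t. f k t x) \<in> MGbar E 2 T"
    and lip: "\<And>k t. k \<in> A ==> t \<in> {0..T} ==> lipschitz_field E K (f k t)"
begin

text \<open>A relation, since substitutions and integrals are determined only up to distance 0;
  \<open>R t\<close> may be any version of the sum.\<close>

definition rhs :: "('d, real^'n) process => ('d, real^'n) process => bool" where
  "rhs X R \<longleftrightarrow> (\<exists>beta I. (\<forall>k\<in>A. is_subst_process E T (f k) X (beta k) \<and>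
      (\<forall>t\<in>{0..T}. SI 2 (D k) (restrict_upto t (beta k)) (I k t))) \<and>
    (\<forall>t\<in>{0..T}. R t \<in> LG E 2 \<and> ds 2 (R t) (%m w. X0 + (\<Sum>k\<in>A. wt k *\<^sub>R I k t m w)) = 0))"

lemma sum_LG:
  assumes "\<And>k. k \<in> A ==> I k \<in> LG E 2"
  shows "(%m w. X0 + (\<Sum>k\<in>A. wt k *\<^sub>R I k m w)) \<in> LG E 2"
  by (intro LG_add LG_const L_ip_const LG_sum LG_scaleR assms ok2)

lemma MGbar_sum:
  assumes "\<And>k. k \<in> A ==> I k \<in> MGbar E 2 T"
  shows "(%t m w. X0 + (\<Sum>k\<in>A. wt k *\<^sub>R I k t m w)) \<in> MGbar E 2 T"
  using A assms
proof (induction A rule: finite_induct)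
  case empty
  show ?case using padp_MGbar[OF padp_const[OF ok2, of X0] ok2] by simp
next
  case (insert k B)
  have "(%t m w. (X0 + (\<Sum>k\<in>B. wt k *\<^sub>R I k t m w)) + wt k *\<^sub>R I k t m w) \<in> MGbar E 2 T"
  proof (rule MGbar_lip2[OF insert.IH _ ok2, where Phi = "%a b. a + wt k *\<^sub>R b" and L = "1 + \<bar>wt k\<bar>"])
    fix a b a' b' :: "real^'n"
    have "norm (a + wt k *\<^sub>R b - (a' + wt k *\<^sub>R b')) \<le> norm (a - a') + \<bar>wt k\<bar> * norm (b - b')"
    proof -
      have "a + wt k *\<^sub>R b - (a' + wt k *\<^sub>R b') = (a - a') + wt k *\<^sub>R (b - b')" by (simp add: algebra_simps)
      then show ?thesis using norm_triangle_ineq[of "a - a'" "wt k *\<^sub>R (b - b')"] by (simp only: norm_scaleR)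
    qed
    also have "... \<le> (1 + \<bar>wt k\<bar>) * (norm (a - a') + norm (b - b'))" by (simp add: algebra_simps)
    finally show "norm (a + wt k *\<^sub>R b - (a' + wt k *\<^sub>R b')) \<le> (1 + \<bar>wt k\<bar>) * (norm (a - a') + norm (b - b'))" .
  qed (use insert.prems in auto)
  then show ?case using insert.hyps by (simp add: add_ac)
qed

text \<open>The substitutions are prescribed, so that a solution can be built from given integrands
  as well as compared with them.\<close>

lemma rhs_of_subst:
  assumes X: "X \<in> MGbar E 2 T" and beta: "\<And>k. k \<in> A ==> is_subst_process E T (f k) X (beta k)"
  shows "\<exists>I. (\<forall>k\<in>A. \<forall>t\<in>{0..T}. SI 2 (D k) (restrict_upto t (beta k)) (I k t)) \<and>
    (%t m w. X0 + (\<Sum>k\<in>A. wt k *\<^sub>R I k t m w)) \<in> MGbar E 2 T \<and>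
    rhs X (%t m w. X0 + (\<Sum>k\<in>A. wt k *\<^sub>R I k t m w))"
proof -
  have betaM: "beta k \<in> MGbar E 2 T" if "k \<in> A" for k using beta[OF that] unfolding is_subst_process_def by blast
  have "\<forall>k. \<exists>I. k \<in> A --> (\<forall>t\<in>{0..T}. SI 2 (D k) (restrict_upto t (beta k)) (I t))"
  proof (intro allI)
    fix k
    have "\<forall>t. \<exists>I. k \<in> A --> SI 2 (D k) (restrict_upto t (beta k)) I"
      using SI_exists[OF D MGbar_restrict[OF betaM ok2]] by blast
    from choice[OF this] show "\<exists>I. k \<in> A --> (\<forall>t\<in>{0..T}. SI 2 (D k) (restrict_upto t (beta k)) (I t))" by blast
  qed
  from choice[OF this] obtain I where I: "\<And>k t. k \<in> A ==> t \<in> {0..T} ==> SI 2 (D k) (restrict_upto t (beta k)) (I k t)" by blast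
  define R where "R = (%t m w. X0 + (\<Sum>k\<in>A. wt k *\<^sub>R I k t m w))"
  have IM: "I k \<in> MGbar E 2 T" if "k \<in> A" for k by (rule SI_process_MGbar[OF D[OF that] betaM[OF that] I[OF that]])
  have RM: "R \<in> MGbar E 2 T" unfolding R_def by (rule MGbar_sum[OF IM])
  have "R t \<in> LG E 2 \<and> ds 2 (R t) (%m w. X0 + (\<Sum>k\<in>A. wt k *\<^sub>R I k t m w)) = 0" if t: "t \<in> {0..T}" for t
    using MGbar_LG[OF RM t] ds_self[of 2 "R t"] by (simp add: R_def)
  then have "rhs X R" unfolding rhs_def using beta I by (intro exI[of _ beta] exI[of _ I]) simp
  with RM I show ?thesis unfolding R_def by (intro exI[of _ I]) simp
qed

lemma rhs_exists:
  assumes X: "X \<in> MGbar E 2 T"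
  shows "\<exists>R\<in>MGbar E 2 T. rhs X R"
proof -
  have "\<forall>k. \<exists>beta. k \<in> A --> is_subst_process E T (f k) X beta"
    using subst_process_exists[OF X f K lip] by blast
  from choice[OF this] obtain beta where "\<And>k. k \<in> A ==> is_subst_process E T (f k) X (beta k)" by blast
  from rhs_of_subst[OF X this] show ?thesis by blast
qed

text \<open>\<open>4 * C k\<close> comes from \<open>SI_est\<close>, the last factor from the
  Lipschitz property of substitution, the number of terms from squaring a sum. The summand 1 makes
  the constant positive.\<close>

definition kappa :: real where
  "kappa = 1 + real (card A) * (\<Sum>k\<in>A. (wt k)\<^sup>2 * (4 * C k)) * (real CARD('n) * K)^2"

lemma C_nonneg: "k \<in> A ==> 0 \<le> C k" using D unfolding integrator_def by blast

lemma kappa_pos: "0 < kappa" unfolding kappa_def by (intro add_pos_nonneg mult_nonneg_nonneg sum_nonneg) (auto simp: C_nonneg)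

lemma rhs_gap:
  assumes X: "X \<in> MGbar E 2 T" "X' \<in> MGbar E 2 T" and R: "rhs X R" "rhs X' R'" and t: "t \<in> {0..T}"
  shows "gap 2 R R' t \<le> kappa * LI T (%s. indicator {0..t} s * gap 2 X X' s)"
proof -
  obtain beta I where b: "\<And>k. k \<in> A ==> is_subst_process E T (f k) X (beta k)"
    "\<And>k. k \<in> A ==> SI 2 (D k) (restrict_upto t (beta k)) (I k t)"
    "R t \<in> LG E 2" "ds 2 (R t) (%m w. X0 + (\<Sum>k\<in>A. wt k *\<^sub>R I k t m w)) = 0"
    using R(1) t unfolding rhs_def by blast
  obtain beta' I' where b': "\<And>k. k \<in> A ==> is_subst_process E T (f k) X' (beta' k)"
    "\<And>k. k \<in> A ==> SI 2 (D k) (restrict_upto t (beta' k)) (I' k t)"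
    "R' t \<in> LG E 2" "ds 2 (R' t) (%m w. X0 + (\<Sum>k\<in>A. wt k *\<^sub>R I' k t m w)) = 0"
    using R(2) t unfolding rhs_def by blast
  have IL: "I k t \<in> LG E 2" "I' k t \<in> LG E 2" if "k \<in> A" for k using SI_LG b(2) b'(2) that by blast+
  have betaM: "beta k \<in> MGbar E 2 T" "beta' k \<in> MGbar E 2 T" if "k \<in> A" for k
    using b(1)[OF that] b'(1)[OF that] unfolding is_subst_process_def by blast+
  define q where "q = LI T (%s. indicator {0..t} s * gap 2 X X' s)"
  define L where "L = (real CARD('n) * K)^2"
  have ri: "integrable (LB T) (%s. indicator {0..t} s * gap 2 X X' s)"
    using gap_integrable[OF MGbar_restrict[OF X(1) ok2, of t] MGbar_restrict[OF X(2) ok2, of t] ok2] by (simp add: gap_restrict[abs_def])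
  have q0: "0 \<le> q" unfolding q_def
    by (rule integral_nonneg_AE, rule AE_I2) (use X in \<open>auto intro!: mult_nonneg_nonneg gap_nonneg MGbar_LG\<close>)
  have Ik: "(ds 2 (I k t) (I' k t))^2 \<le> 4 * C k * (L * q)" if k: "k \<in> A" for k
  proof -
    have M: "restrict_upto t (beta k) \<in> MGbar E 2 T" "restrict_upto t (beta' k) \<in> MGbar E 2 T"
      using MGbar_restrict[OF betaM(1)[OF k] ok2] MGbar_restrict[OF betaM(2)[OF k] ok2] by auto
    have "(ds 2 (I k t) (I' k t))^2 \<le> 4 * C k * LI T (gap 2 (restrict_upto t (beta k)) (restrict_upto t (beta' k)))"
      by (rule SI_est[OF D[OF k] M b(2)[OF k] b'(2)[OF k]])
    also have "... \<le> 4 * C k * LI T (%s. L * (indicator {0..t} s * gap 2 X X' s))"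
    proof (intro mult_left_mono integral_mono)
      show "integrable (LB T) (gap 2 (restrict_upto t (beta k)) (restrict_upto t (beta' k)))" by (rule gap_integrable[OF M ok2])
      fix s assume "s \<in> space (LB T)"
      then have s: "s \<in> {0..T}" by simp
      have "gap 2 (beta k) (beta' k) s \<le> L * gap 2 X X' s" unfolding L_def
        by (rule subst_process_gap[OF X f[OF k] K lip[OF k] b(1)[OF k] b'(1)[OF k] s])
      then show "gap 2 (restrict_upto t (beta k)) (restrict_upto t (beta' k)) s \<le> L * (indicator {0..t} s * gap 2 X X' s)"
        unfolding gap_restrict by (simp add: indicator_def)
    qed (use ri C_nonneg[OF k] in auto)
    finally show ?thesis by (simp add: q_def)
  qed
  let ?S = "%m w. X0 + (\<Sum>k\<in>A. wt k *\<^sub>R I k t m w)" and ?S' = "%m w. X0 + (\<Sum>k\<in>A. wt k *\<^sub>R I' k t m w)"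
  have SL: "?S \<in> LG E 2" "?S' \<in> LG E 2" using sum_LG[of "%k. I k t"] sum_LG[of "%k. I' k t"] IL by auto
  have "ds 2 (R t) (R' t) = ds 2 ?S (R' t)" by (rule ds_zero_shift[OF b(3) SL(1) b'(3) ok2 b(4)])
  also have "... = ds 2 (R' t) ?S" by (rule ds_commute)
  also have "... = ds 2 ?S' ?S" by (rule ds_zero_shift[OF b'(3) SL(2,1) ok2 b'(4)])
  also have "... = ds 2 ?S ?S'" by (rule ds_commute)
  also have "... = ds 2 (%m w. \<Sum>k\<in>A. wt k *\<^sub>R I k t m w) (%m w. \<Sum>k\<in>A. wt k *\<^sub>R I' k t m w)" by simp
  also have "... \<le> (\<Sum>k\<in>A. ds 2 (%m w. wt k *\<^sub>R I k t m w) (%m w. wt k *\<^sub>R I' k t m w))"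
    by (rule ds_sum_le) (use IL in \<open>auto intro: LG_scaleR\<close>)
  also have "... = (\<Sum>k\<in>A. \<bar>wt k\<bar> * ds 2 (I k t) (I' k t))"
  proof (rule sum.cong[OF refl])
    fix k assume k: "k \<in> A"
    show "ds 2 (%m w. wt k *\<^sub>R I k t m w) (%m w. wt k *\<^sub>R I' k t m w) = \<bar>wt k\<bar> * ds 2 (I k t) (I' k t)"
      using Np_scaleR[OF LG_diff[OF IL[OF k] ok2] ok2, of "wt k"] by (simp add: scaleR_diff_right)
  qed
  finally have le: "ds 2 (R t) (R' t) \<le> (\<Sum>k\<in>A. \<bar>wt k\<bar> * ds 2 (I k t) (I' k t))" .
  have "gap 2 R R' t \<le> (\<Sum>k\<in>A. \<bar>wt k\<bar> * ds 2 (I k t) (I' k t))^2"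
    unfolding gap_def using le ds_nonneg[OF b(3) b'(3) ok2] by (rule power_mono)
  also have "... \<le> (\<Sum>k\<in>A. (\<bar>wt k\<bar> * ds 2 (I k t) (I' k t))\<^sup>2) * real (card A)"
    by (rule sum_squared_le_sum_of_squares)
  also have "... \<le> (\<Sum>k\<in>A. (wt k)\<^sup>2 * (4 * C k * (L * q))) * real (card A)"
    by (intro mult_right_mono sum_mono) (auto simp: power_mult_distrib Ik intro: mult_left_mono)
  also have "... = (real (card A) * (\<Sum>k\<in>A. (wt k)\<^sup>2 * (4 * C k)) * L) * q"
    by (simp add: sum_distrib_left sum_distrib_right mult_ac)
  also have "... \<le> kappa * q" unfolding kappa_def L_def by (intro mult_right_mono q0) simp
  finally show ?thesis by (simp add: q_def)
qed

lemma rhs_gap_MGbar: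
  assumes "X \<in> MGbar E 2 T" "X' \<in> MGbar E 2 T" "rhs X R" "rhs X' R'" "t \<in> {0..T}"
  shows "gap 2 R R' t \<le> kappa * LI T (gap 2 X X')"
proof -
  have "LI T (%s. indicator {0..t} s * gap 2 X X' s) \<le> LI T (gap 2 X X')"
  proof (rule integral_mono)
    show "integrable (LB T) (%s. indicator {0..t} s * gap 2 X X' s)"
      using gap_integrable[OF MGbar_restrict[OF assms(1) ok2, of t] MGbar_restrict[OF assms(2) ok2, of t] ok2] by (simp add: gap_restrict[abs_def])
    show "integrable (LB T) (gap 2 X X')" by (rule gap_integrable[OF assms(1,2) ok2])
    fix s assume "s \<in> space (LB T)"
    then have "0 \<le> gap 2 X X' s" by (intro gap_nonneg MGbar_LG[OF assms(1)] MGbar_LG[OF assms(2)] ok2) auto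
    then show "indicator {0..t} s * gap 2 X X' s \<le> gap 2 X X' s" by (simp add: indicator_def)
  qed
  then show ?thesis using rhs_gap[OF assms] kappa_pos by (meson less_imp_le mult_left_mono order_trans)
qed

lemma fixed_point_exists: "\<exists>X\<in>MGbar E 2 T. \<exists>R\<in>MGbar E 2 T. rhs X R \<and> (\<forall>t\<in>{0..T}. gap 2 X R t = 0)"
proof -
  have "\<forall>X. \<exists>R. X \<in> MGbar E 2 T --> R \<in> MGbar E 2 T \<and> rhs X R" using rhs_exists by blast
  from choice[OF this] obtain F where F: "\<And>X. X \<in> MGbar E 2 T ==> F X \<in> MGbar E 2 T" "\<And>X. X \<in> MGbar E 2 T ==> rhs X (F X)" by blast
  define x where "x m = (F ^^ m) (%_ _ _. 0)" for m
  have xS: "x (Suc m) = F (x m)" for m by (simp add: x_def)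
  have xM: "x m \<in> MGbar E 2 T" for m
  proof (induction m)
    case 0 show ?case unfolding x_def using padp_MGbar[OF padp_const[OF ok2, of 0] ok2] by simp
  next
    case (Suc m) then show ?case unfolding xS by (rule F(1))
  qed
  have xr: "rhs (x m) (x (Suc m))" for m unfolding xS by (rule F(2)[OF xM])
  define g where "g m = gap 2 (x (Suc m)) (x m)" for m
  have gi: "integrable (LB T) (g m)" for m unfolding g_def by (rule gap_integrable[OF xM xM ok2])
  have g0: "0 \<le> g m t" if "t \<in> {0..T}" for m t unfolding g_def by (intro gap_nonneg MGbar_LG[OF xM that] ok2)
  have gs: "g (Suc m) t \<le> kappa * LI T (%s. indicator {0..t} s * g m s)" if "t \<in> {0..T}" for m t
    unfolding g_def by (rule rhs_gap[OF xM xM xr xr that])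
  define M where "M = kappa * LI T (g 0) * exp (4 * kappa * T)"
  have I0: "0 \<le> kappa * LI T (g 0)" using kappa_pos by (intro mult_nonneg_nonneg integral_nonneg_AE AE_I2) (auto simp: g0)
  then have M0: "0 \<le> M" by (simp add: M_def)
  have gb: "g (Suc m) t \<le> M * (1/4) ^ m" if t: "t \<in> {0..T}" for m t
  proof -
    have "g (Suc m) t \<le> kappa * LI T (g 0) * exp (4 * kappa * t) * (1/4) ^ m"
      by (rule iterated_bound[where g = g, OF kappa_pos gi g0 gs t])
    also have "... \<le> M * (1/4) ^ m" unfolding M_def using t kappa_pos I0 by (intro mult_right_mono mult_left_mono) auto
    finally show ?thesis .
  qed
  define c where "c = sqrt M"
  \<comment> \<open>Squares decay with ratio 1/4, distances with ratio 1/2. The first difference is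
    left out, as it has no bound uniform in time.\<close>
  have db: "ds 2 (x (Suc (Suc m)) t) (x (Suc m) t) \<le> c * (1/2) ^ m" if t: "t \<in> {0..T}" for m t
  proof (rule power2_le_imp_le)
    have "(1/4 :: real) ^ m = ((1/2) ^ m)^2" by (simp add: power_mult[symmetric] power2_eq_square power_mult_distrib[symmetric])
    then show "(ds 2 (x (Suc (Suc m)) t) (x (Suc m) t))^2 \<le> (c * (1/2) ^ m)^2"
      using gb[OF t, of m] M0 by (simp add: g_def gap_def c_def power_mult_distrib)
    show "0 \<le> c * (1/2) ^ m" using M0 by (simp add: c_def)
  qed
  have "\<forall>t. \<exists>z. t \<in> {0..T} --> z \<in> LG E 2 \<and> (\<forall>m. ds 2 (x (Suc m) t) z \<le> 2 * c * (1/2) ^ m)"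
  proof (intro allI)
    fix t
    show "\<exists>z. t \<in> {0..T} --> z \<in> LG E 2 \<and> (\<forall>m. ds 2 (x (Suc m) t) z \<le> 2 * c * (1/2) ^ m)"
      using geometric_limit[of "%m. x (Suc m) t" c] MGbar_LG[OF xM, of t] db[of t] by blast
  qed
  from choice[OF this] obtain X where X: "\<And>t. t \<in> {0..T} ==> X t \<in> LG E 2"
    "\<And>t m. t \<in> {0..T} ==> ds 2 (x (Suc m) t) (X t) \<le> 2 * c * (1/2) ^ m" by blast
  define delta where "delta m = (2 * c * (1/2) ^ m)^2" for m :: nat
  have "(%m. 2 * c * (1/2 :: real) ^ m) ----> 0"
    using tendsto_mult_left[OF LIMSEQ_power_zero[of "1/2 :: real"], of "2 * c"] by simp
  then have delta: "delta ----> 0" unfolding delta_def[abs_def] using tendsto_power[of _ 0 sequentially 2] by force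
  have gX: "gap 2 (x (Suc m)) X t \<le> delta m" if "t \<in> {0..T}" for m t
    unfolding gap_def delta_def using X(2)[OF that] ds_nonneg[OF MGbar_LG[OF xM that] X(1)[OF that] ok2] by (rule power_mono)
  have XM: "X \<in> MGbar E 2 T" by (rule MGbar_uniform_limit[OF X(1) xM gX delta])
  \<comment> \<open>The right-hand side for the limit is formed anew; by
    \<open>rhs_gap_MGbar\<close> the iterates converge to it as well.\<close>
  obtain R where R: "R \<in> MGbar E 2 T" "rhs X R" using rhs_exists[OF XM] by blast
  have "gap 2 X R t = 0" if t: "t \<in> {0..T}" for t
  proof -
    have tri: "gap 2 X R t \<le> 2 * delta (Suc m) + 2 * (kappa * (T * delta m))" for m
    proof -
      have "gap 2 X R t \<le> 2 * gap 2 X (x (Suc (Suc m))) t + 2 * gap 2 (x (Suc (Suc m))) R t"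
        by (rule gap_triangle[of X t 2 "x (Suc (Suc m))" R, OF X(1)[OF t] MGbar_LG[OF xM t] MGbar_LG[OF R(1) t] ok2])
      moreover have "gap 2 X (x (Suc (Suc m))) t \<le> delta (Suc m)" using gX[OF t, of "Suc m"] by (simp add: gap_commute[of 2 X])
      moreover have "gap 2 (x (Suc (Suc m))) R t \<le> kappa * LI T (gap 2 (x (Suc m)) X)"
        by (rule rhs_gap_MGbar[OF xM XM xr R(2) t])
      moreover have "LI T (gap 2 (x (Suc m)) X) \<le> LI T (%_. delta m)"
        by (rule integral_mono[OF gap_integrable[OF xM XM ok2] LB_const_integrable]) (simp add: gX)
      then have "kappa * LI T (gap 2 (x (Suc m)) X) \<le> kappa * (T * delta m)"
        unfolding LB_integral_const[OF less_imp_le[OF T_pos]] using kappa_pos by (intro mult_left_mono) auto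
      ultimately show ?thesis by linarith
    qed
    have "(%m. 2 * delta (Suc m) + 2 * (kappa * (T * delta m))) ----> 2 * 0 + 2 * (kappa * (T * 0))"
      by (intro tendsto_add tendsto_mult_left delta LIMSEQ_Suc)
    then have "(%m. 2 * delta (Suc m) + 2 * (kappa * (T * delta m))) ----> 0" by simp
    then have "gap 2 X R t \<le> 0" by (rule LIMSEQ_le_const) (use tri in blast)
    then show ?thesis using gap_nonneg[of X t 2 R, OF X(1)[OF t] MGbar_LG[OF R(1) t] ok2] by simp
  qed
  then show ?thesis using XM R by blast
qed

text \<open>\<open>X\<close> and \<open>R\<close> agree only at almost every time, so the iteration
  is applied to the gap of \<open>R\<close> and \<open>R'\<close>, which obeys the integral
  inequality at every time. As a constant sequence in \<open>iterated_bound\<close> it is below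
  arbitrarily small numbers.\<close>

lemma fixed_point_unique:
  assumes X: "X \<in> MGbar E 2 T" "X' \<in> MGbar E 2 T" and R: "R \<in> MGbar E 2 T" "R' \<in> MGbar E 2 T" "rhs X R" "rhs X' R'"
    and eq: "AE t in LB T. gap 2 X R t = 0" "AE t in LB T. gap 2 X' R' t = 0"
  shows "AE t in LB T. gap 2 X X' t = 0"
proof -
  define u where "u = gap 2 R R'"
  have ui: "integrable (LB T) u" unfolding u_def by (rule gap_integrable[OF R(1,2) ok2])
  have u0: "0 \<le> u t" if "t \<in> {0..T}" for t unfolding u_def by (intro gap_nonneg MGbar_LG[OF R(1) that] MGbar_LG[OF R(2) that] ok2)
  have XR: "AE t in LB T. gap 2 X X' t = u t" using eq AE_space[of "LB T"]
  proof eventually_elim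
    case (elim t)
    then have t: "t \<in> {0..T}" by simp
    note L = MGbar_LG[OF X(1) t] MGbar_LG[OF X(2) t] MGbar_LG[OF R(1) t] MGbar_LG[OF R(2) t]
    have z: "ds 2 (X t) (R t) = 0" "ds 2 (X' t) (R' t) = 0" using elim by (simp_all add: gap_def)
    have "ds 2 (X t) (X' t) = ds 2 (R t) (X' t)" by (rule ds_zero_shift[OF L(1,3,2) ok2 z(1)])
    also have "... = ds 2 (X' t) (R t)" by (rule ds_commute)
    also have "... = ds 2 (R' t) (R t)" by (rule ds_zero_shift[OF L(2,4,3) ok2 z(2)])
    also have "... = ds 2 (R t) (R' t)" by (rule ds_commute)
    finally show ?case by (simp add: gap_def u_def)
  qed
  have XXi: "integrable (LB T) (%s. indicator {0..t} s * gap 2 X X' s)" for t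
    using gap_integrable[OF MGbar_restrict[OF X(1) ok2, of t] MGbar_restrict[OF X(2) ok2, of t] ok2] by (simp add: gap_restrict[abs_def])
  have RRi: "integrable (LB T) (%s. indicator {0..t} s * u s)" for t
    using gap_integrable[OF MGbar_restrict[OF R(1) ok2, of t] MGbar_restrict[OF R(2) ok2, of t] ok2] by (simp add: gap_restrict[abs_def] u_def)
  have us: "u t \<le> kappa * LI T (%s. indicator {0..t} s * u s)" if t: "t \<in> {0..T}" for t
  proof -
    have "LI T (%s. indicator {0..t} s * gap 2 X X' s) = LI T (%s. indicator {0..t} s * u s)"
    proof (rule integral_cong_AE[OF borel_measurable_integrable[OF XXi] borel_measurable_integrable[OF RRi]])
      show "AE s in LB T. indicator {0..t} s * gap 2 X X' s = indicator {0..t} s * u s" using XR by eventually_elim simp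
    qed
    then show ?thesis using rhs_gap[OF X R(3,4) t] by (simp add: u_def)
  qed
  have "u t = 0" if t: "t \<in> {0..T}" for t
  proof -
    have "u t \<le> (kappa * LI T u * exp (4 * kappa * t)) * (1/4) ^ m" for m
      using iterated_bound[OF kappa_pos, of "%_. u", OF ui u0 us t] by simp
    moreover have "(%m. (kappa * LI T u * exp (4 * kappa * t)) * (1/4 :: real) ^ m) ----> 0"
      using tendsto_mult_left[OF LIMSEQ_power_zero[of "1/4 :: real"], of "kappa * LI T u * exp (4 * kappa * t)"] by simp
    ultimately have "u t \<le> 0" by (intro LIMSEQ_le_const) blast+
    then show ?thesis using u0[OF t] by simp
  qed
  then show ?thesis using XR AE_space[of "LB T"] by (auto elim!: eventually_elim2)
qed

end

section \<open>The stochastic differential equation\<close>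

context G_time
begin

lemma gap_integral_zero_iff:
  assumes "eta \<in> MGbar E 2 T" "eta' \<in> MGbar E 2 T"
  shows "MGbar_eq E 2 T eta eta' \<longleftrightarrow> (AE t in LB T. gap 2 eta eta' t = 0)"
proof -
  have g0: "0 \<le> gap 2 eta eta' t" if "t \<in> {0..T}" for t
    by (intro gap_nonneg MGbar_LG[OF assms(1) that] MGbar_LG[OF assms(2) that] ok2)
  have gi: "integrable (LB T) (gap 2 eta eta')" by (rule gap_integrable[OF assms ok2])
  have "MGbar_eq E 2 T eta eta' \<longleftrightarrow> (gap 2 eta eta' has_integral 0) {0..T}" unfolding MGbar_eq_def
  proof (rule has_integral_cong)
    fix t assume t: "t \<in> {0..T}"
    show "Eext E (%m w. norm (eta t m w - eta' t m w) ^ 2) = gap 2 eta eta' t"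
      unfolding gap_def by (rule Eext_norm_power[OF LG_diff[OF MGbar_LG[OF assms(1) t] MGbar_LG[OF assms(2) t]]]) simp_all
  qed
  also have "... \<longleftrightarrow> LI T (gap 2 eta eta') = 0" using LB_has_integral[OF g0] gi by simp
  also have "... \<longleftrightarrow> (AE t in LB T. gap 2 eta eta' t = 0)"
    by (rule integral_nonneg_eq_0_iff_AE[OF gi], rule AE_I2) (simp add: g0)
  finally show ?thesis .
qed

lemma lipschitz_field_mono:
  assumes f: "\<And>x. f x \<in> LG E 2" and lip: "lipschitz_field E K f" and le: "K \<le> K'"
  shows "lipschitz_field E K' f"
  unfolding lipschitz_field_def
proof (intro allI)
  fix x x'
  define u where "u = (%m w. norm (f x m w - f x' m w))"
  define v where "v = (%(m::nat) (w :: 'd cpath). K * norm (x - x'))"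
  have uL: "u \<in> LG E 2" unfolding u_def by (intro LG_norm LG_diff f ok2)
  have vL: "v \<in> LG E 2" unfolding v_def by (rule LG_const[OF L_ip_const ok2])
  have uv: "LG_le E u v" using lip unfolding lipschitz_field_def u_def v_def by blast
  have "LG_le E u (%m w. K' * norm (x - x'))"
  proof (rule LG_le_dom[where A = "{0}" and e = "%_. pos_part u v" and c = 1])
    show "u m w \<le> K' * norm (x - x') + 1 * (\<Sum>k\<in>{0}. pos_part u v m w)" for m w
    proof -
      have "v m w \<le> K' * norm (x - x')" unfolding v_def by (rule mult_right_mono[OF le]) simp
      then show ?thesis using pos_part_ge[of u m w v] by simp
    qed
  qed (use LG_L_ip[OF uL] L_ip_const LG_L_ip[OF pos_part_LG[OF uL vL]] LG_le_pos_part[OF uv] pos_part_nonneg in auto)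
  then show "LG_le E (%m w. norm (f x m w - f x' m w)) (%m w. K' * norm (x - x'))" by (simp add: u_def)
qed

end

text \<open>The family of integrators: \<open>dt\<close>, the two terms of the polarised \<open>d\<langle>B\<^sup>i, B\<^sup>j\<rangle>\<close>, and \<open>dB\<^sup>j\<close>.\<close>

type_synonym 'd term_index = "unit + ('d \<times> 'd) + ('d \<times> 'd) + 'd"

definition by_term :: "'z => ('d => 'd => 'z) => ('d => 'd => 'z) => ('d => 'z) => 'd term_index => 'z" where
  "by_term b p q s = case_sum (%_. b) (case_sum (%(i, j). p i j) (case_sum (%(i, j). q i j) s))"

lemma by_term_simps [simp]:
  "by_term b p q s (Inl u) = b"
  "by_term b p q s (Inr (Inl (i, j))) = p i j"
  "by_term b p q s (Inr (Inr (Inl (i, j)))) = q i j"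
  "by_term b p q s (Inr (Inr (Inr j))) = s j" by (simp_all add: by_term_def)

lemma all_term: "(\<forall>k. P k) \<longleftrightarrow> P (Inl ()) \<and> (\<forall>i j. P (Inr (Inl (i, j)))) \<and> (\<forall>i j. P (Inr (Inr (Inl (i, j))))) \<and>
    (\<forall>j. P (Inr (Inr (Inr j))))" by (auto simp: split_sum_all)

lemma term_cases:
  assumes "P (Inl ())" "\<And>i j. P (Inr (Inl (i, j)))" "\<And>i j. P (Inr (Inr (Inl (i, j))))" "\<And>j. P (Inr (Inr (Inr j)))"
  shows "P (k :: 'd term_index)"
  using assms all_term[of P] by blast

lemma sum_terms:
  fixes F :: "'d::finite term_index => 'z::comm_monoid_add"
  shows "(\<Sum>k\<in>UNIV. F k) = F (Inl ()) + ((\<Sum>i\<in>UNIV. \<Sum>j\<in>UNIV. F (Inr (Inl (i, j)))) +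
    ((\<Sum>i\<in>UNIV. \<Sum>j\<in>UNIV. F (Inr (Inr (Inl (i, j))))) + (\<Sum>j\<in>UNIV. F (Inr (Inr (Inr j))))))"
proof -
  have pair: "(\<Sum>k\<in>UNIV. g k) = (\<Sum>i\<in>UNIV. \<Sum>j\<in>UNIV. g (i, j))" for g :: "'d \<times> 'd => 'z"
    unfolding UNIV_Times_UNIV[symmetric] sum.cartesian_product by simp
  have plus: "(\<Sum>k\<in>UNIV. g k) = (\<Sum>k\<in>UNIV. g (Inl k)) + (\<Sum>k\<in>UNIV. g (Inr k))" for g :: "'x::finite + 'y::finite => 'z"
    using sum.Plus[of "UNIV :: 'x set" "UNIV :: 'y set" g] by (simp add: comp_def)
  show ?thesis by (simp add: plus pair UNIV_unit)
qed

locale G_SDE = G_time E T for E :: "('d::finite cpath => real) => real" and T +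
  fixes e :: "'d => real^'d" and X0 :: "real^'n::finite" and K :: real
    and b :: "real => real^'n => ('d, real^'n) rv"
    and h :: "'d => 'd => real => real^'n => ('d, real^'n) rv"
    and \<sigma> :: "'d => real => real^'n => ('d, real^'n) rv"
  assumes K: "0 \<le> K"
    and b: "\<And>x. (%t. b t x) \<in> MGbar E 2 T" and h: "\<And>i j x. (%t. h i j t x) \<in> MGbar E 2 T"
    and \<sigma>: "\<And>j x. (%t. \<sigma> j t x) \<in> MGbar E 2 T"
    and b_lip: "\<And>t. t \<in> {0..T} ==> lipschitz_field E K (b t)"
    and h_lip: "\<And>i j t. t \<in> {0..T} ==> lipschitz_field E K (h i j t)"
    and \<sigma>_lip: "\<And>j t. t \<in> {0..T} ==> lipschitz_field E K (\<sigma> j t)"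
begin

definition DD :: "'d term_index => nat => nat => 'd cpath => real" where
  "DD = by_term Dt (%i j. Dq (e i + e j)) (%i j. Dq (e i - e j)) (%j. Db (e j))"

text \<open>The signs and the factor 1/4 are those of polarisation.\<close>

definition ww :: "'d term_index => real" where
  "ww = by_term 1 (%i j. 1/4) (%i j. - (1/4)) (%j. 1)"

definition ff :: "'d term_index => real => real^'n => ('d, real^'n) rv" where
  "ff = by_term b h h \<sigma>"

definition CC :: "'d term_index => real" where
  "CC k = (SOME C. integrator 2 (DD k) TYPE(real^'n) C)"

lemma integrator_DD: "integrator 2 (DD k) TYPE(real^'n) (CC k)"
proof -
  have "\<exists>C. integrator 2 (DD k) TYPE(real^'n) C"
    by (rule term_cases[where P = "%k. \<exists>C. integrator 2 (DD k) TYPE(real^'n) C"])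
      (use integrator_Dt[of 2] integrator_Dq[of 2] integrator_Db in \<open>auto simp: DD_def\<close>)
  then show ?thesis unfolding CC_def by (rule someI_ex)
qed

sublocale eqn: G_equation E T UNIV DD CC ww ff K X0
proof
  show "(%t. ff k t x) \<in> MGbar E 2 T" for k x
    by (rule term_cases[where P = "%k. (%t. ff k t x) \<in> MGbar E 2 T"]) (simp_all add: ff_def b h \<sigma>)
  show "lipschitz_field E K (ff k t)" if "t \<in> {0..T}" for k t
    by (rule term_cases[where P = "%k. lipschitz_field E K (ff k t)"]) (simp_all only: ff_def by_term_simps b_lip[OF that] h_lip[OF that] \<sigma>_lip[OF that])
qed (simp_all add: K integrator_DD)

lemma weighted_sum:
  "X0 + (\<Sum>k\<in>UNIV. ww k *\<^sub>R y k) = X0 + y (Inl ()) +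
     (\<Sum>i\<in>UNIV. \<Sum>j\<in>UNIV. (1/4) *\<^sub>R (y (Inr (Inl (i, j))) - y (Inr (Inr (Inl (i, j)))))) + (\<Sum>j\<in>UNIV. y (Inr (Inr (Inr j))))"
  unfolding sum_terms by (simp add: ww_def scaleR_diff_right sum_subtractf sum_negf)

text \<open>Fresh substitutions and integrals are chosen for \<open>X\<close>. Their sum
  \<open>Y\<close> is another right-hand side for the same \<open>X\<close>, hence at distance 0
  from \<open>R\<close>. By \<open>SI_2_1\<close> the L^2 integrals are also integrals in the sense
  of the definitions.\<close>

lemma solution_of_fixed_point:
  assumes X: "X \<in> MGbar E 2 T" and R: "R \<in> MGbar E 2 T" "eqn.rhs X R" "\<And>t. t \<in> {0..T} ==> gap 2 X R t = 0"
  shows "is_solution E T e X0 b h \<sigma> X"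
proof -
  obtain beta where beta: "is_subst_process E T b X beta" using subst_process_exists[OF X b K b_lip] by blast
  have "\<forall>i. \<exists>gamma. \<forall>j. is_subst_process E T (h i j) X (gamma j)"
    by (intro allI choice) (rule subst_process_exists[OF X h K h_lip])
  from choice[OF this] obtain gamma where gamma: "\<And>i j. is_subst_process E T (h i j) X (gamma i j)" by blast
  have "\<forall>j. \<exists>zeta. is_subst_process E T (\<sigma> j) X zeta" using subst_process_exists[OF X \<sigma> K \<sigma>_lip] by blast
  from choice[OF this] obtain zeta where zeta: "\<And>j. is_subst_process E T (\<sigma> j) X (zeta j)" by blast
  define B where "B = by_term beta gamma gamma zeta"
  have B: "is_subst_process E T (ff k) X (B k)" for k
    by (rule term_cases[where P = "%k. is_subst_process E T (ff k) X (B k)"]) (simp_all add: ff_def B_def beta gamma zeta)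
  obtain I where I0: "\<forall>k\<in>UNIV. \<forall>t\<in>{0..T}. SI 2 (DD k) (restrict_upto t (B k)) (I k t)"
    and R': "(%t m w. X0 + (\<Sum>k\<in>UNIV. ww k *\<^sub>R I k t m w)) \<in> MGbar E 2 T"
      "eqn.rhs X (%t m w. X0 + (\<Sum>k\<in>UNIV. ww k *\<^sub>R I k t m w))" using eqn.rhs_of_subst[OF X B] by blast
  have I: "SI 2 (DD k) (restrict_upto t (B k)) (I k t)" if "t \<in> {0..T}" for k t using I0 that by blast
  define Y where "Y = (%t m w. X0 + (\<Sum>k\<in>UNIV. ww k *\<^sub>R I k t m w))"
  have Y: "Y \<in> MGbar E 2 T" "eqn.rhs X Y" using R' unfolding Y_def by auto
  have XY: "gap 2 X Y t = 0" if t: "t \<in> {0..T}" for t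
  proof -
    note L = MGbar_LG[OF X t] MGbar_LG[OF R(1) t] MGbar_LG[OF Y(1) t]
    have z: "gap 2 X X = (%_. 0)" by (simp add: gap_def[abs_def] Np_zero)
    have "gap 2 R Y t \<le> 0" using eqn.rhs_gap_MGbar[OF X X R(2) Y(2) t] by (simp add: z)
    moreover have "gap 2 X Y t \<le> 2 * gap 2 X R t + 2 * gap 2 R Y t" by (rule gap_triangle[of X t 2 R Y, OF L ok2])
    moreover have "0 \<le> gap 2 X Y t" by (rule gap_nonneg[of X t 2 Y, OF L(1,3) ok2])
    ultimately show ?thesis using R(3)[OF t] by linarith
  qed
  have BM: "restrict_upto t (B k) \<in> MGbar E 2 T" for k t
    using B[of k] MGbar_restrict ok2 unfolding is_subst_process_def by blast
  have I1: "SI 1 (DD k) (restrict_upto t (B k)) (I k t)" if "t \<in> {0..T}" for k t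
    by (rule SI_2_1[OF integrator_DD BM I[OF that]])
  have "MGbar_eq E 2 T X Y" unfolding gap_integral_zero_iff[OF X Y(1)] by (rule AE_I2) (simp add: XY)
  moreover have "has_int_dt E T (restrict_upto t beta) (I (Inl ()) t)" if t: "t \<in> {0..T}" for t
    using has_int_dt_iff[OF MGbar_2_1[OF BM], of t "Inl ()" "I (Inl ()) t"] I1[OF t, of "Inl ()"] by (simp add: DD_def B_def)
  moreover have "has_int_dQV2 E T (e i) (e j) (restrict_upto t (gamma i j))
      (%m w. (1/4) *\<^sub>R (I (Inr (Inl (i, j))) t m w - I (Inr (Inr (Inl (i, j)))) t m w))" if t: "t \<in> {0..T}" for t i j
  proof -
    have "has_int_dQV E T (e i + e j) (restrict_upto t (gamma i j)) (I (Inr (Inl (i, j))) t)"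
      using has_int_dQV_iff[OF MGbar_2_1[OF BM], of "e i + e j" t "Inr (Inl (i, j))" "I (Inr (Inl (i, j))) t"]
        I1[OF t, of "Inr (Inl (i, j))"] by (simp add: DD_def B_def)
    moreover have "has_int_dQV E T (e i - e j) (restrict_upto t (gamma i j)) (I (Inr (Inr (Inl (i, j)))) t)"
      using has_int_dQV_iff[OF MGbar_2_1[OF BM], of "e i - e j" t "Inr (Inr (Inl (i, j)))" "I (Inr (Inr (Inl (i, j)))) t"]
        I1[OF t, of "Inr (Inr (Inl (i, j)))"] by (simp add: DD_def B_def)
    ultimately show ?thesis unfolding has_int_dQV2_def by blast
  qed
  moreover have "has_int_dB E T (e j) (restrict_upto t (zeta j)) (I (Inr (Inr (Inr j))) t)" if t: "t \<in> {0..T}" for t j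
    using has_int_dB_iff[OF BM, of "e j" t "Inr (Inr (Inr j))" "I (Inr (Inr (Inr j))) t"] I[OF t, of "Inr (Inr (Inr j))"]
    by (simp add: DD_def B_def)
  moreover have "LG_eq E 1 (Y t) (%m w. X0 + I (Inl ()) t m w + (\<Sum>i\<in>UNIV. \<Sum>j\<in>UNIV.
      (1/4) *\<^sub>R (I (Inr (Inl (i, j))) t m w - I (Inr (Inr (Inl (i, j)))) t m w)) + (\<Sum>j\<in>UNIV. I (Inr (Inr (Inr j))) t m w))"
    if t: "t \<in> {0..T}" for t
  proof -
    have "LG_eq E 1 (Y t) (Y t)" by (simp add: LG_eq_def E_const)
    moreover have "Y t = (%m w. X0 + I (Inl ()) t m w + (\<Sum>i\<in>UNIV. \<Sum>j\<in>UNIV.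
      (1/4) *\<^sub>R (I (Inr (Inl (i, j))) t m w - I (Inr (Inr (Inl (i, j)))) t m w)) + (\<Sum>j\<in>UNIV. I (Inr (Inr (Inr j))) t m w))"
      unfolding Y_def by (intro ext weighted_sum)
    ultimately show ?thesis by simp
  qed
  ultimately show ?thesis unfolding is_solution_def using X Y(1) beta gamma zeta
    by (intro conjI exI[of _ beta] exI[of _ gamma] exI[of _ zeta] exI[of _ Y] exI[of _ "I (Inl ())"]
        exI[of _ "%i j t m w. (1/4) *\<^sub>R (I (Inr (Inl (i, j))) t m w - I (Inr (Inr (Inl (i, j)))) t m w)"]
        exI[of _ "%j. I (Inr (Inr (Inr j)))"] allI ballI) simp_all
qed

text \<open>The integrals \<open>dt\<close> and those against the quadratic variations come with the
  solution in L^1 only. The integrands admit integrals in L^2, which agree with the given ones in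
  L^1 by uniqueness; so \<open>R\<close> is a right-hand side in the L^2 sense.\<close>

lemma fixed_point_of_solution:
  assumes "is_solution E T e X0 b h \<sigma> X"
  shows "X \<in> MGbar E 2 T \<and> (\<exists>R\<in>MGbar E 2 T. eqn.rhs X R \<and> (AE t in LB T. gap 2 X R t = 0))"
proof -
  have X: "X \<in> MGbar E 2 T" using assms unfolding is_solution_def by blast
  obtain beta gamma zeta R I J V where sol: "is_subst_process E T b X beta \<and>
      (\<forall>i j. is_subst_process E T (h i j) X (gamma i j)) \<and> (\<forall>j. is_subst_process E T (\<sigma> j) X (zeta j)) \<and>
      (\<forall>t\<in>{0..T}. has_int_dt E T (restrict_upto t beta) (I t) \<and>
        (\<forall>i j. has_int_dQV2 E T (e i) (e j) (restrict_upto t (gamma i j)) (J i j t)) \<and>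
        (\<forall>j. has_int_dB E T (e j) (restrict_upto t (zeta j)) (V j t)) \<and>
        LG_eq E 1 (R t) (%m w. X0 + I t m w + (\<Sum>i\<in>UNIV. \<Sum>j\<in>UNIV. J i j t m w) + (\<Sum>j\<in>UNIV. V j t m w))) \<and>
      R \<in> MGbar E 2 T \<and> MGbar_eq E 2 T X R"
    using assms unfolding is_solution_def by (elim conjE exE) (rule that, intro conjI)
  have subst: "is_subst_process E T b X beta" "\<And>i j. is_subst_process E T (h i j) X (gamma i j)"
      "\<And>j. is_subst_process E T (\<sigma> j) X (zeta j)" using sol by blast+
  have R: "R \<in> MGbar E 2 T" "MGbar_eq E 2 T X R" using sol by blast+
  have int: "has_int_dt E T (restrict_upto t beta) (I t)"
      "has_int_dQV2 E T (e i) (e j) (restrict_upto t (gamma i j)) (J i j t)"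
      "has_int_dB E T (e j) (restrict_upto t (zeta j)) (V j t)" if "t \<in> {0..T}" for t i j using sol that by blast+
  have eq: "LG_eq E 1 (R t) (%m w. X0 + I t m w + (\<Sum>i\<in>UNIV. \<Sum>j\<in>UNIV. J i j t m w) + (\<Sum>j\<in>UNIV. V j t m w))"
    if "t \<in> {0..T}" for t using sol that by blast
  define B where "B = by_term beta gamma gamma zeta"
  have B: "is_subst_process E T (ff k) X (B k)" for k
    by (rule term_cases[where P = "%k. is_subst_process E T (ff k) X (B k)"]) (simp_all add: ff_def B_def subst)
  have BM: "restrict_upto t (B k) \<in> MGbar E 2 T" for k t
    using B[of k] MGbar_restrict ok2 unfolding is_subst_process_def by blast
  obtain Y where Y0: "\<forall>k\<in>UNIV. \<forall>t\<in>{0..T}. SI 2 (DD k) (restrict_upto t (B k)) (Y k t)"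
    using eqn.rhs_of_subst[OF X B] by blast
  have Y: "SI 2 (DD k) (restrict_upto t (B k)) (Y k t)" if "t \<in> {0..T}" for k t using Y0 that by blast
  have YL: "Y k t \<in> LG E 2" if "t \<in> {0..T}" for k t by (rule SI_LG[OF Y[OF that]])
  have Y1: "SI 1 (DD k) (restrict_upto t (B k)) (Y k t)" if "t \<in> {0..T}" for k t
    by (rule SI_2_1[OF integrator_DD BM Y[OF that]])
  have "ds 2 (R t) (%m w. X0 + (\<Sum>k\<in>UNIV. ww k *\<^sub>R Y k t m w)) = 0" if t: "t \<in> {0..T}" for t
  proof -
    have "\<forall>q. \<exists>y. has_int_dQV E T (e (fst q) + e (snd q)) (restrict_upto t (gamma (fst q) (snd q))) (fst y) \<and>
        has_int_dQV E T (e (fst q) - e (snd q)) (restrict_upto t (gamma (fst q) (snd q))) (snd y) \<and>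
        J (fst q) (snd q) t = (%m w. (1/4) *\<^sub>R (fst y m w - snd y m w))"
      using int(2)[OF t] unfolding has_int_dQV2_def split_paired_Ex by simp
    from choice[OF this] obtain y where y: "\<And>q. has_int_dQV E T (e (fst q) + e (snd q)) (restrict_upto t (gamma (fst q) (snd q))) (fst (y q)) \<and>
        has_int_dQV E T (e (fst q) - e (snd q)) (restrict_upto t (gamma (fst q) (snd q))) (snd (y q)) \<and>
        J (fst q) (snd q) t = (%m w. (1/4) *\<^sub>R (fst (y q) m w - snd (y q) m w))" by blast
    define P M where "P i j = fst (y (i, j))" and "M i j = snd (y (i, j))" for i j
    have PM: "has_int_dQV E T (e i + e j) (restrict_upto t (gamma i j)) (P i j)"
        "has_int_dQV E T (e i - e j) (restrict_upto t (gamma i j)) (M i j)"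
        "J i j t = (%m w. (1/4) *\<^sub>R (P i j m w - M i j m w))" for i j
      using y[of "(i, j)"] by (simp_all add: P_def M_def)
    define W where "W = by_term (I t) P M (%j. V j t)"
    have qv: "W k \<in> LG E 1 \<and> ds 1 (W k) (Y k t) = 0" if "has_int_dQV E T a (restrict_upto t (B k)) (W k)" "DD k = Dq a" for a k
    proof -
      obtain c where c: "integrator 1 (Dq a) TYPE(real^'n) c" using integrator_Dq[OF ok1] by blast
      have "SI 1 (Dq a) (restrict_upto t (B k)) (W k)" using that(1) has_int_dQV_iff[OF MGbar_2_1[OF BM]] by blast
      then show ?thesis using SI_unique[OF c MGbar_2_1[OF BM] _ Y1[OF t, of k, unfolded that(2)]] SI_LG by blast
    qed
    have W: "W k \<in> LG E 1 \<and> ds 1 (W k) (Y k t) = 0" for k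
    proof (rule term_cases[where P = "%k. W k \<in> LG E 1 \<and> ds 1 (W k) (Y k t) = 0"])
      have "SI 1 Dt (restrict_upto t (B (Inl ()))) (W (Inl ()))"
        using int(1)[OF t] has_int_dt_iff[OF MGbar_2_1[OF BM], of t "Inl ()" "I t"] by (simp add: B_def W_def)
      then show "W (Inl ()) \<in> LG E 1 \<and> ds 1 (W (Inl ())) (Y (Inl ()) t) = 0"
        using SI_unique[OF integrator_Dt[OF ok1] MGbar_2_1[OF BM] _ Y1[OF t, of "Inl ()", unfolded DD_def by_term_simps]] SI_LG by blast
    next
      show "W (Inr (Inl (i, j))) \<in> LG E 1 \<and> ds 1 (W (Inr (Inl (i, j)))) (Y (Inr (Inl (i, j))) t) = 0" for i j
        by (rule qv[of "e i + e j"]) (use PM(1) in \<open>simp_all add: W_def B_def DD_def\<close>)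
      show "W (Inr (Inr (Inl (i, j)))) \<in> LG E 1 \<and> ds 1 (W (Inr (Inr (Inl (i, j))))) (Y (Inr (Inr (Inl (i, j)))) t) = 0" for i j
        by (rule qv[of "e i - e j"]) (use PM(2) in \<open>simp_all add: W_def B_def DD_def\<close>)
    next
      fix j
      let ?k = "Inr (Inr (Inr j)) :: 'd term_index"
      have "SI 2 (DD ?k) (restrict_upto t (B ?k)) (W ?k)"
        using int(3)[OF t] has_int_dB_iff[OF BM, of "e j" t ?k "V j t"] by (simp add: B_def W_def DD_def)
      then have z: "ds 2 (W ?k) (Y ?k t) = 0" "W ?k \<in> LG E 2"
        using SI_unique[OF integrator_DD BM _ Y[OF t]] SI_LG by blast+
      have dL: "(%m w. W ?k m w - Y ?k t m w) \<in> LG E 2" by (rule LG_diff[OF z(2) YL[OF t] ok2])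
      have "ds 1 (W ?k) (Y ?k t) = 0" using Np_1_le[OF dL ok2] Np_nonneg[OF LG_2_1[OF dL] ok1] z(1) by linarith
      then show "W ?k \<in> LG E 1 \<and> ds 1 (W ?k) (Y ?k t) = 0" using LG_2_1[OF z(2)] by blast
    qed
    let ?Y = "%m w. X0 + (\<Sum>k\<in>UNIV. ww k *\<^sub>R Y k t m w)" and ?W = "%m w. X0 + (\<Sum>k\<in>UNIV. ww k *\<^sub>R W k m w)"
    have Y2L: "?Y \<in> LG E 2" using eqn.sum_LG[of "%k. Y k t"] YL[OF t] by simp
    have WL: "?W \<in> LG E 1" using W by (intro LG_add LG_const L_ip_const LG_sum LG_scaleR ok1) blast
    have RL: "R t \<in> LG E 2" by (rule MGbar_LG[OF R(1) t])
    have "?W = (%m w. X0 + I t m w + (\<Sum>i\<in>UNIV. \<Sum>j\<in>UNIV. J i j t m w) + (\<Sum>j\<in>UNIV. V j t m w))"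
      unfolding weighted_sum by (simp add: W_def PM(3))
    then have "LG_eq E 1 (R t) ?W" using eq[OF t] by simp
    then have RW: "ds 1 (R t) ?W = 0" using LG_eq_iff[OF LG_2_1[OF RL] WL ok1] by blast
    have "ds 1 ?W ?Y = ds 1 (%m w. \<Sum>k\<in>UNIV. ww k *\<^sub>R W k m w) (%m w. \<Sum>k\<in>UNIV. ww k *\<^sub>R Y k t m w)" by simp
    also have "... \<le> (\<Sum>k\<in>UNIV. ds 1 (%m w. ww k *\<^sub>R W k m w) (%m w. ww k *\<^sub>R Y k t m w))"
    proof (rule ds_sum_le[OF _ _ ok1])
      show "(%m w. ww k *\<^sub>R W k m w) \<in> LG E 1" for k using W by (intro LG_scaleR ok1) blast
      show "(%m w. ww k *\<^sub>R Y k t m w) \<in> LG E 1" for k by (intro LG_scaleR LG_2_1 YL t ok1)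
    qed
    also have "... = 0"
    proof (rule sum.neutral, rule ballI)
      fix k
      have "ds 1 (%m w. ww k *\<^sub>R W k m w) (%m w. ww k *\<^sub>R Y k t m w) = Np 1 (%m w. ww k *\<^sub>R (W k m w - Y k t m w))"
        by (simp only: scaleR_diff_right)
      also have "... = \<bar>ww k\<bar> * ds 1 (W k) (Y k t)"
      proof (rule Np_scaleR[OF LG_diff[OF _ LG_2_1[OF YL[OF t]]]])
        show "W k \<in> LG E 1" using W by blast
      qed simp_all
      also have "... = 0" using W by (metis mult_zero_right)
      finally show "ds 1 (%m w. ww k *\<^sub>R W k m w) (%m w. ww k *\<^sub>R Y k t m w) = 0" .
    qed
    finally have "ds 1 (R t) ?Y \<le> 0" using ds_triangle[OF LG_2_1[OF RL] WL LG_2_1[OF Y2L] ok1] RW by linarith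
    then have "ds 1 (R t) ?Y = 0" using ds_nonneg[OF LG_2_1[OF RL] LG_2_1[OF Y2L] ok1] by linarith
    \<comment> \<open>\<open>R t\<close> and the sum both lie in L^2, where distance 0 in L^1
      implies distance 0.\<close>
    then show ?thesis by (rule Np_2_zero[OF LG_diff[OF RL Y2L ok2]])
  qed
  then have "eqn.rhs X R" unfolding eqn.rhs_def using B Y MGbar_LG[OF R(1)] by (intro exI[of _ B] exI[of _ Y]) simp
  then show ?thesis using X R gap_integral_zero_iff[OF X R(1)] by blast
qed

lemma solution_exists_unique:
  "(\<exists>X. is_solution E T e X0 b h \<sigma> X) \<and>
   (\<forall>X X'. is_solution E T e X0 b h \<sigma> X --> is_solution E T e X0 b h \<sigma> X' --> MGbar_eq E 2 T X X')"
proof (intro conjI allI impI)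
  show "\<exists>X. is_solution E T e X0 b h \<sigma> X"
  proof -
    obtain X R where X: "X \<in> MGbar E 2 T" "R \<in> MGbar E 2 T" "eqn.rhs X R" and XR: "\<forall>t\<in>{0..T}. gap 2 X R t = 0"
      using eqn.fixed_point_exists by (elim bexE conjE)
    have "is_solution E T e X0 b h \<sigma> X" by (rule solution_of_fixed_point[OF X]) (use XR in blast)
    then show ?thesis by (intro exI[of _ X])
  qed
next
  fix X X' assume sol: "is_solution E T e X0 b h \<sigma> X" "is_solution E T e X0 b h \<sigma> X'"
  have X: "X \<in> MGbar E 2 T" "X' \<in> MGbar E 2 T" by (rule conjunct1[OF fixed_point_of_solution[OF sol(1)]], rule conjunct1[OF fixed_point_of_solution[OF sol(2)]])
  obtain R where R1: "R \<in> MGbar E 2 T" "eqn.rhs X R" "AE t in LB T. gap 2 X R t = 0"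
    using conjunct2[OF fixed_point_of_solution[OF sol(1)]] by (elim bexE conjE)
  obtain R' where R2: "R' \<in> MGbar E 2 T" "eqn.rhs X' R'" "AE t in LB T. gap 2 X' R' t = 0"
    using conjunct2[OF fixed_point_of_solution[OF sol(2)]] by (elim bexE conjE)
  show "MGbar_eq E 2 T X X'"
    unfolding gap_integral_zero_iff[OF X] by (rule eqn.fixed_point_unique[OF X R1(1) R2(1) R1(2) R2(2) R1(3) R2(3)])
qed

end

theorem theorem1p2:
  fixes G :: "real^'d^'d::finite \<Rightarrow> real"
    and H' :: "('w \<Rightarrow> real) set" and E' :: "('w \<Rightarrow> real) \<Rightarrow> real"
    and \<xi> :: "nat \<Rightarrow> 'w \<Rightarrow> real^'d"
    and E :: "('d cpath \<Rightarrow> real) \<Rightarrow> real"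
    and e :: "'d \<Rightarrow> real^'d"
    and T K :: real
    and X0 :: "real^'n::finite"
    and b :: "real \<Rightarrow> real^'n \<Rightarrow> ('d, real^'n) rv"
    and h :: "'d \<Rightarrow> 'd \<Rightarrow> real \<Rightarrow> real^'n \<Rightarrow> ('d, real^'n) rv"
    and \<sigma> :: "'d \<Rightarrow> real \<Rightarrow> real^'n \<Rightarrow> ('d, real^'n) rv"
  assumes "monotone_sublinear G"
    and "sublinear_expectation_space H' E'"
    and "\<And>i. G_normal H' E' G (\<xi> i)"
    and "\<And>i. indep_from E' (Suc i) \<xi> (\<xi> (Suc i))"
    and "is_G_expectation E' \<xi> E"
    and "\<And>i j. e i \<bullet> e j = (if i = j then 1 else 0)"
    and "T > 0"
    and "\<And>x. (\<lambda>t. b t x) \<in> MGbar E 2 T"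
    and "\<And>i j x. (\<lambda>t. h i j t x) \<in> MGbar E 2 T"
    and "\<And>j x. (\<lambda>t. \<sigma> j t x) \<in> MGbar E 2 T"
    and "\<And>t. t \<in> {0..T} \<Longrightarrow> lipschitz_field E K (b t)"
    and "\<And>i j t. t \<in> {0..T} \<Longrightarrow> lipschitz_field E K (h i j t)"
    and "\<And>j t. t \<in> {0..T} \<Longrightarrow> lipschitz_field E K (\<sigma> j t)"
  shows "(\<exists>X. is_solution E T e X0 b h \<sigma> X) \<and>
         (\<forall>X X'. is_solution E T e X0 b h \<sigma> X \<longrightarrow> is_solution E T e X0 b h \<sigma> X' \<longrightarrow>
            MGbar_eq E 2 T X X')"
proof -
  interpret C: G_construction H' E' G \<xi> E
    by (rule G_construction.intro[OF assms(2)], rule G_construction_axioms.intro) (rule assms(3-5))+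
  interpret G_time E T
  proof (rule G_time.intro)
    show "G_setting E" by unfold_locales (fact C.G_mono C.G_const C.G_subadd C.G_scale C.G_mean C.G_moment)+
    show "G_time_axioms T" by unfold_locales (rule assms(7))
  qed
  \<comment> \<open>The McShane extension is used with a nonnegative constant; a Lipschitz estimate
    persists for a larger one.\<close>
  define K' where "K' = max K 0"
  have K': "0 \<le> K'" "K \<le> K'" by (auto simp: K'_def)
  have "G_SDE E T K' b h \<sigma>"
  proof (unfold_locales)
    fix t assume t: "t \<in> {0..T}"
    show "lipschitz_field E K' (b t)"
      by (rule lipschitz_field_mono[OF _ assms(11)[OF t] K'(2)]) (use MGbar_LG[OF assms(8) t] in simp)
    show "lipschitz_field E K' (h i j t)" for i j
      by (rule lipschitz_field_mono[OF _ assms(12)[OF t] K'(2)]) (use MGbar_LG[OF assms(9) t] in simp)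
    show "lipschitz_field E K' (\<sigma> j t)" for j
      by (rule lipschitz_field_mono[OF _ assms(13)[OF t] K'(2)]) (use MGbar_LG[OF assms(10) t] in simp)
  qed (rule K' assms(8-10))+
  then show ?thesis by (rule G_SDE.solution_exists_unique)
qed

end
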